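(* Let $\Bbbk$ be an algebraically closed field of characteristic zero, let $\mathcal C$ be a modular tensor category over $\Bbbk$ (not assumed semisimple), and let $L=\int^{X\in\mathcal C}X^*\otimes X$ be its canonical Hopf algebra. The subalgebra of $\mathrm{End}_L(L)$ generated by the defect operators $(\mathcal O_D)_{D\in\mathcal C}$ is semisimple (as a $\Bbbk$-algebra) if and only if $\mathcal C$ is semisimple.
   Context: A modular tensor category $\mathcal C$ over $\Bbbk$ is a finite ribbon tensor category (equivalent as a linear category to finite-dimensional modules over a finite-dimensional algebra; rigid, bilinear $\otimes$, simple unit $\mathbf 1$; braiding $\beta$ and twist $\vartheta$) whose canonical Hopf pairing $\omega\colon L\otimes L\to\mathbf 1$ is non-degenerate; equivalently, the canonical functor $\mathcal C\boxtimes\overline{\mathcal C}\to\mathcal Z(\mathcal C)$ to the Drinfeld centre is an equivalence. $\mathcal C$ is taken strictly monoidal and strictly pivotal. Let $\iota_X\colon X^*\otimes X\to L$ be the universal dinatural transformation of the coend $L$. The product $\mu\colon L\otimes L\to L$ and unit $\eta$ of $L$ are determined by $$\mu\circ(\iota_X\otimes\iota_Y)=\iota_{X\otimes Y}\circ(\beta_{X^*\otimes X,\,Y^*}\otimes\mathrm{id}_Y),\qquad \eta=\iota_{\mathbf 1},$$ using $Y^*\otimes X^*=(X\otimes Y)^*$. $\mathrm{End}_L(L)$ is the algebra, under composition, of endomorphisms in $\mathcal C$ of $L$ as a right $L$-module (regular right module). For $D\in\mathcal C$, the internal cocharacter is $\check\chi_D=\iota_D\circ\widetilde{\mathrm{coev}}_D\colon\mathbf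 1\to L$, with $\widetilde{\mathrm{coev}}_D\colon\mathbf 1\to D^*\otimes D$ the coevaluation. The defect operator of $D$ is $$\mathcal O_D=\mu\circ(\check\chi_D\otimes\mathrm{id}_L)\in\mathrm{End}_L(L).$$ (In the paper $\mathcal O_D$ is the endomorphism of the object of bulk fields $\mathbb F_{S^1}\cong L$, under the equivalence of $\mathcal C\boxtimes\overline{\mathcal C}$ with right $L$-modules in $\mathcal C$, corresponding to the correlator, in the diagonal full CFT built from $\mathcal C$, of the cylinder $S^1\times I$ with a $D$-labelled line defect along $S^1\times\{1/2\}$; it is given by the formula above.) *)

theory Defs
  imports "Jordan_Normal_Form.Matrix" "HOL-Computational_Algebra.Polynomial"
begin

section \<open>Algebras\<close>

text \<open>
  An algebra over a field is given by a subspace \<open>A\<close> of a vector space (with scalar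
  multiplication \<open>sc\<close>), a product \<open>mul\<close> and a unit \<open>e\<close>; only the restriction of \<open>mul\<close> to \<open>A\<close>
  matters.
\<close>

definition unital_subalgebra ::
    "('k::field \<Rightarrow> 'm::ab_group_add \<Rightarrow> 'm) \<Rightarrow> ('m \<Rightarrow> 'm \<Rightarrow> 'm) \<Rightarrow> 'm \<Rightarrow> 'm set \<Rightarrow> 'm set \<Rightarrow> bool" where
  "unital_subalgebra sc mul e A B \<longleftrightarrow>
     B \<subseteq> A \<and> module.subspace sc B \<and> e \<in> B \<and> (\<forall>x\<in>B. \<forall>y\<in>B. mul x y \<in> B)"

definition generated_subalgebra ::
    "('k::field \<Rightarrow> 'm::ab_group_add \<Rightarrow> 'm) \<Rightarrow> ('m \<Rightarrow> 'm \<Rightarrow> 'm) \<Rightarrow> 'm \<Rightarrow> 'm set \<Rightarrow> 'm set \<Rightarrow> 'm set" where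
  "generated_subalgebra sc mul e A S = \<Inter> {B. unital_subalgebra sc mul e A B \<and> S \<subseteq> B}"

definition left_ideal ::
    "('k::field \<Rightarrow> 'm::ab_group_add \<Rightarrow> 'm) \<Rightarrow> ('m \<Rightarrow> 'm \<Rightarrow> 'm) \<Rightarrow> 'm set \<Rightarrow> 'm set \<Rightarrow> bool" where
  "left_ideal sc mul A I \<longleftrightarrow>
     I \<subseteq> A \<and> module.subspace sc I \<and> (\<forall>a\<in>A. \<forall>x\<in>I. mul a x \<in> I)"

definition simple_left_ideal ::
    "('k::field \<Rightarrow> 'm::ab_group_add \<Rightarrow> 'm) \<Rightarrow> ('m \<Rightarrow> 'm \<Rightarrow> 'm) \<Rightarrow> 'm set \<Rightarrow> 'm set \<Rightarrow> bool" where
  "simple_left_ideal sc mul A I \<longleftrightarrow>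
     left_ideal sc mul A I \<and> I \<noteq> {0} \<and>
     (\<forall>J. left_ideal sc mul A J \<and> J \<subseteq> I \<longrightarrow> J = {0} \<or> J = I)"

text \<open>
  The regular left module is an internal direct sum of simple submodules. For a unital algebra
  such a sum is automatically finite.
\<close>

definition semisimple_algebra ::
    "('k::field \<Rightarrow> 'm::ab_group_add \<Rightarrow> 'm) \<Rightarrow> ('m \<Rightarrow> 'm \<Rightarrow> 'm) \<Rightarrow> 'm set \<Rightarrow> bool" where
  "semisimple_algebra sc mul A \<longleftrightarrow>
     (\<exists>F. finite F \<and> (\<forall>I\<in>F. simple_left_ideal sc mul A I) \<and>
          (\<forall>a\<in>A. \<exists>!x. x \<in> (\<Pi>\<^sub>E I\<in>F. I) \<and> a = (\<Sum>I\<in>F. x I)))"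


section \<open>Finite-dimensional modules over a finite-dimensional algebra\<close>

text \<open>
  Up to isomorphism, a finite-dimensional algebra is a unital subalgebra of a full matrix
  algebra (by its regular representation), and a finite-dimensional module is a matrix
  representation on some \<open>k\<^sup>d\<close>, the case \<open>d = 0\<close> included.
\<close>

definition matrix_algebra :: "nat \<Rightarrow> 'k::field mat set \<Rightarrow> bool" where
  "matrix_algebra n A \<longleftrightarrow>
     A \<subseteq> carrier_mat n n \<and> 1\<^sub>m n \<in> A \<and>
     (\<forall>a\<in>A. \<forall>b\<in>A. a + b \<in> A \<and> a * b \<in> A) \<and> (\<forall>c. \<forall>a\<in>A. c \<cdot>\<^sub>m a \<in> A)"

definition fd_module :: "nat \<Rightarrow> 'k::field mat set \<Rightarrow> nat \<Rightarrow> ('k mat \<Rightarrow> 'k mat) \<Rightarrow> bool" where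
  "fd_module n A d \<rho> \<longleftrightarrow>
     (\<forall>a\<in>A. \<rho> a \<in> carrier_mat d d) \<and> \<rho> (1\<^sub>m n) = 1\<^sub>m d \<and>
     (\<forall>a\<in>A. \<forall>b\<in>A. \<rho> (a + b) = \<rho> a + \<rho> b \<and> \<rho> (a * b) = \<rho> a * \<rho> b) \<and>
     (\<forall>c. \<forall>a\<in>A. \<rho> (c \<cdot>\<^sub>m a) = c \<cdot>\<^sub>m \<rho> a)"

definition fd_module_hom ::
    "'k::field mat set \<Rightarrow> nat \<Rightarrow> ('k mat \<Rightarrow> 'k mat) \<Rightarrow> nat \<Rightarrow> ('k mat \<Rightarrow> 'k mat) \<Rightarrow> 'k mat set" where
  "fd_module_hom A d \<rho> e \<sigma> = {T \<in> carrier_mat e d. \<forall>a\<in>A. T * \<rho> a = \<sigma> a * T}"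

definition fd_module_iso ::
    "'k::field mat set \<Rightarrow> nat \<Rightarrow> ('k mat \<Rightarrow> 'k mat) \<Rightarrow> nat \<Rightarrow> ('k mat \<Rightarrow> 'k mat) \<Rightarrow> bool" where
  "fd_module_iso A d \<rho> e \<sigma> \<longleftrightarrow>
     (\<exists>T\<in>fd_module_hom A d \<rho> e \<sigma>. \<exists>S\<in>fd_module_hom A e \<sigma> d \<rho>. S * T = 1\<^sub>m d \<and> T * S = 1\<^sub>m e)"


section \<open>Linear categories\<close>

text \<open>
  The objects are all elements of the type \<open>'o\<close>. The morphism spaces are subspaces of one vector
  space \<open>'m\<close>, whose addition and zero they share. This is no restriction: any linear category
  arises in this way with \<open>'m\<close> the direct sum of its morphism spaces, to which composition (and
  likewise the tensor product of morphisms) is extended bilinearly. Morphism spaces need not be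
  disjoint, so a morphism is always considered together with its source and target.
  Composition \<open>g \<cdot> f\<close> means \<open>g\<close> after \<open>f\<close>.
\<close>

record ('k, 'o, 'm) linear_category_data =
  scl :: "'k \<Rightarrow> 'm \<Rightarrow> 'm"
  Hom :: "'o \<Rightarrow> 'o \<Rightarrow> 'm set"
  ide :: "'o \<Rightarrow> 'm"
  cmp :: "'m \<Rightarrow> 'm \<Rightarrow> 'm"  (infixr "\<cdot>\<index>" 70)

locale linear_category = vs: vector_space "scl C"
  for C :: "('k::field, 'o, 'm::ab_group_add, 'x) linear_category_data_scheme" (structure) +
  assumes Hom_subspace: "vs.subspace (Hom C X Y)"
    and ide_in_Hom: "ide C X \<in> Hom C X X"
    and cmp_in_Hom: "\<lbrakk>g \<in> Hom C Y Z; f \<in> Hom C X Y\<rbrakk> \<Longrightarrow> g \<cdot> f \<in> Hom C X Z"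
    and cmp_assoc: "\<lbrakk>h \<in> Hom C Z W; g \<in> Hom C Y Z; f \<in> Hom C X Y\<rbrakk> \<Longrightarrow> (h \<cdot> g) \<cdot> f = h \<cdot> (g \<cdot> f)"
    and ide_left: "f \<in> Hom C X Y \<Longrightarrow> ide C Y \<cdot> f = f"
    and ide_right: "f \<in> Hom C X Y \<Longrightarrow> f \<cdot> ide C X = f"
    and cmp_add_left:
      "\<lbrakk>g \<in> Hom C Y Z; g' \<in> Hom C Y Z; f \<in> Hom C X Y\<rbrakk> \<Longrightarrow> (g + g') \<cdot> f = g \<cdot> f + g' \<cdot> f"
    and cmp_add_right:
      "\<lbrakk>g \<in> Hom C Y Z; f \<in> Hom C X Y; f' \<in> Hom C X Y\<rbrakk> \<Longrightarrow> g \<cdot> (f + f') = g \<cdot> f + g \<cdot> f'"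
    and cmp_scl_left:
      "\<lbrakk>g \<in> Hom C Y Z; f \<in> Hom C X Y\<rbrakk> \<Longrightarrow> scl C c g \<cdot> f = scl C c (g \<cdot> f)"
    and cmp_scl_right:
      "\<lbrakk>g \<in> Hom C Y Z; f \<in> Hom C X Y\<rbrakk> \<Longrightarrow> g \<cdot> scl C c f = scl C c (g \<cdot> f)"
begin

definition is_iso :: "'o \<Rightarrow> 'o \<Rightarrow> 'm \<Rightarrow> bool" where
  "is_iso X Y f \<longleftrightarrow>
     f \<in> Hom C X Y \<and> (\<exists>g\<in>Hom C Y X. g \<cdot> f = ide C X \<and> f \<cdot> g = ide C Y)"

definition is_mono :: "'o \<Rightarrow> 'o \<Rightarrow> 'm \<Rightarrow> bool" where
  "is_mono X Y f \<longleftrightarrow>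
     f \<in> Hom C X Y \<and> (\<forall>Z. \<forall>g\<in>Hom C Z X. \<forall>h\<in>Hom C Z X. f \<cdot> g = f \<cdot> h \<longrightarrow> g = h)"

text \<open>
  In an abelian category, a monomorphism \<open>f = 0\<close> has zero source; thus the condition says that
  \<open>X\<close> is nonzero and that its only subobjects are \<open>0\<close> and \<open>X\<close>.
\<close>

definition simple_object :: "'o \<Rightarrow> bool" where
  "simple_object X \<longleftrightarrow>
     ide C X \<noteq> 0 \<and> (\<forall>Y f. is_mono Y X f \<longrightarrow> f = 0 \<or> is_iso Y X f)"

text \<open>Every object is a direct sum (biproduct) of finitely many, possibly no, simple objects.\<close>

definition semisimple_category :: bool where
  "semisimple_category \<longleftrightarrow>
     (\<forall>X. \<exists>(n::nat) S i p.
        (\<forall>j<n. simple_object (S j) \<and> i j \<in> Hom C (S j) X \<and> p j \<in> Hom C X (S j)) \<and>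
        (\<forall>j<n. \<forall>l<n. p j \<cdot> i l = (if j = l then ide C (S j) else 0)) \<and>
        (\<Sum>j<n. i j \<cdot> p j) = ide C X)"

text \<open>
  A linear functor \<open>X \<mapsto> (d X, \<rho> X)\<close>, \<open>f \<mapsto> \<Phi> X Y f\<close> to the category of finite-dimensional modules
  over \<open>A\<close> that is fully faithful and essentially surjective.
\<close>

definition finite_category :: bool where
  "finite_category \<longleftrightarrow>
     (\<exists>n (A :: 'k mat set) d \<rho> \<Phi>.
        matrix_algebra n A \<and>
        (\<forall>X. fd_module n A (d X) (\<rho> X)) \<and>
        (\<forall>X Y. bij_betw (\<Phi> X Y) (Hom C X Y) (fd_module_hom A (d X) (\<rho> X) (d Y) (\<rho> Y))) \<and>
        (\<forall>X Y. \<forall>f\<in>Hom C X Y. \<forall>g\<in>Hom C X Y. \<Phi> X Y (f + g) = \<Phi> X Y f + \<Phi> X Y g) \<and>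
        (\<forall>X Y c. \<forall>f\<in>Hom C X Y. \<Phi> X Y (scl C c f) = c \<cdot>\<^sub>m \<Phi> X Y f) \<and>
        (\<forall>X. \<Phi> X X (ide C X) = 1\<^sub>m (d X)) \<and>
        (\<forall>X Y Z. \<forall>g\<in>Hom C Y Z. \<forall>f\<in>Hom C X Y. \<Phi> X Z (g \<cdot> f) = \<Phi> Y Z g * \<Phi> X Y f) \<and>
        (\<forall>e \<sigma>. fd_module n A e \<sigma> \<longrightarrow> (\<exists>X. fd_module_iso A e \<sigma> (d X) (\<rho> X))))"

end


section \<open>Strict monoidal linear categories\<close>

record ('k, 'o, 'm) monoidal_category_data = "('k, 'o, 'm) linear_category_data" +
  unit_obj :: 'o  ("\<^bold>1\<index>")
  obj_tensor :: "'o \<Rightarrow> 'o \<Rightarrow> 'o"  (infixr "\<otimes>\<^sub>o\<index>" 75)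
  mor_tensor :: "'m \<Rightarrow> 'm \<Rightarrow> 'm"  (infixr "\<otimes>\<^sub>m\<index>" 75)

locale strict_monoidal_category = linear_category C
  for C :: "('k::field, 'o, 'm::ab_group_add, 'x) monoidal_category_data_scheme" (structure) +
  assumes obj_tensor_assoc: "(X \<otimes>\<^sub>o Y) \<otimes>\<^sub>o Z = X \<otimes>\<^sub>o (Y \<otimes>\<^sub>o Z)"
    and obj_unit_left: "\<^bold>1 \<otimes>\<^sub>o X = X"
    and obj_unit_right: "X \<otimes>\<^sub>o \<^bold>1 = X"
    and tensor_in_Hom:
      "\<lbrakk>f \<in> Hom C X X'; g \<in> Hom C Y Y'\<rbrakk> \<Longrightarrow> f \<otimes>\<^sub>m g \<in> Hom C (X \<otimes>\<^sub>o Y) (X' \<otimes>\<^sub>o Y')"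
    and tensor_ide: "ide C X \<otimes>\<^sub>m ide C Y = ide C (X \<otimes>\<^sub>o Y)"
    and interchange:
      "\<lbrakk>f \<in> Hom C X X'; f' \<in> Hom C X' X''; g \<in> Hom C Y Y'; g' \<in> Hom C Y' Y''\<rbrakk>
        \<Longrightarrow> (f' \<cdot> f) \<otimes>\<^sub>m (g' \<cdot> g) = (f' \<otimes>\<^sub>m g') \<cdot> (f \<otimes>\<^sub>m g)"
    and tensor_assoc:
      "\<lbrakk>f \<in> Hom C X X'; g \<in> Hom C Y Y'; h \<in> Hom C Z Z'\<rbrakk>
        \<Longrightarrow> (f \<otimes>\<^sub>m g) \<otimes>\<^sub>m h = f \<otimes>\<^sub>m (g \<otimes>\<^sub>m h)"
    and tensor_unit_left: "f \<in> Hom C X Y \<Longrightarrow> ide C \<^bold>1 \<otimes>\<^sub>m f = f"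
    and tensor_unit_right: "f \<in> Hom C X Y \<Longrightarrow> f \<otimes>\<^sub>m ide C \<^bold>1 = f"
    and tensor_add_left:
      "\<lbrakk>f \<in> Hom C X X'; f' \<in> Hom C X X'; g \<in> Hom C Y Y'\<rbrakk>
        \<Longrightarrow> (f + f') \<otimes>\<^sub>m g = f \<otimes>\<^sub>m g + f' \<otimes>\<^sub>m g"
    and tensor_add_right:
      "\<lbrakk>f \<in> Hom C X X'; g \<in> Hom C Y Y'; g' \<in> Hom C Y Y'\<rbrakk>
        \<Longrightarrow> f \<otimes>\<^sub>m (g + g') = f \<otimes>\<^sub>m g + f \<otimes>\<^sub>m g'"
    and tensor_scl_left:
      "\<lbrakk>f \<in> Hom C X X'; g \<in> Hom C Y Y'\<rbrakk> \<Longrightarrow> scl C c f \<otimes>\<^sub>m g = scl C c (f \<otimes>\<^sub>m g)"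
    and tensor_scl_right:
      "\<lbrakk>f \<in> Hom C X X'; g \<in> Hom C Y Y'\<rbrakk> \<Longrightarrow> f \<otimes>\<^sub>m scl C c g = scl C c (f \<otimes>\<^sub>m g)"


section \<open>Strictly pivotal categories\<close>

text \<open>
  \<open>ev C X : X\<^sup>\<or> \<otimes> X \<rightarrow> 1\<close> and \<open>coev C X : 1 \<rightarrow> X \<otimes> X\<^sup>\<or>\<close>. Strictly pivotal means that the pivotal
  structure \<open>X \<rightarrow> X\<^sup>\<or>\<^sup>\<or>\<close> and the canonical isomorphisms \<open>Y\<^sup>\<or> \<otimes> X\<^sup>\<or> \<rightarrow> (X \<otimes> Y)\<^sup>\<or>\<close> and \<open>1 \<rightarrow> 1\<^sup>\<or>\<close> are
  identities. The second duality, with \<open>X \<otimes> X\<^sup>\<or> \<rightarrow> 1\<close> and \<open>1 \<rightarrow> X\<^sup>\<or> \<otimes> X\<close>, is therefore given by the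
  first one for the object \<open>X\<^sup>\<or>\<close>, whose dual is \<open>X\<close>.
\<close>

record ('k, 'o, 'm) pivotal_category_data = "('k, 'o, 'm) monoidal_category_data" +
  dual :: "'o \<Rightarrow> 'o"  ("(_\<^sup>\<or>\<index>)" [1000] 999)
  ev :: "'o \<Rightarrow> 'm"
  coev :: "'o \<Rightarrow> 'm"

definition dual_mor ::
    "('k, 'o, 'm, 'x) pivotal_category_data_scheme \<Rightarrow> 'o \<Rightarrow> 'o \<Rightarrow> 'm \<Rightarrow> 'm" where
  "dual_mor C X Y f =
     (ev C Y \<otimes>\<^sub>m\<^bsub>C\<^esub> ide C (X\<^sup>\<or>\<^bsub>C\<^esub>)) \<cdot>\<^bsub>C\<^esub>
     (ide C (Y\<^sup>\<or>\<^bsub>C\<^esub>) \<otimes>\<^sub>m\<^bsub>C\<^esub> f \<otimes>\<^sub>m\<^bsub>C\<^esub> ide C (X\<^sup>\<or>\<^bsub>C\<^esub>)) \<cdot>\<^bsub>C\<^esub>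
     (ide C (Y\<^sup>\<or>\<^bsub>C\<^esub>) \<otimes>\<^sub>m\<^bsub>C\<^esub> coev C X)"

definition coev_tilde :: "('k, 'o, 'm, 'x) pivotal_category_data_scheme \<Rightarrow> 'o \<Rightarrow> 'm" where
  "coev_tilde C X = coev C (X\<^sup>\<or>\<^bsub>C\<^esub>)"

locale strict_pivotal_category = strict_monoidal_category C
  for C :: "('k::field, 'o, 'm::ab_group_add, 'x) pivotal_category_data_scheme" (structure) +
  assumes ev_in_Hom: "ev C X \<in> Hom C (X\<^sup>\<or> \<otimes>\<^sub>o X) \<^bold>1"
    and coev_in_Hom: "coev C X \<in> Hom C \<^bold>1 (X \<otimes>\<^sub>o X\<^sup>\<or>)"
    and zigzag: "(ide C X \<otimes>\<^sub>m ev C X) \<cdot> (coev C X \<otimes>\<^sub>m ide C X) = ide C X"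
    and zigzag_dual: "(ev C X \<otimes>\<^sub>m ide C (X\<^sup>\<or>)) \<cdot> (ide C (X\<^sup>\<or>) \<otimes>\<^sub>m coev C X) = ide C (X\<^sup>\<or>)"
    and dual_unit: "\<^bold>1\<^sup>\<or> = \<^bold>1"
    and dual_tensor: "(X \<otimes>\<^sub>o Y)\<^sup>\<or> = Y\<^sup>\<or> \<otimes>\<^sub>o X\<^sup>\<or>"
    and dual_dual: "(X\<^sup>\<or>)\<^sup>\<or> = X"
    and ev_unit: "ev C \<^bold>1 = ide C \<^bold>1"
    and ev_tensor:
      "ev C (X \<otimes>\<^sub>o Y) = ev C Y \<cdot> (ide C (Y\<^sup>\<or>) \<otimes>\<^sub>m ev C X \<otimes>\<^sub>m ide C Y)"
    and dual_mor_dual_mor: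
      "f \<in> Hom C X Y \<Longrightarrow> dual_mor C (Y\<^sup>\<or>) (X\<^sup>\<or>) (dual_mor C X Y f) = f"


section \<open>Finite ribbon tensor categories\<close>

record ('k, 'o, 'm) ribbon_category_data = "('k, 'o, 'm) pivotal_category_data" +
  braid :: "'o \<Rightarrow> 'o \<Rightarrow> 'm"
  twist :: "'o \<Rightarrow> 'm"

text \<open>
  The axiom \<open>coev_tilde_ribbon\<close> says that the pivotal structure is the one determined by the
  braiding and the twist.
\<close>

locale finite_ribbon_tensor_category = strict_pivotal_category C
  for C :: "('k::field, 'o, 'm::ab_group_add, 'x) ribbon_category_data_scheme" (structure) +
  assumes finite: "finite_category"
    and simple_unit: "simple_object \<^bold>1"
    and braid_iso: "is_iso (X \<otimes>\<^sub>o Y) (Y \<otimes>\<^sub>o X) (braid C X Y)"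
    and braid_natural:
      "\<lbrakk>f \<in> Hom C X X'; g \<in> Hom C Y Y'\<rbrakk>
        \<Longrightarrow> braid C X' Y' \<cdot> (f \<otimes>\<^sub>m g) = (g \<otimes>\<^sub>m f) \<cdot> braid C X Y"
    and hexagon_left:
      "braid C (X \<otimes>\<^sub>o Y) Z = (braid C X Z \<otimes>\<^sub>m ide C Y) \<cdot> (ide C X \<otimes>\<^sub>m braid C Y Z)"
    and hexagon_right:
      "braid C X (Y \<otimes>\<^sub>o Z) = (ide C Y \<otimes>\<^sub>m braid C X Z) \<cdot> (braid C X Y \<otimes>\<^sub>m ide C Z)"
    and twist_iso: "is_iso X X (twist C X)"
    and twist_natural: "f \<in> Hom C X Y \<Longrightarrow> twist C Y \<cdot> f = f \<cdot> twist C X"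
    and twist_tensor:
      "twist C (X \<otimes>\<^sub>o Y) = braid C Y X \<cdot> braid C X Y \<cdot> (twist C X \<otimes>\<^sub>m twist C Y)"
    and twist_dual: "twist C (X\<^sup>\<or>) = dual_mor C X X (twist C X)"
    and coev_tilde_ribbon:
      "coev_tilde C X = (ide C (X\<^sup>\<or>) \<otimes>\<^sub>m twist C X) \<cdot> braid C X (X\<^sup>\<or>) \<cdot> coev C X"


section \<open>The canonical coend and modularity\<close>

locale canonical_coend = finite_ribbon_tensor_category C
  for C :: "('k::field, 'o, 'm::ab_group_add, 'x) ribbon_category_data_scheme" (structure) +
  fixes L :: 'o and \<iota> :: "'o \<Rightarrow> 'm"
  assumes iota_in_Hom: "\<iota> X \<in> Hom C (X\<^sup>\<or> \<otimes>\<^sub>o X) L"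
    and iota_dinatural:
      "f \<in> Hom C X Y \<Longrightarrow>
         \<iota> Y \<cdot> (ide C (Y\<^sup>\<or>) \<otimes>\<^sub>m f) = \<iota> X \<cdot> (dual_mor C X Y f \<otimes>\<^sub>m ide C X)"
    and iota_universal:
      "\<lbrakk>\<And>X. \<kappa> X \<in> Hom C (X\<^sup>\<or> \<otimes>\<^sub>o X) Z;
        \<And>X Y f. f \<in> Hom C X Y \<Longrightarrow>
          \<kappa> Y \<cdot> (ide C (Y\<^sup>\<or>) \<otimes>\<^sub>m f) = \<kappa> X \<cdot> (dual_mor C X Y f \<otimes>\<^sub>m ide C X)\<rbrakk>
        \<Longrightarrow> \<exists>!u. u \<in> Hom C L Z \<and> (\<forall>X. u \<cdot> \<iota> X = \<kappa> X)"
begin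

definition L_mult :: 'm where
  "L_mult = (THE m. m \<in> Hom C (L \<otimes>\<^sub>o L) L \<and>
     (\<forall>X Y. m \<cdot> (\<iota> X \<otimes>\<^sub>m \<iota> Y) =
        \<iota> (X \<otimes>\<^sub>o Y) \<cdot> (braid C (X\<^sup>\<or> \<otimes>\<^sub>o X) (Y\<^sup>\<or>) \<otimes>\<^sub>m ide C Y)))"

definition hopf_pairing :: 'm where
  "hopf_pairing = (THE w. w \<in> Hom C (L \<otimes>\<^sub>o L) \<^bold>1 \<and>
     (\<forall>X Y. w \<cdot> (\<iota> X \<otimes>\<^sub>m \<iota> Y) =
        (ev C X \<otimes>\<^sub>m ev C Y) \<cdot>
        (ide C (X\<^sup>\<or>) \<otimes>\<^sub>m (braid C (Y\<^sup>\<or>) X \<cdot> braid C X (Y\<^sup>\<or>)) \<otimes>\<^sub>m ide C Y)))"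

text \<open>Non-degeneracy: the morphism \<open>L \<rightarrow> L\<^sup>\<or>\<close> corresponding to the pairing is invertible.\<close>

definition hopf_pairing_nondegenerate :: bool where
  "hopf_pairing_nondegenerate \<longleftrightarrow>
     is_iso L (L\<^sup>\<or>) ((hopf_pairing \<otimes>\<^sub>m ide C (L\<^sup>\<or>)) \<cdot> (ide C L \<otimes>\<^sub>m coev C L))"

definition End_L :: "'m set" where
  "End_L = {f \<in> Hom C L L. f \<cdot> L_mult = L_mult \<cdot> (f \<otimes>\<^sub>m ide C L)}"

definition cocharacter :: "'o \<Rightarrow> 'm" where
  "cocharacter D = \<iota> D \<cdot> coev_tilde C D"

definition defect_operator :: "'o \<Rightarrow> 'm" where
  "defect_operator D = L_mult \<cdot> (cocharacter D \<otimes>\<^sub>m ide C L)"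

definition defect_algebra :: "'m set" where
  "defect_algebra = generated_subalgebra (scl C) (cmp C) (ide C L) End_L (range defect_operator)"

end

locale modular_tensor_category = canonical_coend C L \<iota>
  for C :: "('k::field, 'o, 'm::ab_group_add, 'x) ribbon_category_data_scheme" (structure)
    and L :: 'o and \<iota> :: "'o \<Rightarrow> 'm" +
  assumes nondegenerate: "hopf_pairing_nondegenerate"

end

theory Submission
  imports Defs "Jordan_Normal_Form.Char_Poly" "Jordan_Normal_Form.Gauss_Jordan_Elimination"
begin

text \<open>
  The product of \<open>L\<close> gives \<open>defect_operator D \<cdot> \<iota> Y = \<iota> (D \<otimes> Y) \<cdot> (id \<otimes> coev_tilde D \<otimes> id)\<close>. Hence
  defect operators multiply like the objects labelling them, and the defect algebra is their span.
  By non-degeneracy of the Hopf pairing, an element of the span is determined by the natural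
  endomorphism of the identity functor in which \<open>D\<close> acts on \<open>W\<close> by a loop coloured by \<open>D\<close> around a
  strand coloured by \<open>W\<close>. In particular the defect algebra is commutative.

  If \<open>C\<close> is semisimple, these endomorphisms are determined by their scalars on the finitely many
  simple objects. So finitely many characters separate the elements of the defect algebra,
  and it is a product of copies of the field.

  If \<open>C\<close> is not semisimple, there is a projective \<open>P \<noteq> 0\<close> without simple projective summands. Let
  \<open>X\<^sub>1, \<dots>, X\<^sub>r\<close> be the simple projective objects. The operators of \<open>X\<^sub>1, \<dots>, X\<^sub>r, P\<close> are linearly
  independent: dual bases of \<open>Hom(Q, Y)\<close> and \<open>Hom(Y, J)\<close> define dinatural families, and so
  functionals that map the cocharacter of \<open>Y\<close> to \<open>dim Hom(Q, Y)\<close>. Therefore some non-zero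
  combination acts by zero on the \<open>r\<close> objects \<open>X\<^sub>i\<close>. It also acts by zero on every other simple object
  \<open>W\<close>, since a loop coloured by a projective object factors through a projective object on \<open>W\<close>. It is thus
  nilpotent, which is impossible in a commutative semisimple algebra.
\<close>

section \<open>Typed morphisms\<close>

text \<open>Two points carry the non-semisimple case. The first is the existence of
  \<open>P\<close>. By rigidity duals of projectives are projective, so projectives are injective
  and a simple projective subobject splits off. If every non-zero projective had such a subobject,
  induction on dimension would split all of them into simple projectives. The test case is
  \<open>G\<^sup>\<or> \<otimes>\<^sub>o G\<close> for the regular module \<open>G\<close>: its
  evaluation is a non-zero map to the simple unit, so some summand is the unit. A projective unit
  makes every object projective, and the category is semisimple. The second is the count. By Schur's
  lemma the action on \<open>X\<^sub>i\<close> is one scalar, so r + 1 operators meet r linear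
  conditions. Independence is seen by functionals of two kinds: with
  \<open>Q = J = X\<^sub>i\<close> the dimension vanishes on \<open>P\<close> and on the other
  simple projectives, while for the regular module and its dual it is the dimension of the
  underlying space. Characteristic zero keeps these values non-zero in the field.\<close>

text \<open>
  A morphism does not determine its source and target, so the equational laws carry typing
  hypotheses with objects not visible in the equation. Bundling a morphism with its source and
  target makes these hypotheses checkable by rewriting.
\<close>

datatype ('o, 'm) arrow = Arrow (src: 'o) (val: 'm) (trg: 'o)

context strict_monoidal_category
begin

definition ok :: "('o, 'm) arrow \<Rightarrow> bool" where
  "ok f \<longleftrightarrow> val f \<in> Hom C (src f) (trg f)"

definition acomp :: "('o, 'm) arrow \<Rightarrow> ('o, 'm) arrow \<Rightarrow> ('o, 'm) arrow"  (infixr "\<odot>" 70) where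
  "g \<odot> f = Arrow (src f) (val g \<cdot> val f) (trg g)"

definition atensor :: "('o, 'm) arrow \<Rightarrow> ('o, 'm) arrow \<Rightarrow> ('o, 'm) arrow"  (infixr "\<boxtimes>" 75) where
  "f \<boxtimes> g = Arrow (src f \<otimes>\<^sub>o src g) (val f \<otimes>\<^sub>m val g) (trg f \<otimes>\<^sub>o trg g)"

definition aide :: "'o \<Rightarrow> ('o, 'm) arrow"  ("\<I>") where
  "\<I> X = Arrow X (ide C X) X"

lemma arrow_sel [simp]:
  "src (g \<odot> f) = src f" "trg (g \<odot> f) = trg g" "val (g \<odot> f) = val g \<cdot> val f"
  "src (f \<boxtimes> g) = src f \<otimes>\<^sub>o src g" "trg (f \<boxtimes> g) = trg f \<otimes>\<^sub>o trg g" "val (f \<boxtimes> g) = val f \<otimes>\<^sub>m val g"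
  "src (\<I> X) = X" "trg (\<I> X) = X" "val (\<I> X) = ide C X"
  by (simp_all add: acomp_def atensor_def aide_def)

declare obj_tensor_assoc [simp] obj_unit_left [simp] obj_unit_right [simp]

lemma ok_acomp [simp]: "ok g \<Longrightarrow> ok f \<Longrightarrow> src g = trg f \<Longrightarrow> ok (g \<odot> f)"
  by (auto simp: ok_def intro: cmp_in_Hom)

lemma ok_atensor [simp]: "ok f \<Longrightarrow> ok g \<Longrightarrow> ok (f \<boxtimes> g)"
  by (auto simp: ok_def intro: tensor_in_Hom)

lemma ok_aide [simp]: "ok (\<I> X)"
  by (auto simp: ok_def intro: ide_in_Hom)

lemma acomp_assoc [simp]:
  "ok h \<Longrightarrow> ok g \<Longrightarrow> ok f \<Longrightarrow> src h = trg g \<Longrightarrow> src g = trg f \<Longrightarrow> (h \<odot> g) \<odot> f = h \<odot> g \<odot> f"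
  unfolding ok_def by (rule arrow.expand) (auto intro: cmp_assoc)

lemma acomp_aide [simp]:
  "ok f \<Longrightarrow> trg f = X \<Longrightarrow> \<I> X \<odot> f = f"
  "ok f \<Longrightarrow> src f = X \<Longrightarrow> f \<odot> \<I> X = f"
  unfolding ok_def by (rule arrow.expand; auto intro: ide_left ide_right)+

lemma aide_tensor: "\<I> X \<boxtimes> \<I> Y = \<I> (X \<otimes>\<^sub>o Y)"
  by (rule arrow.expand) (simp add: tensor_ide)

lemma atensor_assoc [simp]: "ok f \<Longrightarrow> ok g \<Longrightarrow> ok h \<Longrightarrow> (f \<boxtimes> g) \<boxtimes> h = f \<boxtimes> g \<boxtimes> h"
  unfolding ok_def by (rule arrow.expand) (auto intro: tensor_assoc)

lemma atensor_unit [simp]: "ok f \<Longrightarrow> \<I> \<^bold>1 \<boxtimes> f = f" "ok f \<Longrightarrow> f \<boxtimes> \<I> \<^bold>1 = f"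
  unfolding ok_def by (rule arrow.expand; auto intro: tensor_unit_left tensor_unit_right)+

lemma ainterchange:
  "ok f \<Longrightarrow> ok f' \<Longrightarrow> ok g \<Longrightarrow> ok g' \<Longrightarrow> src f' = trg f \<Longrightarrow> src g' = trg g \<Longrightarrow>
    (f' \<boxtimes> g') \<odot> (f \<boxtimes> g) = (f' \<odot> f) \<boxtimes> (g' \<odot> g)"
  unfolding ok_def by (rule arrow.expand) (auto intro: interchange[symmetric])

text \<open>The two orders in which boxes on disjoint strands can be drawn; moving one past the
  other in a diagram is this lemma used twice.\<close>

lemma slide:
  assumes "ok f" "ok g"
  shows "(f \<boxtimes> \<I> (trg g)) \<odot> (\<I> (src f) \<boxtimes> g) = f \<boxtimes> g"
    "(\<I> (trg f) \<boxtimes> g) \<odot> (f \<boxtimes> \<I> (src g)) = f \<boxtimes> g"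
  using assms by (simp_all add: ainterchange)

text \<open>\<open>acomp_assoc\<close> nests composites to the right, which hides
  \<open>g \<odot> f\<close> inside \<open>g \<odot> f \<odot> h\<close>. An equation of composites
  is therefore applied together with its tail \<open>h\<close>; \<open>acomp_tail1\<close> does this
  for an arbitrary right-hand side.\<close>

lemma acomp_tail:
  assumes "g \<odot> f = g' \<odot> f'" "ok g" "ok f" "src g = trg f" "ok g'" "ok f'" "src g' = trg f'"
    "ok h" "trg h = src f"
  shows "g \<odot> f \<odot> h = g' \<odot> f' \<odot> h"
proof -
  have "trg h = src f'" using assms(1,9) by (metis arrow_sel(1))
  then show ?thesis using assms by (metis acomp_assoc)
qed

lemma acomp_tail1:
  assumes "g \<odot> f = k" "ok g" "ok f" "src g = trg f" "ok h" "trg h = src f"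
  shows "g \<odot> f \<odot> h = k \<odot> h"
  using assms by (metis acomp_assoc)

lemma whisker_comp:
  assumes "ok f" "ok g" "src g = trg f"
  shows "(\<I> X \<boxtimes> g) \<odot> (\<I> X \<boxtimes> f) = \<I> X \<boxtimes> (g \<odot> f)" "(g \<boxtimes> \<I> X) \<odot> (f \<boxtimes> \<I> X) = (g \<odot> f) \<boxtimes> \<I> X"
  using assms by (simp_all add: ainterchange)

end

context strict_pivotal_category
begin

declare dual_unit [simp] dual_tensor [simp] dual_dual [simp]

definition aev where "aev X = Arrow (X\<^sup>\<or> \<otimes>\<^sub>o X) (ev C X) \<^bold>1"
definition acoev where "acoev X = Arrow \<^bold>1 (coev C X) (X \<otimes>\<^sub>o X\<^sup>\<or>)"
definition adual where "adual f = Arrow ((trg f)\<^sup>\<or>) (dual_mor C (src f) (trg f) (val f)) ((src f)\<^sup>\<or>)"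

lemma aev_sel [simp]:
  "src (aev X) = X\<^sup>\<or> \<otimes>\<^sub>o X" "trg (aev X) = \<^bold>1" "val (aev X) = ev C X" "ok (aev X)"
  "src (acoev X) = \<^bold>1" "trg (acoev X) = X \<otimes>\<^sub>o X\<^sup>\<or>" "val (acoev X) = coev C X" "ok (acoev X)"
  by (simp_all add: aev_def acoev_def ok_def ev_in_Hom coev_in_Hom)

lemma azigzag:
  "(\<I> X \<boxtimes> aev X) \<odot> (acoev X \<boxtimes> \<I> X) = \<I> X"
  "(aev X \<boxtimes> \<I> (X\<^sup>\<or>)) \<odot> (\<I> (X\<^sup>\<or>) \<boxtimes> acoev X) = \<I> (X\<^sup>\<or>)"
  by (rule arrow.expand; simp add: zigzag zigzag_dual)+

section \<open>Transposition along duals\<close>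

definition rcurry where "rcurry Z X h = (h \<boxtimes> \<I> (X\<^sup>\<or>)) \<odot> (\<I> Z \<boxtimes> acoev X)"
definition runcurry where "runcurry U X g = (\<I> U \<boxtimes> aev X) \<odot> (g \<boxtimes> \<I> X)"
text \<open>The left-hand transposition uses the other duality of \<open>X\<close>. Strict
  pivotality makes it the first duality of \<open>X\<^sup>\<or>\<close>, hence the coevaluation of
  \<open>X\<^sup>\<or>\<close> here and its evaluation in \<open>luncurry\<close>.\<close>

definition lcurry where "lcurry Z X h = (\<I> (X\<^sup>\<or>) \<boxtimes> h) \<odot> (acoev (X\<^sup>\<or>) \<boxtimes> \<I> Z)"
definition luncurry where "luncurry U X g = (aev (X\<^sup>\<or>) \<boxtimes> \<I> U) \<odot> (\<I> X \<boxtimes> g)"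

lemma rcurry_sel [simp]:
  "src (rcurry Z X h) = Z" "trg (rcurry Z X h) = trg h \<otimes>\<^sub>o X\<^sup>\<or>"
  "ok h \<Longrightarrow> src h = Z \<otimes>\<^sub>o X \<Longrightarrow> ok (rcurry Z X h)"
  "src (runcurry U X g) = src g \<otimes>\<^sub>o X" "trg (runcurry U X g) = U"
  "ok g \<Longrightarrow> trg g = U \<otimes>\<^sub>o X\<^sup>\<or> \<Longrightarrow> ok (runcurry U X g)"
  by (simp_all add: rcurry_def runcurry_def)

lemma lcurry_sel [simp]:
  "src (lcurry Z X h) = Z" "trg (lcurry Z X h) = X\<^sup>\<or> \<otimes>\<^sub>o trg h"
  "ok h \<Longrightarrow> src h = X \<otimes>\<^sub>o Z \<Longrightarrow> ok (lcurry Z X h)"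
  "src (luncurry U X g) = X \<otimes>\<^sub>o src g" "trg (luncurry U X g) = U"
  "ok g \<Longrightarrow> trg g = X\<^sup>\<or> \<otimes>\<^sub>o U \<Longrightarrow> ok (luncurry U X g)"
  by (simp_all add: lcurry_def luncurry_def)

text \<open>Sliding \<open>h\<close> off the evaluation leaves the snake of \<open>X\<close>, which
  is the identity. The other three inversion lemmas straighten their strand in the same way.\<close>

lemma runcurry_rcurry:
  assumes [simp]: "ok h" "src h = Z \<otimes>\<^sub>o X" "trg h = U"
  shows "runcurry U X (rcurry Z X h) = h"
proof -
  have "runcurry U X (rcurry Z X h) =
      (\<I> U \<boxtimes> aev X) \<odot> (h \<boxtimes> \<I> (X\<^sup>\<or> \<otimes>\<^sub>o X)) \<odot> (\<I> Z \<boxtimes> acoev X \<boxtimes> \<I> X)"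
    by (simp add: runcurry_def rcurry_def flip: whisker_comp aide_tensor)
  also have "\<dots> = (h \<boxtimes> aev X) \<odot> (\<I> Z \<boxtimes> acoev X \<boxtimes> \<I> X)"
    using slide(2)[of h "aev X"] by (intro acomp_tail1) auto
  also have "\<dots> = h \<odot> (\<I> (Z \<otimes>\<^sub>o X) \<boxtimes> aev X) \<odot> (\<I> Z \<boxtimes> acoev X \<boxtimes> \<I> X)"
    using slide(1)[of h "aev X"] by (intro acomp_tail1[symmetric, of h, simplified]) auto
  also have "\<dots> = h \<odot> (\<I> Z \<boxtimes> ((\<I> X \<boxtimes> aev X) \<odot> (acoev X \<boxtimes> \<I> X)))"
    by (simp flip: aide_tensor whisker_comp)
  also have "\<dots> = h"
    by (simp add: azigzag aide_tensor)
  finally show ?thesis .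
qed

lemma rcurry_runcurry:
  assumes [simp]: "ok g" "src g = Z" "trg g = U \<otimes>\<^sub>o X\<^sup>\<or>"
  shows "rcurry Z X (runcurry U X g) = g"
proof -
  have "rcurry Z X (runcurry U X g) =
      (\<I> U \<boxtimes> aev X \<boxtimes> \<I> (X\<^sup>\<or>)) \<odot> (g \<boxtimes> \<I> (X \<otimes>\<^sub>o X\<^sup>\<or>)) \<odot> (\<I> Z \<boxtimes> acoev X)"
    by (simp add: runcurry_def rcurry_def flip: whisker_comp aide_tensor)
  also have "\<dots> = (\<I> U \<boxtimes> aev X \<boxtimes> \<I> (X\<^sup>\<or>)) \<odot> (\<I> (U \<otimes>\<^sub>o X\<^sup>\<or>) \<boxtimes> acoev X) \<odot> g"
    using slide[of g "acoev X"] by simp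
  also have "\<dots> = ((\<I> U \<boxtimes> aev X \<boxtimes> \<I> (X\<^sup>\<or>)) \<odot> (\<I> U \<boxtimes> \<I> (X\<^sup>\<or>) \<boxtimes> acoev X)) \<odot> g"
    by (simp flip: aide_tensor)
  also have "(\<I> U \<boxtimes> aev X \<boxtimes> \<I> (X\<^sup>\<or>)) \<odot> (\<I> U \<boxtimes> \<I> (X\<^sup>\<or>) \<boxtimes> acoev X) = \<I> U \<boxtimes> \<I> (X\<^sup>\<or>)"
    by (simp add: whisker_comp azigzag)
  finally show ?thesis by (simp add: aide_tensor)
qed

lemma luncurry_lcurry:
  assumes [simp]: "ok h" "src h = X \<otimes>\<^sub>o Z" "trg h = U"
  shows "luncurry U X (lcurry Z X h) = h"
proof -
  have "luncurry U X (lcurry Z X h) =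
      (aev (X\<^sup>\<or>) \<boxtimes> \<I> U) \<odot> (\<I> (X \<otimes>\<^sub>o X\<^sup>\<or>) \<boxtimes> h) \<odot> (\<I> X \<boxtimes> acoev (X\<^sup>\<or>) \<boxtimes> \<I> Z)"
    by (simp add: luncurry_def lcurry_def flip: whisker_comp aide_tensor)
  also have "\<dots> = (aev (X\<^sup>\<or>) \<boxtimes> h) \<odot> (\<I> X \<boxtimes> acoev (X\<^sup>\<or>) \<boxtimes> \<I> Z)"
    using slide(1)[of "aev (X\<^sup>\<or>)" h] by (intro acomp_tail1) auto
  also have "\<dots> = h \<odot> (aev (X\<^sup>\<or>) \<boxtimes> \<I> (X \<otimes>\<^sub>o Z)) \<odot> (\<I> X \<boxtimes> acoev (X\<^sup>\<or>) \<boxtimes> \<I> Z)"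
    using slide(2)[of "aev (X\<^sup>\<or>)" h] by (intro acomp_tail1[symmetric, of h, simplified]) auto
  also have "\<dots> = h \<odot> (((aev (X\<^sup>\<or>) \<boxtimes> \<I> X) \<odot> (\<I> X \<boxtimes> acoev (X\<^sup>\<or>))) \<boxtimes> \<I> Z)"
    by (simp flip: aide_tensor whisker_comp)
  also have "\<dots> = h"
    using azigzag(2)[of "X\<^sup>\<or>"] by (simp add: aide_tensor)
  finally show ?thesis .
qed

lemma lcurry_luncurry:
  assumes [simp]: "ok g" "src g = Z" "trg g = X\<^sup>\<or> \<otimes>\<^sub>o U"
  shows "lcurry Z X (luncurry U X g) = g"
proof -
  have "lcurry Z X (luncurry U X g) =
      (\<I> (X\<^sup>\<or>) \<boxtimes> aev (X\<^sup>\<or>) \<boxtimes> \<I> U) \<odot> (\<I> (X\<^sup>\<or> \<otimes>\<^sub>o X) \<boxtimes> g) \<odot> (acoev (X\<^sup>\<or>) \<boxtimes> \<I> Z)"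
    by (simp add: luncurry_def lcurry_def flip: whisker_comp aide_tensor)
  also have "\<dots> = (\<I> (X\<^sup>\<or>) \<boxtimes> aev (X\<^sup>\<or>) \<boxtimes> \<I> U) \<odot> (acoev (X\<^sup>\<or>) \<boxtimes> \<I> (X\<^sup>\<or> \<otimes>\<^sub>o U)) \<odot> g"
    using slide[of "acoev (X\<^sup>\<or>)" g] by simp
  also have "\<dots> = ((\<I> (X\<^sup>\<or>) \<boxtimes> aev (X\<^sup>\<or>) \<boxtimes> \<I> U) \<odot> (acoev (X\<^sup>\<or>) \<boxtimes> \<I> (X\<^sup>\<or>) \<boxtimes> \<I> U)) \<odot> g"
    by (simp flip: aide_tensor)
  also have "(\<I> (X\<^sup>\<or>) \<boxtimes> aev (X\<^sup>\<or>) \<boxtimes> \<I> U) \<odot> (acoev (X\<^sup>\<or>) \<boxtimes> \<I> (X\<^sup>\<or>) \<boxtimes> \<I> U) = \<I> (X\<^sup>\<or>) \<boxtimes> \<I> U"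
    using azigzag(1)[of "X\<^sup>\<or>"] whisker_comp(2)[of "acoev (X\<^sup>\<or>) \<boxtimes> \<I> (X\<^sup>\<or>)" "\<I> (X\<^sup>\<or>) \<boxtimes> aev (X\<^sup>\<or>)" U]
    by simp
  finally show ?thesis by (simp add: aide_tensor)
qed

lemma rcurry_comp:
  assumes [simp]: "ok h" "src h = Z \<otimes>\<^sub>o X" "ok u" "src u = Z'" "trg u = Z"
  shows "rcurry Z X h \<odot> u = rcurry Z' X (h \<odot> (u \<boxtimes> \<I> X))"
proof -
  have "rcurry Z X h \<odot> u = (h \<boxtimes> \<I> (X\<^sup>\<or>)) \<odot> (u \<boxtimes> acoev X)"
    using slide(2)[of u "acoev X"] by (simp add: rcurry_def)
  also have "\<dots> = (h \<boxtimes> \<I> (X\<^sup>\<or>)) \<odot> (u \<boxtimes> \<I> X \<boxtimes> \<I> (X\<^sup>\<or>)) \<odot> (\<I> Z' \<boxtimes> acoev X)"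
    using slide(1)[of u "acoev X"] by (simp flip: aide_tensor)
  also have "\<dots> = rcurry Z' X (h \<odot> (u \<boxtimes> \<I> X))"
    by (simp add: rcurry_def flip: whisker_comp)
  finally show ?thesis .
qed

lemma lcurry_comp:
  assumes [simp]: "ok h" "src h = X \<otimes>\<^sub>o Z" "ok u" "src u = Z'" "trg u = Z"
  shows "lcurry Z X h \<odot> u = lcurry Z' X (h \<odot> (\<I> X \<boxtimes> u))"
proof -
  have "lcurry Z X h \<odot> u = (\<I> (X\<^sup>\<or>) \<boxtimes> h) \<odot> (acoev (X\<^sup>\<or>) \<boxtimes> u)"
    using slide(1)[of "acoev (X\<^sup>\<or>)" u] by (simp add: lcurry_def)
  also have "\<dots> = (\<I> (X\<^sup>\<or>) \<boxtimes> h) \<odot> (\<I> (X\<^sup>\<or>) \<boxtimes> \<I> X \<boxtimes> u) \<odot> (acoev (X\<^sup>\<or>) \<boxtimes> \<I> Z')"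
    using slide(2)[of "acoev (X\<^sup>\<or>)" u] by (simp flip: aide_tensor)
  also have "\<dots> = lcurry Z' X (h \<odot> (\<I> X \<boxtimes> u))"
    by (simp add: lcurry_def flip: whisker_comp)
  finally show ?thesis .
qed

lemma comp_rcurry:
  assumes [simp]: "ok h" "src h = Z \<otimes>\<^sub>o X" "ok k" "src k = trg h"
  shows "rcurry Z X (k \<odot> h) = (k \<boxtimes> \<I> (X\<^sup>\<or>)) \<odot> rcurry Z X h"
  by (simp add: rcurry_def flip: whisker_comp)

lemma comp_lcurry:
  assumes [simp]: "ok h" "src h = X \<otimes>\<^sub>o Z" "ok k" "src k = trg h"
  shows "lcurry Z X (k \<odot> h) = (\<I> (X\<^sup>\<or>) \<boxtimes> k) \<odot> lcurry Z X h"
  by (simp add: lcurry_def flip: whisker_comp)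

lemma runcurry_comp:
  assumes [simp]: "ok u" "ok k" "src u = trg k" "trg u = U \<otimes>\<^sub>o X\<^sup>\<or>"
  shows "runcurry U X (u \<odot> k) = runcurry U X u \<odot> (k \<boxtimes> \<I> X)"
  by (simp add: runcurry_def flip: whisker_comp)

lemma luncurry_comp:
  assumes [simp]: "ok u" "ok k" "src u = trg k" "trg u = X\<^sup>\<or> \<otimes>\<^sub>o U"
  shows "luncurry U X (u \<odot> k) = luncurry U X u \<odot> (\<I> X \<boxtimes> k)"
  by (simp add: luncurry_def flip: whisker_comp)


subsection \<open>Dual morphisms\<close>

text \<open>Reading the dual morphism as a transpose characterises it by its evaluation
  (\<open>aev_adual\<close>), and transposition is injective (\<open>aev_unique\<close>). Identities
  between duals thus become identities between evaluations.\<close>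

lemma adual_rcurry:
  "ok f \<Longrightarrow> src f = X \<Longrightarrow> trg f = Y \<Longrightarrow> adual f = rcurry (Y\<^sup>\<or>) X (aev Y \<odot> (\<I> (Y\<^sup>\<or>) \<boxtimes> f))"
  by (subst whisker_comp(2)[symmetric] | simp add: rcurry_def)+
    (rule arrow.expand, simp add: adual_def dual_mor_def)

lemma adual_sel [simp]: "src (adual f) = (trg f)\<^sup>\<or>" "trg (adual f) = (src f)\<^sup>\<or>"
    "val (adual f) = dual_mor C (src f) (trg f) (val f)"
  by (simp_all add: adual_def)

lemma ok_adual [simp]: "ok f \<Longrightarrow> ok (adual f)"
  by (simp add: adual_rcurry)

lemma aev_adual:
  assumes [simp]: "ok f" "src f = X" "trg f = Y"
  shows "aev X \<odot> (adual f \<boxtimes> \<I> X) = aev Y \<odot> (\<I> (Y\<^sup>\<or>) \<boxtimes> f)"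
  using runcurry_rcurry[of "aev Y \<odot> (\<I> (Y\<^sup>\<or>) \<boxtimes> f)" "Y\<^sup>\<or>" X "\<^bold>1"]
  by (simp add: adual_rcurry[of f X Y, symmetric]) (simp add: runcurry_def)

lemma aev_unique:
  assumes "ok g" "ok g'" "trg g = X\<^sup>\<or>" "trg g' = X\<^sup>\<or>" "src g = src g'"
    "aev X \<odot> (g \<boxtimes> \<I> X) = aev X \<odot> (g' \<boxtimes> \<I> X)"
  shows "g = g'"
proof -
  have "runcurry \<^bold>1 X g = runcurry \<^bold>1 X g'" using assms by (simp add: runcurry_def)
  then show ?thesis using assms rcurry_runcurry[of _ _ "\<^bold>1" X] by (metis obj_unit_left)
qed

lemma adual_aide [simp]: "adual (\<I> X) = \<I> (X\<^sup>\<or>)"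
  by (rule aev_unique[where X=X]) (simp_all add: aev_adual[of "\<I> X" X X])

lemma adual_comp:
  assumes [simp]: "ok g" "ok f" "src g = trg f"
  shows "adual (g \<odot> f) = adual f \<odot> adual g"
proof (rule aev_unique[where X="src f"])
  let ?X = "src f" and ?Y = "trg f" and ?Z = "trg g"
  have "aev ?X \<odot> ((adual f \<odot> adual g) \<boxtimes> \<I> ?X) = (aev ?X \<odot> (adual f \<boxtimes> \<I> ?X)) \<odot> (adual g \<boxtimes> \<I> ?X)"
    by (simp flip: whisker_comp)
  also have "\<dots> = aev ?Y \<odot> (\<I> (?Y\<^sup>\<or>) \<boxtimes> f) \<odot> (adual g \<boxtimes> \<I> ?X)"
    by (subst aev_adual[of _ _ ?Y]) simp_all
  also have "\<dots> = (aev ?Y \<odot> (adual g \<boxtimes> \<I> ?Y)) \<odot> (\<I> (?Z\<^sup>\<or>) \<boxtimes> f)"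
    using slide[of "adual g" f] by simp
  also have "\<dots> = aev ?Z \<odot> (\<I> (?Z\<^sup>\<or>) \<boxtimes> (g \<odot> f))"
    by (subst aev_adual[of _ _ ?Z]) (simp_all add: whisker_comp)
  finally show "aev ?X \<odot> (adual (g \<odot> f) \<boxtimes> \<I> ?X) = aev ?X \<odot> ((adual f \<odot> adual g) \<boxtimes> \<I> ?X)"
    by (subst aev_adual[of _ _ ?Z]) simp_all
qed simp_all

lemma aev_tensor: "aev (X \<otimes>\<^sub>o Y) = aev Y \<odot> (\<I> (Y\<^sup>\<or>) \<boxtimes> aev X \<boxtimes> \<I> Y)"
  by (rule arrow.expand) (simp add: ev_tensor)

text \<open>Both sides are compared after evaluation. The evaluation of a product is nested, so
  \<open>f\<close> is moved across the inner pairing and \<open>g\<close> across the outer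
  one.\<close>

lemma adual_tensor:
  assumes [simp]: "ok f" "ok g"
  shows "adual (f \<boxtimes> g) = adual g \<boxtimes> adual f"
proof (rule aev_unique[where X="src f \<otimes>\<^sub>o src g"])
  let ?X = "src f" and ?X' = "trg f" and ?Y = "src g" and ?Y' = "trg g"
  let ?e = "aev ?X' \<odot> (\<I> (?X'\<^sup>\<or>) \<boxtimes> f)"
  have "aev (?X \<otimes>\<^sub>o ?Y) \<odot> ((adual g \<boxtimes> adual f) \<boxtimes> \<I> (?X \<otimes>\<^sub>o ?Y))
      = aev ?Y \<odot> (\<I> (?Y\<^sup>\<or>) \<boxtimes> aev ?X \<boxtimes> \<I> ?Y) \<odot> (adual g \<boxtimes> (adual f \<boxtimes> \<I> ?X) \<boxtimes> \<I> ?Y)"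
    by (simp add: aev_tensor flip: aide_tensor)
  also have "(\<I> (?Y\<^sup>\<or>) \<boxtimes> aev ?X \<boxtimes> \<I> ?Y) \<odot> (adual g \<boxtimes> (adual f \<boxtimes> \<I> ?X) \<boxtimes> \<I> ?Y)
      = adual g \<boxtimes> (aev ?X \<odot> (adual f \<boxtimes> \<I> ?X)) \<boxtimes> \<I> ?Y"
    by (subst ainterchange; simp del: atensor_assoc)+
  also have "aev ?X \<odot> (adual f \<boxtimes> \<I> ?X) = ?e"
    by (subst aev_adual[of _ _ ?X']) simp_all
  also have "adual g \<boxtimes> ?e \<boxtimes> \<I> ?Y = (adual g \<boxtimes> \<I> ?Y) \<odot> (\<I> (?Y'\<^sup>\<or>) \<boxtimes> ?e \<boxtimes> \<I> ?Y)"
    using slide(1)[of "adual g" "?e \<boxtimes> \<I> ?Y"] by simp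
  also have "aev ?Y \<odot> \<dots> = (aev ?Y \<odot> (adual g \<boxtimes> \<I> ?Y)) \<odot> (\<I> (?Y'\<^sup>\<or>) \<boxtimes> ?e \<boxtimes> \<I> ?Y)"
    by simp
  also have "\<dots> = (aev ?Y' \<odot> (\<I> (?Y'\<^sup>\<or>) \<boxtimes> g)) \<odot> (\<I> (?Y'\<^sup>\<or>) \<boxtimes> ?e \<boxtimes> \<I> ?Y)"
    by (subst aev_adual[of _ _ ?Y']) simp_all
  also have "\<dots> = aev ?Y' \<odot> (\<I> (?Y'\<^sup>\<or>) \<boxtimes> (?e \<boxtimes> g))"
    using slide(2)[of ?e g] by (simp add: whisker_comp)
  also have "?e \<boxtimes> g = (aev ?X' \<boxtimes> \<I> ?Y') \<odot> (\<I> (?X'\<^sup>\<or>) \<boxtimes> f \<boxtimes> g)"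
    using ainterchange[of "\<I> (?X'\<^sup>\<or>) \<boxtimes> f" "aev ?X'" g "\<I> ?Y'"] by simp
  also have "aev ?Y' \<odot> (\<I> (?Y'\<^sup>\<or>) \<boxtimes> \<dots>) = aev (?X' \<otimes>\<^sub>o ?Y') \<odot> (\<I> ((?X' \<otimes>\<^sub>o ?Y')\<^sup>\<or>) \<boxtimes> f \<boxtimes> g)"
    by (simp add: aev_tensor flip: aide_tensor whisker_comp)
  also have "\<dots> = aev (?X \<otimes>\<^sub>o ?Y) \<odot> (adual (f \<boxtimes> g) \<boxtimes> \<I> (?X \<otimes>\<^sub>o ?Y))"
    by (subst aev_adual[of _ _ "?X' \<otimes>\<^sub>o ?Y'"]) simp_all
  finally show "aev (?X \<otimes>\<^sub>o ?Y) \<odot> (adual (f \<boxtimes> g) \<boxtimes> \<I> (?X \<otimes>\<^sub>o ?Y))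
      = aev (?X \<otimes>\<^sub>o ?Y) \<odot> ((adual g \<boxtimes> adual f) \<boxtimes> \<I> (?X \<otimes>\<^sub>o ?Y))" ..
qed simp_all

lemma adual_adual: "ok f \<Longrightarrow> adual (adual f) = f"
  by (rule arrow.expand) (simp add: ok_def dual_mor_dual_mor)

text \<open>The counterpart of \<open>aev_adual\<close> for coevaluations: bending the leg
  \<open>X\<^sup>\<or>\<close> back turns both sides into \<open>f\<close>.\<close>

lemma acoev_adual:
  assumes [simp]: "ok f" "src f = X" "trg f = Y"
  shows "(\<I> Y \<boxtimes> adual f) \<odot> acoev Y = (f \<boxtimes> \<I> (X\<^sup>\<or>)) \<odot> acoev X"
proof -
  have "runcurry Y X ((\<I> Y \<boxtimes> adual f) \<odot> acoev Y)
      = (\<I> Y \<boxtimes> (aev X \<odot> (adual f \<boxtimes> \<I> X))) \<odot> (acoev Y \<boxtimes> \<I> X)"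
    by (simp add: runcurry_def flip: whisker_comp)
  also have "\<dots> = (\<I> Y \<boxtimes> aev Y) \<odot> (\<I> Y \<boxtimes> \<I> (Y\<^sup>\<or>) \<boxtimes> f) \<odot> (acoev Y \<boxtimes> \<I> X)"
    by (subst aev_adual[of f X Y]) (simp_all flip: whisker_comp)
  also have "\<dots> = (\<I> Y \<boxtimes> aev Y) \<odot> (\<I> (Y \<otimes>\<^sub>o Y\<^sup>\<or>) \<boxtimes> f) \<odot> (acoev Y \<boxtimes> \<I> X)"
    by (simp flip: aide_tensor)
  also have "\<dots> = (\<I> Y \<boxtimes> aev Y) \<odot> (acoev Y \<boxtimes> \<I> Y) \<odot> f"
    using slide[of "acoev Y" f] by simp
  also have "\<dots> = f"
    using azigzag(1)[of Y] acomp_tail1[of "\<I> Y \<boxtimes> aev Y" "acoev Y \<boxtimes> \<I> Y" "\<I> Y" f] by simp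
  finally have *: "runcurry Y X ((\<I> Y \<boxtimes> adual f) \<odot> acoev Y) = f" .
  show ?thesis
    using rcurry_runcurry[of "(\<I> Y \<boxtimes> adual f) \<odot> acoev Y" "\<^bold>1" Y X, unfolded *]
    by (simp add: rcurry_def)
qed

text \<open>The axioms normalise evaluations at the unit and at products only. A coevaluation is
  determined by its evaluation through the snake identity, so it inherits the normal form, here and
  in \<open>acoev_tensor\<close>.\<close>

lemma acoev_unit: "acoev \<^bold>1 = \<I> \<^bold>1"
proof -
  have "aev \<^bold>1 = \<I> \<^bold>1" by (rule arrow.expand) (simp add: ev_unit)
  then show ?thesis using azigzag(1)[of "\<^bold>1"] by simp
qed

lemma acoev_tensor: "acoev (X \<otimes>\<^sub>o Y) = (\<I> X \<boxtimes> acoev Y \<boxtimes> \<I> (X\<^sup>\<or>)) \<odot> acoev X"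
proof -
  let ?c = "(\<I> X \<boxtimes> acoev Y \<boxtimes> \<I> (X\<^sup>\<or>)) \<odot> acoev X"
  let ?e = "\<I> X \<boxtimes> aev X" and ?k = "\<I> X \<boxtimes> acoev Y"
  have s: "(\<I> X \<boxtimes> \<I> Y \<boxtimes> \<I> (Y\<^sup>\<or>) \<boxtimes> aev X) \<odot> (\<I> X \<boxtimes> acoev Y \<boxtimes> \<I> (X\<^sup>\<or>) \<boxtimes> \<I> X)
     = ?k \<odot> ?e"
    using slide[of ?k "aev X"] by (simp flip: aide_tensor)
  have w: "?c \<boxtimes> \<I> X \<boxtimes> \<I> Y =
      (\<I> X \<boxtimes> acoev Y \<boxtimes> \<I> (X\<^sup>\<or>) \<boxtimes> \<I> X \<boxtimes> \<I> Y) \<odot> (acoev X \<boxtimes> \<I> X \<boxtimes> \<I> Y)"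
    using whisker_comp(2)[of "acoev X" "\<I> X \<boxtimes> acoev Y \<boxtimes> \<I> (X\<^sup>\<or>)" "X \<otimes>\<^sub>o Y"]
    by (simp flip: aide_tensor)
  have "runcurry (X \<otimes>\<^sub>o Y) (X \<otimes>\<^sub>o Y) ?c = (\<I> X \<boxtimes> \<I> Y \<boxtimes> aev Y) \<odot>
      (((\<I> X \<boxtimes> \<I> Y \<boxtimes> \<I> (Y\<^sup>\<or>) \<boxtimes> aev X) \<odot> (\<I> X \<boxtimes> acoev Y \<boxtimes> \<I> (X\<^sup>\<or>) \<boxtimes> \<I> X) \<odot> (acoev X \<boxtimes> \<I> X)) \<boxtimes> \<I> Y)"
    by (simp add: runcurry_def aev_tensor w flip: aide_tensor whisker_comp)
  also have "(\<I> X \<boxtimes> \<I> Y \<boxtimes> \<I> (Y\<^sup>\<or>) \<boxtimes> aev X) \<odot> (\<I> X \<boxtimes> acoev Y \<boxtimes> \<I> (X\<^sup>\<or>) \<boxtimes> \<I> X) \<odot> (acoev X \<boxtimes> \<I> X)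
      = ?k \<odot> ?e \<odot> (acoev X \<boxtimes> \<I> X)"
    by (rule acomp_tail[OF s]) simp_all
  also have "\<dots> = ?k"
    by (simp add: azigzag)
  also have "(\<I> X \<boxtimes> \<I> Y \<boxtimes> aev Y) \<odot> (?k \<boxtimes> \<I> Y) = \<I> X \<boxtimes> ((\<I> Y \<boxtimes> aev Y) \<odot> (acoev Y \<boxtimes> \<I> Y))"
    by (simp flip: whisker_comp)
  also have "\<dots> = \<I> (X \<otimes>\<^sub>o Y)" by (simp add: azigzag aide_tensor)
  finally have *: "runcurry (X \<otimes>\<^sub>o Y) (X \<otimes>\<^sub>o Y) ?c = \<I> (X \<otimes>\<^sub>o Y)" .
  show ?thesis
    using rcurry_runcurry[of ?c "\<^bold>1" "X \<otimes>\<^sub>o Y" "X \<otimes>\<^sub>o Y", unfolded *]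
    by (simp add: rcurry_def aide_tensor)
qed

end

subsection \<open>Braiding\<close>

context finite_ribbon_tensor_category
begin

definition abr where "abr X Y = Arrow (X \<otimes>\<^sub>o Y) (braid C X Y) (Y \<otimes>\<^sub>o X)"

lemma abr_sel [simp]:
  "src (abr X Y) = X \<otimes>\<^sub>o Y" "trg (abr X Y) = Y \<otimes>\<^sub>o X" "val (abr X Y) = braid C X Y" "ok (abr X Y)"
  using braid_iso[of X Y] by (simp_all add: abr_def ok_def is_iso_def)

lemma abr_natural:
  assumes "ok f" "ok g" "src f = X" "trg f = X'" "src g = Y" "trg g = Y'"
  shows "abr X' Y' \<odot> (f \<boxtimes> g) = (g \<boxtimes> f) \<odot> abr X Y"
  using assms by (intro arrow.expand) (auto simp: ok_def intro: braid_natural)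

lemma abr_tensor:
  "abr (X \<otimes>\<^sub>o Y) Z = (abr X Z \<boxtimes> \<I> Y) \<odot> (\<I> X \<boxtimes> abr Y Z)"
  "abr X (Y \<otimes>\<^sub>o Z) = (\<I> Y \<boxtimes> abr X Z) \<odot> (abr X Y \<boxtimes> \<I> Z)"
  by (rule arrow.expand; simp add: hexagon_left hexagon_right)+

lemma abr_inverse: "\<exists>g. ok g \<and> src g = Y \<otimes>\<^sub>o X \<and> trg g = X \<otimes>\<^sub>o Y \<and> g \<odot> abr X Y = \<I> (X \<otimes>\<^sub>o Y)"
proof -
  obtain g where "g \<in> Hom C (Y \<otimes>\<^sub>o X) (X \<otimes>\<^sub>o Y)" "g \<cdot> braid C X Y = ide C (X \<otimes>\<^sub>o Y)"
    using braid_iso[of X Y] by (auto simp: is_iso_def)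
  then show ?thesis
    by (intro exI[of _ "Arrow (Y \<otimes>\<^sub>o X) g (X \<otimes>\<^sub>o Y)"] conjI arrow.expand) (simp_all add: ok_def)
qed

text \<open>A hexagon with both merged factors equal to the unit makes this braiding idempotent, and
  an invertible idempotent is an identity.\<close>

lemma abr_unit [simp]: "abr \<^bold>1 Y = \<I> Y" "abr Y \<^bold>1 = \<I> Y"
proof -
  have idem: "b = \<I> Y" if b: "ok b" "src b = Y" "trg b = Y" "b \<odot> b = b"
    and g: "\<exists>g. ok g \<and> src g = Y \<and> trg g = Y \<and> g \<odot> b = \<I> Y" for b
  proof -
    from g obtain g where g: "ok g" "src g = Y" "trg g = Y" "g \<odot> b = \<I> Y" by blast
    have "(g \<odot> b) \<odot> b = g \<odot> b" using b g(1-3) by simp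
    then show ?thesis unfolding g(4) using b by simp
  qed
  show "abr \<^bold>1 Y = \<I> Y"
    using abr_tensor(1)[of "\<^bold>1" "\<^bold>1" Y, simplified, symmetric] abr_inverse[of Y "\<^bold>1"] by (intro idem) simp_all
  show "abr Y \<^bold>1 = \<I> Y"
    using abr_tensor(2)[of Y "\<^bold>1" "\<^bold>1", simplified, symmetric] abr_inverse[of "\<^bold>1" Y] by (intro idem) simp_all
qed

text \<open>The monodromy of the two strands.\<close>

definition dbr where "dbr X Y = abr Y X \<odot> abr X Y"

lemma dbr_sel [simp]: "src (dbr X Y) = X \<otimes>\<^sub>o Y" "trg (dbr X Y) = X \<otimes>\<^sub>o Y" "ok (dbr X Y)"
  by (simp_all add: dbr_def)

lemma dbr_natural:
  assumes [simp]: "ok f" "ok g" "src f = X" "trg f = X'" "src g = Y" "trg g = Y'"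
  shows "dbr X' Y' \<odot> (f \<boxtimes> g) = (f \<boxtimes> g) \<odot> dbr X Y"
proof -
  have "dbr X' Y' \<odot> (f \<boxtimes> g) = abr Y' X' \<odot> (g \<boxtimes> f) \<odot> abr X Y"
    by (simp add: dbr_def abr_natural[of f g X X' Y Y'])
  also have "\<dots> = (f \<boxtimes> g) \<odot> abr Y X \<odot> abr X Y"
    by (rule acomp_tail[OF abr_natural]) simp_all
  finally show ?thesis by (simp add: dbr_def)
qed

lemma dbr_tensor:
  "dbr (D \<otimes>\<^sub>o E) W = (\<I> D \<boxtimes> abr W E) \<odot> (dbr D W \<boxtimes> \<I> E) \<odot> (\<I> D \<boxtimes> abr E W)"
  by (simp add: dbr_def abr_tensor flip: whisker_comp)

text \<open>A loop coloured by \<open>D\<close> around a strand coloured by \<open>W\<close>.\<close>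

definition loop where
  "loop D W = (aev D \<boxtimes> \<I> W) \<odot> (\<I> (D\<^sup>\<or>) \<boxtimes> dbr D W) \<odot> (acoev (D\<^sup>\<or>) \<boxtimes> \<I> W)"

lemma loop_sel [simp]: "src (loop D W) = W" "trg (loop D W) = W" "ok (loop D W)"
  by (simp_all add: loop_def)

text \<open>The monodromy is natural in \<open>W\<close>, and both ends of the loop lie on strands
  disjoint from \<open>W\<close>.\<close>

lemma loop_natural:
  assumes [simp]: "ok g" "src g = W" "trg g = W'"
  shows "loop D W' \<odot> g = g \<odot> loop D W"
proof -
  have 1: "(acoev (D\<^sup>\<or>) \<boxtimes> \<I> W') \<odot> g = (\<I> (D\<^sup>\<or>) \<boxtimes> \<I> D \<boxtimes> g) \<odot> (acoev (D\<^sup>\<or>) \<boxtimes> \<I> W)"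
    using slide[of "acoev (D\<^sup>\<or>)" g] by (simp flip: aide_tensor)
  have 2: "(aev D \<boxtimes> \<I> W') \<odot> (\<I> (D\<^sup>\<or>) \<boxtimes> \<I> D \<boxtimes> g) = g \<odot> (aev D \<boxtimes> \<I> W)"
    using slide[of "aev D" g] by (simp flip: aide_tensor)
  have "loop D W' \<odot> g = (aev D \<boxtimes> \<I> W') \<odot>
      (\<I> (D\<^sup>\<or>) \<boxtimes> (dbr D W' \<odot> (\<I> D \<boxtimes> g))) \<odot> (acoev (D\<^sup>\<or>) \<boxtimes> \<I> W)"
    by (simp add: loop_def 1 flip: whisker_comp)
  also have "\<dots> = ((aev D \<boxtimes> \<I> W') \<odot> (\<I> (D\<^sup>\<or>) \<boxtimes> \<I> D \<boxtimes> g)) \<odot>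
      (\<I> (D\<^sup>\<or>) \<boxtimes> dbr D W) \<odot> (acoev (D\<^sup>\<or>) \<boxtimes> \<I> W)"
    by (simp add: dbr_natural[of "\<I> D" g D D W W'] flip: whisker_comp)
  also have "\<dots> = g \<odot> loop D W"
    unfolding 2 by (simp add: loop_def)
  finally show ?thesis .
qed

lemma loop_unit: "loop \<^bold>1 W = \<I> W"
proof -
  have "aev \<^bold>1 = \<I> \<^bold>1" by (rule arrow.expand) (simp add: ev_unit)
  then show ?thesis by (simp add: loop_def dbr_def acoev_unit)
qed

text \<open>The evaluation and coevaluation of a product are nested, so the loop consists of two
  nested loops. Naturality of the braiding slides the inner one along \<open>W\<close> past the
  strand \<open>E\<close>.\<close>

lemma loop_tensor: "loop (D \<otimes>\<^sub>o E) W = loop D W \<odot> loop E W"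
proof -
  \<comment> \<open>The \<open>D\<close> loop is closed while the strand \<open>E\<close> is still
    open.\<close>
  let ?M = "(aev D \<boxtimes> \<I> E \<boxtimes> \<I> W) \<odot> (\<I> (D\<^sup>\<or>) \<boxtimes> dbr (D \<otimes>\<^sub>o E) W) \<odot> (acoev (D\<^sup>\<or>) \<boxtimes> \<I> E \<boxtimes> \<I> W)"
  have 1: "(\<I> (D\<^sup>\<or>) \<boxtimes> \<I> D \<boxtimes> abr E W) \<odot> (acoev (D\<^sup>\<or>) \<boxtimes> \<I> E \<boxtimes> \<I> W)
      = (acoev (D\<^sup>\<or>) \<boxtimes> \<I> W \<boxtimes> \<I> E) \<odot> abr E W"
    using slide[of "acoev (D\<^sup>\<or>)" "abr E W"] by (simp flip: aide_tensor)
  have 2: "(aev D \<boxtimes> \<I> E \<boxtimes> \<I> W) \<odot> (\<I> (D\<^sup>\<or>) \<boxtimes> \<I> D \<boxtimes> abr W E) = abr W E \<odot> (aev D \<boxtimes> \<I> W \<boxtimes> \<I> E)"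
    using slide[of "aev D" "abr W E"] by (simp flip: aide_tensor)
  have "?M = ((aev D \<boxtimes> \<I> E \<boxtimes> \<I> W) \<odot> (\<I> (D\<^sup>\<or>) \<boxtimes> \<I> D \<boxtimes> abr W E)) \<odot>
      (\<I> (D\<^sup>\<or>) \<boxtimes> dbr D W \<boxtimes> \<I> E) \<odot> (acoev (D\<^sup>\<or>) \<boxtimes> \<I> W \<boxtimes> \<I> E) \<odot> abr E W"
    by (simp add: dbr_tensor 1 flip: whisker_comp)
  also have "\<dots> = abr W E \<odot> (loop D W \<boxtimes> \<I> E) \<odot> abr E W"
    unfolding 2 by (simp add: loop_def flip: whisker_comp)
  also have "\<dots> = (\<I> E \<boxtimes> loop D W) \<odot> abr W E \<odot> abr E W"
    by (rule acomp_tail[OF abr_natural]) simp_all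
  finally have M: "?M = (\<I> E \<boxtimes> loop D W) \<odot> dbr E W" by (simp add: dbr_def)
  have 3: "(aev E \<boxtimes> \<I> W) \<odot> (\<I> (E\<^sup>\<or>) \<boxtimes> \<I> E \<boxtimes> loop D W) = loop D W \<odot> (aev E \<boxtimes> \<I> W)"
    using slide[of "aev E" "loop D W"] by (simp flip: aide_tensor)
  have "loop (D \<otimes>\<^sub>o E) W = (aev E \<boxtimes> \<I> W) \<odot> (\<I> (E\<^sup>\<or>) \<boxtimes> ?M) \<odot> (acoev (E\<^sup>\<or>) \<boxtimes> \<I> W)"
    by (simp add: loop_def aev_tensor acoev_tensor flip: aide_tensor whisker_comp)
  also have "\<dots> = ((aev E \<boxtimes> \<I> W) \<odot> (\<I> (E\<^sup>\<or>) \<boxtimes> \<I> E \<boxtimes> loop D W)) \<odot>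
      (\<I> (E\<^sup>\<or>) \<boxtimes> dbr E W) \<odot> (acoev (E\<^sup>\<or>) \<boxtimes> \<I> W)"
    unfolding M by (simp flip: whisker_comp)
  also have "\<dots> = loop D W \<odot> loop E W"
    unfolding 3 by (simp add: loop_def)
  finally show ?thesis .
qed

end


section \<open>The canonical coend\<close>

context canonical_coend
begin

definition ai where "ai X = Arrow (X\<^sup>\<or> \<otimes>\<^sub>o X) (\<iota> X) L"

lemma ai_sel [simp]: "src (ai X) = X\<^sup>\<or> \<otimes>\<^sub>o X" "trg (ai X) = L" "val (ai X) = \<iota> X" "ok (ai X)"
  by (simp_all add: ai_def ok_def iota_in_Hom)

lemma ai_dinatural:
  "ok f \<Longrightarrow> src f = X \<Longrightarrow> trg f = Y \<Longrightarrow> ai Y \<odot> (\<I> (Y\<^sup>\<or>) \<boxtimes> f) = ai X \<odot> (adual f \<boxtimes> \<I> X)"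
  by (rule arrow.expand) (auto simp: ok_def intro: iota_dinatural)

lemma coend_unique:
  assumes "\<And>X. ok (\<kappa> X)" "\<And>X. src (\<kappa> X) = X\<^sup>\<or> \<otimes>\<^sub>o X" "\<And>X. trg (\<kappa> X) = Z"
    and "\<And>f. ok f \<Longrightarrow> \<kappa> (trg f) \<odot> (\<I> ((trg f)\<^sup>\<or>) \<boxtimes> f) = \<kappa> (src f) \<odot> (adual f \<boxtimes> \<I> (src f))"
  shows "\<exists>!u. ok u \<and> src u = L \<and> trg u = Z \<and> (\<forall>X. u \<odot> ai X = \<kappa> X)"
proof -
  have 1: "\<exists>!u. u \<in> Hom C L Z \<and> (\<forall>X. u \<cdot> \<iota> X = val (\<kappa> X))"
  proof (rule iota_universal)
    show "val (\<kappa> X) \<in> Hom C (X\<^sup>\<or> \<otimes>\<^sub>o X) Z" for X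
      using assms(1)[of X] by (simp add: ok_def assms)
    show "val (\<kappa> Y) \<cdot> (ide C (Y\<^sup>\<or>) \<otimes>\<^sub>m f) = val (\<kappa> X) \<cdot> (dual_mor C X Y f \<otimes>\<^sub>m ide C X)"
      if "f \<in> Hom C X Y" for X Y f
      using arg_cong[OF assms(4)[of "Arrow X f Y"], of val] that by (simp add: ok_def)
  qed
  then obtain u where u: "u \<in> Hom C L Z" "\<And>X. u \<cdot> \<iota> X = val (\<kappa> X)"
    "\<And>v. v \<in> Hom C L Z \<and> (\<forall>X. v \<cdot> \<iota> X = val (\<kappa> X)) \<Longrightarrow> v = u" by metis
  show ?thesis
  proof (rule ex1I[of _ "Arrow L u Z"], intro conjI allI)
    show "Arrow L u Z \<odot> ai X = \<kappa> X" for X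
      by (rule arrow.expand) (simp add: assms u)
    fix v assume v: "ok v \<and> src v = L \<and> trg v = Z \<and> (\<forall>X. v \<odot> ai X = \<kappa> X)"
    then have "val v \<cdot> \<iota> X = val (\<kappa> X)" for X by (metis ai_sel(3) arrow_sel(3))
    with v u(3)[of "val v"] show "v = Arrow L u Z" by (intro arrow.expand) (auto simp: ok_def)
  qed (simp_all add: ok_def u)
qed

section \<open>Universal property of \<open>L\<close> in the presence of further tensor
  factors\<close>

lemma coend_eqI:
  assumes "ok u" "ok v" "src u = L" "src v = L" "trg u = trg v" "\<And>X. u \<odot> ai X = v \<odot> ai X"
  shows "u = v"
proof -
  have "\<exists>!w. ok w \<and> src w = L \<and> trg w = trg u \<and> (\<forall>X. w \<odot> ai X = u \<odot> ai X)"
    by (rule coend_unique) (simp_all add: assms(1,3) ai_dinatural)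
  then show ?thesis using assms by metis
qed

text \<open>Rigidity: \<open>lcurry\<close> moves \<open>W\<close> into the target, where
  \<open>coend_eqI\<close> applies. Tensoring with an object therefore keeps the maps
  \<open>ai X\<close> jointly epic.\<close>

lemma coend_left_eqI:
  assumes "ok u" "ok v" "src u = W \<otimes>\<^sub>o L" "src v = W \<otimes>\<^sub>o L" "trg u = trg v"
    "\<And>X. u \<odot> (\<I> W \<boxtimes> ai X) = v \<odot> (\<I> W \<boxtimes> ai X)"
  shows "u = v"
proof -
  have "lcurry L W u = lcurry L W v"
    using assms by (rule_tac coend_eqI) (simp_all add: lcurry_comp)
  then show ?thesis using assms by (metis luncurry_lcurry)
qed

lemma coend_right_eqI:
  assumes "ok u" "ok v" "src u = L \<otimes>\<^sub>o W" "src v = L \<otimes>\<^sub>o W" "trg u = trg v"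
    "\<And>X. u \<odot> (ai X \<boxtimes> \<I> W) = v \<odot> (ai X \<boxtimes> \<I> W)"
  shows "u = v"
proof -
  have "rcurry L W u = rcurry L W v"
    using assms by (rule_tac coend_eqI) (simp_all add: rcurry_comp)
  then show ?thesis using assms by (metis runcurry_rcurry)
qed

lemma coend2_eqI:
  assumes uv: "ok u" "ok v" "src u = L \<otimes>\<^sub>o L" "src v = L \<otimes>\<^sub>o L" "trg u = trg v"
    and "\<And>X Y. u \<odot> (ai X \<boxtimes> ai Y) = v \<odot> (ai X \<boxtimes> ai Y)"
  shows "u = v"
proof (rule coend_right_eqI[OF uv], rule coend_left_eqI)
  fix X Y
  have "(u \<odot> (ai X \<boxtimes> \<I> L)) \<odot> (\<I> (X\<^sup>\<or> \<otimes>\<^sub>o X) \<boxtimes> ai Y) = u \<odot> (ai X \<boxtimes> ai Y)"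
    "(v \<odot> (ai X \<boxtimes> \<I> L)) \<odot> (\<I> (X\<^sup>\<or> \<otimes>\<^sub>o X) \<boxtimes> ai Y) = v \<odot> (ai X \<boxtimes> ai Y)"
    using slide(1)[of "ai X" "ai Y"] uv by simp_all
  then show "(u \<odot> (ai X \<boxtimes> \<I> L)) \<odot> (\<I> (X\<^sup>\<or> \<otimes>\<^sub>o X) \<boxtimes> ai Y) = (v \<odot> (ai X \<boxtimes> \<I> L)) \<odot> (\<I> (X\<^sup>\<or> \<otimes>\<^sub>o X) \<boxtimes> ai Y)"
    using assms by simp
qed (use uv in simp_all)

text \<open>Existence by the same transposition: a family that is dinatural in \<open>X\<close>,
  with \<open>W\<close> as a spectator, factors through
  \<open>W \<otimes>\<^sub>o L\<close>.\<close>

lemma coend_left_factor: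
  assumes [simp]: "\<And>X. ok (\<kappa> X)" "\<And>X. src (\<kappa> X) = W \<otimes>\<^sub>o X\<^sup>\<or> \<otimes>\<^sub>o X" "\<And>X. trg (\<kappa> X) = Z"
    and din: "\<And>f. ok f \<Longrightarrow>
      \<kappa> (trg f) \<odot> (\<I> W \<boxtimes> \<I> ((trg f)\<^sup>\<or>) \<boxtimes> f) = \<kappa> (src f) \<odot> (\<I> W \<boxtimes> adual f \<boxtimes> \<I> (src f))"
  shows "\<exists>u. ok u \<and> src u = W \<otimes>\<^sub>o L \<and> trg u = Z \<and> (\<forall>X. u \<odot> (\<I> W \<boxtimes> ai X) = \<kappa> X)"
proof -
  let ?\<kappa> = "\<lambda>X. lcurry (X\<^sup>\<or> \<otimes>\<^sub>o X) W (\<kappa> X)"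
  have "\<exists>!u. ok u \<and> src u = L \<and> trg u = W\<^sup>\<or> \<otimes>\<^sub>o Z \<and> (\<forall>X. u \<odot> ai X = ?\<kappa> X)"
    by (rule coend_unique) (simp_all add: lcurry_comp din)
  then obtain u where u: "ok u" "src u = L" "trg u = W\<^sup>\<or> \<otimes>\<^sub>o Z" "\<And>X. u \<odot> ai X = ?\<kappa> X" by blast
  have "luncurry Z W u \<odot> (\<I> W \<boxtimes> ai X) = \<kappa> X" for X
    using u luncurry_lcurry[of "\<kappa> X" W "X\<^sup>\<or> \<otimes>\<^sub>o X" Z] by (simp flip: luncurry_comp)
  then show ?thesis using u by (intro exI[of _ "luncurry Z W u"]) simp
qed

lemma coend_right_factor:
  assumes [simp]: "\<And>X. ok (\<kappa> X)" "\<And>X. src (\<kappa> X) = X\<^sup>\<or> \<otimes>\<^sub>o X \<otimes>\<^sub>o W" "\<And>X. trg (\<kappa> X) = Z"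
    and din: "\<And>f. ok f \<Longrightarrow>
      \<kappa> (trg f) \<odot> (\<I> ((trg f)\<^sup>\<or>) \<boxtimes> f \<boxtimes> \<I> W) = \<kappa> (src f) \<odot> (adual f \<boxtimes> \<I> (src f) \<boxtimes> \<I> W)"
  shows "\<exists>u. ok u \<and> src u = L \<otimes>\<^sub>o W \<and> trg u = Z \<and> (\<forall>X. u \<odot> (ai X \<boxtimes> \<I> W) = \<kappa> X)"
proof -
  let ?\<kappa> = "\<lambda>X. rcurry (X\<^sup>\<or> \<otimes>\<^sub>o X) W (\<kappa> X)"
  have "\<exists>!u. ok u \<and> src u = L \<and> trg u = Z \<otimes>\<^sub>o W\<^sup>\<or> \<and> (\<forall>X. u \<odot> ai X = ?\<kappa> X)"
    by (rule coend_unique) (simp_all add: rcurry_comp din)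
  then obtain u where u: "ok u" "src u = L" "trg u = Z \<otimes>\<^sub>o W\<^sup>\<or>" "\<And>X. u \<odot> ai X = ?\<kappa> X" by blast
  have "runcurry Z W u \<odot> (ai X \<boxtimes> \<I> W) = \<kappa> X" for X
    using u runcurry_rcurry[of "\<kappa> X" "X\<^sup>\<or> \<otimes>\<^sub>o X" W Z] by (simp flip: runcurry_comp)
  then show ?thesis using u by (intro exI[of _ "runcurry Z W u"]) simp
qed

text \<open>Fubini for coends: factor in the second variable for each fixed \<open>X\<close>, then
  in the first. The intermediate maps \<open>u X\<close> are dinatural in \<open>X\<close> because
  this can be tested on the jointly epic \<open>ai Y\<close>, where it is
  \<open>din1\<close>.\<close>

lemma coend2_factor:
  assumes [simp]: "\<And>X Y. ok (\<kappa> X Y)" "\<And>X Y. src (\<kappa> X Y) = X\<^sup>\<or> \<otimes>\<^sub>o X \<otimes>\<^sub>o Y\<^sup>\<or> \<otimes>\<^sub>o Y"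
      "\<And>X Y. trg (\<kappa> X Y) = Z"
    and din1: "\<And>f Y. ok f \<Longrightarrow> \<kappa> (trg f) Y \<odot> (\<I> ((trg f)\<^sup>\<or>) \<boxtimes> f \<boxtimes> \<I> (Y\<^sup>\<or>) \<boxtimes> \<I> Y)
        = \<kappa> (src f) Y \<odot> (adual f \<boxtimes> \<I> (src f) \<boxtimes> \<I> (Y\<^sup>\<or>) \<boxtimes> \<I> Y)"
    and din2: "\<And>f X. ok f \<Longrightarrow> \<kappa> X (trg f) \<odot> (\<I> (X\<^sup>\<or>) \<boxtimes> \<I> X \<boxtimes> \<I> ((trg f)\<^sup>\<or>) \<boxtimes> f)
        = \<kappa> X (src f) \<odot> (\<I> (X\<^sup>\<or>) \<boxtimes> \<I> X \<boxtimes> adual f \<boxtimes> \<I> (src f))"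
  shows "\<exists>!u. ok u \<and> src u = L \<otimes>\<^sub>o L \<and> trg u = Z \<and> (\<forall>X Y. u \<odot> (ai X \<boxtimes> ai Y) = \<kappa> X Y)"
proof -
  have "\<exists>u. ok u \<and> src u = (X\<^sup>\<or> \<otimes>\<^sub>o X) \<otimes>\<^sub>o L \<and> trg u = Z \<and>
      (\<forall>Y. u \<odot> (\<I> (X\<^sup>\<or> \<otimes>\<^sub>o X) \<boxtimes> ai Y) = \<kappa> X Y)" for X
    by (rule coend_left_factor) (simp_all add: din2 flip: aide_tensor)
  then obtain u where u [simp]: "\<And>X. ok (u X)" "\<And>X. src (u X) = X\<^sup>\<or> \<otimes>\<^sub>o X \<otimes>\<^sub>o L"
    "\<And>X. trg (u X) = Z" and u': "\<And>X Y. u X \<odot> (\<I> (X\<^sup>\<or> \<otimes>\<^sub>o X) \<boxtimes> ai Y) = \<kappa> X Y"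
    by (simp del: aide_tensor) metis
  have "\<exists>v. ok v \<and> src v = L \<otimes>\<^sub>o L \<and> trg v = Z \<and> (\<forall>X. v \<odot> (ai X \<boxtimes> \<I> L) = u X)"
  proof (rule coend_right_factor)
    fix f assume [simp]: "ok f"
    let ?X = "src f" and ?Y = "trg f"
    show "u ?Y \<odot> (\<I> (?Y\<^sup>\<or>) \<boxtimes> f \<boxtimes> \<I> L) = u ?X \<odot> (adual f \<boxtimes> \<I> ?X \<boxtimes> \<I> L)"
    proof (rule coend_left_eqI[where W = "?Y\<^sup>\<or> \<otimes>\<^sub>o ?X"])
      fix Y
      have 1: "(\<I> (?Y\<^sup>\<or>) \<boxtimes> f \<boxtimes> \<I> L) \<odot> (\<I> (?Y\<^sup>\<or> \<otimes>\<^sub>o ?X) \<boxtimes> ai Y)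
          = (\<I> (?Y\<^sup>\<or> \<otimes>\<^sub>o ?Y) \<boxtimes> ai Y) \<odot> (\<I> (?Y\<^sup>\<or>) \<boxtimes> f \<boxtimes> \<I> (Y\<^sup>\<or>) \<boxtimes> \<I> Y)"
        using slide[of "\<I> (?Y\<^sup>\<or>) \<boxtimes> f" "ai Y"] by (simp flip: aide_tensor)
      have 2: "(adual f \<boxtimes> \<I> ?X \<boxtimes> \<I> L) \<odot> (\<I> (?Y\<^sup>\<or> \<otimes>\<^sub>o ?X) \<boxtimes> ai Y)
          = (\<I> (?X\<^sup>\<or> \<otimes>\<^sub>o ?X) \<boxtimes> ai Y) \<odot> (adual f \<boxtimes> \<I> ?X \<boxtimes> \<I> (Y\<^sup>\<or>) \<boxtimes> \<I> Y)"
        using slide[of "adual f \<boxtimes> \<I> ?X" "ai Y"] by (simp flip: aide_tensor)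
      have "(u ?Y \<odot> (\<I> (?Y\<^sup>\<or>) \<boxtimes> f \<boxtimes> \<I> L)) \<odot> (\<I> (?Y\<^sup>\<or> \<otimes>\<^sub>o ?X) \<boxtimes> ai Y)
          = \<kappa> ?Y Y \<odot> (\<I> (?Y\<^sup>\<or>) \<boxtimes> f \<boxtimes> \<I> (Y\<^sup>\<or>) \<boxtimes> \<I> Y)"
        by (simp add: 1 flip: u')
      also have "\<dots> = \<kappa> ?X Y \<odot> (adual f \<boxtimes> \<I> ?X \<boxtimes> \<I> (Y\<^sup>\<or>) \<boxtimes> \<I> Y)"
        by (simp add: din1)
      also have "\<dots> = (u ?X \<odot> (adual f \<boxtimes> \<I> ?X \<boxtimes> \<I> L)) \<odot> (\<I> (?Y\<^sup>\<or> \<otimes>\<^sub>o ?X) \<boxtimes> ai Y)"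
        by (simp add: 2 flip: u')
      finally show "(u ?Y \<odot> (\<I> (?Y\<^sup>\<or>) \<boxtimes> f \<boxtimes> \<I> L)) \<odot> (\<I> (?Y\<^sup>\<or> \<otimes>\<^sub>o ?X) \<boxtimes> ai Y)
          = (u ?X \<odot> (adual f \<boxtimes> \<I> ?X \<boxtimes> \<I> L)) \<odot> (\<I> (?Y\<^sup>\<or> \<otimes>\<^sub>o ?X) \<boxtimes> ai Y)" .
    qed simp_all
  qed simp_all
  then obtain v where v: "ok v" "src v = L \<otimes>\<^sub>o L" "trg v = Z" "\<And>X. v \<odot> (ai X \<boxtimes> \<I> L) = u X"
    by blast
  have "v \<odot> (ai X \<boxtimes> ai Y) = \<kappa> X Y" for X Y
  proof -
    have "v \<odot> (ai X \<boxtimes> ai Y) = (v \<odot> (ai X \<boxtimes> \<I> L)) \<odot> (\<I> (X\<^sup>\<or> \<otimes>\<^sub>o X) \<boxtimes> ai Y)"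
      using slide(1)[of "ai X" "ai Y"] v(1-3) by simp
    then show ?thesis using u' v by simp
  qed
  then show ?thesis using v coend2_eqI by (intro ex1I[of _ v]) auto
qed

end

context finite_ribbon_tensor_category
begin

lemma abr_natural_whisker:
  assumes "ok h" "ok k" "src h = A" "trg h = A'" "src k = V" "trg k = V'"
  shows "(abr A' V' \<boxtimes> \<I> Y) \<odot> (h \<boxtimes> k \<boxtimes> \<I> Y) = (k \<boxtimes> h \<boxtimes> \<I> Y) \<odot> (abr A V \<boxtimes> \<I> Y)"
proof -
  have "(abr A' V' \<boxtimes> \<I> Y) \<odot> ((h \<boxtimes> k) \<boxtimes> \<I> Y) = ((k \<boxtimes> h) \<boxtimes> \<I> Y) \<odot> (abr A V \<boxtimes> \<I> Y)"
    using assms abr_natural[OF assms] by (simp add: whisker_comp del: atensor_assoc)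
  then show ?thesis using assms by simp
qed

lemma dbr_natural_whisker:
  assumes "ok f" "ok k" "ok l" "src f = X" "trg f = X'" "src k = V" "trg k = V'" "src l = Y" "trg l = Y'"
  shows "(\<I> A \<boxtimes> dbr X' V' \<boxtimes> \<I> Y') \<odot> (\<I> A \<boxtimes> f \<boxtimes> k \<boxtimes> l) = (\<I> A \<boxtimes> f \<boxtimes> k \<boxtimes> l) \<odot> (\<I> A \<boxtimes> dbr X V \<boxtimes> \<I> Y)"
proof -
  have "(dbr X' V' \<boxtimes> \<I> Y') \<odot> ((f \<boxtimes> k) \<boxtimes> l) = ((f \<boxtimes> k) \<boxtimes> l) \<odot> (dbr X V \<boxtimes> \<I> Y)"
    using assms dbr_natural[of f k X X' V V'] by (simp add: ainterchange del: atensor_assoc)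
  then have "\<I> A \<boxtimes> ((dbr X' V' \<boxtimes> \<I> Y') \<odot> ((f \<boxtimes> k) \<boxtimes> l)) = \<I> A \<boxtimes> (((f \<boxtimes> k) \<boxtimes> l) \<odot> (dbr X V \<boxtimes> \<I> Y))"
    by simp
  then show ?thesis using assms by (simp flip: whisker_comp)
qed

end

context canonical_coend
begin

subsection \<open>Product and pairing\<close>

text \<open>Gives meaning to the definite description in \<open>L_mult\<close>. Naturality carries a
  morphism and its dual past the braiding; dinaturality of \<iota> at the products
  \<open>f \<boxtimes> \<I> Y\<close> and \<open>\<I> X \<boxtimes> g\<close> finishes, with
  \<open>adual_tensor\<close> splitting the dual.\<close>

lemma L_mult_unique:
  "\<exists>!m. m \<in> Hom C (L \<otimes>\<^sub>o L) L \<and>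
     (\<forall>X Y. m \<cdot> (\<iota> X \<otimes>\<^sub>m \<iota> Y) = \<iota> (X \<otimes>\<^sub>o Y) \<cdot> (braid C (X\<^sup>\<or> \<otimes>\<^sub>o X) (Y\<^sup>\<or>) \<otimes>\<^sub>m ide C Y))"
  (is "\<exists>!m. ?P m")
proof -
  let ?\<kappa> = "\<lambda>X Y. ai (X \<otimes>\<^sub>o Y) \<odot> (abr (X\<^sup>\<or> \<otimes>\<^sub>o X) (Y\<^sup>\<or>) \<boxtimes> \<I> Y)"
  have "\<exists>!u. ok u \<and> src u = L \<otimes>\<^sub>o L \<and> trg u = L \<and> (\<forall>X Y. u \<odot> (ai X \<boxtimes> ai Y) = ?\<kappa> X Y)"
  proof (rule coend2_factor)
    fix f Y assume [simp]: "ok f"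
    let ?X = "src f" and ?X' = "trg f"
    have 1: "(abr (?X'\<^sup>\<or> \<otimes>\<^sub>o ?X') (Y\<^sup>\<or>) \<boxtimes> \<I> Y) \<odot> (\<I> (?X'\<^sup>\<or>) \<boxtimes> f \<boxtimes> \<I> (Y\<^sup>\<or>) \<boxtimes> \<I> Y)
        = (\<I> (Y\<^sup>\<or>) \<boxtimes> \<I> (?X'\<^sup>\<or>) \<boxtimes> f \<boxtimes> \<I> Y) \<odot> (abr (?X'\<^sup>\<or> \<otimes>\<^sub>o ?X) (Y\<^sup>\<or>) \<boxtimes> \<I> Y)"
      using abr_natural_whisker[of "\<I> (?X'\<^sup>\<or>) \<boxtimes> f" "\<I> (Y\<^sup>\<or>)"] by simp
    have 2: "(abr (?X\<^sup>\<or> \<otimes>\<^sub>o ?X) (Y\<^sup>\<or>) \<boxtimes> \<I> Y) \<odot> (adual f \<boxtimes> \<I> ?X \<boxtimes> \<I> (Y\<^sup>\<or>) \<boxtimes> \<I> Y)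
        = (\<I> (Y\<^sup>\<or>) \<boxtimes> adual f \<boxtimes> \<I> ?X \<boxtimes> \<I> Y) \<odot> (abr (?X'\<^sup>\<or> \<otimes>\<^sub>o ?X) (Y\<^sup>\<or>) \<boxtimes> \<I> Y)"
      using abr_natural_whisker[of "adual f \<boxtimes> \<I> ?X" "\<I> (Y\<^sup>\<or>)"] by simp
    have 3: "ai (?X' \<otimes>\<^sub>o Y) \<odot> (\<I> (Y\<^sup>\<or>) \<boxtimes> \<I> (?X'\<^sup>\<or>) \<boxtimes> f \<boxtimes> \<I> Y)
        = ai (?X \<otimes>\<^sub>o Y) \<odot> (\<I> (Y\<^sup>\<or>) \<boxtimes> adual f \<boxtimes> \<I> ?X \<boxtimes> \<I> Y)"
      using ai_dinatural[OF _ refl refl, of "f \<boxtimes> \<I> Y"] by (simp add: adual_tensor flip: aide_tensor)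
    have "ai (?X' \<otimes>\<^sub>o Y) \<odot> (\<I> (Y\<^sup>\<or>) \<boxtimes> \<I> (?X'\<^sup>\<or>) \<boxtimes> f \<boxtimes> \<I> Y) \<odot> (abr (?X'\<^sup>\<or> \<otimes>\<^sub>o ?X) (Y\<^sup>\<or>) \<boxtimes> \<I> Y)
      = ai (?X \<otimes>\<^sub>o Y) \<odot> (\<I> (Y\<^sup>\<or>) \<boxtimes> adual f \<boxtimes> \<I> ?X \<boxtimes> \<I> Y) \<odot> (abr (?X'\<^sup>\<or> \<otimes>\<^sub>o ?X) (Y\<^sup>\<or>) \<boxtimes> \<I> Y)"
      by (rule acomp_tail[OF 3]) simp_all
    then show "?\<kappa> ?X' Y \<odot> (\<I> (?X'\<^sup>\<or>) \<boxtimes> f \<boxtimes> \<I> (Y\<^sup>\<or>) \<boxtimes> \<I> Y)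
        = ?\<kappa> ?X Y \<odot> (adual f \<boxtimes> \<I> ?X \<boxtimes> \<I> (Y\<^sup>\<or>) \<boxtimes> \<I> Y)"
      by (simp add: 1 2)
  next
    fix g X assume [simp]: "ok g"
    let ?Y = "src g" and ?Y' = "trg g"
    have 1: "(abr (X\<^sup>\<or> \<otimes>\<^sub>o X) (?Y'\<^sup>\<or>) \<boxtimes> \<I> ?Y') \<odot> (\<I> (X\<^sup>\<or>) \<boxtimes> \<I> X \<boxtimes> \<I> (?Y'\<^sup>\<or>) \<boxtimes> g)
        = (\<I> (?Y'\<^sup>\<or>) \<boxtimes> \<I> (X\<^sup>\<or>) \<boxtimes> \<I> X \<boxtimes> g) \<odot> (abr (X\<^sup>\<or> \<otimes>\<^sub>o X) (?Y'\<^sup>\<or>) \<boxtimes> \<I> ?Y)"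
      using slide[of "abr (X\<^sup>\<or> \<otimes>\<^sub>o X) (?Y'\<^sup>\<or>)" g] by (simp flip: aide_tensor)
    have 2: "(abr (X\<^sup>\<or> \<otimes>\<^sub>o X) (?Y\<^sup>\<or>) \<boxtimes> \<I> ?Y) \<odot> (\<I> (X\<^sup>\<or>) \<boxtimes> \<I> X \<boxtimes> adual g \<boxtimes> \<I> ?Y)
        = (adual g \<boxtimes> \<I> (X\<^sup>\<or>) \<boxtimes> \<I> X \<boxtimes> \<I> ?Y) \<odot> (abr (X\<^sup>\<or> \<otimes>\<^sub>o X) (?Y'\<^sup>\<or>) \<boxtimes> \<I> ?Y)"
      using abr_natural_whisker[of "\<I> (X\<^sup>\<or>) \<boxtimes> \<I> X" "adual g"] by simp
    have 3: "ai (X \<otimes>\<^sub>o ?Y') \<odot> (\<I> (?Y'\<^sup>\<or>) \<boxtimes> \<I> (X\<^sup>\<or>) \<boxtimes> \<I> X \<boxtimes> g)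
        = ai (X \<otimes>\<^sub>o ?Y) \<odot> (adual g \<boxtimes> \<I> (X\<^sup>\<or>) \<boxtimes> \<I> X \<boxtimes> \<I> ?Y)"
      using ai_dinatural[OF _ refl refl, of "\<I> X \<boxtimes> g"] by (simp add: adual_tensor flip: aide_tensor)
    have "ai (X \<otimes>\<^sub>o ?Y') \<odot> (\<I> (?Y'\<^sup>\<or>) \<boxtimes> \<I> (X\<^sup>\<or>) \<boxtimes> \<I> X \<boxtimes> g) \<odot> (abr (X\<^sup>\<or> \<otimes>\<^sub>o X) (?Y'\<^sup>\<or>) \<boxtimes> \<I> ?Y)
      = ai (X \<otimes>\<^sub>o ?Y) \<odot> (adual g \<boxtimes> \<I> (X\<^sup>\<or>) \<boxtimes> \<I> X \<boxtimes> \<I> ?Y) \<odot> (abr (X\<^sup>\<or> \<otimes>\<^sub>o X) (?Y'\<^sup>\<or>) \<boxtimes> \<I> ?Y)"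
      by (rule acomp_tail[OF 3]) simp_all
    then show "?\<kappa> X ?Y' \<odot> (\<I> (X\<^sup>\<or>) \<boxtimes> \<I> X \<boxtimes> \<I> (?Y'\<^sup>\<or>) \<boxtimes> g)
        = ?\<kappa> X ?Y \<odot> (\<I> (X\<^sup>\<or>) \<boxtimes> \<I> X \<boxtimes> adual g \<boxtimes> \<I> ?Y)"
      by (simp add: 1 2)
  qed simp_all
  then obtain u where u: "ok u" "src u = L \<otimes>\<^sub>o L" "trg u = L" "\<And>X Y. u \<odot> (ai X \<boxtimes> ai Y) = ?\<kappa> X Y"
    by blast
  show ?thesis
  proof (rule ex1I[of _ "val u"])
    show "?P (val u)"
      using u(1-3) arg_cong[OF u(4), of val] by (auto simp: ok_def)
    fix m assume m: "?P m"
    have "Arrow (L \<otimes>\<^sub>o L) m L = u"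
    proof (rule coend2_eqI)
      fix X Y show "Arrow (L \<otimes>\<^sub>o L) m L \<odot> (ai X \<boxtimes> ai Y) = u \<odot> (ai X \<boxtimes> ai Y)"
        unfolding u(4) by (rule arrow.expand) (simp add: m)
    qed (use u m in \<open>simp_all add: ok_def\<close>)
    then show "m = val u" by auto
  qed
qed

text \<open>The same for the Hopf pairing: morphisms pass the monodromy by naturality and change
  sides at the evaluations by \<open>aev_adual\<close>.\<close>

lemma hopf_pairing_unique:
  "\<exists>!w. w \<in> Hom C (L \<otimes>\<^sub>o L) \<^bold>1 \<and>
     (\<forall>X Y. w \<cdot> (\<iota> X \<otimes>\<^sub>m \<iota> Y) = (ev C X \<otimes>\<^sub>m ev C Y) \<cdot>
        (ide C (X\<^sup>\<or>) \<otimes>\<^sub>m (braid C (Y\<^sup>\<or>) X \<cdot> braid C X (Y\<^sup>\<or>)) \<otimes>\<^sub>m ide C Y))"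
  (is "\<exists>!m. ?P m")
proof -
  let ?\<kappa> = "\<lambda>X Y. (aev X \<boxtimes> aev Y) \<odot> (\<I> (X\<^sup>\<or>) \<boxtimes> dbr X (Y\<^sup>\<or>) \<boxtimes> \<I> Y)"
  have "\<exists>!u. ok u \<and> src u = L \<otimes>\<^sub>o L \<and> trg u = \<^bold>1 \<and> (\<forall>X Y. u \<odot> (ai X \<boxtimes> ai Y) = ?\<kappa> X Y)"
  proof (rule coend2_factor)
    fix f Y assume [simp]: "ok f"
    let ?X = "src f" and ?X' = "trg f"
    let ?Y = "\<I> (Y\<^sup>\<or>) \<boxtimes> \<I> Y"
    have 1: "(\<I> (?X'\<^sup>\<or>) \<boxtimes> dbr ?X' (Y\<^sup>\<or>) \<boxtimes> \<I> Y) \<odot> (\<I> (?X'\<^sup>\<or>) \<boxtimes> f \<boxtimes> ?Y)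
      = (\<I> (?X'\<^sup>\<or>) \<boxtimes> f \<boxtimes> ?Y) \<odot> (\<I> (?X'\<^sup>\<or>) \<boxtimes> dbr ?X (Y\<^sup>\<or>) \<boxtimes> \<I> Y)"
      using dbr_natural_whisker[of f "\<I> (Y\<^sup>\<or>)" "\<I> Y"] by simp
    have 2: "(\<I> (?X\<^sup>\<or>) \<boxtimes> dbr ?X (Y\<^sup>\<or>) \<boxtimes> \<I> Y) \<odot> (adual f \<boxtimes> \<I> ?X \<boxtimes> ?Y)
      = (adual f \<boxtimes> \<I> ?X \<boxtimes> ?Y) \<odot> (\<I> (?X'\<^sup>\<or>) \<boxtimes> dbr ?X (Y\<^sup>\<or>) \<boxtimes> \<I> Y)"
      using slide[of "adual f" "dbr ?X (Y\<^sup>\<or>) \<boxtimes> \<I> Y"] by (simp flip: aide_tensor)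
    have "(aev ?X' \<boxtimes> aev Y) \<odot> ((\<I> (?X'\<^sup>\<or>) \<boxtimes> f) \<boxtimes> ?Y) = (aev ?X \<boxtimes> aev Y) \<odot> ((adual f \<boxtimes> \<I> ?X) \<boxtimes> ?Y)"
      by (subst (1 2) ainterchange) (simp_all add: aev_adual del: atensor_assoc add: aide_tensor)
    then have 3: "(aev ?X' \<boxtimes> aev Y) \<odot> (\<I> (?X'\<^sup>\<or>) \<boxtimes> f \<boxtimes> ?Y) = (aev ?X \<boxtimes> aev Y) \<odot> (adual f \<boxtimes> \<I> ?X \<boxtimes> ?Y)"
      by simp
    have "(aev ?X' \<boxtimes> aev Y) \<odot> (\<I> (?X'\<^sup>\<or>) \<boxtimes> f \<boxtimes> ?Y) \<odot> (\<I> (?X'\<^sup>\<or>) \<boxtimes> dbr ?X (Y\<^sup>\<or>) \<boxtimes> \<I> Y)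
       = (aev ?X \<boxtimes> aev Y) \<odot> (adual f \<boxtimes> \<I> ?X \<boxtimes> ?Y) \<odot> (\<I> (?X'\<^sup>\<or>) \<boxtimes> dbr ?X (Y\<^sup>\<or>) \<boxtimes> \<I> Y)"
      by (rule acomp_tail[OF 3]) simp_all
    then show "?\<kappa> ?X' Y \<odot> (\<I> (?X'\<^sup>\<or>) \<boxtimes> f \<boxtimes> ?Y) = ?\<kappa> ?X Y \<odot> (adual f \<boxtimes> \<I> ?X \<boxtimes> ?Y)"
      by (simp add: 1 2)
  next
    fix g X assume [simp]: "ok g"
    let ?Y = "src g" and ?Y' = "trg g"
    have 1: "(\<I> (X\<^sup>\<or>) \<boxtimes> dbr X (?Y'\<^sup>\<or>) \<boxtimes> \<I> ?Y') \<odot> (\<I> (X\<^sup>\<or>) \<boxtimes> \<I> X \<boxtimes> \<I> (?Y'\<^sup>\<or>) \<boxtimes> g)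
      = (\<I> (X\<^sup>\<or>) \<boxtimes> \<I> X \<boxtimes> \<I> (?Y'\<^sup>\<or>) \<boxtimes> g) \<odot> (\<I> (X\<^sup>\<or>) \<boxtimes> dbr X (?Y'\<^sup>\<or>) \<boxtimes> \<I> ?Y)"
      by (rule dbr_natural_whisker) simp_all
    have 2: "(\<I> (X\<^sup>\<or>) \<boxtimes> dbr X (?Y\<^sup>\<or>) \<boxtimes> \<I> ?Y) \<odot> (\<I> (X\<^sup>\<or>) \<boxtimes> \<I> X \<boxtimes> adual g \<boxtimes> \<I> ?Y)
      = (\<I> (X\<^sup>\<or>) \<boxtimes> \<I> X \<boxtimes> adual g \<boxtimes> \<I> ?Y) \<odot> (\<I> (X\<^sup>\<or>) \<boxtimes> dbr X (?Y'\<^sup>\<or>) \<boxtimes> \<I> ?Y)"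
      by (rule dbr_natural_whisker) simp_all
    have "(aev X \<boxtimes> aev ?Y') \<odot> ((\<I> (X\<^sup>\<or>) \<boxtimes> \<I> X) \<boxtimes> \<I> (?Y'\<^sup>\<or>) \<boxtimes> g)
        = (aev X \<boxtimes> aev ?Y) \<odot> ((\<I> (X\<^sup>\<or>) \<boxtimes> \<I> X) \<boxtimes> adual g \<boxtimes> \<I> ?Y)"
      by (subst (1 2) ainterchange) (simp_all add: aev_adual del: atensor_assoc add: aide_tensor)
    then have 3: "(aev X \<boxtimes> aev ?Y') \<odot> (\<I> (X\<^sup>\<or>) \<boxtimes> \<I> X \<boxtimes> \<I> (?Y'\<^sup>\<or>) \<boxtimes> g)
        = (aev X \<boxtimes> aev ?Y) \<odot> (\<I> (X\<^sup>\<or>) \<boxtimes> \<I> X \<boxtimes> adual g \<boxtimes> \<I> ?Y)"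
      by simp
    have "(aev X \<boxtimes> aev ?Y') \<odot> (\<I> (X\<^sup>\<or>) \<boxtimes> \<I> X \<boxtimes> \<I> (?Y'\<^sup>\<or>) \<boxtimes> g) \<odot> (\<I> (X\<^sup>\<or>) \<boxtimes> dbr X (?Y'\<^sup>\<or>) \<boxtimes> \<I> ?Y)
        = (aev X \<boxtimes> aev ?Y) \<odot> (\<I> (X\<^sup>\<or>) \<boxtimes> \<I> X \<boxtimes> adual g \<boxtimes> \<I> ?Y) \<odot> (\<I> (X\<^sup>\<or>) \<boxtimes> dbr X (?Y'\<^sup>\<or>) \<boxtimes> \<I> ?Y)"
      by (rule acomp_tail[OF 3]) simp_all
    then show "?\<kappa> X ?Y' \<odot> (\<I> (X\<^sup>\<or>) \<boxtimes> \<I> X \<boxtimes> \<I> (?Y'\<^sup>\<or>) \<boxtimes> g)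
        = ?\<kappa> X ?Y \<odot> (\<I> (X\<^sup>\<or>) \<boxtimes> \<I> X \<boxtimes> adual g \<boxtimes> \<I> ?Y)"
      by (simp add: 1 2)
  qed simp_all
  then obtain u where u: "ok u" "src u = L \<otimes>\<^sub>o L" "trg u = \<^bold>1" "\<And>X Y. u \<odot> (ai X \<boxtimes> ai Y) = ?\<kappa> X Y"
    by blast
  show ?thesis
  proof (rule ex1I[of _ "val u"])
    show "?P (val u)"
      using u(1-3) arg_cong[OF u(4), of val] by (auto simp: ok_def dbr_def)
    fix m assume m: "?P m"
    have "Arrow (L \<otimes>\<^sub>o L) m \<^bold>1 = u"
    proof (rule coend2_eqI)
      fix X Y show "Arrow (L \<otimes>\<^sub>o L) m \<^bold>1 \<odot> (ai X \<boxtimes> ai Y) = u \<odot> (ai X \<boxtimes> ai Y)"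
        unfolding u(4) by (rule arrow.expand) (simp add: m dbr_def)
    qed (use u m in \<open>simp_all add: ok_def\<close>)
    then show "m = val u" by auto
  qed
qed

definition amu where "amu = Arrow (L \<otimes>\<^sub>o L) L_mult L"
definition apair where "apair = Arrow (L \<otimes>\<^sub>o L) hopf_pairing \<^bold>1"

lemma amu_sel [simp]: "src amu = L \<otimes>\<^sub>o L" "trg amu = L" "val amu = L_mult" "ok amu"
  using theI'[OF L_mult_unique] by (simp_all add: amu_def ok_def L_mult_def)

lemma apair_sel [simp]: "src apair = L \<otimes>\<^sub>o L" "trg apair = \<^bold>1" "val apair = hopf_pairing" "ok apair"
  using theI'[OF hopf_pairing_unique] by (simp_all add: apair_def ok_def hopf_pairing_def)

lemma amu_ai: "amu \<odot> (ai X \<boxtimes> ai Y) = ai (X \<otimes>\<^sub>o Y) \<odot> (abr (X\<^sup>\<or> \<otimes>\<^sub>o X) (Y\<^sup>\<or>) \<boxtimes> \<I> Y)"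
  using theI'[OF L_mult_unique] by (intro arrow.expand) (simp add: L_mult_def)

lemma apair_ai: "apair \<odot> (ai X \<boxtimes> ai Y) = (aev X \<boxtimes> aev Y) \<odot> (\<I> (X\<^sup>\<or>) \<boxtimes> dbr X (Y\<^sup>\<or>) \<boxtimes> \<I> Y)"
  using theI'[OF hopf_pairing_unique] by (intro arrow.expand) (simp add: hopf_pairing_def dbr_def)


subsection \<open>Defect operators\<close>

definition achar where "achar D = ai D \<odot> acoev (D\<^sup>\<or>)"
definition aop where "aop D = amu \<odot> (achar D \<boxtimes> \<I> L)"

lemma achar_sel [simp]: "src (achar D) = \<^bold>1" "trg (achar D) = L" "ok (achar D)" "val (achar D) = cocharacter D"
  by (simp_all add: achar_def cocharacter_def coev_tilde_def)

lemma aop_sel [simp]: "src (aop D) = L" "trg (aop D) = L" "ok (aop D)" "val (aop D) = defect_operator D"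
  by (simp_all add: aop_def defect_operator_def)

text \<open>The braiding in the product of \<open>L\<close> disappears: by naturality it passes the
  coevaluation of \<open>D\<close>, after which one of its strands is the unit.\<close>

lemma aop_ai: "aop D \<odot> ai Y = ai (D \<otimes>\<^sub>o Y) \<odot> (\<I> (Y\<^sup>\<or>) \<boxtimes> acoev (D\<^sup>\<or>) \<boxtimes> \<I> Y)"
proof -
  have "aop D \<odot> ai Y = amu \<odot> (achar D \<boxtimes> ai Y)"
    using slide(1)[of "achar D" "ai Y"] by (simp add: aop_def)
  also have "achar D \<boxtimes> ai Y = (ai D \<boxtimes> ai Y) \<odot> (acoev (D\<^sup>\<or>) \<boxtimes> \<I> (Y\<^sup>\<or>) \<boxtimes> \<I> Y)"
    using ainterchange[of "acoev (D\<^sup>\<or>)" "ai D" "\<I> (Y\<^sup>\<or> \<otimes>\<^sub>o Y)" "ai Y"] by (simp add: achar_def aide_tensor)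
  also have "amu \<odot> \<dots> = (ai (D \<otimes>\<^sub>o Y) \<odot> (abr (D\<^sup>\<or> \<otimes>\<^sub>o D) (Y\<^sup>\<or>) \<boxtimes> \<I> Y)) \<odot> (acoev (D\<^sup>\<or>) \<boxtimes> \<I> (Y\<^sup>\<or>) \<boxtimes> \<I> Y)"
    using acomp_tail1[OF amu_ai] by simp
  also have "\<dots> = ai (D \<otimes>\<^sub>o Y) \<odot> (abr (D\<^sup>\<or> \<otimes>\<^sub>o D) (Y\<^sup>\<or>) \<boxtimes> \<I> Y) \<odot> (acoev (D\<^sup>\<or>) \<boxtimes> \<I> (Y\<^sup>\<or>) \<boxtimes> \<I> Y)"
    by simp
  also have "(abr (D\<^sup>\<or> \<otimes>\<^sub>o D) (Y\<^sup>\<or>) \<boxtimes> \<I> Y) \<odot> (acoev (D\<^sup>\<or>) \<boxtimes> \<I> (Y\<^sup>\<or>) \<boxtimes> \<I> Y) =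
      \<I> (Y\<^sup>\<or>) \<boxtimes> acoev (D\<^sup>\<or>) \<boxtimes> \<I> Y"
    using abr_natural_whisker[of "acoev (D\<^sup>\<or>)" "\<I> (Y\<^sup>\<or>)" "\<^bold>1" "D\<^sup>\<or> \<otimes>\<^sub>o D" "Y\<^sup>\<or>" "Y\<^sup>\<or>" Y]
    by (simp add: aide_tensor)
  finally show ?thesis .
qed

text \<open>At the unit object \<open>ai\<close> is the unit of the algebra \<open>L\<close>, so an
  operator remembers its cocharacter.\<close>

lemma aop_unit_part: "aop D \<odot> ai \<^bold>1 = achar D"
  by (simp add: aop_ai achar_def)

lemma aop_unit: "aop \<^bold>1 = \<I> L"
  by (rule coend_eqI) (simp_all add: aop_ai acoev_unit aide_tensor)

text \<open>Each operator inserts a coevaluation in the middle of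
  \<open>Y\<^sup>\<or> \<otimes>\<^sub>o Y\<close>, so composition nests them, which is how the
  coevaluation of a product looks (\<open>acoev_tensor\<close>).\<close>

lemma aop_tensor: "aop (D \<otimes>\<^sub>o E) = aop D \<odot> aop E"
proof (rule coend_eqI)
  fix Y
  have "(aop D \<odot> aop E) \<odot> ai Y = aop D \<odot> ai (E \<otimes>\<^sub>o Y) \<odot> (\<I> (Y\<^sup>\<or>) \<boxtimes> acoev (E\<^sup>\<or>) \<boxtimes> \<I> Y)"
    by (simp add: aop_ai)
  also have "\<dots> = (ai (D \<otimes>\<^sub>o E \<otimes>\<^sub>o Y) \<odot> (\<I> (Y\<^sup>\<or> \<otimes>\<^sub>o E\<^sup>\<or>) \<boxtimes> acoev (D\<^sup>\<or>) \<boxtimes> \<I> (E \<otimes>\<^sub>o Y)))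
      \<odot> (\<I> (Y\<^sup>\<or>) \<boxtimes> acoev (E\<^sup>\<or>) \<boxtimes> \<I> Y)"
    using acomp_tail1[OF aop_ai] by simp
  also have "\<dots> = ai (D \<otimes>\<^sub>o E \<otimes>\<^sub>o Y) \<odot> (\<I> (Y\<^sup>\<or>) \<boxtimes>
      ((\<I> (E\<^sup>\<or>) \<boxtimes> acoev (D\<^sup>\<or>) \<boxtimes> \<I> E) \<odot> acoev (E\<^sup>\<or>)) \<boxtimes> \<I> Y)"
    using whisker_comp(2)[of "acoev (E\<^sup>\<or>)" "\<I> (E\<^sup>\<or>) \<boxtimes> acoev (D\<^sup>\<or>) \<boxtimes> \<I> E" Y]
    by (simp add: whisker_comp(1) flip: aide_tensor)
  also have "\<dots> = aop (D \<otimes>\<^sub>o E) \<odot> ai Y"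
    using acoev_tensor[of "E\<^sup>\<or>" "D\<^sup>\<or>"] by (simp add: aop_ai)
  finally show "aop (D \<otimes>\<^sub>o E) \<odot> ai Y = (aop D \<odot> aop E) \<odot> ai Y" ..
qed simp_all

text \<open>Right \<open>L\<close>-linearity. The insertion takes place inside the block
  \<open>X\<^sup>\<or> \<otimes>\<^sub>o X\<close>, which the braiding of the product moves as a
  whole.\<close>

lemma aop_amu: "aop D \<odot> amu = amu \<odot> (aop D \<boxtimes> \<I> L)"
proof (rule coend2_eqI)
  fix X Y
  let ?c = "\<I> (X\<^sup>\<or>) \<boxtimes> acoev (D\<^sup>\<or>) \<boxtimes> \<I> X"
  have nat: "(abr (X\<^sup>\<or> \<otimes>\<^sub>o D\<^sup>\<or> \<otimes>\<^sub>o D \<otimes>\<^sub>o X) (Y\<^sup>\<or>) \<boxtimes> \<I> Y) \<odot> (?c \<boxtimes> \<I> (Y\<^sup>\<or>) \<boxtimes> \<I> Y)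
     = (\<I> (Y\<^sup>\<or>) \<boxtimes> ?c \<boxtimes> \<I> Y) \<odot> (abr (X\<^sup>\<or> \<otimes>\<^sub>o X) (Y\<^sup>\<or>) \<boxtimes> \<I> Y)"
    by (rule abr_natural_whisker) simp_all
  have "(amu \<odot> (aop D \<boxtimes> \<I> L)) \<odot> (ai X \<boxtimes> ai Y) = amu \<odot> ((aop D \<odot> ai X) \<boxtimes> ai Y)"
    by (simp add: ainterchange)
  also have "(aop D \<odot> ai X) \<boxtimes> ai Y = (ai (D \<otimes>\<^sub>o X) \<boxtimes> ai Y) \<odot> (?c \<boxtimes> \<I> (Y\<^sup>\<or> \<otimes>\<^sub>o Y))"
    by (subst ainterchange) (simp_all add: aop_ai)
  also have "amu \<odot> \<dots> = (ai (D \<otimes>\<^sub>o X \<otimes>\<^sub>o Y) \<odot> (abr (X\<^sup>\<or> \<otimes>\<^sub>o D\<^sup>\<or> \<otimes>\<^sub>o D \<otimes>\<^sub>o X) (Y\<^sup>\<or>) \<boxtimes> \<I> Y)) \<odot> (?c \<boxtimes> \<I> (Y\<^sup>\<or> \<otimes>\<^sub>o Y))"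
    using acomp_tail1[OF amu_ai[of "D \<otimes>\<^sub>o X" Y], of "?c \<boxtimes> \<I> (Y\<^sup>\<or> \<otimes>\<^sub>o Y)"] by simp
  also have "\<dots> = ai (D \<otimes>\<^sub>o X \<otimes>\<^sub>o Y) \<odot> (\<I> (Y\<^sup>\<or>) \<boxtimes> ?c \<boxtimes> \<I> Y) \<odot> (abr (X\<^sup>\<or> \<otimes>\<^sub>o X) (Y\<^sup>\<or>) \<boxtimes> \<I> Y)"
    using nat by (simp flip: aide_tensor)
  also have "\<dots> = (ai (D \<otimes>\<^sub>o X \<otimes>\<^sub>o Y) \<odot> (\<I> ((X \<otimes>\<^sub>o Y)\<^sup>\<or>) \<boxtimes> acoev (D\<^sup>\<or>) \<boxtimes> \<I> (X \<otimes>\<^sub>o Y))) \<odot> (abr (X\<^sup>\<or> \<otimes>\<^sub>o X) (Y\<^sup>\<or>) \<boxtimes> \<I> Y)"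
    by (simp flip: aide_tensor)
  also have "\<dots> = (aop D \<odot> ai (X \<otimes>\<^sub>o Y)) \<odot> (abr (X\<^sup>\<or> \<otimes>\<^sub>o X) (Y\<^sup>\<or>) \<boxtimes> \<I> Y)"
    by (simp add: aop_ai)
  also have "\<dots> = (aop D \<odot> amu) \<odot> (ai X \<boxtimes> ai Y)"
    by (simp add: amu_ai)
  finally show "(aop D \<odot> amu) \<odot> (ai X \<boxtimes> ai Y) = (amu \<odot> (aop D \<boxtimes> \<I> L)) \<odot> (ai X \<boxtimes> ai Y)" ..
qed simp_all

text \<open>The coevaluation in the cocharacter, the monodromy of the pairing and the evaluation of
  \<open>D\<close> close up to a loop. The strand that it encircles is the dual
  \<open>Y\<^sup>\<or>\<close>.\<close>

lemma apair_achar: "apair \<odot> (achar D \<boxtimes> ai Y) = aev Y \<odot> (loop D (Y\<^sup>\<or>) \<boxtimes> \<I> Y)"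
proof -
  let ?c = "acoev (D\<^sup>\<or>) \<boxtimes> \<I> (Y\<^sup>\<or>) \<boxtimes> \<I> Y"
  let ?b = "\<I> (D\<^sup>\<or>) \<boxtimes> dbr D (Y\<^sup>\<or>) \<boxtimes> \<I> Y"
  have "achar D \<boxtimes> ai Y = (ai D \<boxtimes> ai Y) \<odot> ?c"
    using ainterchange[of "acoev (D\<^sup>\<or>)" "ai D" "\<I> (Y\<^sup>\<or> \<otimes>\<^sub>o Y)" "ai Y"] by (simp add: achar_def aide_tensor)
  then have "apair \<odot> (achar D \<boxtimes> ai Y) = ((aev D \<boxtimes> aev Y) \<odot> ?b) \<odot> ?c"
    using acomp_tail1[OF apair_ai, of D Y ?c] by simp
  also have "\<dots> = (aev D \<boxtimes> aev Y) \<odot> ?b \<odot> ?c" by simp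
  also have "aev D \<boxtimes> aev Y = aev Y \<odot> (aev D \<boxtimes> \<I> (Y\<^sup>\<or>) \<boxtimes> \<I> Y)"
    using slide(2)[of "aev D" "aev Y"] by (simp add: aide_tensor)
  also have "\<dots> \<odot> ?b \<odot> ?c = aev Y \<odot> (aev D \<boxtimes> \<I> (Y\<^sup>\<or>) \<boxtimes> \<I> Y) \<odot> ?b \<odot> ?c"
    by simp
  also have "\<dots> = aev Y \<odot> (loop D (Y\<^sup>\<or>) \<boxtimes> \<I> Y)"
    by (simp add: loop_def flip: whisker_comp(2))
  finally show ?thesis .
qed

end

section \<open>Linearity\<close>

context linear_category
begin

lemma Hom_zero [simp]: "0 \<in> Hom C X Y"
  using Hom_subspace by (rule vs.subspace_0)

lemma Hom_add: "f \<in> Hom C X Y \<Longrightarrow> g \<in> Hom C X Y \<Longrightarrow> f + g \<in> Hom C X Y"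
  using Hom_subspace by (rule vs.subspace_add)

lemma Hom_scl: "f \<in> Hom C X Y \<Longrightarrow> scl C c f \<in> Hom C X Y"
  using Hom_subspace by (rule vs.subspace_scale)

lemma Hom_diff: "f \<in> Hom C X Y \<Longrightarrow> g \<in> Hom C X Y \<Longrightarrow> f - g \<in> Hom C X Y"
  using Hom_subspace by (rule vs.subspace_diff)

lemma Hom_sum: "(\<And>i. i \<in> I \<Longrightarrow> f i \<in> Hom C X Y) \<Longrightarrow> (\<Sum>i\<in>I. f i) \<in> Hom C X Y"
  using Hom_subspace by (rule vs.subspace_sum)

text \<open>Composition and tensor product are bilinear on hom spaces only; outside them nothing is
  assumed. Linearity is therefore relative to a set.\<close>

definition linear_on :: "'m set \<Rightarrow> ('m \<Rightarrow> 'm) \<Rightarrow> bool" where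
  "linear_on V F \<longleftrightarrow>
    (\<forall>a\<in>V. \<forall>b\<in>V. F (a + b) = F a + F b) \<and> (\<forall>c. \<forall>a\<in>V. F (scl C c a) = scl C c (F a))"

definition functional_on :: "'m set \<Rightarrow> ('m \<Rightarrow> 'k) \<Rightarrow> bool" where
  "functional_on V F \<longleftrightarrow>
    (\<forall>a\<in>V. \<forall>b\<in>V. F (a + b) = F a + F b) \<and> (\<forall>c. \<forall>a\<in>V. F (scl C c a) = c * F a)"

lemma linear_on_zero:
  assumes "linear_on (Hom C X Y) F"
  shows "F 0 = 0"
proof -
  have "F (scl C 0 0) = scl C 0 (F 0)" using assms Hom_zero unfolding linear_on_def by blast
  then show ?thesis by simp
qed

lemma functional_on_zero:
  assumes "functional_on (Hom C X Y) F"
  shows "F 0 = 0"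
proof -
  have "F (scl C 0 0) = 0 * (F 0)" using assms Hom_zero unfolding functional_on_def by blast
  then show ?thesis by simp
qed

lemma linear_on_sum:
  assumes F: "linear_on (Hom C X Y) F" and "\<And>i. i \<in> I \<Longrightarrow> f i \<in> Hom C X Y"
  shows "F (\<Sum>i\<in>I. scl C (c i) (f i)) = (\<Sum>i\<in>I. scl C (c i) (F (f i)))"
  using assms(2)
proof (induction I rule: infinite_finite_induct)
  case (insert j J)
  have "scl C (c j) (f j) \<in> Hom C X Y" "(\<Sum>i\<in>J. scl C (c i) (f i)) \<in> Hom C X Y"
    using insert.prems by (auto intro!: Hom_scl Hom_sum)
  then have "F (scl C (c j) (f j) + (\<Sum>i\<in>J. scl C (c i) (f i)))
      = F (scl C (c j) (f j)) + F (\<Sum>i\<in>J. scl C (c i) (f i))"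
    using F unfolding linear_on_def by blast
  then show ?case using insert F by (auto simp: linear_on_def)
qed (simp_all add: linear_on_zero[OF F])

lemma functional_on_sum:
  assumes F: "functional_on (Hom C X Y) F" and "\<And>i. i \<in> I \<Longrightarrow> f i \<in> Hom C X Y"
  shows "F (\<Sum>i\<in>I. scl C (c i) (f i)) = (\<Sum>i\<in>I. c i * F (f i))"
  using assms(2)
proof (induction I rule: infinite_finite_induct)
  case (insert j J)
  have "scl C (c j) (f j) \<in> Hom C X Y" "(\<Sum>i\<in>J. scl C (c i) (f i)) \<in> Hom C X Y"
    using insert.prems by (auto intro!: Hom_scl Hom_sum)
  then have "F (scl C (c j) (f j) + (\<Sum>i\<in>J. scl C (c i) (f i)))
      = F (scl C (c j) (f j)) + F (\<Sum>i\<in>J. scl C (c i) (f i))"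
    using F unfolding functional_on_def by blast
  then show ?case using insert F by (auto simp: functional_on_def)
qed (simp_all add: functional_on_zero[OF F])

lemma linear_on_sum1:
  assumes F: "linear_on (Hom C X Y) F" and "\<And>i. i \<in> I \<Longrightarrow> f i \<in> Hom C X Y"
  shows "F (\<Sum>i\<in>I. f i) = (\<Sum>i\<in>I. F (f i))"
  using linear_on_sum[OF assms, where c = "\<lambda>_. 1"] by simp

lemma linear_on_diff:
  assumes F: "linear_on (Hom C X Y) F" and f: "f \<in> Hom C X Y" "g \<in> Hom C X Y"
  shows "F (f - g) = F f - F g"
proof -
  have "F (f - g + g) = F (f - g) + F g"
    using F Hom_diff[OF f] f unfolding linear_on_def by blast
  then show ?thesis by simp
qed

lemma linear_on_comp:
  "linear_on V F \<Longrightarrow> (\<And>a. a \<in> V \<Longrightarrow> F a \<in> V') \<Longrightarrow> linear_on V' G \<Longrightarrow> linear_on V (\<lambda>a. G (F a))"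
  by (simp add: linear_on_def)

lemma functional_on_comp:
  "linear_on V F \<Longrightarrow> (\<And>a. a \<in> V \<Longrightarrow> F a \<in> V') \<Longrightarrow> functional_on V' G \<Longrightarrow> functional_on V (\<lambda>a. G (F a))"
  by (simp add: linear_on_def functional_on_def)

lemma linear_on_cmp:
  "f \<in> Hom C X Y \<Longrightarrow> linear_on (Hom C Y Z) (\<lambda>g. g \<cdot> f)"
  "g \<in> Hom C Y Z \<Longrightarrow> linear_on (Hom C X Y) (\<lambda>f. g \<cdot> f)"
  by (auto simp: linear_on_def cmp_add_left cmp_add_right cmp_scl_left cmp_scl_right)

lemmas cmp_zero = linear_on_zero[OF linear_on_cmp(1)] linear_on_zero[OF linear_on_cmp(2)]
lemmas cmp_sum_left = linear_on_sum1[OF linear_on_cmp(1)]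
lemmas cmp_sum_right = linear_on_sum1[OF linear_on_cmp(2)]
lemmas cmp_diff_left = linear_on_diff[OF linear_on_cmp(1)]
lemmas cmp_diff_right = linear_on_diff[OF linear_on_cmp(2)]

lemma linear_on_span_eq:
  assumes F: "linear_on (Hom C X Y) F" and G: "linear_on (Hom C X Y) G"
    and S: "S \<subseteq> Hom C X Y" and eq: "\<And>s. s \<in> S \<Longrightarrow> F s = G s" and t: "t \<in> vs.span S"
  shows "F t = G t"
proof -
  have "t \<in> Hom C X Y \<and> F t = G t"
    using t
  proof (induction rule: vs.span_induct_alt)
    case base show ?case by (simp add: linear_on_zero[OF F] linear_on_zero[OF G])
  next
    case (step c x y)
    then have "x \<in> Hom C X Y" "scl C c x \<in> Hom C X Y" using S Hom_scl by auto
    then show ?case using step F G by (simp add: linear_on_def Hom_add eq)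
  qed
  then show ?thesis ..
qed

lemma span_subset_Hom: "S \<subseteq> Hom C X Y \<Longrightarrow> vs.span S \<subseteq> Hom C X Y"
  using Hom_subspace by (intro vs.span_minimal)

end

context strict_monoidal_category
begin

lemma linear_on_tensor:
  "g \<in> Hom C Y Y' \<Longrightarrow> linear_on (Hom C X X') (\<lambda>f. f \<otimes>\<^sub>m g)"
  "f \<in> Hom C X X' \<Longrightarrow> linear_on (Hom C Y Y') (\<lambda>g. f \<otimes>\<^sub>m g)"
  by (auto simp: linear_on_def tensor_add_left tensor_add_right tensor_scl_left tensor_scl_right)

lemma ok_Arrow [simp]: "ok (Arrow X f Y) \<longleftrightarrow> f \<in> Hom C X Y"
  by (simp add: ok_def)

lemma val_in_Hom: "ok f \<Longrightarrow> src f = X \<Longrightarrow> trg f = Y \<Longrightarrow> val f \<in> Hom C X Y"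
  by (auto simp: ok_def)

end

context strict_pivotal_category
begin

lemma dual_mor_in_Hom: "f \<in> Hom C X Y \<Longrightarrow> dual_mor C X Y f \<in> Hom C (Y\<^sup>\<or>) (X\<^sup>\<or>)"
  using ok_adual[of "Arrow X f Y"] by (simp add: ok_def)

lemma dual_mor_cmp:
  "f \<in> Hom C X Y \<Longrightarrow> g \<in> Hom C Y Z \<Longrightarrow> dual_mor C X Z (g \<cdot> f) = dual_mor C X Y f \<cdot> dual_mor C Y Z g"
  using arg_cong[OF adual_comp[of "Arrow Y g Z" "Arrow X f Y"], of val] by simp

lemma linear_on_dual_mor: "linear_on (Hom C X Y) (dual_mor C X Y)"
proof -
  let ?V = "Hom C (Y\<^sup>\<or> \<otimes>\<^sub>o X \<otimes>\<^sub>o X\<^sup>\<or>) (Y\<^sup>\<or> \<otimes>\<^sub>o Y \<otimes>\<^sub>o X\<^sup>\<or>)"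
  have 1: "f \<otimes>\<^sub>m ide C (X\<^sup>\<or>) \<in> Hom C (X \<otimes>\<^sub>o X\<^sup>\<or>) (Y \<otimes>\<^sub>o X\<^sup>\<or>)" if "f \<in> Hom C X Y" for f
    by (intro tensor_in_Hom that ide_in_Hom)
  have 2: "ide C (Y\<^sup>\<or>) \<otimes>\<^sub>m f \<otimes>\<^sub>m ide C (X\<^sup>\<or>) \<in> ?V" if "f \<in> Hom C X Y" for f
    by (intro tensor_in_Hom that ide_in_Hom)
  have c: "ide C (Y\<^sup>\<or>) \<otimes>\<^sub>m coev C X \<in> Hom C (Y\<^sup>\<or>) (Y\<^sup>\<or> \<otimes>\<^sub>o X \<otimes>\<^sub>o X\<^sup>\<or>)"
    using tensor_in_Hom[OF ide_in_Hom[of "Y\<^sup>\<or>"] coev_in_Hom[of X]] by simp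
  have e: "ev C Y \<otimes>\<^sub>m ide C (X\<^sup>\<or>) \<in> Hom C (Y\<^sup>\<or> \<otimes>\<^sub>o Y \<otimes>\<^sub>o X\<^sup>\<or>) (X\<^sup>\<or>)"
    using tensor_in_Hom[OF ev_in_Hom[of Y] ide_in_Hom[of "X\<^sup>\<or>"]] by simp
  have "linear_on (Hom C X Y) (\<lambda>f. ide C (Y\<^sup>\<or>) \<otimes>\<^sub>m f \<otimes>\<^sub>m ide C (X\<^sup>\<or>))"
    using linear_on_comp[OF linear_on_tensor(1)[OF ide_in_Hom] 1 linear_on_tensor(2)[OF ide_in_Hom]] .
  from linear_on_comp[OF this 2 linear_on_cmp(1)[OF c]]
  have "linear_on (Hom C X Y) (\<lambda>f. (ide C (Y\<^sup>\<or>) \<otimes>\<^sub>m f \<otimes>\<^sub>m ide C (X\<^sup>\<or>)) \<cdot> (ide C (Y\<^sup>\<or>) \<otimes>\<^sub>m coev C X))" .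
  from linear_on_comp[OF this cmp_in_Hom[OF 2 c] linear_on_cmp(2)[OF e]]
  show ?thesis by (simp add: dual_mor_def[abs_def])
qed

end


subsection \<open>The defect algebra\<close>

context modular_tensor_category
begin

definition defect_span where "defect_span = vs.span (range defect_operator)"

lemma defect_operator_in_Hom: "defect_operator D \<in> Hom C L L"
  using val_in_Hom[of "aop D" L L] by simp

lemma defect_span_subset_Hom: "t \<in> defect_span \<Longrightarrow> t \<in> Hom C L L"
  using span_subset_Hom[of "range defect_operator" L L] defect_operator_in_Hom by (auto simp: defect_span_def)

lemma defect_operator_in_defect_span: "defect_operator D \<in> defect_span"
  by (auto simp: defect_span_def intro: vs.span_base)

lemma defect_span_eqI:
  assumes "linear_on (Hom C L L) F" "linear_on (Hom C L L) G"
    "\<And>D. F (defect_operator D) = G (defect_operator D)" "t \<in> defect_span"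
  shows "F t = G t"
  using linear_on_span_eq[OF assms(1,2), of "range defect_operator"] assms(3,4) defect_operator_in_Hom
  by (auto simp: defect_span_def)

lemma defect_span_subspace: "vs.subspace defect_span"
  by (simp add: defect_span_def)

lemma defect_operator_tensor: "defect_operator (D \<otimes>\<^sub>o D') = defect_operator D \<cdot> defect_operator D'"
  using arg_cong[OF aop_tensor, of val] by simp

lemma defect_operator_unit: "defect_operator \<^bold>1 = ide C L"
  using arg_cong[OF aop_unit, of val] by simp

lemma defect_span_induct [consumes 1, case_names zero step]:
  assumes "t \<in> defect_span" "P 0"
    "\<And>c D t. t \<in> defect_span \<Longrightarrow> P t \<Longrightarrow> P (scl C c (defect_operator D) + t)"
  shows "P t"
proof -
  have "t \<in> defect_span \<and> P t"
    using assms(1) unfolding defect_span_def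
  proof (induction rule: vs.span_induct_alt)
    case (step c x y)
    then show ?case using assms(3)[of y c] by (auto simp: defect_span_def intro: vs.span_add vs.span_scale vs.span_base)
  qed (simp add: assms(2) vs.span_zero)
  then show ?thesis ..
qed

lemma defect_span_cmp:
  assumes t: "t \<in> defect_span" and s: "s \<in> defect_span"
  shows "t \<cdot> s \<in> defect_span"
proof -
  note add = vs.subspace_add[OF defect_span_subspace] and scale = vs.subspace_scale[OF defect_span_subspace]
    and dH = defect_operator_in_Hom
  have 1: "defect_operator D \<cdot> s \<in> defect_span" for D
    using s
  proof (induction rule: defect_span_induct)
    case zero show ?case by (simp add: cmp_zero(2)[OF dH] vs.subspace_0[OF defect_span_subspace])
  next
    case (step c D' t)
    have "defect_operator D \<cdot> (scl C c (defect_operator D') + t)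
        = scl C c (defect_operator (D \<otimes>\<^sub>o D')) + defect_operator D \<cdot> t"
      using cmp_add_right[OF dH Hom_scl[OF dH] defect_span_subset_Hom[OF step(1)]]
      by (simp add: cmp_scl_right[OF dH dH] defect_operator_tensor)
    then show ?case using step by (simp add: add scale defect_operator_in_defect_span)
  qed
  show ?thesis
    using t
  proof (induction rule: defect_span_induct)
    case zero show ?case by (simp add: cmp_zero(1)[OF defect_span_subset_Hom[OF s]] vs.subspace_0[OF defect_span_subspace])
  next
    case (step c D t)
    have "(scl C c (defect_operator D) + t) \<cdot> s = scl C c (defect_operator D \<cdot> s) + t \<cdot> s"
      using cmp_add_left[OF Hom_scl[OF dH] defect_span_subset_Hom[OF step(1)] defect_span_subset_Hom[OF s]]
      by (simp add: cmp_scl_left[OF dH defect_span_subset_Hom[OF s]])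
    then show ?case using step 1 by (simp add: add scale)
  qed
qed

lemma amu_in_Hom: "L_mult \<in> Hom C (L \<otimes>\<^sub>o L) L"
  using val_in_Hom[OF amu_sel(4) refl refl] by simp

lemma defect_span_subset_End_L:
  assumes "t \<in> defect_span"
  shows "t \<in> End_L"
proof -
  have 1: "linear_on (Hom C L L) (\<lambda>t. t \<cdot> L_mult)" by (rule linear_on_cmp(1)[OF amu_in_Hom])
  have 2: "linear_on (Hom C L L) (\<lambda>t. L_mult \<cdot> (t \<otimes>\<^sub>m ide C L))"
  proof (rule linear_on_comp[OF _ _ linear_on_cmp(2)[OF amu_in_Hom]])
    show "linear_on (Hom C L L) (\<lambda>t. t \<otimes>\<^sub>m ide C L)" by (rule linear_on_tensor(1)[OF ide_in_Hom])
    show "t \<otimes>\<^sub>m ide C L \<in> Hom C (L \<otimes>\<^sub>o L) (L \<otimes>\<^sub>o L)" if "t \<in> Hom C L L" for t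
      by (intro tensor_in_Hom that ide_in_Hom)
  qed
  have "t \<cdot> L_mult = L_mult \<cdot> (t \<otimes>\<^sub>m ide C L)"
  proof (rule defect_span_eqI[OF 1 2 _ assms])
    fix D show "defect_operator D \<cdot> L_mult = L_mult \<cdot> (defect_operator D \<otimes>\<^sub>m ide C L)"
      using arg_cong[OF aop_amu, of val D] by simp
  qed
  then show ?thesis using defect_span_subset_Hom[OF assms] by (simp add: End_L_def)
qed

lemma defect_algebra_eq: "defect_algebra = defect_span"
proof -
  let ?B = "{B. unital_subalgebra (scl C) (cmp C) (ide C L) End_L B \<and> range defect_operator \<subseteq> B}"
  have "defect_span \<in> ?B"
    using defect_span_subset_End_L defect_span_subspace defect_span_cmp defect_operator_in_defect_span defect_operator_in_defect_span[of "\<^bold>1"]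
    by (auto simp: unital_subalgebra_def defect_operator_unit)
  moreover have "defect_span \<subseteq> B" if "B \<in> ?B" for B
    using that vs.span_minimal[of "range defect_operator" B] by (auto simp: unital_subalgebra_def defect_span_def)
  ultimately show ?thesis unfolding defect_algebra_def generated_subalgebra_def by blast
qed

text \<open>
  \<open>Psi W\<close> extends \<open>defect_operator D \<mapsto> loop D W\<close> linearly: it is the endomorphism of \<open>W\<close> given by
  the Hopf pairing with the element \<open>t \<cdot> \<iota> \<^bold>1\<close> of \<open>Hom C \<^bold>1 L\<close>.
\<close>

definition Psi where
  "Psi W t = ((hopf_pairing \<cdot> ((t \<cdot> \<iota> \<^bold>1) \<otimes>\<^sub>m \<iota> (W\<^sup>\<or>))) \<otimes>\<^sub>m ide C W) \<cdot> (ide C W \<otimes>\<^sub>m coev C (W\<^sup>\<or>))"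

lemma Psi_arrow:
  "t \<in> Hom C L L \<Longrightarrow> Psi W t = val (rcurry W (W\<^sup>\<or>) (apair \<odot> ((Arrow L t L \<odot> ai \<^bold>1) \<boxtimes> ai (W\<^sup>\<or>))))"
  by (simp add: Psi_def rcurry_def)

lemma Psi_in_Hom: "t \<in> Hom C L L \<Longrightarrow> Psi W t \<in> Hom C W W"
  by (simp add: Psi_arrow val_in_Hom)

lemma linear_on_Psi: "linear_on (Hom C L L) (Psi W)"
proof -
  have i: "\<iota> \<^bold>1 \<in> Hom C \<^bold>1 L" using iota_in_Hom[of "\<^bold>1"] by simp
  have iW: "\<iota> (W\<^sup>\<or>) \<in> Hom C (W \<otimes>\<^sub>o W\<^sup>\<or>) L" using iota_in_Hom[of "W\<^sup>\<or>"] by simp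
  have p: "hopf_pairing \<in> Hom C (L \<otimes>\<^sub>o L) \<^bold>1" using val_in_Hom[OF apair_sel(4) refl refl] by simp
  have c: "ide C W \<otimes>\<^sub>m coev C (W\<^sup>\<or>) \<in> Hom C W (W \<otimes>\<^sub>o W\<^sup>\<or> \<otimes>\<^sub>o W)"
    using tensor_in_Hom[OF ide_in_Hom[of W] coev_in_Hom[of "W\<^sup>\<or>"]] by simp
  have 1: "t \<cdot> \<iota> \<^bold>1 \<in> Hom C \<^bold>1 L" if "t \<in> Hom C L L" for t by (rule cmp_in_Hom[OF that i])
  have 2: "(t \<cdot> \<iota> \<^bold>1) \<otimes>\<^sub>m \<iota> (W\<^sup>\<or>) \<in> Hom C (W \<otimes>\<^sub>o W\<^sup>\<or>) (L \<otimes>\<^sub>o L)" if "t \<in> Hom C L L" for t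
    using tensor_in_Hom[OF 1[OF that] iW] by simp
  have 4: "(hopf_pairing \<cdot> ((t \<cdot> \<iota> \<^bold>1) \<otimes>\<^sub>m \<iota> (W\<^sup>\<or>))) \<otimes>\<^sub>m ide C W \<in> Hom C (W \<otimes>\<^sub>o W\<^sup>\<or> \<otimes>\<^sub>o W) W"
    if "t \<in> Hom C L L" for t
    using tensor_in_Hom[OF cmp_in_Hom[OF p 2[OF that]] ide_in_Hom[of W]] by simp
  note l2 = linear_on_comp[OF linear_on_cmp(1)[OF i] 1 linear_on_tensor(1)[OF iW]]
  note l3 = linear_on_comp[OF l2 2 linear_on_cmp(2)[OF p]]
  note l4 = linear_on_comp[OF l3 cmp_in_Hom[OF p 2] linear_on_tensor(1)[OF ide_in_Hom[of W]]]
  note l5 = linear_on_comp[OF l4 4 linear_on_cmp(1)[OF c]]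
  show ?thesis using l5 by (simp add: Psi_def[abs_def])
qed

text \<open>\<open>apair_achar\<close> encircles a dual strand, which is why \<open>Psi W\<close>
  pairs with \<open>W\<^sup>\<or>\<close>; the transposition in \<open>Psi\<close> then removes the
  remaining evaluation.\<close>

lemma Psi_defect_operator: "Psi W (defect_operator D) = val (loop D W)"
proof -
  have a: "Arrow L (defect_operator D) L = aop D" by (rule arrow.expand) simp
  have "Psi W (defect_operator D) = val (rcurry W (W\<^sup>\<or>) (aev (W\<^sup>\<or>) \<odot> (loop D W \<boxtimes> \<I> (W\<^sup>\<or>))))"
    using apair_achar[of D "W\<^sup>\<or>"] by (simp add: Psi_arrow defect_operator_in_Hom a aop_unit_part)
  also have "aev (W\<^sup>\<or>) \<odot> (loop D W \<boxtimes> \<I> (W\<^sup>\<or>)) = runcurry \<^bold>1 (W\<^sup>\<or>) (loop D W)"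
    by (simp add: runcurry_def)
  also have "rcurry W (W\<^sup>\<or>) \<dots> = loop D W"
    by (rule rcurry_runcurry) simp_all
  finally show ?thesis .
qed

lemma Psi_natural:
  assumes g: "g \<in> Hom C W W'" and t: "t \<in> defect_span"
  shows "Psi W' t \<cdot> g = g \<cdot> Psi W t"
proof (rule defect_span_eqI[OF _ _ _ t])
  show "linear_on (Hom C L L) (\<lambda>t. Psi W' t \<cdot> g)"
    by (rule linear_on_comp[OF linear_on_Psi Psi_in_Hom linear_on_cmp(1)[OF g]])
  show "linear_on (Hom C L L) (\<lambda>t. g \<cdot> Psi W t)"
    by (rule linear_on_comp[OF linear_on_Psi Psi_in_Hom linear_on_cmp(2)[OF g]])
  show "Psi W' (defect_operator D) \<cdot> g = g \<cdot> Psi W (defect_operator D)" for D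
    using arg_cong[OF loop_natural[of "Arrow W g W'" W W' D], of val] g by (simp add: Psi_defect_operator)
qed

lemma Psi_cmp:
  assumes t: "t \<in> defect_span" and s: "s \<in> defect_span"
  shows "Psi W (t \<cdot> s) = Psi W t \<cdot> Psi W s"
proof (rule defect_span_eqI[OF _ _ _ t])
  note sH = defect_span_subset_Hom[OF s]
  show "linear_on (Hom C L L) (\<lambda>t. Psi W (t \<cdot> s))"
    by (rule linear_on_comp[OF linear_on_cmp(1)[OF sH] cmp_in_Hom[OF _ sH] linear_on_Psi])
  show "linear_on (Hom C L L) (\<lambda>t. Psi W t \<cdot> Psi W s)"
    by (rule linear_on_comp[OF linear_on_Psi Psi_in_Hom linear_on_cmp(1)[OF Psi_in_Hom[OF sH]]])
  fix D
  note dH = defect_operator_in_Hom[of D]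
  show "Psi W (defect_operator D \<cdot> s) = Psi W (defect_operator D) \<cdot> Psi W s"
  proof (rule defect_span_eqI[OF _ _ _ s])
    show "linear_on (Hom C L L) (\<lambda>s. Psi W (defect_operator D \<cdot> s))"
      by (rule linear_on_comp[OF linear_on_cmp(2)[OF dH] cmp_in_Hom[OF dH] linear_on_Psi])
    show "linear_on (Hom C L L) (\<lambda>s. Psi W (defect_operator D) \<cdot> Psi W s)"
      by (rule linear_on_comp[OF linear_on_Psi Psi_in_Hom linear_on_cmp(2)[OF Psi_in_Hom[OF dH]]])
    show "Psi W (defect_operator D \<cdot> defect_operator D') =
        Psi W (defect_operator D) \<cdot> Psi W (defect_operator D')" for D'
      using arg_cong[OF loop_tensor, of val D D' W]
      by (simp add: Psi_defect_operator flip: defect_operator_tensor)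
  qed
qed

lemma Psi_ide: "Psi W (ide C L) = ide C W"
  using arg_cong[OF loop_unit, of val W] by (simp add: Psi_defect_operator flip: defect_operator_unit)

text \<open>True of each operator by definition, and both sides are linear. \<open>Psi\<close> only
  sees the value of \<open>t\<close> on the unit of \<open>L\<close>; this identity recovers
  \<open>t\<close> from that value.\<close>

lemma defect_span_eq_mult: "t \<in> defect_span \<Longrightarrow> t = L_mult \<cdot> ((t \<cdot> \<iota> \<^bold>1) \<otimes>\<^sub>m ide C L)"
proof -
  have i: "\<iota> \<^bold>1 \<in> Hom C \<^bold>1 L" using iota_in_Hom[of "\<^bold>1"] by simp
  have 1: "t \<cdot> \<iota> \<^bold>1 \<in> Hom C \<^bold>1 L" if "t \<in> Hom C L L" for t by (rule cmp_in_Hom[OF that i])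
  have 2: "(t \<cdot> \<iota> \<^bold>1) \<otimes>\<^sub>m ide C L \<in> Hom C L (L \<otimes>\<^sub>o L)" if "t \<in> Hom C L L" for t
    using tensor_in_Hom[OF 1[OF that] ide_in_Hom[of L]] by simp
  note l2 = linear_on_comp[OF linear_on_cmp(1)[OF i] 1 linear_on_tensor(1)[OF ide_in_Hom[of L]]]
  note l3 = linear_on_comp[OF l2 2 linear_on_cmp(2)[OF amu_in_Hom]]
  have l0: "linear_on (Hom C L L) (\<lambda>t. t)" by (simp add: linear_on_def)
  have d: "defect_operator D \<cdot> \<iota> \<^bold>1 = cocharacter D" for D
    using arg_cong[OF aop_unit_part, of val D] by simp
  show "t \<in> defect_span \<Longrightarrow> t = L_mult \<cdot> ((t \<cdot> \<iota> \<^bold>1) \<otimes>\<^sub>m ide C L)"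
    by (rule defect_span_eqI[OF l0 l3]) (simp_all add: d, simp add: defect_operator_def)
qed

text \<open>Let \<open>x\<close> be the value of \<open>t\<close> on the unit of \<open>L\<close>.
  Vanishing of all \<open>Psi W t\<close> says that \<open>x\<close> pairs to zero with every
  \<open>ai Y\<close>, hence with \<open>L\<close>. So the map from \<open>L\<close> to its dual
  kills \<open>x\<close>; it is invertible by non-degeneracy, and \<open>x = 0\<close> forces
  \<open>t = 0\<close>.\<close>

lemma Psi_injective:
  assumes t: "t \<in> defect_span" and 0: "\<And>W. Psi W t = 0"
  shows "t = 0"
proof -
  have i: "\<iota> \<^bold>1 \<in> Hom C \<^bold>1 L" using iota_in_Hom[of "\<^bold>1"] by simp
  note tH = defect_span_subset_Hom[OF t]
  define x where "x = Arrow L t L \<odot> ai \<^bold>1"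
  have x [simp]: "ok x" "src x = \<^bold>1" "trg x = L" "val x = t \<cdot> \<iota> \<^bold>1" using tH by (simp_all add: x_def)
  have h: "apair \<odot> (x \<boxtimes> ai Y) = Arrow (Y\<^sup>\<or> \<otimes>\<^sub>o Y) 0 \<^bold>1" for Y
  proof -
    let ?h = "apair \<odot> (x \<boxtimes> ai Y)"
    have "val (rcurry (Y\<^sup>\<or>) Y ?h) = 0" using 0[of "Y\<^sup>\<or>"] tH by (simp add: Psi_arrow x_def)
    then have "rcurry (Y\<^sup>\<or>) Y ?h = Arrow (Y\<^sup>\<or>) 0 (Y\<^sup>\<or>)" by (intro arrow.expand) simp
    then have "?h = runcurry \<^bold>1 Y (Arrow (Y\<^sup>\<or>) 0 (Y\<^sup>\<or>))"
      using runcurry_rcurry[of ?h "Y\<^sup>\<or>" Y "\<^bold>1"] by simp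
    also have "\<dots> = Arrow (Y\<^sup>\<or> \<otimes>\<^sub>o Y) 0 \<^bold>1"
      using linear_on_zero[OF linear_on_tensor(1)[OF ide_in_Hom[of Y]]] cmp_zero(2)[OF ev_in_Hom[of Y]]
      by (simp add: runcurry_def acomp_def atensor_def tensor_unit_left[OF ev_in_Hom])
    finally show ?thesis .
  qed
  have z: "Arrow L 0 \<^bold>1 = apair \<odot> (x \<boxtimes> \<I> L)"
  proof (rule coend_eqI)
    fix Y
    have "(apair \<odot> (x \<boxtimes> \<I> L)) \<odot> ai Y = apair \<odot> (x \<boxtimes> ai Y)"
      using slide(1)[of x "ai Y"] by simp
    also have "\<dots> = Arrow L 0 \<^bold>1 \<odot> ai Y"
      unfolding h by (simp add: acomp_def cmp_zero(1)[OF iota_in_Hom])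
    finally show "Arrow L 0 \<^bold>1 \<odot> ai Y = (apair \<odot> (x \<boxtimes> \<I> L)) \<odot> ai Y" ..
  qed simp_all
  have "val (rcurry L L apair) \<cdot> val x = val (rcurry L L apair \<odot> x)" by simp
  also have "rcurry L L apair \<odot> x = rcurry \<^bold>1 L (Arrow L 0 \<^bold>1)"
    unfolding z by (rule rcurry_comp) simp_all
  also have "val \<dots> = (0 \<otimes>\<^sub>m ide C (L\<^sup>\<or>)) \<cdot> (ide C \<^bold>1 \<otimes>\<^sub>m coev C L)"
    by (simp add: rcurry_def tensor_unit_left[OF coev_in_Hom])
  also have "\<dots> = 0"
    using linear_on_zero[OF linear_on_tensor(1)[OF ide_in_Hom[of "L\<^sup>\<or>"]]]
      cmp_zero(1)[OF coev_in_Hom[of L]] by (simp add: tensor_unit_left[OF coev_in_Hom])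
  finally have r: "val (rcurry L L apair) \<cdot> (t \<cdot> \<iota> \<^bold>1) = 0" by simp
  have v: "val (rcurry L L apair) = (hopf_pairing \<otimes>\<^sub>m ide C (L\<^sup>\<or>)) \<cdot> (ide C L \<otimes>\<^sub>m coev C L)"
    by (simp add: rcurry_def)
  then have vH: "val (rcurry L L apair) \<in> Hom C L (L\<^sup>\<or>)" by (intro val_in_Hom) simp_all
  obtain g where g: "g \<in> Hom C (L\<^sup>\<or>) L" "g \<cdot> val (rcurry L L apair) = ide C L"
    using nondegenerate unfolding hopf_pairing_nondegenerate_def is_iso_def v by blast
  have xH: "t \<cdot> \<iota> \<^bold>1 \<in> Hom C \<^bold>1 L" by (rule cmp_in_Hom[OF tH i])
  have "t \<cdot> \<iota> \<^bold>1 = (g \<cdot> val (rcurry L L apair)) \<cdot> (t \<cdot> \<iota> \<^bold>1)"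
    unfolding g(2) using ide_left[OF xH] by simp
  also have "\<dots> = g \<cdot> (val (rcurry L L apair) \<cdot> (t \<cdot> \<iota> \<^bold>1))" by (rule cmp_assoc[OF g(1) vH xH])
  also have "\<dots> = 0" unfolding r by (rule cmp_zero(2)[OF g(1)])
  finally have "t \<cdot> \<iota> \<^bold>1 = 0" .
  with defect_span_eq_mult[OF t] have "t = L_mult \<cdot> (0 \<otimes>\<^sub>m ide C L)" by simp
  then show "t = 0"
    using linear_on_zero[OF linear_on_tensor(1)[OF ide_in_Hom[of L]]] cmp_zero(2)[OF amu_in_Hom] by simp
qed

lemma defect_span_commute:
  assumes t: "t \<in> defect_span" and s: "s \<in> defect_span"
  shows "t \<cdot> s = s \<cdot> t"
proof -
  have d: "t \<cdot> s - s \<cdot> t \<in> defect_span" by (intro vs.subspace_diff defect_span_subspace defect_span_cmp t s)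
  have "Psi W (t \<cdot> s - s \<cdot> t) = Psi W t \<cdot> Psi W s - Psi W s \<cdot> Psi W t" for W
    using linear_on_diff[OF linear_on_Psi defect_span_subset_Hom[OF defect_span_cmp[OF t s]] defect_span_subset_Hom[OF defect_span_cmp[OF s t]]]
    by (simp add: Psi_cmp t s)
  \<comment> \<open>Naturality of \<open>Psi W t\<close> with respect to the endomorphism
    \<open>Psi W s\<close>.\<close>
  then have "Psi W (t \<cdot> s - s \<cdot> t) = 0" for W
    using Psi_natural[OF Psi_in_Hom[OF defect_span_subset_Hom[OF s]] t] by simp
  from Psi_injective[OF d this] show ?thesis by simp
qed

end

section \<open>Functionals on internal cocharacters\<close>

context canonical_coend
begin

text \<open>
  If \<open>(f, g) \<mapsto> \<phi> (g \<cdot> f)\<close> is a perfect pairing of \<open>Hom C P Y\<close> with \<open>Hom C Y J\<close> for every \<open>Y\<close>, then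
  the canonical elements of \<open>Hom C P Y \<otimes> Hom C Y J\<close> form a dinatural family
  \<open>Y\<^sup>\<or> \<otimes> Y \<rightarrow> P\<^sup>\<or> \<otimes> J\<close>, through which cocharacters are mapped to dimensions.
\<close>

lemma cocharacter_functional:
  fixes P J :: 'o and n :: "'o \<Rightarrow> nat" and b c :: "'o \<Rightarrow> nat \<Rightarrow> 'm" and \<phi> :: "'m \<Rightarrow> 'k"
  assumes lin: "functional_on (Hom C P J) \<phi>"
    and b: "\<And>Y i. i < n Y \<Longrightarrow> b Y i \<in> Hom C P Y" and c: "\<And>Y i. i < n Y \<Longrightarrow> c Y i \<in> Hom C Y J"
    and dual: "\<And>Y i. i < n Y \<Longrightarrow> \<phi> (c Y i \<cdot> b Y i) = 1"
    and exp_b: "\<And>Y h. h \<in> Hom C P Y \<Longrightarrow> h = (\<Sum>i<n Y. scl C (\<phi> (c Y i \<cdot> h)) (b Y i))"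
    and exp_c: "\<And>Y h. h \<in> Hom C Y J \<Longrightarrow> h = (\<Sum>i<n Y. scl C (\<phi> (h \<cdot> b Y i)) (c Y i))"
  shows "\<exists>\<xi>. functional_on (Hom C \<^bold>1 L) \<xi> \<and> (\<forall>Y. \<xi> (cocharacter Y) = of_nat (n Y))"
proof -
  let ?d = "\<lambda>Y i. dual_mor C P Y (b Y i)"
  have d: "?d Y i \<in> Hom C (Y\<^sup>\<or>) (P\<^sup>\<or>)" if "i < n Y" for Y i
    by (rule dual_mor_in_Hom[OF b[OF that]])
  have dc: "?d Y i \<otimes>\<^sub>m c Y i \<in> Hom C (Y\<^sup>\<or> \<otimes>\<^sub>o Y) (P\<^sup>\<or> \<otimes>\<^sub>o J)" if "i < n Y" for Y i
    by (rule tensor_in_Hom[OF d[OF that] c[OF that]])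
  define \<kappa> where "\<kappa> Y = (\<Sum>i<n Y. ?d Y i \<otimes>\<^sub>m c Y i)" for Y
  have \<kappa>: "\<kappa> Y \<in> Hom C (Y\<^sup>\<or> \<otimes>\<^sub>o Y) (P\<^sup>\<or> \<otimes>\<^sub>o J)" for Y
    unfolding \<kappa>_def using dc by (intro Hom_sum) simp
  have "\<exists>!u. u \<in> Hom C L (P\<^sup>\<or> \<otimes>\<^sub>o J) \<and> (\<forall>X. u \<cdot> \<iota> X = \<kappa> X)"
  proof (rule iota_universal[OF \<kappa>])
    fix X Y f assume f: "f \<in> Hom C X Y"
    \<comment> \<open>The matrix of \<open>f\<close>. It expands \<open>c Y j \<cdot> f\<close> in
      the family \<open>c X\<close> and \<open>f \<cdot> b X i\<close> in the family
      \<open>b Y\<close> with the same entries, which is what makes \<kappa> dinatural.\<close>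
    let ?m = "\<lambda>j i. \<phi> (c Y j \<cdot> f \<cdot> b X i)"
    have If: "ide C (Y\<^sup>\<or>) \<otimes>\<^sub>m f \<in> Hom C (Y\<^sup>\<or> \<otimes>\<^sub>o X) (Y\<^sup>\<or> \<otimes>\<^sub>o Y)"
      by (intro tensor_in_Hom ide_in_Hom f)
    have fI: "dual_mor C X Y f \<otimes>\<^sub>m ide C X \<in> Hom C (Y\<^sup>\<or> \<otimes>\<^sub>o X) (X\<^sup>\<or> \<otimes>\<^sub>o X)"
      by (intro tensor_in_Hom ide_in_Hom dual_mor_in_Hom f)
    have "\<kappa> Y \<cdot> (ide C (Y\<^sup>\<or>) \<otimes>\<^sub>m f) = (\<Sum>j<n Y. (?d Y j \<otimes>\<^sub>m c Y j) \<cdot> (ide C (Y\<^sup>\<or>) \<otimes>\<^sub>m f))"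
      unfolding \<kappa>_def by (rule cmp_sum_left[OF If]) (auto intro: dc)
    also have "\<dots> = (\<Sum>j<n Y. ?d Y j \<otimes>\<^sub>m (c Y j \<cdot> f))"
      using interchange[OF ide_in_Hom d f c] by (intro sum.cong) (simp_all add: ide_right[OF d])
    also have "\<dots> = (\<Sum>j<n Y. \<Sum>i<n X. scl C (?m j i) (?d Y j \<otimes>\<^sub>m c X i))"
    proof (intro sum.cong refl)
      fix j assume "j \<in> {..<n Y}"
      then have j: "j < n Y" by simp
      have "c Y j \<cdot> f = (\<Sum>i<n X. scl C (\<phi> ((c Y j \<cdot> f) \<cdot> b X i)) (c X i))"
        by (rule exp_c[OF cmp_in_Hom[OF c[OF j] f]])
      also have "\<dots> = (\<Sum>i<n X. scl C (?m j i) (c X i))"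
        by (intro sum.cong refl) (simp add: cmp_assoc[OF c[OF j] f b])
      finally have "?d Y j \<otimes>\<^sub>m (c Y j \<cdot> f) = ?d Y j \<otimes>\<^sub>m (\<Sum>i<n X. scl C (?m j i) (c X i))" by simp
      also have "\<dots> = (\<Sum>i<n X. scl C (?m j i) (?d Y j \<otimes>\<^sub>m c X i))"
        by (rule linear_on_sum[OF linear_on_tensor(2)[OF d[OF j]]]) (auto intro: c)
      finally show "?d Y j \<otimes>\<^sub>m (c Y j \<cdot> f) = (\<Sum>i<n X. scl C (?m j i) (?d Y j \<otimes>\<^sub>m c X i))" .
    qed
    also have "\<dots> = (\<Sum>i<n X. \<Sum>j<n Y. scl C (?m j i) (?d Y j \<otimes>\<^sub>m c X i))"
      by (rule sum.swap)
    also have "\<dots> = (\<Sum>i<n X. (?d X i \<cdot> dual_mor C X Y f) \<otimes>\<^sub>m c X i)"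
    proof (intro sum.cong refl)
      fix i assume "i \<in> {..<n X}"
      then have i: "i < n X" by simp
      have "?d X i \<cdot> dual_mor C X Y f = dual_mor C P Y (f \<cdot> b X i)"
        by (rule dual_mor_cmp[OF b[OF i] f, symmetric])
      also have "\<dots> = dual_mor C P Y (\<Sum>j<n Y. scl C (?m j i) (b Y j))"
        using exp_b[OF cmp_in_Hom[OF f b[OF i]]] by simp
      also have "\<dots> = (\<Sum>j<n Y. scl C (?m j i) (?d Y j))"
        by (rule linear_on_sum[OF linear_on_dual_mor]) (simp add: b)
      finally have "(?d X i \<cdot> dual_mor C X Y f) \<otimes>\<^sub>m c X i = (\<Sum>j<n Y. scl C (?m j i) (?d Y j)) \<otimes>\<^sub>m c X i"
        by simp
      also have "\<dots> = (\<Sum>j<n Y. scl C (?m j i) (?d Y j \<otimes>\<^sub>m c X i))"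
        by (rule linear_on_sum[OF linear_on_tensor(1)[OF c[OF i]]]) (auto intro: d)
      finally show "(\<Sum>j<n Y. scl C (?m j i) (?d Y j \<otimes>\<^sub>m c X i)) = (?d X i \<cdot> dual_mor C X Y f) \<otimes>\<^sub>m c X i" ..
    qed
    also have "\<dots> = (\<Sum>i<n X. (?d X i \<otimes>\<^sub>m c X i) \<cdot> (dual_mor C X Y f \<otimes>\<^sub>m ide C X))"
      using interchange[OF dual_mor_in_Hom[OF f] d ide_in_Hom c]
      by (intro sum.cong) (simp_all add: ide_right[OF c])
    also have "\<dots> = \<kappa> X \<cdot> (dual_mor C X Y f \<otimes>\<^sub>m ide C X)"
      unfolding \<kappa>_def by (rule cmp_sum_left[OF fI, symmetric]) (auto intro: dc)
    finally show "\<kappa> Y \<cdot> (ide C (Y\<^sup>\<or>) \<otimes>\<^sub>m f) = \<kappa> X \<cdot> (dual_mor C X Y f \<otimes>\<^sub>m ide C X)" .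
  qed
  then obtain u where u: "u \<in> Hom C L (P\<^sup>\<or> \<otimes>\<^sub>o J)" "\<And>X. u \<cdot> \<iota> X = \<kappa> X" by blast
  \<comment> \<open>Transposition from \<open>P\<^sup>\<or> \<otimes>\<^sub>o J\<close> back to
    morphisms from \<open>P\<close> to \<open>J\<close>, where \<phi> can be applied.\<close>
  let ?T = "\<lambda>y. (ev C (P\<^sup>\<or>) \<otimes>\<^sub>m ide C J) \<cdot> (ide C P \<otimes>\<^sub>m y)"
  have e: "ev C (P\<^sup>\<or>) \<otimes>\<^sub>m ide C J \<in> Hom C (P \<otimes>\<^sub>o P\<^sup>\<or> \<otimes>\<^sub>o J) J"
    using tensor_in_Hom[OF ev_in_Hom[of "P\<^sup>\<or>"] ide_in_Hom[of J]] by simp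
  have i: "ide C P \<otimes>\<^sub>m y \<in> Hom C P (P \<otimes>\<^sub>o P\<^sup>\<or> \<otimes>\<^sub>o J)" if "y \<in> Hom C \<^bold>1 (P\<^sup>\<or> \<otimes>\<^sub>o J)" for y
    using tensor_in_Hom[OF ide_in_Hom[of P] that] by simp
  have T: "linear_on (Hom C \<^bold>1 (P\<^sup>\<or> \<otimes>\<^sub>o J)) ?T"
    by (rule linear_on_comp[OF linear_on_tensor(2)[OF ide_in_Hom] i linear_on_cmp(2)[OF e]])
  have T_in_Hom: "?T y \<in> Hom C P J" if "y \<in> Hom C \<^bold>1 (P\<^sup>\<or> \<otimes>\<^sub>o J)" for y
    by (rule cmp_in_Hom[OF e i[OF that]])
  \<comment> \<open>Closing a summand of \<kappa> with the coevaluation of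
    \<open>Y\<^sup>\<or>\<close> gives the composite of two dual basis vectors. Each contributes 1
    under \<phi>, and the sum counts them.\<close>
  have key: "?T ((?d Y i \<otimes>\<^sub>m c Y i) \<cdot> coev C (Y\<^sup>\<or>)) = c Y i \<cdot> b Y i" if i: "i < n Y" for Y i
  proof -
    let ?b = "Arrow P (b Y i) Y" and ?c = "Arrow Y (c Y i) J"
    note [simp] = b[OF i] c[OF i]
    have "(adual ?b \<boxtimes> ?c) \<odot> acoev (Y\<^sup>\<or>) = (\<I> (P\<^sup>\<or>) \<boxtimes> ?c) \<odot> (adual ?b \<boxtimes> \<I> Y) \<odot> acoev (Y\<^sup>\<or>)"
      using acomp_tail1[OF slide(2)[of "adual ?b" ?c], of "acoev (Y\<^sup>\<or>)"] by simp
    also have "(adual ?b \<boxtimes> \<I> Y) \<odot> acoev (Y\<^sup>\<or>) = (\<I> (P\<^sup>\<or>) \<boxtimes> ?b) \<odot> acoev (P\<^sup>\<or>)"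
      using acoev_adual[of "adual ?b" "Y\<^sup>\<or>" "P\<^sup>\<or>"] by (simp add: adual_adual)
    also have "(\<I> (P\<^sup>\<or>) \<boxtimes> ?c) \<odot> \<dots> = lcurry \<^bold>1 P (?c \<odot> ?b)"
      by (simp add: lcurry_def flip: whisker_comp)
    finally have "luncurry J P ((adual ?b \<boxtimes> ?c) \<odot> acoev (Y\<^sup>\<or>)) = ?c \<odot> ?b"
      using luncurry_lcurry[of "?c \<odot> ?b" P "\<^bold>1" J] by simp
    from arg_cong[OF this, of val] show ?thesis by (simp add: luncurry_def)
  qed
  have cH: "(?d Y i \<otimes>\<^sub>m c Y i) \<cdot> coev C (Y\<^sup>\<or>) \<in> Hom C \<^bold>1 (P\<^sup>\<or> \<otimes>\<^sub>o J)" if "i < n Y" for Y i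
    using cmp_in_Hom[OF dc[OF that]] coev_in_Hom[of "Y\<^sup>\<or>"] by simp
  have coev': "coev C (Y\<^sup>\<or>) \<in> Hom C \<^bold>1 (Y\<^sup>\<or> \<otimes>\<^sub>o Y)" for Y
    using coev_in_Hom[of "Y\<^sup>\<or>"] by simp
  let ?\<xi> = "\<lambda>x. \<phi> (?T (u \<cdot> x))"
  have "functional_on (Hom C \<^bold>1 L) ?\<xi>"
    by (rule functional_on_comp[OF linear_on_comp[OF linear_on_cmp(2)[OF u(1)] cmp_in_Hom[OF u(1)] T]
          T_in_Hom[OF cmp_in_Hom[OF u(1)]] lin])
  moreover have "?\<xi> (cocharacter Y) = of_nat (n Y)" for Y
  proof -
    have "u \<cdot> cocharacter Y = \<kappa> Y \<cdot> coev C (Y\<^sup>\<or>)"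
      unfolding cocharacter_def coev_tilde_def using cmp_assoc[OF u(1) iota_in_Hom coev'] u(2) by simp
    also have "\<dots> = (\<Sum>i<n Y. (?d Y i \<otimes>\<^sub>m c Y i) \<cdot> coev C (Y\<^sup>\<or>))"
      unfolding \<kappa>_def by (rule cmp_sum_left[OF coev']) (auto intro: dc)
    finally have "?T (u \<cdot> cocharacter Y) = ?T (\<Sum>i<n Y. (?d Y i \<otimes>\<^sub>m c Y i) \<cdot> coev C (Y\<^sup>\<or>))" by simp
    also have "\<dots> = (\<Sum>i<n Y. ?T ((?d Y i \<otimes>\<^sub>m c Y i) \<cdot> coev C (Y\<^sup>\<or>)))"
      by (rule linear_on_sum1[OF T]) (auto intro: cH)
    also have "\<dots> = (\<Sum>i<n Y. c Y i \<cdot> b Y i)"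
      by (simp add: key)
    finally have "?\<xi> (cocharacter Y) = \<phi> (\<Sum>i<n Y. scl C 1 (c Y i \<cdot> b Y i))" by simp
    also have "\<dots> = (\<Sum>i<n Y. 1 * \<phi> (c Y i \<cdot> b Y i))"
      by (rule functional_on_sum[OF lin]) (auto intro: cmp_in_Hom[OF c b])
    also have "\<dots> = of_nat (n Y)" by (simp add: dual)
    finally show ?thesis .
  qed
  ultimately show ?thesis by blast
qed

end


section \<open>Projective objects\<close>

context strict_monoidal_category
begin

text \<open>Stated for arrows, so that transposition applies; \<open>epi_iff\<close> and
  \<open>is_mono_imp_mono\<close> make the link to hom spaces.\<close>

definition epi where
  "epi e \<longleftrightarrow> ok e \<and> (\<forall>g h. ok g \<and> ok h \<and> src g = trg e \<and> src h = trg e \<and> trg g = trg h \<and>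
     g \<odot> e = h \<odot> e \<longrightarrow> g = h)"

definition mono where
  "mono f \<longleftrightarrow> ok f \<and> (\<forall>g h. ok g \<and> ok h \<and> trg g = src f \<and> trg h = src f \<and> src g = src h \<and>
     f \<odot> g = f \<odot> h \<longrightarrow> g = h)"

definition proj where
  "proj P \<longleftrightarrow> (\<forall>e h. epi e \<and> ok h \<and> src h = P \<and> trg h = trg e \<longrightarrow>
     (\<exists>g. ok g \<and> src g = P \<and> trg g = src e \<and> e \<odot> g = h))"

lemma epi_cancel:
  "epi e \<Longrightarrow> ok g \<Longrightarrow> ok h \<Longrightarrow> src g = trg e \<Longrightarrow> src h = trg e \<Longrightarrow> trg g = trg h \<Longrightarrow>
    g \<odot> e = h \<odot> e \<Longrightarrow> g = h"
  unfolding epi_def by blast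

lemma mono_cancel:
  "mono f \<Longrightarrow> ok g \<Longrightarrow> ok h \<Longrightarrow> trg g = src f \<Longrightarrow> trg h = src f \<Longrightarrow> src g = src h \<Longrightarrow>
    f \<odot> g = f \<odot> h \<Longrightarrow> g = h"
  unfolding mono_def by blast

lemma proj_lift:
  assumes "proj P" "epi e" "ok h" "src h = P" "trg h = trg e"
  obtains g where "ok g" "src g = P" "trg g = src e" "e \<odot> g = h"
  using assms unfolding proj_def by blast

lemma proj_retract:
  assumes P: "proj P" and i: "ok i" "src i = Q" "trg i = P" and r: "ok r" "src r = P" "trg r = Q"
    and ri: "r \<odot> i = \<I> Q"
  shows "proj Q"
  unfolding proj_def
proof (intro allI impI)
  fix e h assume eh: "epi e \<and> ok h \<and> src h = Q \<and> trg h = trg e"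
  then have [simp]: "ok e" "ok h" by (simp_all add: epi_def)
  obtain g where g: "ok g" "src g = P" "trg g = src e" "e \<odot> g = h \<odot> r"
    using proj_lift[OF P, of e "h \<odot> r"] eh r by auto
  have "e \<odot> g \<odot> i = (e \<odot> g) \<odot> i" using g(1-3) i by simp
  also have "\<dots> = h \<odot> r \<odot> i" unfolding g(4) using eh i r by simp
  also have "\<dots> = h" using ri eh by simp
  finally show "\<exists>g. ok g \<and> src g = Q \<and> trg g = src e \<and> e \<odot> g = h"
    using g i by (intro exI[of _ "g \<odot> i"]) simp
qed

end

context strict_pivotal_category
begin

text \<open>\<open>rcurry\<close> makes tensoring with \<open>W\<close> a left adjoint, and left
  adjoints preserve epimorphisms.\<close>

lemma epi_tensor_right:
  assumes "epi e"
  shows "epi (e \<boxtimes> \<I> W)"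
  unfolding epi_def
proof (intro conjI allI impI)
  have [simp]: "ok e" using assms by (simp add: epi_def)
  show "ok (e \<boxtimes> \<I> W)" by simp
  fix g h assume gh: "ok g \<and> ok h \<and> src g = trg (e \<boxtimes> \<I> W) \<and> src h = trg (e \<boxtimes> \<I> W) \<and> trg g = trg h
    \<and> g \<odot> (e \<boxtimes> \<I> W) = h \<odot> (e \<boxtimes> \<I> W)"
  then have "rcurry (trg e) W g \<odot> e = rcurry (trg e) W h \<odot> e" by (simp add: rcurry_comp)
  then have "rcurry (trg e) W g = rcurry (trg e) W h"
    using gh by (rule_tac epi_cancel[OF assms]) simp_all
  then have eq: "runcurry (trg h) W (rcurry (trg e) W g) = runcurry (trg h) W (rcurry (trg e) W h)"
    by (rule arg_cong)
  have "runcurry (trg h) W (rcurry (trg e) W g) = g" "runcurry (trg h) W (rcurry (trg e) W h) = h"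
    using gh by (rule_tac runcurry_rcurry; simp)+
  with eq show "g = h" by (simp only:)
qed

lemma epi_tensor_left:
  assumes "epi e"
  shows "epi (\<I> W \<boxtimes> e)"
  unfolding epi_def
proof (intro conjI allI impI)
  have [simp]: "ok e" using assms by (simp add: epi_def)
  show "ok (\<I> W \<boxtimes> e)" by simp
  fix g h assume gh: "ok g \<and> ok h \<and> src g = trg (\<I> W \<boxtimes> e) \<and> src h = trg (\<I> W \<boxtimes> e) \<and> trg g = trg h
    \<and> g \<odot> (\<I> W \<boxtimes> e) = h \<odot> (\<I> W \<boxtimes> e)"
  then have "lcurry (trg e) W g \<odot> e = lcurry (trg e) W h \<odot> e" by (simp add: lcurry_comp)
  then have "lcurry (trg e) W g = lcurry (trg e) W h"
    using gh by (rule_tac epi_cancel[OF assms]) simp_all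
  then have eq: "luncurry (trg h) W (lcurry (trg e) W g) = luncurry (trg h) W (lcurry (trg e) W h)"
    by (rule arg_cong)
  have "luncurry (trg h) W (lcurry (trg e) W g) = g" "luncurry (trg h) W (lcurry (trg e) W h) = h"
    using gh by (rule_tac luncurry_lcurry; simp)+
  with eq show "g = h" by (simp only:)
qed

text \<open>To lift \<open>h\<close> through \<open>e\<close> is to lift its transpose from
  \<open>P\<close> through \<open>e \<boxtimes> \<I> (W\<^sup>\<or>)\<close>, which is still
  epic.\<close>

lemma proj_tensor_right:
  assumes P: "proj P"
  shows "proj (P \<otimes>\<^sub>o W)"
  unfolding proj_def
proof (intro allI impI)
  fix e h assume eh: "epi e \<and> ok h \<and> src h = P \<otimes>\<^sub>o W \<and> trg h = trg e"
  then have [simp]: "ok e" "ok h" by (simp_all add: epi_def)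
  obtain g where g: "ok g" "src g = P" "trg g = src e \<otimes>\<^sub>o W\<^sup>\<or>" "(e \<boxtimes> \<I> (W\<^sup>\<or>)) \<odot> g = rcurry P W h"
    using proj_lift[OF P epi_tensor_right, of e "rcurry P W h" "W\<^sup>\<or>"] eh by auto
  have "rcurry P W (e \<odot> runcurry (src e) W g) = rcurry P W h"
    using g rcurry_runcurry[of g P "src e" W] by (simp add: comp_rcurry)
  note eq = this
  have "e \<odot> runcurry (src e) W g = runcurry (trg e) W (rcurry P W (e \<odot> runcurry (src e) W g))"
    using g(1-3) by (intro runcurry_rcurry[symmetric]) simp_all
  also have "\<dots> = runcurry (trg e) W (rcurry P W h)" by (simp only: eq)
  also have "\<dots> = h" using eh by (intro runcurry_rcurry) simp_all
  finally have "e \<odot> runcurry (src e) W g = h" .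
  then show "\<exists>g. ok g \<and> src g = P \<otimes>\<^sub>o W \<and> trg g = src e \<and> e \<odot> g = h"
    using g by (intro exI[of _ "runcurry (src e) W g"]) simp
qed

lemma proj_tensor_left:
  assumes P: "proj P"
  shows "proj (W \<otimes>\<^sub>o P)"
  unfolding proj_def
proof (intro allI impI)
  fix e h assume eh: "epi e \<and> ok h \<and> src h = W \<otimes>\<^sub>o P \<and> trg h = trg e"
  then have [simp]: "ok e" "ok h" by (simp_all add: epi_def)
  obtain g where g: "ok g" "src g = P" "trg g = W\<^sup>\<or> \<otimes>\<^sub>o src e" "(\<I> (W\<^sup>\<or>) \<boxtimes> e) \<odot> g = lcurry P W h"
    using proj_lift[OF P epi_tensor_left, of e "lcurry P W h" "W\<^sup>\<or>"] eh by auto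
  have "lcurry P W (e \<odot> luncurry (src e) W g) = lcurry P W h"
    using g lcurry_luncurry[of g P W "src e"] by (simp add: comp_lcurry)
  note eq = this
  have "e \<odot> luncurry (src e) W g = luncurry (trg e) W (lcurry P W (e \<odot> luncurry (src e) W g))"
    using g(1-3) by (intro luncurry_lcurry[symmetric]) simp_all
  also have "\<dots> = luncurry (trg e) W (lcurry P W h)" by (simp only: eq)
  also have "\<dots> = h" using eh by (intro luncurry_lcurry) simp_all
  finally have "e \<odot> luncurry (src e) W g = h" .
  then show "\<exists>g. ok g \<and> src g = W \<otimes>\<^sub>o P \<and> trg g = src e \<and> e \<odot> g = h"
    using g by (intro exI[of _ "luncurry (src e) W g"]) simp
qed

text \<open>The snake identity exhibits \<open>P\<^sup>\<or>\<close> as a retract of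
  \<open>P\<^sup>\<or> \<otimes>\<^sub>o P \<otimes>\<^sub>o P\<^sup>\<or>\<close>, which is
  projective because of its middle factor.\<close>

lemma proj_dual:
  assumes "proj P"
  shows "proj (P\<^sup>\<or>)"
proof (rule proj_retract)
  show "proj (P\<^sup>\<or> \<otimes>\<^sub>o P \<otimes>\<^sub>o P\<^sup>\<or>)" by (intro proj_tensor_left proj_tensor_right assms)
  show "(aev P \<boxtimes> \<I> (P\<^sup>\<or>)) \<odot> (\<I> (P\<^sup>\<or>) \<boxtimes> acoev P) = \<I> (P\<^sup>\<or>)" by (rule azigzag)
qed simp_all

lemma epi_adual:
  assumes "mono f"
  shows "epi (adual f)"
  unfolding epi_def
proof (intro conjI allI impI)
  have [simp]: "ok f" using assms by (simp add: mono_def)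
  show "ok (adual f)" by simp
  fix g h assume gh: "ok g \<and> ok h \<and> src g = trg (adual f) \<and> src h = trg (adual f) \<and> trg g = trg h
    \<and> g \<odot> adual f = h \<odot> adual f"
  then have [simp]: "ok g" "ok h" "src g = (src f)\<^sup>\<or>" "src h = (src f)\<^sup>\<or>"
    and eq: "g \<odot> adual f = h \<odot> adual f" by auto
  have "f \<odot> adual g = f \<odot> adual h"
    using arg_cong[OF eq, of adual] by (simp add: adual_comp adual_adual)
  then have "adual g = adual h" using gh by (rule_tac mono_cancel[OF assms]) simp_all
  then show "g = h" using gh adual_adual by metis
qed

text \<open>Projective objects are injective: a monomorphism out of \<open>P\<close> dualises to an
  epimorphism onto the projective \<open>P\<^sup>\<or>\<close>, and the dual of its section is the
  retraction.\<close>

lemma proj_mono_splits: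
  assumes P: "proj P" and f: "mono f" "src f = P"
  shows "\<exists>s. ok s \<and> src s = trg f \<and> trg s = P \<and> s \<odot> f = \<I> P"
proof -
  have [simp]: "ok f" using f by (simp add: mono_def)
  obtain g where g: "ok g" "src g = P\<^sup>\<or>" "trg g = (trg f)\<^sup>\<or>" "adual f \<odot> g = \<I> (P\<^sup>\<or>)"
    using proj_lift[OF proj_dual[OF P] epi_adual[OF f(1)], of "\<I> (P\<^sup>\<or>)"] f(2) by auto
  have "adual g \<odot> f = \<I> P"
    using arg_cong[OF g(4), of adual] g(1-3) f(2) by (simp add: adual_comp adual_adual)
  then show ?thesis using g by (intro exI[of _ "adual g"]) simp
qed

lemma proj_epi_splits:
  assumes P: "proj P" and f: "epi e" "trg e = P"
  shows "\<exists>s. ok s \<and> src s = P \<and> trg s = src e \<and> e \<odot> s = \<I> P"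
  using proj_lift[OF P f(1), of "\<I> P"] f(2) by auto

end

section \<open>Linear algebra\<close>

text \<open>Elimination with one pivot: equation \<open>j\<close> is solved for the unknown
  \<open>i0\<close> and subtracted from the others. Besides bounds on independent families it later
  produces the combination of defect operators that acts by zero on the simple projectives.\<close>

lemma underdetermined:
  fixes M :: "'a \<Rightarrow> 'b \<Rightarrow> 'k::field"
  assumes "finite J" "finite I" "card J < card I"
  shows "\<exists>c. (\<exists>i\<in>I. c i \<noteq> 0) \<and> (\<forall>j\<in>J. (\<Sum>i\<in>I. c i * M i j) = 0)"
  using assms
proof (induction J arbitrary: I M rule: finite_induct)
  case empty
  then have "I \<noteq> {}" by auto
  then show ?case by (intro exI[of _ "\<lambda>_. 1"]) auto
next
  case (insert j J)
  show ?case
  proof (cases "\<forall>i\<in>I. M i j = 0")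
    case True
    have "card J < card I" using insert by simp
    from insert.IH[OF insert.prems(1) this, of M] True show ?thesis by auto
  next
    case False
    then obtain i0 where i0: "i0 \<in> I" "M i0 j \<noteq> 0" by blast
    define I' where "I' = I - {i0}"
    have I: "I = insert i0 I'" "i0 \<notin> I'" "finite I'" using i0 insert.prems by (auto simp: I'_def)
    define M' where "M' i k = M i k - M i j / M i0 j * M i0 k" for i k
    have "card J < card I'" using insert I by simp
    from insert.IH[OF I(3) this, of M'] obtain c
      where c: "\<exists>i\<in>I'. c i \<noteq> 0" "\<And>k. k \<in> J \<Longrightarrow> (\<Sum>i\<in>I'. c i * M' i k) = 0" by blast
    define c0 where "c0 = - (\<Sum>i\<in>I'. c i * M i j) / M i0 j"
    define c' where "c' = c(i0 := c0)"
    have c': "(\<Sum>i\<in>I. c' i * M i k) = c0 * M i0 k + (\<Sum>i\<in>I'. c i * M i k)" for k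
    proof -
      have "(\<Sum>i\<in>I'. c' i * M i k) = (\<Sum>i\<in>I'. c i * M i k)"
        using I(2) by (intro sum.cong) (auto simp: c'_def)
      then show ?thesis using I by (simp add: c'_def)
    qed
    have "(\<Sum>i\<in>I. c' i * M i k) = 0" if "k \<in> insert j J" for k
    proof (cases "k = j")
      case True
      then show ?thesis using i0 by (simp add: c' c0_def)
    next
      case False
      then have k: "k \<in> J" using that by simp
      have "(\<Sum>i\<in>I'. c i * M' i k) = (\<Sum>i\<in>I'. c i * M i k - (c i * M i j) * (M i0 k / M i0 j))"
        by (intro sum.cong) (auto simp: M'_def algebra_simps)
      also have "\<dots> = (\<Sum>i\<in>I'. c i * M i k) - (\<Sum>i\<in>I'. c i * M i j) * (M i0 k / M i0 j)"
        by (simp only: sum_subtractf sum_distrib_right)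
      also have "\<dots> = (\<Sum>i\<in>I'. c i * M i k) + c0 * M i0 k"
        by (simp add: c0_def)
      finally show ?thesis using c(2)[OF k] by (simp add: c' add.commute)
    qed
    moreover have "\<exists>i\<in>I. c' i \<noteq> 0" using c(1) I by (auto simp: c'_def)
    ultimately show ?thesis by blast
  qed
qed

section \<open>Rank and one-sided inverses\<close>

lemma index_mult_mat_sum:
  assumes "A \<in> carrier_mat m n" "B \<in> carrier_mat n p" "i < m" "j < p"
  shows "(A * B) $$ (i, j) = (\<Sum>k<n. A $$ (i, k) * B $$ (k, j))"
proof -
  have "(A * B) $$ (i, j) = (\<Sum>k = 0..<n. A $$ (i, k) * B $$ (k, j))"
    using assms by (simp add: scalar_prod_def)
  then show ?thesis by (simp add: atLeast0LessThan)
qed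

text \<open>With \<open>R = P * T\<close> in reduced echelon form and \<open>Q\<close> inverse to
  \<open>P\<close>, the product \<open>T = Q * R\<close> involves only the first \<open>r\<close>
  columns of \<open>Q\<close> and the \<open>r\<close> non-zero rows of \<open>R\<close>. These are
  split by the first rows of \<open>P\<close> and by the selection of the pivot columns.\<close>

lemma rank_factorization:
  fixes T :: "'k::field mat"
  assumes T: "T \<in> carrier_mat m n"
  obtains r M M' E E' where
    "M \<in> carrier_mat m r" "M' \<in> carrier_mat r m" "E \<in> carrier_mat r n" "E' \<in> carrier_mat n r"
    "T = M * E" "M' * M = 1\<^sub>m r" "E * E' = 1\<^sub>m r"
proof -
  define R where "R = gauss_jordan_single T"
  note gj = gauss_jordan_single[OF T R_def[symmetric]]
  have R: "R \<in> carrier_mat m n" by (rule gj(2))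
  obtain P Q where PQ: "R = P * T" "P \<in> carrier_mat m m" "Q \<in> carrier_mat m m" "P * Q = 1\<^sub>m m" "Q * P = 1\<^sub>m m"
    using gj(4) by blast
  obtain f where "pivot_fun R f (dim_col R)" using gj(3) unfolding row_echelon_form_def by blast
  then have "pivot_fun R f n" using R by simp
  note pf = pivot_funD[OF _ this, of m]
  have dR: "dim_row R = m" using R by simp
  note pf = pf[OF dR]
  \<comment> \<open>The rank: a zero row has its pivot at position \<open>n\<close>, and pivots
    increase, so all rows from \<open>r\<close> on are zero.\<close>
  define r where "r = (LEAST i. i = m \<or> f i = n)"
  have r1: "r = m \<or> f r = n" unfolding r_def by (rule LeastI[of _ m]) simp
  have rm: "r \<le> m" unfolding r_def by (rule Least_le) simp
  have lt: "f i < n" if "i < r" for i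
    using not_less_Least[of i "\<lambda>i. i = m \<or> f i = n"] that pf(1)[of i] rm by (simp add: r_def)
  have ge: "f i = n" if "r \<le> i" "i < m" for i
    using that
  proof (induction i rule: dec_induct)
    case base then show ?case using r1 by simp
  next
    case (step k)
    then show ?case using pf(3)[of k] pf(1)[of "Suc k"] by auto
  qed
  define M where "M = mat m r (\<lambda>(i, j). Q $$ (i, j))"
  define M' where "M' = mat r m (\<lambda>(i, j). P $$ (i, j))"
  define E where "E = mat r n (\<lambda>(i, j). R $$ (i, j))"
  define E' where "E' = mat n r (\<lambda>(j, i). if j = f i then 1 else (0::'k))"
  have c: "M \<in> carrier_mat m r" "M' \<in> carrier_mat r m" "E \<in> carrier_mat r n" "E' \<in> carrier_mat n r"
    by (simp_all add: M_def M'_def E_def E'_def)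
  have "Q * R = (Q * P) * T" unfolding PQ(1) using PQ(2,3) T by simp
  then have TQ: "T = Q * R" using PQ(5) T by simp
  have "T = M * E"
  proof (rule eq_matI)
    fix i j assume "i < dim_row (M * E)" "j < dim_col (M * E)"
    then have ij: "i < m" "j < n" using c by auto
    have "T $$ (i, j) = (\<Sum>k<m. Q $$ (i, k) * R $$ (k, j))"
      unfolding TQ by (rule index_mult_mat_sum[OF PQ(3) R ij])
    also have "\<dots> = (\<Sum>k<r. Q $$ (i, k) * R $$ (k, j))"
      using rm ij ge pf(2) by (intro sum.mono_neutral_right) auto
    also have "\<dots> = (M * E) $$ (i, j)"
      using ij rm by (subst index_mult_mat_sum[OF c(1,3)]) (auto simp: M_def E_def)
    finally show "T $$ (i, j) = (M * E) $$ (i, j)" .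
  qed (use T c in auto)
  moreover have "M' * M = 1\<^sub>m r"
  proof (rule eq_matI)
    fix i j assume ij: "i < dim_row (1\<^sub>m r :: 'k mat)" "j < dim_col (1\<^sub>m r :: 'k mat)"
    then have "(M' * M) $$ (i, j) = (\<Sum>k<m. P $$ (i, k) * Q $$ (k, j))"
      by (subst index_mult_mat_sum[OF c(2,1)]) (auto simp: M_def M'_def)
    also have "\<dots> = (P * Q) $$ (i, j)"
      using ij rm by (subst index_mult_mat_sum[OF PQ(2,3)]) auto
    finally show "(M' * M) $$ (i, j) = 1\<^sub>m r $$ (i, j)" using ij rm PQ(4) by simp
  qed (use c in auto)
  moreover have "E * E' = 1\<^sub>m r"
  proof (rule eq_matI)
    fix i j assume "i < dim_row (1\<^sub>m r :: 'k mat)" "j < dim_col (1\<^sub>m r :: 'k mat)"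
    then have ij: "i < r" "j < r" by auto
    then have "(E * E') $$ (i, j) = (\<Sum>k<n. R $$ (i, k) * (if k = f j then 1 else 0))"
      by (subst index_mult_mat_sum[OF c(3,4)]) (auto simp: E_def E'_def)
    also have "\<dots> = R $$ (i, f j)" using lt[OF ij(2)] by (simp add: if_distrib cong: if_cong)
    also have "\<dots> = 1\<^sub>m r $$ (i, j)"
      using ij lt[OF ij(2)] pf(4)[of j] pf(5)[of j i] rm by auto
    finally show "(E * E') $$ (i, j) = 1\<^sub>m r $$ (i, j)" .
  qed (use c in auto)
  ultimately show ?thesis using that[OF c] by blast
qed

text \<open>Padding by zeros makes both matrices square, so that the left inverse is also a right
  inverse; but \<open>A\<close> has a zero row as soon as \<open>m < r\<close>.\<close>

lemma left_inverse_dim: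
  fixes M :: "'k::field mat"
  assumes M: "M \<in> carrier_mat m r" "M' \<in> carrier_mat r m" and inv: "M' * M = 1\<^sub>m r"
  shows "r \<le> m"
proof (rule ccontr)
  assume "\<not> r \<le> m"
  then have mr: "m < r" by simp
  define A where "A = mat r r (\<lambda>(i, j). if i < m then M $$ (i, j) else 0)"
  define B where "B = mat r r (\<lambda>(i, j). if j < m then M' $$ (i, j) else 0)"
  have AB: "A \<in> carrier_mat r r" "B \<in> carrier_mat r r" by (simp_all add: A_def B_def)
  have "B * A = 1\<^sub>m r"
  proof (rule eq_matI)
    fix i j assume "i < dim_row (1\<^sub>m r :: 'k mat)" "j < dim_col (1\<^sub>m r :: 'k mat)"
    then have ij: "i < r" "j < r" by auto
    have "(B * A) $$ (i, j) = (\<Sum>k<r. (if k < m then M' $$ (i, k) else 0) * (if k < m then M $$ (k, j) else 0))"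
      using ij by (subst index_mult_mat_sum[OF AB(2,1)]) (auto simp: A_def B_def)
    also have "\<dots> = (\<Sum>k<m. M' $$ (i, k) * M $$ (k, j))"
      using mr by (intro sum.mono_neutral_cong_right) auto
    also have "\<dots> = (M' * M) $$ (i, j)" by (rule index_mult_mat_sum[OF M(2,1) ij, symmetric])
    finally show "(B * A) $$ (i, j) = 1\<^sub>m r $$ (i, j)" using inv by simp
  qed (use AB in auto)
  then have "A * B = 1\<^sub>m r" by (rule mat_mult_left_right_inverse[OF AB(2,1)])
  then have "(A * B) $$ (m, m) = 1" using mr by simp
  moreover have "(A * B) $$ (m, m) = 0"
    using mr by (subst index_mult_mat_sum[OF AB]) (auto simp: A_def)
  ultimately show False by simp
qed

text \<open>The hypothesis is a trivial left kernel. In a rank factorisation the difference of the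
  identity and \<open>M * M'\<close> annihilates \<open>T\<close>, so it vanishes, and
  \<open>E' * M'\<close> is the right inverse.\<close>

lemma right_inverse_if:
  fixes T :: "'k::field mat"
  assumes T: "T \<in> carrier_mat m n"
    and ker: "\<And>W. W \<in> carrier_mat m m \<Longrightarrow> W * T = 0\<^sub>m m n \<Longrightarrow> W = 0\<^sub>m m m"
  shows "\<exists>R\<in>carrier_mat n m. T * R = 1\<^sub>m m"
proof -
  obtain r M M' E E' where rf: "M \<in> carrier_mat m r" "M' \<in> carrier_mat r m" "E \<in> carrier_mat r n"
    "E' \<in> carrier_mat n r" "T = M * E" "M' * M = 1\<^sub>m r" "E * E' = 1\<^sub>m r"
    using rank_factorization[OF T] by metis
  have MM: "M * M' \<in> carrier_mat m m" using rf by simp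
  have "M' * T = (M' * M) * E" unfolding rf(5) by (rule assoc_mult_mat[OF rf(2,1,3), symmetric])
  then have "(M * M') * T = T" using assoc_mult_mat[OF rf(1,2) T] rf by simp
  then have "(1\<^sub>m m - M * M') * T = 0\<^sub>m m n"
    using T MM by (simp add: minus_mult_distrib_mat[of _ m m])
  then have z: "1\<^sub>m m - M * M' = 0\<^sub>m m m" using minus_carrier_mat[OF MM] by (intro ker) auto
  have eq: "M * M' = 1\<^sub>m m"
  proof (rule eq_matI)
    fix i j assume ij: "i < dim_row (1\<^sub>m m :: 'k mat)" "j < dim_col (1\<^sub>m m :: 'k mat)"
    then have "(1\<^sub>m m - M * M') $$ (i, j) = 0" using z by simp
    then show "(M * M') $$ (i, j) = 1\<^sub>m m $$ (i, j)"
      using ij carrier_matD[OF rf(1)] carrier_matD[OF rf(2)] by (auto split: if_splits)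
  qed (use MM in auto)
  have "T * E' = M * (E * E')" unfolding rf(5) by (rule assoc_mult_mat[OF rf(1,3,4)])
  then have "T * (E' * M') = 1\<^sub>m m" using assoc_mult_mat[OF T rf(4,2)] rf(1,7) eq by simp
  then show ?thesis using rf by (intro bexI[of _ "E' * M'"]) auto
qed

lemma left_inverse_if:
  fixes T :: "'k::field mat"
  assumes T: "T \<in> carrier_mat m n"
    and ker: "\<And>W. W \<in> carrier_mat n n \<Longrightarrow> T * W = 0\<^sub>m m n \<Longrightarrow> W = 0\<^sub>m n n"
  shows "\<exists>R\<in>carrier_mat n m. R * T = 1\<^sub>m n"
proof -
  have "\<exists>R\<in>carrier_mat m n. transpose_mat T * R = 1\<^sub>m n"
  proof (rule right_inverse_if)
    show "transpose_mat T \<in> carrier_mat n m" using T by simp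
    fix W :: "'k mat" assume W: "W \<in> carrier_mat n n" "W * transpose_mat T = 0\<^sub>m n m"
    have "T * transpose_mat W = transpose_mat (W * transpose_mat T)"
      using W T by (subst transpose_mult[of _ n n _ m]) auto
    also have "\<dots> = 0\<^sub>m m n" using W by simp
    finally have "transpose_mat W = 0\<^sub>m n n" using W by (intro ker) auto
    then have "transpose_mat (transpose_mat W) = transpose_mat (0\<^sub>m n n)" by simp
    then show "W = 0\<^sub>m n n" by simp
  qed
  then obtain R where R: "R \<in> carrier_mat m n" "transpose_mat T * R = 1\<^sub>m n" by blast
  have "transpose_mat R * T = transpose_mat (transpose_mat T * R)"
    using R T by (subst transpose_mult[of _ n m _ n]) auto
  then have "transpose_mat R * T = 1\<^sub>m n" using R by simp
  then show ?thesis using R by (intro bexI[of _ "transpose_mat R"]) auto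
qed

lemma eigenvector_exists:
  fixes T :: "'k::alg_closed_field mat"
  assumes T: "T \<in> carrier_mat n n" and n: "n > 0"
  obtains c v where "v \<in> carrier_vec n" "v \<noteq> 0\<^sub>v n" "T *\<^sub>v v = c \<cdot>\<^sub>v v"
proof -
  have "degree (char_poly T) > 0" using degree_monic_char_poly[OF T] n by simp
  then obtain c where "poly (char_poly T) c = 0" using alg_closed_imp_poly_has_root by blast
  then have "eigenvalue T c" using eigenvalue_root_char_poly[OF T] by simp
  then show ?thesis using that T unfolding eigenvalue_def eigenvector_def by auto
qed

text \<open>
  Matrices of a fixed size are not a type of their own, so that \<open>sum\<close> is not available for them;
  linear combinations are therefore described by their entries.
\<close>

definition comb :: "nat \<Rightarrow> 'k::field mat \<Rightarrow> nat \<Rightarrow> (nat \<Rightarrow> 'k) \<Rightarrow> (nat \<Rightarrow> 'k mat) \<Rightarrow> bool" where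
  "comb n x p c y \<longleftrightarrow> (\<forall>i<n. \<forall>j<n. x $$ (i, j) = (\<Sum>k<p. c k * y k $$ (i, j)))"

text \<open>A linearly independent family of maximal length, which exists because the length is at
  most \<open>n * n\<close>; the \<kappa> are its coordinate functions.\<close>

lemma matrix_algebra_basis:
  assumes A: "matrix_algebra n (A :: 'k::field mat set)"
  obtains m B \<kappa> where "\<And>i. i < m \<Longrightarrow> B i \<in> A"
    "\<And>a. a \<in> A \<Longrightarrow> comb n a m (\<lambda>i. \<kappa> i a) B"
    "\<And>a c i. a \<in> A \<Longrightarrow> comb n a m c B \<Longrightarrow> i < m \<Longrightarrow> c i = \<kappa> i a"
proof -
  define indep where "indep m B \<longleftrightarrow> (\<forall>i<m. B i \<in> A) \<and>
    (\<forall>c. (\<forall>p<n. \<forall>q<n. (\<Sum>i<m. c i * B i $$ (p, q)) = 0) \<longrightarrow> (\<forall>i<m. c i = (0::'k)))" for m :: nat and B :: "nat \<Rightarrow> 'k mat"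
  have bound: "m \<le> n * n" if "indep m B" for m B
  proof (rule ccontr)
    assume "\<not> m \<le> n * n"
    then have "card ({..<n} \<times> {..<n}) < card {..<m}" by simp
    from underdetermined[OF _ _ this, of "\<lambda>i pq. B i $$ pq"]
    obtain c where "\<exists>i<m. c i \<noteq> 0" "\<forall>pq\<in>{..<n} \<times> {..<n}. (\<Sum>i<m. c i * B i $$ pq) = 0" by auto
    then have "\<exists>i<m. c i \<noteq> 0" "\<forall>p<n. \<forall>q<n. (\<Sum>i<m. c i * B i $$ (p, q)) = 0" by auto
    with that show False unfolding indep_def by blast
  qed
  have "\<exists>B. indep 0 B" by (simp add: indep_def)
  then obtain m where m: "\<exists>B. indep m B" "\<And>m'. \<exists>B. indep m' B \<Longrightarrow> m' \<le> m"
    using ex_has_greatest_nat[of "\<lambda>m. \<exists>B. indep m B" 0 "\<lambda>m. m" "Suc (n * n)"] bound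
    by (auto simp: less_Suc_eq_le)
  then obtain B where B: "indep m B" by blast
  have ex: "\<exists>c. comb n a m c B" if a: "a \<in> A" for a
  proof -
    define B' where "B' = B(m := a)"
    have "\<not> indep (Suc m) B'" using m(2)[of "Suc m"] by auto
    moreover have "\<forall>i<Suc m. B' i \<in> A" using B a by (auto simp: B'_def indep_def less_Suc_eq)
    ultimately obtain c where c: "\<And>p q. p < n \<Longrightarrow> q < n \<Longrightarrow> (\<Sum>i<Suc m. c i * B' i $$ (p, q)) = 0"
      "\<exists>i<Suc m. c i \<noteq> 0" unfolding indep_def by blast
    have c': "(\<Sum>i<m. c i * B i $$ (p, q)) + c m * a $$ (p, q) = 0" if "p < n" "q < n" for p q
      using c(1)[OF that] by (simp add: B'_def)
    have "c m \<noteq> 0"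
    proof
      assume "c m = 0"
      then have "\<forall>i<m. c i = 0" using B c' unfolding indep_def by simp
      with \<open>c m = 0\<close> c(2) show False by (auto simp: less_Suc_eq)
    qed
    have "a $$ (p, q) = (\<Sum>i<m. (- c i / c m) * B i $$ (p, q))" if "p < n" "q < n" for p q
    proof -
      have "(\<Sum>i<m. (- c i / c m) * B i $$ (p, q)) = (- 1 / c m) * (\<Sum>i<m. c i * B i $$ (p, q))"
        by (simp add: sum_distrib_left)
      also have "(\<Sum>i<m. c i * B i $$ (p, q)) = - (c m * a $$ (p, q))"
        using c'[OF that] by (simp only: eq_neg_iff_add_eq_0)
      finally show ?thesis using \<open>c m \<noteq> 0\<close> by simp
    qed
    then show ?thesis unfolding comb_def by (intro exI[of _ "\<lambda>i. - c i / c m"] allI impI)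
  qed
  define \<kappa> where "\<kappa> i a = (SOME c. comb n a m c B) i" for i a
  have \<kappa>: "comb n a m (\<lambda>i. \<kappa> i a) B" if "a \<in> A" for a
    unfolding \<kappa>_def using someI_ex[OF ex[OF that]] by simp
  have uniq: "c i = \<kappa> i a" if "a \<in> A" "comb n a m c B" "i < m" for a c i
  proof -
    have "(\<Sum>i<m. (c i - \<kappa> i a) * B i $$ (p, q)) = 0" if "p < n" "q < n" for p q
      using that \<open>comb n a m c B\<close> \<kappa>[OF \<open>a \<in> A\<close>] unfolding comb_def
      by (simp add: left_diff_distrib sum_subtractf)
    then have "\<forall>i<m. c i - \<kappa> i a = 0"
      using B unfolding indep_def by (elim conjE allE[of _ "\<lambda>i. c i - \<kappa> i a"]) simp
    then show ?thesis using \<open>i < m\<close> by simp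
  qed
  show ?thesis using that[of m B \<kappa>] B \<kappa> uniq unfolding indep_def by blast
qed

text \<open>Representations are additive on \<open>A\<close> only, so the partial sums of the
  combination are built as elements \<open>s\<close> of \<open>A\<close>; the last one equals
  \<open>x\<close> entry by entry.\<close>

lemma fd_module_comb:
  assumes A: "matrix_algebra n (A :: 'k::field mat set)" and \<rho>: "fd_module n A d \<rho>"
    and x: "x \<in> A" and y: "\<And>k. k < p \<Longrightarrow> y k \<in> A" and c: "comb n x p c y"
  shows "comb d (\<rho> x) p c (\<lambda>k. \<rho> (y k))"
proof -
  have "\<exists>s\<in>A. comb n s q c y \<and> comb d (\<rho> s) q c (\<lambda>k. \<rho> (y k))" if "q \<le> p" for q
    using that
  proof (induction q)
    case 0
    have 1: "1\<^sub>m n \<in> A" using A by (simp add: matrix_algebra_def)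
    then have "0 \<cdot>\<^sub>m 1\<^sub>m n \<in> A" using A by (simp add: matrix_algebra_def)
    moreover have "\<rho> (0 \<cdot>\<^sub>m 1\<^sub>m n) = 0 \<cdot>\<^sub>m 1\<^sub>m d" using \<rho> 1 by (auto simp: fd_module_def)
    ultimately show ?case by (intro bexI[of _ "0 \<cdot>\<^sub>m 1\<^sub>m n"]) (simp_all add: comb_def)
  next
    case (Suc q)
    then obtain s where s: "s \<in> A" "comb n s q c y" "comb d (\<rho> s) q c (\<lambda>k. \<rho> (y k))" by auto
    have yq: "y q \<in> A" using Suc y by simp
    then have cy: "c q \<cdot>\<^sub>m y q \<in> A" using A by (simp add: matrix_algebra_def)
    then have sA: "s + c q \<cdot>\<^sub>m y q \<in> A" using A s by (simp add: matrix_algebra_def)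
    have car: "y q \<in> carrier_mat n n" using A yq by (auto simp: matrix_algebra_def)
    have \<rho>s: "\<rho> (s + c q \<cdot>\<^sub>m y q) = \<rho> s + c q \<cdot>\<^sub>m \<rho> (y q)" and cr: "\<rho> (y q) \<in> carrier_mat d d"
      using \<rho> s cy yq by (simp_all add: fd_module_def)
    show ?case
      using s car cr by (intro bexI[OF _ sA]) (auto simp: comb_def \<rho>s)
  qed
  then obtain s where s: "s \<in> A" "comb n s p c y" "comb d (\<rho> s) p c (\<lambda>k. \<rho> (y k))" by blast
  have "s \<in> carrier_mat n n" "x \<in> carrier_mat n n" using A s x by (auto simp: matrix_algebra_def)
  then have "s = x" using s(2) c by (intro eq_matI) (auto simp: comb_def)
  then show ?thesis using s by simp
qed

lemma comb_mult:
  assumes "a \<in> carrier_mat n n" "x \<in> carrier_mat n n" "\<And>k. k < p \<Longrightarrow> y k \<in> carrier_mat n n" "comb n x p c y"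
  shows "comb n (a * x) p c (\<lambda>k. a * y k)" "comb n (x * a) p c (\<lambda>k. y k * a)"
proof -
  have "(a * x) $$ (i, j) = (\<Sum>k<p. c k * (a * y k) $$ (i, j))" if "i < n" "j < n" for i j
  proof -
    have "(a * x) $$ (i, j) = (\<Sum>l<n. \<Sum>k<p. c k * (a $$ (i, l) * y k $$ (l, j)))"
      using that assms(4) by (subst index_mult_mat_sum[OF assms(1,2)])
        (auto simp: comb_def sum_distrib_left algebra_simps intro!: sum.cong)
    also have "\<dots> = (\<Sum>k<p. \<Sum>l<n. c k * (a $$ (i, l) * y k $$ (l, j)))" by (rule sum.swap)
    also have "\<dots> = (\<Sum>k<p. c k * (a * y k) $$ (i, j))"
      using that by (intro sum.cong refl) (auto simp: index_mult_mat_sum[OF assms(1) assms(3)] sum_distrib_left)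
    finally show ?thesis .
  qed
  then show "comb n (a * x) p c (\<lambda>k. a * y k)" by (simp add: comb_def)
  have "(x * a) $$ (i, j) = (\<Sum>k<p. c k * (y k * a) $$ (i, j))" if "i < n" "j < n" for i j
  proof -
    have "(x * a) $$ (i, j) = (\<Sum>l<n. \<Sum>k<p. c k * (y k $$ (i, l) * a $$ (l, j)))"
      using that assms(4) by (subst index_mult_mat_sum[OF assms(2,1)])
        (auto simp: comb_def sum_distrib_right sum_distrib_left algebra_simps intro!: sum.cong)
    also have "\<dots> = (\<Sum>k<p. \<Sum>l<n. c k * (y k $$ (i, l) * a $$ (l, j)))" by (rule sum.swap)
    also have "\<dots> = (\<Sum>k<p. c k * (y k * a) $$ (i, j))"
      using that by (intro sum.cong refl) (auto simp: index_mult_mat_sum[OF assms(3) assms(1)] sum_distrib_left)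
    finally show ?thesis .
  qed
  then show "comb n (x * a) p c (\<lambda>k. y k * a)" by (simp add: comb_def)
qed

text \<open>
  The regular module and its dual: \<open>Hom(A, Y) = Y\<close> and \<open>Hom(Y, A\<^sup>*) = Y\<^sup>*\<close>, and the composition
  pairing followed by \<open>\<phi>\<close> = evaluation at the unit is the canonical pairing of \<open>Y\<close> with \<open>Y\<^sup>*\<close>.
\<close>

lemma regular_modules:
  assumes A: "matrix_algebra n (A :: 'k::field mat set)"
  obtains m l l' \<phi> b c where "fd_module n A m l" "fd_module n A m l'"
    "\<And>S T. S \<in> carrier_mat m m \<Longrightarrow> T \<in> carrier_mat m m \<Longrightarrow> \<phi> (S + T) = \<phi> S + \<phi> T"
    "\<And>x T. T \<in> carrier_mat m m \<Longrightarrow> \<phi> (x \<cdot>\<^sub>m T) = x * \<phi> T"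
    "\<And>d \<rho> i. fd_module n A d \<rho> \<Longrightarrow> i < d \<Longrightarrow> b d \<rho> i \<in> fd_module_hom A m l d \<rho>"
    "\<And>d \<rho> i. fd_module n A d \<rho> \<Longrightarrow> i < d \<Longrightarrow> c d \<rho> i \<in> fd_module_hom A d \<rho> m l'"
    "\<And>d \<rho> d' \<rho>' F i j. fd_module n A d \<rho> \<Longrightarrow> fd_module n A d' \<rho>' \<Longrightarrow> F \<in> fd_module_hom A d \<rho> d' \<rho>' \<Longrightarrow>
       i < d' \<Longrightarrow> j < d \<Longrightarrow> \<phi> (c d' \<rho>' i * (F * b d \<rho> j)) = F $$ (i, j)"
    "\<And>d \<rho> H p k. fd_module n A d \<rho> \<Longrightarrow> H \<in> fd_module_hom A m l d \<rho> \<Longrightarrow> p < d \<Longrightarrow> k < m \<Longrightarrow>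
       H $$ (p, k) = (\<Sum>i<d. \<phi> (c d \<rho> i * H) * b d \<rho> i $$ (p, k))"
    "\<And>d \<rho> K p k. fd_module n A d \<rho> \<Longrightarrow> K \<in> fd_module_hom A d \<rho> m l' \<Longrightarrow> p < d \<Longrightarrow> k < m \<Longrightarrow>
       K $$ (k, p) = (\<Sum>i<d. \<phi> (K * b d \<rho> i) * c d \<rho> i $$ (k, p))"
proof -
  obtain m B \<kappa> where B: "\<And>i. i < m \<Longrightarrow> B i \<in> A"
    and \<kappa>: "\<And>a. a \<in> A \<Longrightarrow> comb n a m (\<lambda>i. \<kappa> i a) B"
    and uniq: "\<And>a c i. a \<in> A \<Longrightarrow> comb n a m c B \<Longrightarrow> i < m \<Longrightarrow> c i = \<kappa> i a"
    using matrix_algebra_basis[OF A] by metis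
  have car: "a \<in> carrier_mat n n" if "a \<in> A" for a using A that by (auto simp: matrix_algebra_def)
  have mult: "a * a' \<in> A" and add: "a + a' \<in> A" and scale: "x \<cdot>\<^sub>m a \<in> A" if "a \<in> A" "a' \<in> A" for a a' x
    using A that by (auto simp: matrix_algebra_def)
  have one: "1\<^sub>m n \<in> A" using A by (auto simp: matrix_algebra_def)
  have \<kappa>_comb: "\<kappa> i x = (\<Sum>k<p. c k * \<kappa> i (y k))"
    if x: "x \<in> A" and y: "\<And>k. k < p \<Longrightarrow> y k \<in> A" and c: "comb n x p c y" and i: "i < m" for x p c y i
  proof (rule uniq[OF x _ i, symmetric])
    show "comb n x m (\<lambda>i. \<Sum>k<p. c k * \<kappa> i (y k)) B"
      unfolding comb_def
    proof (intro allI impI)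
      fix r s assume rs: "r < n" "s < n"
      have "x $$ (r, s) = (\<Sum>k<p. c k * (\<Sum>i<m. \<kappa> i (y k) * B i $$ (r, s)))"
        using rs c \<kappa>[OF y] by (simp add: comb_def)
      also have "\<dots> = (\<Sum>k<p. \<Sum>i<m. c k * \<kappa> i (y k) * B i $$ (r, s))"
        by (simp add: sum_distrib_left algebra_simps)
      also have "\<dots> = (\<Sum>i<m. \<Sum>k<p. c k * \<kappa> i (y k) * B i $$ (r, s))" by (rule sum.swap)
      finally show "x $$ (r, s) = (\<Sum>i<m. (\<Sum>k<p. c k * \<kappa> i (y k)) * B i $$ (r, s))"
        by (simp add: sum_distrib_right)
    qed
  qed
  have \<kappa>_B: "\<kappa> i (B j) = (if i = j then 1 else 0)" if "i < m" "j < m" for i j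
    using that by (intro uniq[OF B, symmetric]) (auto simp: comb_def if_distrib[of "\<lambda>x. x * _"] cong: if_cong)
  have \<kappa>_add: "\<kappa> i (a + a') = \<kappa> i a + \<kappa> i a'" if "a \<in> A" "a' \<in> A" "i < m" for a a' i
    using that \<kappa>[of a] \<kappa>[of a'] car[of a'] car[of a]
    by (intro uniq[OF add, symmetric]) (auto simp: comb_def algebra_simps sum.distrib)
  have \<kappa>_scale: "\<kappa> i (x \<cdot>\<^sub>m a) = x * \<kappa> i a" if "a \<in> A" "i < m" for a x i
    using that \<kappa>[of a] car[of a]
    by (intro uniq[OF scale, symmetric]) (auto simp: comb_def algebra_simps sum_distrib_left)
  define \<epsilon> where "\<epsilon> i = \<kappa> i (1\<^sub>m n)" for i
  define l where "l a = mat m m (\<lambda>(i, j). \<kappa> i (a * B j))" for a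
  \<comment> \<open>The transpose of right multiplication, hence the left module dual to the right
    regular one.\<close>
  define l' where "l' a = mat m m (\<lambda>(i, j). \<kappa> j (B i * a))" for a
  \<comment> \<open>Evaluates a map from the regular module to its dual at the unit, and the
    resulting functional at the unit again.\<close>
  define \<phi> where "\<phi> T = (\<Sum>j<m. \<Sum>k<m. \<epsilon> j * T $$ (j, k) * \<epsilon> k)" for T :: "'k mat"
  \<comment> \<open>\<open>b d \<rho> i\<close> is a \<mapsto> \<rho>(a) e_i, and
    \<open>c d \<rho> i\<close> sends y to the functional a \<mapsto> (\<rho>(a) y)_i.\<close>
  define b where "b d \<rho> i = mat d m (\<lambda>(p, k). \<rho> (B k) $$ (p, i))" for d :: nat and \<rho> :: "'k mat \<Rightarrow> 'k mat" and i
  define c where "c d \<rho> i = mat m d (\<lambda>(k, q). \<rho> (B k) $$ (i, q))" for d :: nat and \<rho> :: "'k mat \<Rightarrow> 'k mat" and i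
  have dims: "l a \<in> carrier_mat m m" "l' a \<in> carrier_mat m m" "b d \<rho> i \<in> carrier_mat d m" "c d \<rho> i \<in> carrier_mat m d"
    for a d \<rho> i by (simp_all add: l_def l'_def b_def c_def)
  have combB: "comb n (a * B j) m (\<lambda>k. \<kappa> k (a * B j)) B" "comb n (B j * a) m (\<lambda>k. \<kappa> k (B j * a)) B"
    if "a \<in> A" "j < m" for a j using that mult B by (auto intro: \<kappa>)
  have l_mult: "l (a * a') = l a * l a'" if a: "a \<in> A" "a' \<in> A" for a a'
  proof (rule eq_matI)
    fix i j assume "i < dim_row (l a * l a')" "j < dim_col (l a * l a')"
    then have ij: "i < m" "j < m" using dims by (auto simp: l_def)
    have "comb n (a * (a' * B j)) m (\<lambda>k. \<kappa> k (a' * B j)) (\<lambda>k. a * B k)"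
      using a ij B mult by (intro comb_mult combB car) auto
    then have "\<kappa> i (a * (a' * B j)) = (\<Sum>k<m. \<kappa> k (a' * B j) * \<kappa> i (a * B k))"
      using a ij B mult by (intro \<kappa>_comb) auto
    moreover have "a * a' * B j = a * (a' * B j)"
      using a ij B by (intro assoc_mult_mat[of _ n n _ n _ n] car) auto
    ultimately show "l (a * a') $$ (i, j) = (l a * l a') $$ (i, j)"
      using ij by (subst index_mult_mat_sum[OF dims(1) dims(1)]) (auto simp: l_def mult.commute)
  qed (simp_all add: l_def)
  have l'_mult: "l' (a * a') = l' a * l' a'" if a: "a \<in> A" "a' \<in> A" for a a'
  proof (rule eq_matI)
    fix i j assume "i < dim_row (l' a * l' a')" "j < dim_col (l' a * l' a')"
    then have ij: "i < m" "j < m" using dims by (auto simp: l'_def)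
    have "comb n (B i * a * a') m (\<lambda>k. \<kappa> k (B i * a)) (\<lambda>k. B k * a')"
      using a ij B mult by (intro comb_mult combB car) auto
    then have "\<kappa> j (B i * a * a') = (\<Sum>k<m. \<kappa> k (B i * a) * \<kappa> j (B k * a'))"
      using a ij B mult by (intro \<kappa>_comb) auto
    moreover have "B i * (a * a') = B i * a * a'"
      using a ij B by (intro assoc_mult_mat[of _ n n _ n _ n, symmetric] car) auto
    ultimately show "l' (a * a') $$ (i, j) = (l' a * l' a') $$ (i, j)"
      using ij by (subst index_mult_mat_sum[OF dims(2) dims(2)]) (auto simp: l'_def)
  qed (simp_all add: l'_def)
  have l_one: "l (1\<^sub>m n) = 1\<^sub>m m" "l' (1\<^sub>m n) = 1\<^sub>m m"
    by (auto intro!: eq_matI simp: l_def l'_def \<kappa>_B left_mult_one_mat[OF car[OF B]] right_mult_one_mat[OF car[OF B]])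
  have l_lin: "l (a + a') = l a + l a'" "l' (a + a') = l' a + l' a'" if a: "a \<in> A" "a' \<in> A" for a a'
    using a B mult car by (auto intro!: eq_matI simp: l_def l'_def \<kappa>_add
      add_mult_distrib_mat[of _ n n _ _ n] mult_add_distrib_mat[of _ n n _ n])
  have l_scale: "l (x \<cdot>\<^sub>m a) = x \<cdot>\<^sub>m l a" "l' (x \<cdot>\<^sub>m a) = x \<cdot>\<^sub>m l' a" if a: "a \<in> A" for a x
    using a B mult car by (auto intro!: eq_matI simp: l_def l'_def \<kappa>_scale
      mult_smult_assoc_mat[of _ n n _ n] mult_smult_distrib[of _ n n _ n])
  have mod: "fd_module n A m l" "fd_module n A m l'"
    using dims l_mult l'_mult l_one l_lin l_scale by (auto simp: fd_module_def)
  have \<phi>_add: "\<phi> (S + T) = \<phi> S + \<phi> T" if "S \<in> carrier_mat m m" "T \<in> carrier_mat m m" for S T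
    using that by (auto simp: \<phi>_def sum.distrib algebra_simps)
  have \<phi>_scale: "\<phi> (x \<cdot>\<^sub>m T) = x * \<phi> T" if "T \<in> carrier_mat m m" for T x
    using that by (auto simp: \<phi>_def sum_distrib_left algebra_simps)
  have b_hom: "b d \<rho> i \<in> fd_module_hom A m l d \<rho>" if \<rho>: "fd_module n A d \<rho>" and i: "i < d" for d \<rho> i
    unfolding fd_module_hom_def
  proof (intro CollectI conjI ballI dims)
    fix a assume a: "a \<in> A"
    have ra: "\<rho> a \<in> carrier_mat d d" using \<rho> a by (auto simp: fd_module_def)
    show "b d \<rho> i * l a = \<rho> a * b d \<rho> i"
    proof (rule eq_matI)
      fix p j assume "p < dim_row (\<rho> a * b d \<rho> i)" "j < dim_col (\<rho> a * b d \<rho> i)"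
      then have pj: "p < d" "j < m" using ra dims(3)[of d \<rho> i] by auto
      have Bj: "\<rho> (B j) \<in> carrier_mat d d" using \<rho> B pj by (auto simp: fd_module_def)
      have "comb d (\<rho> (a * B j)) m (\<lambda>k. \<kappa> k (a * B j)) (\<lambda>k. \<rho> (B k))"
        using a pj B mult by (intro fd_module_comb[OF A \<rho>] combB) auto
      then have "\<rho> (a * B j) $$ (p, i) = (\<Sum>k<m. \<kappa> k (a * B j) * \<rho> (B k) $$ (p, i))"
        using pj i by (simp add: comb_def)
      moreover have "\<rho> (a * B j) = \<rho> a * \<rho> (B j)" using \<rho> a B pj by (auto simp: fd_module_def)
      ultimately have "(b d \<rho> i * l a) $$ (p, j) = (\<rho> a * \<rho> (B j)) $$ (p, i)"
        using pj by (subst index_mult_mat_sum[OF dims(3) dims(1)]) (auto simp: b_def l_def mult.commute)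
      also have "\<dots> = (\<rho> a * b d \<rho> i) $$ (p, j)"
        using pj i by (subst (1 2) index_mult_mat_sum[OF ra]) (auto simp: b_def intro!: Bj)
      finally show "(b d \<rho> i * l a) $$ (p, j) = (\<rho> a * b d \<rho> i) $$ (p, j)" .
    qed (use ra dims in \<open>auto simp: b_def l_def\<close>)
  qed
  have c_hom: "c d \<rho> i \<in> fd_module_hom A d \<rho> m l'" if \<rho>: "fd_module n A d \<rho>" and i: "i < d" for d \<rho> i
    unfolding fd_module_hom_def
  proof (intro CollectI conjI ballI dims)
    fix a assume a: "a \<in> A"
    have ra: "\<rho> a \<in> carrier_mat d d" using \<rho> a by (auto simp: fd_module_def)
    show "c d \<rho> i * \<rho> a = l' a * c d \<rho> i"
    proof (rule eq_matI)
      fix j p assume "j < dim_row (l' a * c d \<rho> i)" "p < dim_col (l' a * c d \<rho> i)"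
      then have pj: "p < d" "j < m" using dims(2)[of a] dims(4)[of d \<rho> i] by auto
      have Bj: "\<rho> (B j) \<in> carrier_mat d d" using \<rho> B pj by (auto simp: fd_module_def)
      have "comb d (\<rho> (B j * a)) m (\<lambda>k. \<kappa> k (B j * a)) (\<lambda>k. \<rho> (B k))"
        using a pj B mult by (intro fd_module_comb[OF A \<rho>] combB) auto
      then have "\<rho> (B j * a) $$ (i, p) = (\<Sum>k<m. \<kappa> k (B j * a) * \<rho> (B k) $$ (i, p))"
        using pj i by (simp add: comb_def)
      moreover have "\<rho> (B j * a) = \<rho> (B j) * \<rho> a" using \<rho> a B pj by (auto simp: fd_module_def)
      ultimately have "(l' a * c d \<rho> i) $$ (j, p) = (\<rho> (B j) * \<rho> a) $$ (i, p)"
        using pj by (subst index_mult_mat_sum[OF dims(2) dims(4)]) (auto simp: c_def l'_def)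
      also have "\<dots> = (c d \<rho> i * \<rho> a) $$ (j, p)"
        using pj i Bj by (subst (1 2) index_mult_mat_sum[OF _ ra]) (auto simp: c_def)
      finally show "(c d \<rho> i * \<rho> a) $$ (j, p) = (l' a * c d \<rho> i) $$ (j, p)" ..
    qed (use ra dims in \<open>auto simp: c_def l'_def\<close>)
  qed
  have \<epsilon>_sum: "(\<Sum>k<m. \<rho> (B k) $$ (p, q) * \<epsilon> k) = (if p = q then 1 else 0)"
    if \<rho>: "fd_module n A d \<rho>" and pq: "p < d" "q < d" for d \<rho> p q
  proof -
    have "comb d (\<rho> (1\<^sub>m n)) m \<epsilon> (\<lambda>k. \<rho> (B k))"
      unfolding \<epsilon>_def by (intro fd_module_comb[OF A \<rho> one] B \<kappa>[OF one])
    moreover have "\<rho> (1\<^sub>m n) = 1\<^sub>m d" using \<rho> by (simp add: fd_module_def)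
    ultimately show ?thesis using pq by (simp add: comb_def mult.commute)
  qed
  \<comment> \<open>Only coordinate \<open>i\<close> of the image of the unit under \<open>H\<close>
    survives, because the unit acts as the identity (\<open>\<epsilon>_sum\<close>).\<close>
  have \<phi>_c: "\<phi> (c d \<rho> i * H) = (\<Sum>k<m. H $$ (i, k) * \<epsilon> k)"
    if \<rho>: "fd_module n A d \<rho>" and H: "H \<in> carrier_mat d m" and i: "i < d" for d \<rho> H i
  proof -
    have "\<phi> (c d \<rho> i * H) = (\<Sum>j<m. \<Sum>k<m. \<Sum>q<d. \<rho> (B j) $$ (i, q) * \<epsilon> j * (H $$ (q, k) * \<epsilon> k))"
      unfolding \<phi>_def
    proof (intro sum.cong refl)
      fix j k assume jk: "j \<in> {..<m}" "k \<in> {..<m}"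
      have "(c d \<rho> i * H) $$ (j, k) = (\<Sum>q<d. \<rho> (B j) $$ (i, q) * H $$ (q, k))"
        using jk by (subst index_mult_mat_sum[OF dims(4) H]) (auto simp: c_def)
      then show "\<epsilon> j * (c d \<rho> i * H) $$ (j, k) * \<epsilon> k = (\<Sum>q<d. \<rho> (B j) $$ (i, q) * \<epsilon> j * (H $$ (q, k) * \<epsilon> k))"
        by (simp add: sum_distrib_left sum_distrib_right algebra_simps)
    qed
    also have "\<dots> = (\<Sum>k<m. \<Sum>j<m. \<Sum>q<d. \<rho> (B j) $$ (i, q) * \<epsilon> j * (H $$ (q, k) * \<epsilon> k))"
      by (rule sum.swap)
    also have "\<dots> = (\<Sum>k<m. \<Sum>q<d. \<Sum>j<m. \<rho> (B j) $$ (i, q) * \<epsilon> j * (H $$ (q, k) * \<epsilon> k))"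
      by (intro sum.cong refl sum.swap)
    also have "\<dots> = (\<Sum>k<m. \<Sum>q<d. (if i = q then 1 else 0) * (H $$ (q, k) * \<epsilon> k))"
      using i by (intro sum.cong refl) (simp add: \<epsilon>_sum[OF \<rho> i] flip: sum_distrib_right)
    also have "\<dots> = (\<Sum>k<m. H $$ (i, k) * \<epsilon> k)"
      using i by (simp add: if_distrib[of "\<lambda>x. x * _"] cong: if_cong)
    finally show ?thesis .
  qed
  have \<phi>_b: "\<phi> (K * b d \<rho> i) = (\<Sum>j<m. \<epsilon> j * K $$ (j, i))"
    if \<rho>: "fd_module n A d \<rho>" and K: "K \<in> carrier_mat m d" and i: "i < d" for d \<rho> K i
  proof -
    have "\<phi> (K * b d \<rho> i) = (\<Sum>j<m. \<Sum>k<m. \<Sum>q<d. (\<epsilon> j * K $$ (j, q)) * (\<rho> (B k) $$ (q, i) * \<epsilon> k))"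
      unfolding \<phi>_def
    proof (intro sum.cong refl)
      fix j k assume jk: "j \<in> {..<m}" "k \<in> {..<m}"
      have "(K * b d \<rho> i) $$ (j, k) = (\<Sum>q<d. K $$ (j, q) * \<rho> (B k) $$ (q, i))"
        using jk by (subst index_mult_mat_sum[OF K dims(3)]) (auto simp: b_def)
      then show "\<epsilon> j * (K * b d \<rho> i) $$ (j, k) * \<epsilon> k = (\<Sum>q<d. (\<epsilon> j * K $$ (j, q)) * (\<rho> (B k) $$ (q, i) * \<epsilon> k))"
        by (simp add: sum_distrib_left sum_distrib_right algebra_simps)
    qed
    also have "\<dots> = (\<Sum>j<m. \<Sum>q<d. \<Sum>k<m. (\<epsilon> j * K $$ (j, q)) * (\<rho> (B k) $$ (q, i) * \<epsilon> k))"
      by (intro sum.cong refl sum.swap)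
    also have "\<dots> = (\<Sum>j<m. \<Sum>q<d. (\<epsilon> j * K $$ (j, q)) * (if q = i then 1 else 0))"
      using i by (intro sum.cong refl) (simp add: \<epsilon>_sum[OF \<rho> _ i] flip: sum_distrib_left)
    also have "\<dots> = (\<Sum>j<m. \<epsilon> j * K $$ (j, i))"
      using i by (simp add: if_distrib cong: if_cong)
    finally show ?thesis .
  qed
  have \<epsilon>_l: "(\<Sum>i<m. l (B k) $$ (j, i) * \<epsilon> i) = (if j = k then 1 else 0)"
    "(\<Sum>i<m. \<epsilon> i * l' (B k) $$ (i, j)) = (if j = k then 1 else 0)" if jk: "j < m" "k < m" for j k
  proof -
    have 1: "comb n (B k * 1\<^sub>m n) m \<epsilon> (\<lambda>i. B k * B i)" "comb n (1\<^sub>m n * B k) m \<epsilon> (\<lambda>i. B i * B k)"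
      unfolding \<epsilon>_def using jk by (intro comb_mult car B one \<kappa>[OF one]; simp)+
    have "\<kappa> j (B k * 1\<^sub>m n) = (\<Sum>i<m. \<epsilon> i * \<kappa> j (B k * B i))"
      using jk B one mult by (intro \<kappa>_comb 1) auto
    then show "(\<Sum>i<m. l (B k) $$ (j, i) * \<epsilon> i) = (if j = k then 1 else 0)"
      using jk car[OF B[OF jk(2)]] by (simp add: l_def \<kappa>_B mult.commute)
    have "\<kappa> j (1\<^sub>m n * B k) = (\<Sum>i<m. \<epsilon> i * \<kappa> j (B i * B k))"
      using jk B one mult by (intro \<kappa>_comb 1) auto
    then show "(\<Sum>i<m. \<epsilon> i * l' (B k) $$ (i, j)) = (if j = k then 1 else 0)"
      using jk car[OF B[OF jk(2)]] by (simp add: l'_def \<kappa>_B)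
  qed
  have F: "\<phi> (c d' \<rho>' i * (F * b d \<rho> j)) = F $$ (i, j)"
    if \<rho>: "fd_module n A d \<rho>" "fd_module n A d' \<rho>'" and F: "F \<in> fd_module_hom A d \<rho> d' \<rho>'"
      and ij: "i < d'" "j < d" for d \<rho> d' \<rho>' F i j
  proof -
    have Fc: "F \<in> carrier_mat d' d" using F by (simp add: fd_module_hom_def)
    have "\<phi> (c d' \<rho>' i * (F * b d \<rho> j)) = (\<Sum>k<m. (F * b d \<rho> j) $$ (i, k) * \<epsilon> k)"
      using \<phi>_c[OF \<rho>(2) mult_carrier_mat[OF Fc dims(3)] ij(1)] .
    also have "\<dots> = (\<Sum>k<m. \<Sum>q<d. F $$ (i, q) * (\<rho> (B k) $$ (q, j) * \<epsilon> k))"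
    proof (intro sum.cong refl)
      fix k assume "k \<in> {..<m}"
      then have "(F * b d \<rho> j) $$ (i, k) = (\<Sum>q<d. F $$ (i, q) * \<rho> (B k) $$ (q, j))"
        using ij by (subst index_mult_mat_sum[OF Fc dims(3)]) (auto simp: b_def)
      then show "(F * b d \<rho> j) $$ (i, k) * \<epsilon> k = (\<Sum>q<d. F $$ (i, q) * (\<rho> (B k) $$ (q, j) * \<epsilon> k))"
        by (simp add: sum_distrib_right sum_distrib_left algebra_simps)
    qed
    also have "\<dots> = (\<Sum>q<d. \<Sum>k<m. F $$ (i, q) * (\<rho> (B k) $$ (q, j) * \<epsilon> k))" by (rule sum.swap)
    also have "\<dots> = (\<Sum>q<d. F $$ (i, q) * (if q = j then 1 else 0))"
      using ij by (intro sum.cong refl) (simp add: \<epsilon>_sum[OF \<rho>(1) _ ij(2)] flip: sum_distrib_left)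
    also have "\<dots> = F $$ (i, j)" using ij by (simp add: if_distrib cong: if_cong)
    finally show ?thesis .
  qed
  \<comment> \<open>\<open>H\<close> is determined by the image y of the unit: it sends an algebra
    element to its action on y, and so does the combination of the \<open>b d \<rho> i\<close> with
    the coordinates of y.\<close>
  have expH: "H $$ (p, k) = (\<Sum>i<d. \<phi> (c d \<rho> i * H) * b d \<rho> i $$ (p, k))"
    if \<rho>: "fd_module n A d \<rho>" and H: "H \<in> fd_module_hom A m l d \<rho>" and pk: "p < d" "k < m" for d \<rho> H p k
  proof -
    have Hc: "H \<in> carrier_mat d m" and eq: "H * l (B k) = \<rho> (B k) * H"
      using H B pk by (auto simp: fd_module_hom_def)
    have rc: "\<rho> (B k) \<in> carrier_mat d d" using \<rho> B pk by (auto simp: fd_module_def)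
    have "(\<Sum>i<d. \<phi> (c d \<rho> i * H) * b d \<rho> i $$ (p, k))
        = (\<Sum>i<d. \<Sum>u<m. \<rho> (B k) $$ (p, i) * H $$ (i, u) * \<epsilon> u)"
      using pk by (intro sum.cong refl) (simp add: \<phi>_c[OF \<rho> Hc] b_def sum_distrib_left sum_distrib_right algebra_simps)
    also have "\<dots> = (\<Sum>u<m. \<Sum>i<d. \<rho> (B k) $$ (p, i) * H $$ (i, u) * \<epsilon> u)" by (rule sum.swap)
    also have "\<dots> = (\<Sum>u<m. (\<rho> (B k) * H) $$ (p, u) * \<epsilon> u)"
      using pk by (intro sum.cong refl) (simp add: index_mult_mat_sum[OF rc Hc] sum_distrib_right)
    also have "\<dots> = (\<Sum>u<m. \<Sum>j<m. H $$ (p, j) * (l (B k) $$ (j, u) * \<epsilon> u))"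
      unfolding eq[symmetric] using pk
      by (intro sum.cong refl) (simp add: index_mult_mat_sum[OF Hc dims(1)] sum_distrib_left sum_distrib_right algebra_simps)
    also have "\<dots> = (\<Sum>j<m. \<Sum>u<m. H $$ (p, j) * (l (B k) $$ (j, u) * \<epsilon> u))" by (rule sum.swap)
    also have "\<dots> = (\<Sum>j<m. H $$ (p, j) * (if j = k then 1 else 0))"
      using pk by (intro sum.cong refl) (simp add: \<epsilon>_l(1) flip: sum_distrib_left)
    also have "\<dots> = H $$ (p, k)" using pk by (simp add: if_distrib cong: if_cong)
    finally show ?thesis ..
  qed
  \<comment> \<open>Dually, the value of the functional K(y) at \<open>B k\<close> is the value of
    K(\<rho>(B k) y) at the unit.\<close>
  have expK: "K $$ (k, p) = (\<Sum>i<d. \<phi> (K * b d \<rho> i) * c d \<rho> i $$ (k, p))"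
    if \<rho>: "fd_module n A d \<rho>" and K: "K \<in> fd_module_hom A d \<rho> m l'" and pk: "p < d" "k < m" for d \<rho> K p k
  proof -
    have Kc: "K \<in> carrier_mat m d" and eq: "K * \<rho> (B k) = l' (B k) * K"
      using K B pk by (auto simp: fd_module_hom_def)
    have rc: "\<rho> (B k) \<in> carrier_mat d d" using \<rho> B pk by (auto simp: fd_module_def)
    have "(\<Sum>i<d. \<phi> (K * b d \<rho> i) * c d \<rho> i $$ (k, p))
        = (\<Sum>i<d. \<Sum>u<m. \<epsilon> u * (K $$ (u, i) * \<rho> (B k) $$ (i, p)))"
      using pk by (intro sum.cong refl) (simp add: \<phi>_b[OF \<rho> Kc] c_def sum_distrib_left sum_distrib_right algebra_simps)
    also have "\<dots> = (\<Sum>u<m. \<Sum>i<d. \<epsilon> u * (K $$ (u, i) * \<rho> (B k) $$ (i, p)))" by (rule sum.swap)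
    also have "\<dots> = (\<Sum>u<m. \<epsilon> u * (K * \<rho> (B k)) $$ (u, p))"
      using pk by (intro sum.cong refl) (simp add: index_mult_mat_sum[OF Kc rc] sum_distrib_left)
    also have "\<dots> = (\<Sum>u<m. \<Sum>j<m. (\<epsilon> u * l' (B k) $$ (u, j)) * K $$ (j, p))"
      unfolding eq using pk
      by (intro sum.cong refl) (simp add: index_mult_mat_sum[OF dims(2) Kc] sum_distrib_left algebra_simps)
    also have "\<dots> = (\<Sum>j<m. \<Sum>u<m. (\<epsilon> u * l' (B k) $$ (u, j)) * K $$ (j, p))" by (rule sum.swap)
    also have "\<dots> = (\<Sum>j<m. (if j = k then 1 else 0) * K $$ (j, p))"
      using pk by (intro sum.cong refl) (simp add: \<epsilon>_l(2) flip: sum_distrib_right)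
    also have "\<dots> = K $$ (k, p)" using pk by (simp add: if_distrib[of "\<lambda>x. x * _"] cong: if_cong)
    finally show ?thesis ..
  qed
  show ?thesis by (rule that[OF mod \<phi>_add \<phi>_scale b_hom c_hom F expH expK])
qed

section \<open>Finite linear categories\<close>

lemma fd_module_hom_mult:
  assumes "fd_module n A d1 r1" "fd_module n A d2 r2" "fd_module n A d3 r3"
    and S: "S \<in> fd_module_hom A d2 r2 d3 r3" and T: "T \<in> fd_module_hom A d1 r1 d2 r2"
  shows "S * T \<in> fd_module_hom A d1 r1 d3 r3"
proof -
  have c: "S \<in> carrier_mat d3 d2" "T \<in> carrier_mat d2 d1" using S T by (auto simp: fd_module_hom_def)
  have "S * T * r1 a = r3 a * (S * T)" if a: "a \<in> A" for a
  proof -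
    have r: "r1 a \<in> carrier_mat d1 d1" "r2 a \<in> carrier_mat d2 d2" "r3 a \<in> carrier_mat d3 d3"
      using assms a by (auto simp: fd_module_def)
    have "S * T * r1 a = S * (T * r1 a)" by (rule assoc_mult_mat[OF c r(1)])
    also have "T * r1 a = r2 a * T" using T a by (simp add: fd_module_hom_def)
    also have "S * (r2 a * T) = S * r2 a * T" by (rule assoc_mult_mat[OF c(1) r(2) c(2), symmetric])
    also have "S * r2 a = r3 a * S" using S a by (simp add: fd_module_hom_def)
    also have "r3 a * S * T = r3 a * (S * T)" by (rule assoc_mult_mat[OF r(3) c])
    finally show ?thesis .
  qed
  then show ?thesis using c by (auto simp: fd_module_hom_def)
qed

section \<open>The category as modules over a matrix algebra\<close>

locale finite_model = linear_category C
  for C :: "('k::{alg_closed_field, field_char_0}, 'o, 'm::ab_group_add, 'x) linear_category_data_scheme"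
    (structure) +
  fixes N :: nat and A :: "'k mat set" and d :: "'o \<Rightarrow> nat" and \<rho> :: "'o \<Rightarrow> 'k mat \<Rightarrow> 'k mat"
    and \<Phi> :: "'o \<Rightarrow> 'o \<Rightarrow> 'm \<Rightarrow> 'k mat"
  assumes A: "matrix_algebra N A"
    and modules: "fd_module N A (d X) (\<rho> X)"
    and \<Phi>_bij: "bij_betw (\<Phi> X Y) (Hom C X Y) (fd_module_hom A (d X) (\<rho> X) (d Y) (\<rho> Y))"
    and \<Phi>_add: "f \<in> Hom C X Y \<Longrightarrow> g \<in> Hom C X Y \<Longrightarrow> \<Phi> X Y (f + g) = \<Phi> X Y f + \<Phi> X Y g"
    and \<Phi>_scl: "f \<in> Hom C X Y \<Longrightarrow> \<Phi> X Y (scl C x f) = x \<cdot>\<^sub>m \<Phi> X Y f"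
    and \<Phi>_ide: "\<Phi> X X (ide C X) = 1\<^sub>m (d X)"
    and \<Phi>_cmp: "g \<in> Hom C Y Z \<Longrightarrow> f \<in> Hom C X Y \<Longrightarrow> \<Phi> X Z (g \<cdot> f) = \<Phi> Y Z g * \<Phi> X Y f"
    and \<Phi>_ess: "fd_module N A e \<sigma> \<Longrightarrow> \<exists>X. fd_module_iso A e \<sigma> (d X) (\<rho> X)"
begin

lemma \<Phi>_hom: "f \<in> Hom C X Y \<Longrightarrow> \<Phi> X Y f \<in> fd_module_hom A (d X) (\<rho> X) (d Y) (\<rho> Y)"
  using \<Phi>_bij by (auto simp: bij_betw_def)

lemma \<Phi>_car: "f \<in> Hom C X Y \<Longrightarrow> \<Phi> X Y f \<in> carrier_mat (d Y) (d X)"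
  using \<Phi>_hom by (auto simp: fd_module_hom_def)

lemma \<Phi>_inj: "f \<in> Hom C X Y \<Longrightarrow> g \<in> Hom C X Y \<Longrightarrow> \<Phi> X Y f = \<Phi> X Y g \<Longrightarrow> f = g"
  using \<Phi>_bij[of X Y] by (auto simp: bij_betw_def inj_on_def)

lemma \<Phi>_lift:
  assumes "T \<in> fd_module_hom A (d X) (\<rho> X) (d Y) (\<rho> Y)"
  shows "\<exists>f\<in>Hom C X Y. \<Phi> X Y f = T"
proof -
  have "T \<in> \<Phi> X Y ` Hom C X Y" using assms \<Phi>_bij[of X Y] by (simp add: bij_betw_def)
  then show ?thesis by blast
qed

lemma \<Phi>_zero: "\<Phi> X Y 0 = 0\<^sub>m (d Y) (d X)"
proof -
  have "\<Phi> X Y (scl C 0 0) = 0 \<cdot>\<^sub>m \<Phi> X Y 0" by (rule \<Phi>_scl) simp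
  then have "\<Phi> X Y 0 = 0 \<cdot>\<^sub>m \<Phi> X Y 0" by simp
  also have "\<dots> = 0\<^sub>m (d Y) (d X)"
    using \<Phi>_car[of 0 X Y] by (intro eq_matI) auto
  finally show ?thesis .
qed

lemma \<Phi>_sum_index:
  assumes "\<And>i. i \<in> I \<Longrightarrow> f i \<in> Hom C X Y" "p < d Y" "q < d X"
  shows "\<Phi> X Y (\<Sum>i\<in>I. scl C (x i) (f i)) $$ (p, q) = (\<Sum>i\<in>I. x i * \<Phi> X Y (f i) $$ (p, q))"
  using assms(1)
proof (induction I rule: infinite_finite_induct)
  case (insert j I)
  have h: "scl C (x j) (f j) \<in> Hom C X Y" "(\<Sum>i\<in>I. scl C (x i) (f i)) \<in> Hom C X Y"
    using insert.prems by (auto intro!: Hom_scl Hom_sum)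
  have fj: "f j \<in> Hom C X Y" using insert.prems by simp
  show ?case
    using insert assms(2,3) \<Phi>_car[OF h(1)] \<Phi>_car[OF h(2)] \<Phi>_car[OF fj]
    by (simp add: \<Phi>_add[OF h] \<Phi>_scl[OF fj])
qed (use assms in \<open>simp_all add: \<Phi>_zero\<close>)

text \<open>Essential surjectivity realises the regular module and its dual as objects
  \<open>G\<close> and \<open>J\<close>. Fullness provides \<open>b\<close> and \<open>c\<close>,
  the isomorphisms \<open>T\<close> and \<open>S'\<close> transport \<phi>, and faithfulness reduces
  the two expansions to matrix entries.\<close>

lemma coordinates:
  obtains G J b c \<phi> where "functional_on (Hom C G J) \<phi>"
    "\<And>Y i. i < d Y \<Longrightarrow> b Y i \<in> Hom C G Y" "\<And>Y i. i < d Y \<Longrightarrow> c Y i \<in> Hom C Y J"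
    "\<And>X Y f i j. f \<in> Hom C X Y \<Longrightarrow> i < d Y \<Longrightarrow> j < d X \<Longrightarrow> \<phi> (c Y i \<cdot> (f \<cdot> b X j)) = \<Phi> X Y f $$ (i, j)"
    "\<And>Y h. h \<in> Hom C G Y \<Longrightarrow> h = (\<Sum>i<d Y. scl C (\<phi> (c Y i \<cdot> h)) (b Y i))"
    "\<And>Y h. h \<in> Hom C Y J \<Longrightarrow> h = (\<Sum>i<d Y. scl C (\<phi> (h \<cdot> b Y i)) (c Y i))"
proof -
  obtain m l l' \<phi>0 b0 c0 where l: "fd_module N A m l" and l': "fd_module N A m l'"
    and \<phi>0_add: "\<And>S T. S \<in> carrier_mat m m \<Longrightarrow> T \<in> carrier_mat m m \<Longrightarrow> \<phi>0 (S + T) = \<phi>0 S + \<phi>0 T"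
    and \<phi>0_scale: "\<And>x T. T \<in> carrier_mat m m \<Longrightarrow> \<phi>0 (x \<cdot>\<^sub>m T) = x * \<phi>0 T"
    and b0: "\<And>d \<rho> i. fd_module N A d \<rho> \<Longrightarrow> i < d \<Longrightarrow> b0 d \<rho> i \<in> fd_module_hom A m l d \<rho>"
    and c0: "\<And>d \<rho> i. fd_module N A d \<rho> \<Longrightarrow> i < d \<Longrightarrow> c0 d \<rho> i \<in> fd_module_hom A d \<rho> m l'"
    and coord: "\<And>d \<rho> d' \<rho>' F i j. fd_module N A d \<rho> \<Longrightarrow> fd_module N A d' \<rho>' \<Longrightarrow>
       F \<in> fd_module_hom A d \<rho> d' \<rho>' \<Longrightarrow> i < d' \<Longrightarrow> j < d \<Longrightarrow> \<phi>0 (c0 d' \<rho>' i * (F * b0 d \<rho> j)) = F $$ (i, j)"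
    and expH: "\<And>d \<rho> H p k. fd_module N A d \<rho> \<Longrightarrow> H \<in> fd_module_hom A m l d \<rho> \<Longrightarrow> p < d \<Longrightarrow> k < m \<Longrightarrow>
       H $$ (p, k) = (\<Sum>i<d. \<phi>0 (c0 d \<rho> i * H) * b0 d \<rho> i $$ (p, k))"
    and expK: "\<And>d \<rho> K p k. fd_module N A d \<rho> \<Longrightarrow> K \<in> fd_module_hom A d \<rho> m l' \<Longrightarrow> p < d \<Longrightarrow> k < m \<Longrightarrow>
       K $$ (k, p) = (\<Sum>i<d. \<phi>0 (K * b0 d \<rho> i) * c0 d \<rho> i $$ (k, p))"
    apply (rule regular_modules[OF A])
    subgoal premises p for m l l' \<phi> b c by (rule p(1)[OF p(2-10)])
    done
  obtain G S T where S: "S \<in> fd_module_hom A (d G) (\<rho> G) m l" and T: "T \<in> fd_module_hom A m l (d G) (\<rho> G)"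
    and ST: "S * T = 1\<^sub>m m" "T * S = 1\<^sub>m (d G)"
    using \<Phi>_ess[OF l] unfolding fd_module_iso_def by blast
  obtain J S' T' where S': "S' \<in> fd_module_hom A (d J) (\<rho> J) m l'" and T': "T' \<in> fd_module_hom A m l' (d J) (\<rho> J)"
    and ST': "S' * T' = 1\<^sub>m m" "T' * S' = 1\<^sub>m (d J)"
    using \<Phi>_ess[OF l'] unfolding fd_module_iso_def by blast
  have Sc: "S \<in> carrier_mat m (d G)" "T \<in> carrier_mat (d G) m" "S' \<in> carrier_mat m (d J)" "T' \<in> carrier_mat (d J) m"
    using S T S' T' by (simp_all add: fd_module_hom_def)
  have b0c: "b0 (d Y) (\<rho> Y) i \<in> carrier_mat (d Y) m" and c0c: "c0 (d Y) (\<rho> Y) i \<in> carrier_mat m (d Y)"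
    if "i < d Y" for Y i
    using b0[OF modules that] c0[OF modules that] by (simp_all add: fd_module_hom_def)
  have "\<exists>f\<in>Hom C G Y. \<Phi> G Y f = b0 (d Y) (\<rho> Y) i * S" if "i < d Y" for Y i
    by (rule \<Phi>_lift[OF fd_module_hom_mult[OF modules l modules b0[OF modules that] S]])
  note ex_b = this
  define b where "b Y i = (SOME f. f \<in> Hom C G Y \<and> \<Phi> G Y f = b0 (d Y) (\<rho> Y) i * S)" for Y i
  have "b Y i \<in> Hom C G Y \<and> \<Phi> G Y (b Y i) = b0 (d Y) (\<rho> Y) i * S" if "i < d Y" for Y i
    unfolding b_def by (rule someI_ex) (use ex_b[OF that] in blast)
  then have b: "\<And>Y i. i < d Y \<Longrightarrow> b Y i \<in> Hom C G Y"
    and \<Phi>b: "\<And>Y i. i < d Y \<Longrightarrow> \<Phi> G Y (b Y i) = b0 (d Y) (\<rho> Y) i * S" by auto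
  have "\<exists>f\<in>Hom C Y J. \<Phi> Y J f = T' * c0 (d Y) (\<rho> Y) i" if "i < d Y" for Y i
    by (rule \<Phi>_lift[OF fd_module_hom_mult[OF modules l' modules T' c0[OF modules that]]])
  note ex_c = this
  define c where "c Y i = (SOME f. f \<in> Hom C Y J \<and> \<Phi> Y J f = T' * c0 (d Y) (\<rho> Y) i)" for Y i
  have "c Y i \<in> Hom C Y J \<and> \<Phi> Y J (c Y i) = T' * c0 (d Y) (\<rho> Y) i" if "i < d Y" for Y i
    unfolding c_def by (rule someI_ex) (use ex_c[OF that] in blast)
  then have c: "\<And>Y i. i < d Y \<Longrightarrow> c Y i \<in> Hom C Y J"
    and \<Phi>c: "\<And>Y i. i < d Y \<Longrightarrow> \<Phi> Y J (c Y i) = T' * c0 (d Y) (\<rho> Y) i" by auto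
  define \<phi> where "\<phi> f = \<phi>0 (S' * \<Phi> G J f * T)" for f
  have car: "S' * F * T \<in> carrier_mat m m" if "F \<in> carrier_mat (d J) (d G)" for F
    using Sc that by auto
  have lin: "functional_on (Hom C G J) \<phi>"
    unfolding functional_on_def
  proof (intro conjI ballI allI)
    fix f g x assume f: "f \<in> Hom C G J"
    note Ff = \<Phi>_car[OF f]
    have "S' * (x \<cdot>\<^sub>m \<Phi> G J f) * T = x \<cdot>\<^sub>m (S' * \<Phi> G J f * T)"
      using Sc Ff by (simp add: mult_smult_distrib[OF Sc(3) Ff]
          mult_smult_assoc_mat[OF mult_carrier_mat[OF Sc(3) Ff] Sc(2)])
    then show "\<phi> (scl C x f) = x * \<phi> f" using f by (simp add: \<phi>_def \<Phi>_scl \<phi>0_scale car[OF Ff])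
    assume g: "g \<in> Hom C G J"
    note Fg = \<Phi>_car[OF g]
    have "S' * (\<Phi> G J f + \<Phi> G J g) * T = S' * \<Phi> G J f * T + S' * \<Phi> G J g * T"
      by (simp add: mult_add_distrib_mat[OF Sc(3) Ff Fg] add_mult_distrib_mat[OF mult_carrier_mat[OF Sc(3) Ff]
            mult_carrier_mat[OF Sc(3) Fg] Sc(2)])
    then show "\<phi> (f + g) = \<phi> f + \<phi> g" using f g by (simp add: \<phi>_def \<Phi>_add \<phi>0_add car[OF Ff] car[OF Fg])
  qed
  have \<phi>_c: "\<phi> (c Y i \<cdot> h) = \<phi>0 (c0 (d Y) (\<rho> Y) i * (\<Phi> G Y h * T))"
    if h: "h \<in> Hom C G Y" and i: "i < d Y" for Y h i
  proof -
    let ?c = "c0 (d Y) (\<rho> Y) i" and ?h = "\<Phi> G Y h"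
    have hc: "?h \<in> carrier_mat (d Y) (d G)" by (rule \<Phi>_car[OF h])
    have "S' * (T' * ?c * ?h) * T = S' * (T' * (?c * ?h)) * T"
      using assoc_mult_mat[OF Sc(4) c0c[OF i] hc] by simp
    also have "\<dots> = (S' * T') * (?c * ?h) * T"
      using assoc_mult_mat[OF Sc(3,4) mult_carrier_mat[OF c0c[OF i] hc]] by simp
    also have "\<dots> = ?c * ?h * T" unfolding ST'(1) left_mult_one_mat[OF mult_carrier_mat[OF c0c[OF i] hc]] by (rule refl)
    also have "\<dots> = ?c * (?h * T)" by (rule assoc_mult_mat[OF c0c[OF i] hc Sc(2)])
    finally show ?thesis using c[OF i] h i by (simp add: \<phi>_def \<Phi>_cmp \<Phi>c)
  qed
  have \<phi>_b: "\<phi> (h \<cdot> b Y i) = \<phi>0 (S' * \<Phi> Y J h * b0 (d Y) (\<rho> Y) i)"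
    if h: "h \<in> Hom C Y J" and i: "i < d Y" for Y h i
  proof -
    let ?b = "b0 (d Y) (\<rho> Y) i" and ?h = "\<Phi> Y J h"
    have hc: "?h \<in> carrier_mat (d J) (d Y)" by (rule \<Phi>_car[OF h])
    have "S' * (?h * (?b * S)) * T = S' * (?h * ?b * S) * T"
      using assoc_mult_mat[OF hc b0c[OF i] Sc(1)] by simp
    also have "\<dots> = S' * (?h * ?b * S * T)"
      by (rule assoc_mult_mat[OF Sc(3) _ Sc(2)]) (use hc b0c[OF i] Sc in auto)
    also have "?h * ?b * S * T = ?h * ?b * (S * T)"
      by (rule assoc_mult_mat[OF mult_carrier_mat[OF hc b0c[OF i]] Sc(1,2)])
    also have "\<dots> = ?h * ?b" unfolding ST(1) by (rule right_mult_one_mat[OF mult_carrier_mat[OF hc b0c[OF i]]])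
    also have "S' * (?h * ?b) = S' * ?h * ?b" by (rule assoc_mult_mat[OF Sc(3) hc b0c[OF i], symmetric])
    finally show ?thesis using b[OF i] h i by (simp add: \<phi>_def \<Phi>_cmp \<Phi>b)
  qed
  have coord': "\<phi> (c Y i \<cdot> (f \<cdot> b X j)) = \<Phi> X Y f $$ (i, j)"
    if f: "f \<in> Hom C X Y" and ij: "i < d Y" "j < d X" for X Y f i j
  proof -
    let ?b = "b0 (d X) (\<rho> X) j" and ?f = "\<Phi> X Y f"
    note fc = \<Phi>_car[OF f]
    have "\<Phi> G Y (f \<cdot> b X j) * T = ?f * (?b * S) * T" using f b[OF ij(2)] ij by (simp add: \<Phi>_cmp \<Phi>b)
    also have "?f * (?b * S) = ?f * ?b * S" by (rule assoc_mult_mat[OF fc b0c[OF ij(2)] Sc(1), symmetric])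
    also have "?f * ?b * S * T = ?f * ?b * (S * T)"
      by (rule assoc_mult_mat[OF mult_carrier_mat[OF fc b0c[OF ij(2)]] Sc(1,2)])
    also have "\<dots> = ?f * ?b" unfolding ST(1) by (rule right_mult_one_mat[OF mult_carrier_mat[OF fc b0c[OF ij(2)]]])
    finally show ?thesis
      using \<phi>_c[OF cmp_in_Hom[OF f b[OF ij(2)]] ij(1)] coord[OF modules modules \<Phi>_hom[OF f] ij] by simp
  qed
  have exp_b: "h = (\<Sum>i<d Y. scl C (\<phi> (c Y i \<cdot> h)) (b Y i))" if h: "h \<in> Hom C G Y" for Y h
  proof (rule \<Phi>_inj[OF h])
    let ?s = "\<Sum>i<d Y. scl C (\<phi> (c Y i \<cdot> h)) (b Y i)" and ?h = "\<Phi> G Y h"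
    let ?H = "?h * T"
    have hc: "?h \<in> carrier_mat (d Y) (d G)" by (rule \<Phi>_car[OF h])
    have Hc: "?H \<in> carrier_mat (d Y) m" using hc Sc by auto
    show s: "?s \<in> Hom C G Y" by (intro Hom_sum Hom_scl b) simp
    show "?h = \<Phi> G Y ?s"
    proof (rule eq_matI)
      fix p q assume "p < dim_row (\<Phi> G Y ?s)" "q < dim_col (\<Phi> G Y ?s)"
      then have pq: "p < d Y" "q < d G" using \<Phi>_car[OF s] by auto
      have "?H * S = ?h * (T * S)" by (rule assoc_mult_mat[OF hc Sc(2,1)])
      then have "?h $$ (p, q) = (?H * S) $$ (p, q)" unfolding ST(2) right_mult_one_mat[OF hc] by simp
      also have "\<dots> = (\<Sum>k<m. ?H $$ (p, k) * S $$ (k, q))" by (rule index_mult_mat_sum[OF Hc Sc(1) pq])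
      also have "\<dots> = (\<Sum>k<m. \<Sum>i<d Y. \<phi> (c Y i \<cdot> h) * b0 (d Y) (\<rho> Y) i $$ (p, k) * S $$ (k, q))"
      proof (intro sum.cong refl)
        fix k assume "k \<in> {..<m}"
        then have "?H $$ (p, k) = (\<Sum>i<d Y. \<phi>0 (c0 (d Y) (\<rho> Y) i * ?H) * b0 (d Y) (\<rho> Y) i $$ (p, k))"
          using pq by (intro expH modules fd_module_hom_mult[OF l modules modules \<Phi>_hom[OF h] T]) auto
        also have "\<dots> = (\<Sum>i<d Y. \<phi> (c Y i \<cdot> h) * b0 (d Y) (\<rho> Y) i $$ (p, k))"
          by (intro sum.cong refl) (simp add: \<phi>_c[OF h])
        finally show "?H $$ (p, k) * S $$ (k, q) =
            (\<Sum>i<d Y. \<phi> (c Y i \<cdot> h) * b0 (d Y) (\<rho> Y) i $$ (p, k) * S $$ (k, q))"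
          by (simp add: sum_distrib_right)
      qed
      also have "\<dots> = (\<Sum>i<d Y. \<Sum>k<m. \<phi> (c Y i \<cdot> h) * b0 (d Y) (\<rho> Y) i $$ (p, k) * S $$ (k, q))"
        by (rule sum.swap)
      also have "\<dots> = (\<Sum>i<d Y. \<phi> (c Y i \<cdot> h) * \<Phi> G Y (b Y i) $$ (p, q))"
        by (intro sum.cong refl)
          (simp add: \<Phi>b index_mult_mat_sum[OF b0c Sc(1) pq] sum_distrib_left mult.assoc)
      also have "\<dots> = \<Phi> G Y ?s $$ (p, q)"
        by (rule \<Phi>_sum_index[symmetric]) (use b pq in auto)
      finally show "?h $$ (p, q) = \<Phi> G Y ?s $$ (p, q)" .
    qed (use \<Phi>_car[OF s] hc in auto)
  qed
  have exp_c: "h = (\<Sum>i<d Y. scl C (\<phi> (h \<cdot> b Y i)) (c Y i))" if h: "h \<in> Hom C Y J" for Y h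
  proof (rule \<Phi>_inj[OF h])
    let ?s = "\<Sum>i<d Y. scl C (\<phi> (h \<cdot> b Y i)) (c Y i)" and ?h = "\<Phi> Y J h"
    let ?K = "S' * ?h"
    have hc: "?h \<in> carrier_mat (d J) (d Y)" by (rule \<Phi>_car[OF h])
    have Kc: "?K \<in> carrier_mat m (d Y)" using hc Sc by auto
    show s: "?s \<in> Hom C Y J" by (intro Hom_sum Hom_scl c) simp
    show "?h = \<Phi> Y J ?s"
    proof (rule eq_matI)
      fix q p assume "q < dim_row (\<Phi> Y J ?s)" "p < dim_col (\<Phi> Y J ?s)"
      then have pq: "q < d J" "p < d Y" using \<Phi>_car[OF s] by auto
      have "T' * ?K = (T' * S') * ?h" by (rule assoc_mult_mat[OF Sc(4,3) hc, symmetric])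
      then have "?h $$ (q, p) = (T' * ?K) $$ (q, p)" unfolding ST'(2) left_mult_one_mat[OF hc] by simp
      also have "\<dots> = (\<Sum>k<m. T' $$ (q, k) * ?K $$ (k, p))" by (rule index_mult_mat_sum[OF Sc(4) Kc pq])
      also have "\<dots> = (\<Sum>k<m. \<Sum>i<d Y. \<phi> (h \<cdot> b Y i) * (T' $$ (q, k) * c0 (d Y) (\<rho> Y) i $$ (k, p)))"
      proof (intro sum.cong refl)
        fix k assume "k \<in> {..<m}"
        then have "?K $$ (k, p) = (\<Sum>i<d Y. \<phi>0 (?K * b0 (d Y) (\<rho> Y) i) * c0 (d Y) (\<rho> Y) i $$ (k, p))"
          using pq by (intro expK modules fd_module_hom_mult[OF modules modules l' S' \<Phi>_hom[OF h]]) auto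
        also have "\<dots> = (\<Sum>i<d Y. \<phi> (h \<cdot> b Y i) * c0 (d Y) (\<rho> Y) i $$ (k, p))"
          by (intro sum.cong refl) (simp add: \<phi>_b[OF h])
        finally show "T' $$ (q, k) * ?K $$ (k, p) =
            (\<Sum>i<d Y. \<phi> (h \<cdot> b Y i) * (T' $$ (q, k) * c0 (d Y) (\<rho> Y) i $$ (k, p)))"
          by (simp add: sum_distrib_left algebra_simps)
      qed
      also have "\<dots> = (\<Sum>i<d Y. \<Sum>k<m. \<phi> (h \<cdot> b Y i) * (T' $$ (q, k) * c0 (d Y) (\<rho> Y) i $$ (k, p)))"
        by (rule sum.swap)
      also have "\<dots> = (\<Sum>i<d Y. \<phi> (h \<cdot> b Y i) * \<Phi> Y J (c Y i) $$ (q, p))"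
        by (intro sum.cong refl)
          (simp add: \<Phi>c index_mult_mat_sum[OF Sc(4) c0c pq] sum_distrib_left)
      also have "\<dots> = \<Phi> Y J ?s $$ (q, p)"
        by (rule \<Phi>_sum_index[symmetric]) (use c pq in auto)
      finally show "?h $$ (q, p) = \<Phi> Y J ?s $$ (q, p)" .
    qed (use \<Phi>_car[OF s] hc in auto)
  qed
  show ?thesis by (rule that[OF lin b c coord' exp_b exp_c])
qed

text \<open>The rank factorisation is made on underlying spaces. The middle space receives the
  action \<open>M' * (\<rho> Y a * M)\<close>; the image of \<open>M\<close> is that of
  \<open>f\<close> and hence stable, so \<open>M\<close> and \<open>E\<close> become module maps.
  The linear one-sided inverses stay in the conclusion as certificates that \<open>e\<close> is epic
  and \<open>m\<close> is monic.\<close>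

lemma image_factorization:
  assumes f: "f \<in> Hom C X Y"
  obtains Z e m E' M' where "e \<in> Hom C X Z" "m \<in> Hom C Z Y" "f = m \<cdot> e"
    "E' \<in> carrier_mat (d X) (d Z)" "\<Phi> X Z e * E' = 1\<^sub>m (d Z)"
    "M' \<in> carrier_mat (d Z) (d Y)" "M' * \<Phi> Z Y m = 1\<^sub>m (d Z)"
proof -
  let ?T = "\<Phi> X Y f"
  have T: "?T \<in> carrier_mat (d Y) (d X)" by (rule \<Phi>_car[OF f])
  obtain r M M' E E' where M: "M \<in> carrier_mat (d Y) r" "M' \<in> carrier_mat r (d Y)" and E: "E \<in> carrier_mat r (d X)"
    "E' \<in> carrier_mat (d X) r" and T_eq: "?T = M * E" and inv: "M' * M = 1\<^sub>m r" "E * E' = 1\<^sub>m r"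
    by (rule rank_factorization[OF T])
  define \<sigma> where "\<sigma> a = M' * (\<rho> Y a * M)" for a
  have rc: "\<rho> Y a \<in> carrier_mat (d Y) (d Y)" "\<rho> X a \<in> carrier_mat (d X) (d X)" if "a \<in> A" for a
    using modules that by (auto simp: fd_module_def)
  have rT: "?T * \<rho> X a = \<rho> Y a * ?T" if "a \<in> A" for a
    using \<Phi>_hom[OF f] that by (simp add: fd_module_hom_def)
  have M_hom: "M * \<sigma> a = \<rho> Y a * M" if a: "a \<in> A" for a
  proof -
    note r = rc[OF a]
    have "\<rho> Y a * M = \<rho> Y a * (?T * E')"
      unfolding T_eq assoc_mult_mat[OF M(1) E] inv(2) using M by simp
    also have "\<dots> = (?T * \<rho> X a) * E'"
      unfolding rT[OF a] by (rule assoc_mult_mat[OF r(1) T E(2), symmetric])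
    also have "\<dots> = ?T * (\<rho> X a * E')" by (rule assoc_mult_mat[OF T r(2) E(2)])
    also have "\<dots> = M * (E * (\<rho> X a * E'))"
      unfolding T_eq by (rule assoc_mult_mat[OF M(1) E(1) mult_carrier_mat[OF r(2) E(2)]])
    finally have eq: "\<rho> Y a * M = M * (E * (\<rho> X a * E'))" .
    have c: "E * (\<rho> X a * E') \<in> carrier_mat r r" using E r by auto
    have "M * \<sigma> a = M * ((M' * M) * (E * (\<rho> X a * E')))"
      unfolding \<sigma>_def eq using assoc_mult_mat[OF M(2,1) c] by simp
    then show ?thesis unfolding inv(1) eq left_mult_one_mat[OF c] .
  qed
  have \<sigma>c: "\<sigma> a \<in> carrier_mat r r" if "a \<in> A" for a using rc[OF that] M by (auto simp: \<sigma>_def)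
  have \<sigma>: "fd_module N A r \<sigma>"
    unfolding fd_module_def
  proof (intro conjI ballI allI \<sigma>c)
    have "\<rho> Y (1\<^sub>m N) = 1\<^sub>m (d Y)" using modules by (simp add: fd_module_def)
    then show "\<sigma> (1\<^sub>m N) = 1\<^sub>m r" using M inv by (simp add: \<sigma>_def)
    fix a b x assume a: "a \<in> A"
    note ra = rc(1)[OF a]
    have "\<rho> Y (x \<cdot>\<^sub>m a) = x \<cdot>\<^sub>m \<rho> Y a" using modules a by (simp add: fd_module_def)
    then show "\<sigma> (x \<cdot>\<^sub>m a) = x \<cdot>\<^sub>m \<sigma> a"
      by (simp add: \<sigma>_def mult_smult_assoc_mat[OF ra M(1)] mult_smult_distrib[OF M(2) mult_carrier_mat[OF ra M(1)]])
    assume b: "b \<in> A"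
    note rb = rc(1)[OF b]
    have "\<rho> Y (a + b) = \<rho> Y a + \<rho> Y b" using modules a b by (simp add: fd_module_def)
    then show "\<sigma> (a + b) = \<sigma> a + \<sigma> b"
      by (simp add: \<sigma>_def add_mult_distrib_mat[OF ra rb M(1)]
          mult_add_distrib_mat[OF M(2) mult_carrier_mat[OF ra M(1)] mult_carrier_mat[OF rb M(1)]])
    have "\<sigma> a * \<sigma> b = M' * (\<rho> Y a * M * \<sigma> b)"
      unfolding \<sigma>_def[of a] by (rule assoc_mult_mat[OF M(2) mult_carrier_mat[OF ra M(1)] \<sigma>c[OF b]])
    also have "\<rho> Y a * M * \<sigma> b = \<rho> Y a * (M * \<sigma> b)" by (rule assoc_mult_mat[OF ra M(1) \<sigma>c[OF b]])
    also have "\<dots> = \<rho> Y a * \<rho> Y b * M"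
      unfolding M_hom[OF b] by (rule assoc_mult_mat[OF ra rb M(1), symmetric])
    also have "\<rho> Y a * \<rho> Y b = \<rho> Y (a * b)" using modules a b by (simp add: fd_module_def)
    finally show "\<sigma> (a * b) = \<sigma> a * \<sigma> b" by (simp add: \<sigma>_def)
  qed
  have Mh: "M \<in> fd_module_hom A r \<sigma> (d Y) (\<rho> Y)" using M M_hom by (auto simp: fd_module_hom_def)
  have "E * \<rho> X a = \<sigma> a * E" if a: "a \<in> A" for a
  proof -
    note r = rc[OF a]
    have "\<sigma> a * E = M' * (\<rho> Y a * M * E)"
      unfolding \<sigma>_def by (rule assoc_mult_mat[OF M(2) mult_carrier_mat[OF r(1) M(1)] E(1)])
    also have "\<rho> Y a * M * E = ?T * \<rho> X a"
      unfolding rT[OF a] unfolding T_eq by (rule assoc_mult_mat[OF r(1) M(1) E(1)])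
    also have "\<dots> = M * (E * \<rho> X a)" unfolding T_eq by (rule assoc_mult_mat[OF M(1) E(1) r(2)])
    also have "M' * \<dots> = (M' * M) * (E * \<rho> X a)"
      by (rule assoc_mult_mat[OF M(2,1) mult_carrier_mat[OF E(1) r(2)], symmetric])
    finally show ?thesis unfolding inv(1) left_mult_one_mat[OF mult_carrier_mat[OF E(1) r(2)]] by (rule sym)
  qed
  then have Eh: "E \<in> fd_module_hom A (d X) (\<rho> X) r \<sigma>" using E by (auto simp: fd_module_hom_def)
  obtain Z U V where U: "U \<in> fd_module_hom A r \<sigma> (d Z) (\<rho> Z)" and V: "V \<in> fd_module_hom A (d Z) (\<rho> Z) r \<sigma>"
    and VU: "V * U = 1\<^sub>m r" "U * V = 1\<^sub>m (d Z)"
    using \<Phi>_ess[OF \<sigma>] unfolding fd_module_iso_def by blast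
  have c: "U \<in> carrier_mat (d Z) r" "V \<in> carrier_mat r (d Z)" using U V by (simp_all add: fd_module_hom_def)
  obtain m where m: "m \<in> Hom C Z Y" "\<Phi> Z Y m = M * V"
    using \<Phi>_lift[OF fd_module_hom_mult[OF modules \<sigma> modules Mh V]] by blast
  obtain e where e: "e \<in> Hom C X Z" "\<Phi> X Z e = U * E"
    using \<Phi>_lift[OF fd_module_hom_mult[OF modules \<sigma> modules U Eh]] by blast
  have "(M * V) * (U * E) = M * (V * (U * E))" by (rule assoc_mult_mat[OF M(1) c(2) mult_carrier_mat[OF c(1) E(1)]])
  also have "V * (U * E) = (V * U) * E" by (rule assoc_mult_mat[OF c(2,1) E(1), symmetric])
  finally have "\<Phi> X Y f = \<Phi> X Y (m \<cdot> e)" using m e E by (simp add: \<Phi>_cmp T_eq VU(1))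
  then have "f = m \<cdot> e" by (rule \<Phi>_inj[OF f cmp_in_Hom[OF m(1) e(1)]])
  moreover have "(U * E) * (E' * V) = 1\<^sub>m (d Z)"
  proof -
    have "(U * E) * (E' * V) = U * (E * (E' * V))" by (rule assoc_mult_mat[OF c(1) E(1) mult_carrier_mat[OF E(2) c(2)]])
    also have "E * (E' * V) = (E * E') * V" by (rule assoc_mult_mat[OF E c(2), symmetric])
    finally show ?thesis using inv VU c by simp
  qed
  moreover have "(U * M') * (M * V) = 1\<^sub>m (d Z)"
  proof -
    have "(U * M') * (M * V) = U * (M' * (M * V))" by (rule assoc_mult_mat[OF c(1) M(2) mult_carrier_mat[OF M(1) c(2)]])
    also have "M' * (M * V) = (M' * M) * V" by (rule assoc_mult_mat[OF M(2,1) c(2), symmetric])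
    finally show ?thesis using inv VU c by simp
  qed
  ultimately show ?thesis
    using that[OF e(1) m(1), of "E' * V" "U * M'"] e m c E M by simp
qed

end

context linear_category
begin

section \<open>Cancellation, and powers of endomorphisms\<close>

definition is_epi :: "'o \<Rightarrow> 'o \<Rightarrow> 'm \<Rightarrow> bool" where
  "is_epi X Y e \<longleftrightarrow> e \<in> Hom C X Y \<and> (\<forall>Z. \<forall>g\<in>Hom C Y Z. \<forall>h\<in>Hom C Y Z. g \<cdot> e = h \<cdot> e \<longrightarrow> g = h)"

primrec pow :: "'o \<Rightarrow> 'm \<Rightarrow> nat \<Rightarrow> 'm" where
  "pow X f 0 = ide C X"
| "pow X f (Suc n) = f \<cdot> pow X f n"

lemma pow_in_Hom: "f \<in> Hom C X X \<Longrightarrow> pow X f n \<in> Hom C X X"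
  by (induction n) (auto intro: ide_in_Hom cmp_in_Hom)

lemma pow_natural:
  assumes "f \<in> Hom C X X" "f' \<in> Hom C Y Y" "g \<in> Hom C X Y" "f' \<cdot> g = g \<cdot> f"
  shows "pow Y f' n \<cdot> g = g \<cdot> pow X f n"
proof (induction n)
  case (Suc n)
  have "pow Y f' (Suc n) \<cdot> g = f' \<cdot> (g \<cdot> pow X f n)"
    using cmp_assoc[OF assms(2) pow_in_Hom[OF assms(2)] assms(3)] Suc by simp
  also have "\<dots> = (g \<cdot> f) \<cdot> pow X f n"
    using cmp_assoc[OF assms(2,3) pow_in_Hom[OF assms(1)]] assms(4) by simp
  finally show ?case using cmp_assoc[OF assms(3,1) pow_in_Hom[OF assms(1)]] by simp
qed (simp add: ide_left[OF assms(3)] ide_right[OF assms(3)])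

lemma is_mono_zero:
  assumes "is_mono X Y f" "g \<in> Hom C Z X" "f \<cdot> g = 0"
  shows "g = 0"
proof -
  have "f \<cdot> g = f \<cdot> 0" using assms cmp_zero(2) by (auto simp: is_mono_def)
  then show ?thesis using assms Hom_zero unfolding is_mono_def by blast
qed

lemma is_monoI:
  assumes "f \<in> Hom C X Y" "\<And>Z g. g \<in> Hom C Z X \<Longrightarrow> f \<cdot> g = 0 \<Longrightarrow> g = 0"
  shows "is_mono X Y f"
  unfolding is_mono_def
proof (intro conjI allI ballI impI)
  fix Z g h assume gh: "g \<in> Hom C Z X" "h \<in> Hom C Z X" "f \<cdot> g = f \<cdot> h"
  then have "f \<cdot> (g - h) = 0" using cmp_diff_right[OF assms(1) gh(1,2)] by simp
  then show "g = h" using assms(2)[OF Hom_diff[OF gh(1,2)]] by simp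
qed (rule assms)

lemma is_epi_zero:
  assumes "is_epi X Y e" "g \<in> Hom C Y Z" "g \<cdot> e = 0"
  shows "g = 0"
proof -
  have "g \<cdot> e = 0 \<cdot> e" using assms cmp_zero(1) by (auto simp: is_epi_def)
  then show ?thesis using assms Hom_zero unfolding is_epi_def by blast
qed

lemma is_epiI:
  assumes "e \<in> Hom C X Y" "\<And>Z g. g \<in> Hom C Y Z \<Longrightarrow> g \<cdot> e = 0 \<Longrightarrow> g = 0"
  shows "is_epi X Y e"
  unfolding is_epi_def
proof (intro conjI allI ballI impI)
  fix Z g h assume gh: "g \<in> Hom C Y Z" "h \<in> Hom C Y Z" "g \<cdot> e = h \<cdot> e"
  then have "(g - h) \<cdot> e = 0" using cmp_diff_left[OF assms(1) gh(1,2)] by simp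
  then show "g = h" using assms(2)[OF Hom_diff[OF gh(1,2)]] by simp
qed (rule assms)

end

text \<open>\<open>G\<close> and \<open>J\<close> represent the underlying vector space and its
  dual: the \<open>b Y i\<close> form a basis of \<open>Hom C G Y\<close>, the \<open>c Y i\<close>
  the dual basis in \<open>Hom C Y J\<close>, and \<open>coord\<close> identifies
  \<open>\<Phi> X Y f\<close> with the matrix of composition with \<open>f\<close>.\<close>

locale coordinate_model = finite_model C N A d \<rho> \<Phi>
  for C :: "('k::{alg_closed_field, field_char_0}, 'o, 'm::ab_group_add, 'x) linear_category_data_scheme"
    (structure) and N A d \<rho> \<Phi> +
  fixes G J :: 'o and b c :: "'o \<Rightarrow> nat \<Rightarrow> 'm" and \<phi> :: "'m \<Rightarrow> 'k"
  assumes \<phi>: "functional_on (Hom C G J) \<phi>"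
    and b: "i < d Y \<Longrightarrow> b Y i \<in> Hom C G Y" and c: "i < d Y \<Longrightarrow> c Y i \<in> Hom C Y J"
    and coord: "f \<in> Hom C X Y \<Longrightarrow> i < d Y \<Longrightarrow> j < d X \<Longrightarrow> \<phi> (c Y i \<cdot> (f \<cdot> b X j)) = \<Phi> X Y f $$ (i, j)"
    and exp_b: "h \<in> Hom C G Y \<Longrightarrow> h = (\<Sum>i<d Y. scl C (\<phi> (c Y i \<cdot> h)) (b Y i))"
    and exp_c: "h \<in> Hom C Y J \<Longrightarrow> h = (\<Sum>i<d Y. scl C (\<phi> (h \<cdot> b Y i)) (c Y i))"
begin

lemma functional_left:
  "g \<in> Hom C Y J \<Longrightarrow> functional_on (Hom C G Y) (\<lambda>h. \<phi> (g \<cdot> h))"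
  by (rule functional_on_comp[OF linear_on_cmp(2) cmp_in_Hom \<phi>])

lemma functional_right:
  "h \<in> Hom C G Y \<Longrightarrow> functional_on (Hom C Y J) (\<lambda>g. \<phi> (g \<cdot> h))"
  by (rule functional_on_comp[OF linear_on_cmp(1) _ \<phi>]) (auto intro: cmp_in_Hom)

lemma coord_cb: "i < d Y \<Longrightarrow> j < d Y \<Longrightarrow> \<phi> (c Y i \<cdot> b Y j) = (if i = j then 1 else 0)"
  using coord[OF ide_in_Hom, of i Y j] by (simp add: ide_left[OF b] \<Phi>_ide)

lemma coord_comb:
  assumes "i < d Y"
  shows "\<phi> (c Y i \<cdot> (\<Sum>j<d Y. scl C (x j) (b Y j))) = x i"
    "\<phi> ((\<Sum>j<d Y. scl C (x j) (c Y j)) \<cdot> b Y i) = x i"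
proof -
  show "\<phi> (c Y i \<cdot> (\<Sum>j<d Y. scl C (x j) (b Y j))) = x i"
    using assms by (subst functional_on_sum[OF functional_left[OF c]])
      (auto simp: b coord_cb if_distrib cong: if_cong)
  show "\<phi> ((\<Sum>j<d Y. scl C (x j) (c Y j)) \<cdot> b Y i) = x i"
    using assms by (subst functional_on_sum[OF functional_right[OF b]])
      (auto simp: c coord_cb if_distrib cong: if_cong)
qed

lemma comb_b_in_Hom: "(\<Sum>j<d Y. scl C (x j) (b Y j)) \<in> Hom C G Y"
  by (intro Hom_sum Hom_scl b) simp

lemma comb_c_in_Hom: "(\<Sum>j<d Y. scl C (x j) (c Y j)) \<in> Hom C Y J"
  by (intro Hom_sum Hom_scl c) simp

lemma coord_apply:
  assumes f: "f \<in> Hom C X Y" and h: "h \<in> Hom C G X" and p: "p < d Y"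
  shows "\<phi> (c Y p \<cdot> (f \<cdot> h)) = (\<Sum>j<d X. \<Phi> X Y f $$ (p, j) * \<phi> (c X j \<cdot> h))"
proof -
  have lin: "functional_on (Hom C G X) (\<lambda>h. \<phi> (c Y p \<cdot> (f \<cdot> h)))"
    by (rule functional_on_comp[OF linear_on_cmp(2)[OF f] cmp_in_Hom[OF f] functional_left[OF c[OF p]]])
  have "\<phi> (c Y p \<cdot> (f \<cdot> h)) = \<phi> (c Y p \<cdot> (f \<cdot> (\<Sum>j<d X. scl C (\<phi> (c X j \<cdot> h)) (b X j))))"
    using exp_b[OF h] by simp
  also have "\<dots> = (\<Sum>j<d X. \<phi> (c X j \<cdot> h) * \<phi> (c Y p \<cdot> (f \<cdot> b X j)))"
    by (rule functional_on_sum[OF lin]) (simp add: b)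
  finally show ?thesis by (simp add: coord[OF f p] mult.commute)
qed

lemma coord_apply':
  assumes f: "f \<in> Hom C X Y" and h: "h \<in> Hom C Y J" and j: "j < d X"
  shows "\<phi> ((h \<cdot> f) \<cdot> b X j) = (\<Sum>p<d Y. \<phi> (h \<cdot> b Y p) * \<Phi> X Y f $$ (p, j))"
proof -
  have "\<phi> ((h \<cdot> f) \<cdot> b X j) = \<phi> ((\<Sum>p<d Y. scl C (\<phi> (h \<cdot> b Y p)) (c Y p)) \<cdot> (f \<cdot> b X j))"
    using exp_c[OF h] cmp_assoc[OF h f b[OF j]] by simp
  also have "\<dots> = (\<Sum>p<d Y. \<phi> (h \<cdot> b Y p) * \<phi> (c Y p \<cdot> (f \<cdot> b X j)))"
    by (rule functional_on_sum[OF functional_right[OF cmp_in_Hom[OF f b[OF j]]]]) (simp add: c)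
  finally show ?thesis by (simp add: coord[OF f _ j])
qed

lemma coord_eqI:
  assumes "h \<in> Hom C G Y" "h' \<in> Hom C G Y" "\<And>i. i < d Y \<Longrightarrow> \<phi> (c Y i \<cdot> h) = \<phi> (c Y i \<cdot> h')"
  shows "h = h'"
  using exp_b[OF assms(1)] exp_b[OF assms(2)] assms(3) by simp

lemma generator_eqI:
  assumes f: "f \<in> Hom C X Y" "f' \<in> Hom C X Y" and eq: "\<And>h. h \<in> Hom C G X \<Longrightarrow> f \<cdot> h = f' \<cdot> h"
  shows "f = f'"
proof (rule \<Phi>_inj[OF f], rule eq_matI)
  fix i j assume "i < dim_row (\<Phi> X Y f')" "j < dim_col (\<Phi> X Y f')"
  then have ij: "i < d Y" "j < d X" using \<Phi>_car[OF f(2)] by auto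
  show "\<Phi> X Y f $$ (i, j) = \<Phi> X Y f' $$ (i, j)"
    using coord[OF f(1) ij] coord[OF f(2) ij] eq[OF b[OF ij(2)]] by simp
qed (use \<Phi>_car[OF f(1)] \<Phi>_car[OF f(2)] in auto)

lemma left_inverse_mono:
  assumes f: "f \<in> Hom C X Y" and M: "M \<in> carrier_mat (d X) (d Y)" "M * \<Phi> X Y f = 1\<^sub>m (d X)"
  shows "is_mono X Y f"
proof (rule is_monoI[OF f])
  fix Z g assume g: "g \<in> Hom C Z X" "f \<cdot> g = 0"
  have "\<Phi> X Y f * \<Phi> Z X g = 0\<^sub>m (d Y) (d Z)"
    using \<Phi>_cmp[OF f g(1)] g(2) \<Phi>_zero by simp
  then have "(M * \<Phi> X Y f) * \<Phi> Z X g = 0\<^sub>m (d X) (d Z)"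
    using assoc_mult_mat[OF M(1) \<Phi>_car[OF f] \<Phi>_car[OF g(1)]] M by simp
  then have "\<Phi> Z X g = \<Phi> Z X 0"
    unfolding M(2) \<Phi>_zero using left_mult_one_mat[OF \<Phi>_car[OF g(1)]] by simp
  then show "g = 0" by (rule \<Phi>_inj[OF g(1) Hom_zero])
qed

lemma right_inverse_epi:
  assumes f: "f \<in> Hom C X Y" and M: "M \<in> carrier_mat (d X) (d Y)" "\<Phi> X Y f * M = 1\<^sub>m (d Y)"
  shows "is_epi X Y f"
proof (rule is_epiI[OF f])
  fix Z g assume g: "g \<in> Hom C Y Z" "g \<cdot> f = 0"
  have "\<Phi> Y Z g * \<Phi> X Y f = 0\<^sub>m (d Z) (d X)"
    using \<Phi>_cmp[OF g(1) f] g(2) \<Phi>_zero by simp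
  then have "\<Phi> Y Z g * (\<Phi> X Y f * M) = 0\<^sub>m (d Z) (d Y)"
    using assoc_mult_mat[OF \<Phi>_car[OF g(1)] \<Phi>_car[OF f] M(1)] M by simp
  then have "\<Phi> Y Z g = \<Phi> Y Z 0"
    unfolding M(2) \<Phi>_zero using right_mult_one_mat[OF \<Phi>_car[OF g(1)]] by simp
  then show "g = 0" by (rule \<Phi>_inj[OF g(1) Hom_zero])
qed

text \<open>A column annihilated by the matrix of \<open>f\<close> is the coordinate vector of a
  morphism from \<open>G\<close> that \<open>f\<close> annihilates, so a categorical monomorphism is
  injective on underlying spaces.\<close>

lemma mono_left_inverse:
  assumes "is_mono X Y f"
  shows "\<exists>M\<in>carrier_mat (d X) (d Y). M * \<Phi> X Y f = 1\<^sub>m (d X)"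
proof (rule left_inverse_if)
  have f: "f \<in> Hom C X Y" using assms by (simp add: is_mono_def)
  show fc: "\<Phi> X Y f \<in> carrier_mat (d Y) (d X)" by (rule \<Phi>_car[OF f])
  fix W assume W: "W \<in> carrier_mat (d X) (d X)" "\<Phi> X Y f * W = 0\<^sub>m (d Y) (d X)"
  show "W = 0\<^sub>m (d X) (d X)"
  proof (rule eq_matI)
    fix i k assume "i < dim_row (0\<^sub>m (d X) (d X) :: 'k mat)" "k < dim_col (0\<^sub>m (d X) (d X) :: 'k mat)"
    then have ik: "i < d X" "k < d X" by auto
    let ?g = "\<Sum>j<d X. scl C (W $$ (j, k)) (b X j)"
    have gH: "?g \<in> Hom C G X" by (rule comb_b_in_Hom)
    have "f \<cdot> ?g = 0"
    proof (rule coord_eqI[OF cmp_in_Hom[OF f gH] Hom_zero])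
      fix p assume p: "p < d Y"
      have "\<phi> (c Y p \<cdot> (f \<cdot> ?g)) = (\<Sum>j<d X. \<Phi> X Y f $$ (p, j) * W $$ (j, k))"
        using coord_apply[OF f gH p] by (simp add: coord_comb)
      also have "\<dots> = (\<Phi> X Y f * W) $$ (p, k)" by (rule index_mult_mat_sum[OF fc W(1) p ik(2), symmetric])
      also have "\<dots> = 0" using W p ik by simp
      finally show "\<phi> (c Y p \<cdot> (f \<cdot> ?g)) = \<phi> (c Y p \<cdot> 0)"
        by (simp add: cmp_zero(2)[OF c[OF p]] functional_on_zero[OF \<phi>])
    qed
    then have "?g = 0" by (rule is_mono_zero[OF assms gH])
    then show "W $$ (i, k) = 0\<^sub>m (d X) (d X) $$ (i, k)"
      using coord_comb(1)[OF ik(1), of "\<lambda>j. W $$ (j, k)"] ik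
      by (simp add: cmp_zero(2)[OF c[OF ik(1)]] functional_on_zero[OF \<phi>])
  qed (use W in auto)
qed

text \<open>Dually, a row annihilated by the matrix is a morphism \<open>g\<close> into
  \<open>J\<close> with \<open>g \<cdot> f = 0\<close>.\<close>

lemma epi_right_inverse:
  assumes "is_epi X Y f"
  shows "\<exists>M\<in>carrier_mat (d X) (d Y). \<Phi> X Y f * M = 1\<^sub>m (d Y)"
proof (rule right_inverse_if)
  have f: "f \<in> Hom C X Y" using assms by (simp add: is_epi_def)
  show fc: "\<Phi> X Y f \<in> carrier_mat (d Y) (d X)" by (rule \<Phi>_car[OF f])
  fix W assume W: "W \<in> carrier_mat (d Y) (d Y)" "W * \<Phi> X Y f = 0\<^sub>m (d Y) (d X)"
  show "W = 0\<^sub>m (d Y) (d Y)"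
  proof (rule eq_matI)
    fix k i assume "k < dim_row (0\<^sub>m (d Y) (d Y) :: 'k mat)" "i < dim_col (0\<^sub>m (d Y) (d Y) :: 'k mat)"
    then have ik: "i < d Y" "k < d Y" by auto
    let ?g = "\<Sum>j<d Y. scl C (W $$ (k, j)) (c Y j)"
    have gH: "?g \<in> Hom C Y J" by (rule comb_c_in_Hom)
    have gf: "?g \<cdot> f \<in> Hom C X J" by (rule cmp_in_Hom[OF gH f])
    have "\<phi> ((?g \<cdot> f) \<cdot> b X p) = 0" if p: "p < d X" for p
    proof -
      have "\<phi> ((?g \<cdot> f) \<cdot> b X p) = (\<Sum>j<d Y. W $$ (k, j) * \<Phi> X Y f $$ (j, p))"
        using coord_apply'[OF f gH p] by (simp add: coord_comb)
      also have "\<dots> = (W * \<Phi> X Y f) $$ (k, p)" by (rule index_mult_mat_sum[OF W(1) fc ik(2) p, symmetric])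
      also have "\<dots> = 0" using W p ik by simp
      finally show ?thesis .
    qed
    then have "?g \<cdot> f = 0" using exp_c[OF gf] by simp
    then have "?g = 0" by (rule is_epi_zero[OF assms gH])
    then show "W $$ (k, i) = 0\<^sub>m (d Y) (d Y) $$ (k, i)"
      using coord_comb(2)[OF ik(1), of "\<lambda>j. W $$ (k, j)"] ik
      by (simp add: cmp_zero(1)[OF b[OF ik(1)]] functional_on_zero[OF \<phi>])
  qed (use W in auto)
qed

lemma mono_dim:
  assumes "is_mono X Y f"
  shows "d X \<le> d Y"
proof -
  have "\<Phi> X Y f \<in> carrier_mat (d Y) (d X)" using assms by (intro \<Phi>_car) (simp add: is_mono_def)
  then show ?thesis using mono_left_inverse[OF assms] left_inverse_dim by blast
qed

text \<open>The two one-sided matrix inverses coincide. A linear inverse of a module map is a module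
  map, so fullness lifts it.\<close>

lemma mono_epi_iso:
  assumes "is_mono X Y f" "is_epi X Y f"
  shows "is_iso X Y f"
proof -
  have f: "f \<in> Hom C X Y" using assms by (simp add: is_mono_def)
  obtain M where M: "M \<in> carrier_mat (d X) (d Y)" "M * \<Phi> X Y f = 1\<^sub>m (d X)" using mono_left_inverse[OF assms(1)] by blast
  obtain R where R: "R \<in> carrier_mat (d X) (d Y)" "\<Phi> X Y f * R = 1\<^sub>m (d Y)" using epi_right_inverse[OF assms(2)] by blast
  note fc = \<Phi>_car[OF f]
  have "M = M * (\<Phi> X Y f * R)" using M R by simp
  also have "\<dots> = R" using assoc_mult_mat[OF M(1) fc R(1)] M(2) R(1) by simp
  finally have MR: "M = R" .
  have "M * \<rho> Y a = \<rho> X a * M" if a: "a \<in> A" for a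
  proof -
    have r: "\<rho> X a \<in> carrier_mat (d X) (d X)" "\<rho> Y a \<in> carrier_mat (d Y) (d Y)"
      using modules a by (auto simp: fd_module_def)
    have eq: "\<Phi> X Y f * \<rho> X a = \<rho> Y a * \<Phi> X Y f" using \<Phi>_hom[OF f] a by (simp add: fd_module_hom_def)
    have "M * \<rho> Y a = M * (\<rho> Y a * (\<Phi> X Y f * M))" using M R r by (simp add: MR)
    also have "\<rho> Y a * (\<Phi> X Y f * M) = \<Phi> X Y f * \<rho> X a * M"
      unfolding eq by (rule assoc_mult_mat[OF r(2) fc M(1), symmetric])
    also have "\<dots> = \<Phi> X Y f * (\<rho> X a * M)" by (rule assoc_mult_mat[OF fc r(1) M(1)])
    also have "M * \<dots> = (M * \<Phi> X Y f) * (\<rho> X a * M)"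
      by (rule assoc_mult_mat[OF M(1) fc mult_carrier_mat[OF r(1) M(1)], symmetric])
    finally show ?thesis unfolding M(2) left_mult_one_mat[OF mult_carrier_mat[OF r(1) M(1)]] .
  qed
  then have "M \<in> fd_module_hom A (d Y) (\<rho> Y) (d X) (\<rho> X)" using M by (auto simp: fd_module_hom_def)
  then obtain g where g: "g \<in> Hom C Y X" "\<Phi> Y X g = M" using \<Phi>_lift by blast
  have "g \<cdot> f = ide C X"
    by (rule \<Phi>_inj[OF cmp_in_Hom[OF g(1) f] ide_in_Hom]) (simp add: \<Phi>_cmp[OF g(1) f] g(2) M(2) \<Phi>_ide)
  moreover have "f \<cdot> g = ide C Y"
    by (rule \<Phi>_inj[OF cmp_in_Hom[OF f g(1)] ide_in_Hom]) (simp add: \<Phi>_cmp[OF f g(1)] g(2) MR R(2) \<Phi>_ide)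
  ultimately show ?thesis unfolding is_iso_def using f g by blast
qed

lemma mono_same_dim_iso:
  assumes "is_mono X Y f" "d X = d Y"
  shows "is_iso X Y f"
proof (rule mono_epi_iso[OF assms(1)])
  have f: "f \<in> Hom C X Y" using assms by (simp add: is_mono_def)
  obtain M where M: "M \<in> carrier_mat (d X) (d Y)" "M * \<Phi> X Y f = 1\<^sub>m (d X)" using mono_left_inverse[OF assms(1)] by blast
  have "\<Phi> X Y f * M = 1\<^sub>m (d Y)"
    using mat_mult_left_right_inverse[of M "d X" "\<Phi> X Y f"] M \<Phi>_car[OF f] assms(2) by simp
  then show "is_epi X Y f" by (rule right_inverse_epi[OF f M(1)])
qed

lemma iso_epi:
  assumes "is_iso X Y f"
  shows "is_epi X Y f"
proof -
  obtain g where g: "f \<in> Hom C X Y" "g \<in> Hom C Y X" "f \<cdot> g = ide C Y" using assms by (auto simp: is_iso_def)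
  show ?thesis
  proof (rule is_epiI[OF g(1)])
    fix Z h assume h: "h \<in> Hom C Y Z" "h \<cdot> f = 0"
    have "h = h \<cdot> (f \<cdot> g)" unfolding g(3) using ide_right[OF h(1)] by simp
    also have "\<dots> = 0" unfolding cmp_assoc[OF h(1) g(1,2), symmetric] h(2) by (rule cmp_zero(1)[OF g(2)])
    finally show "h = 0" .
  qed
qed

lemma image:
  assumes "f \<in> Hom C X Y"
  obtains Z e m where "is_epi X Z e" "is_mono Z Y m" "f = m \<cdot> e"
proof -
  obtain Z e m E' M' where "e \<in> Hom C X Z" "m \<in> Hom C Z Y" "f = m \<cdot> e"
    "E' \<in> carrier_mat (d X) (d Z)" "\<Phi> X Z e * E' = 1\<^sub>m (d Z)"
    "M' \<in> carrier_mat (d Z) (d Y)" "M' * \<Phi> Z Y m = 1\<^sub>m (d Z)"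
    by (rule image_factorization[OF assms])
  then show ?thesis using that left_inverse_mono right_inverse_epi by blast
qed

lemma dim_zero_iff: "d X = 0 \<longleftrightarrow> ide C X = 0"
proof
  assume "d X = 0"
  then have "\<Phi> X X (ide C X) = \<Phi> X X 0" unfolding \<Phi>_zero \<Phi>_ide by (intro eq_matI) auto
  then show "ide C X = 0" by (rule \<Phi>_inj[OF ide_in_Hom Hom_zero])
next
  assume "ide C X = 0"
  then have eq: "1\<^sub>m (d X) = (0\<^sub>m (d X) (d X) :: 'k mat)" using \<Phi>_zero[of X X] \<Phi>_ide[of X] by simp
  show "d X = 0"
  proof (rule ccontr)
    assume "d X \<noteq> 0"
    then have "(1\<^sub>m (d X) :: 'k mat) $$ (0, 0) = 1" "(0\<^sub>m (d X) (d X) :: 'k mat) $$ (0, 0) = 0" by auto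
    with eq show False by simp
  qed
qed


subsection \<open>Simple objects\<close>

text \<open>The definition of simplicity speaks of subobjects only: the image of \<open>f\<close> is
  a non-zero one, hence all of \<open>S\<close>. The statement about monomorphisms out of
  \<open>S\<close> is then a consequence.\<close>

lemma simple_epi:
  assumes S: "simple_object S" and f: "f \<in> Hom C Y S" "f \<noteq> 0"
  shows "is_epi Y S f"
proof -
  obtain Z e m where em: "is_epi Y Z e" "is_mono Z S m" "f = m \<cdot> e" using image[OF f(1)] .
  have mH: "m \<in> Hom C Z S" "e \<in> Hom C Y Z" using em by (auto simp: is_mono_def is_epi_def)
  have "m \<noteq> 0" using f(2) em(3) cmp_zero(1)[OF mH(2)] by auto
  then have "is_iso Z S m" using S em(2) by (auto simp: simple_object_def)
  then have m: "is_epi Z S m" by (rule iso_epi)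
  show ?thesis
  proof (rule is_epiI[OF f(1)])
    fix W g assume g: "g \<in> Hom C S W" "g \<cdot> f = 0"
    then have "(g \<cdot> m) \<cdot> e = 0" using em(3) cmp_assoc[OF g(1) mH] by simp
    then have "g \<cdot> m = 0" by (rule is_epi_zero[OF em(1) cmp_in_Hom[OF g(1) mH(1)]])
    then show "g = 0" by (rule is_epi_zero[OF m g(1)])
  qed
qed

lemma simple_mono:
  assumes S: "simple_object S" and f: "f \<in> Hom C S Y" "f \<noteq> 0"
  shows "is_mono S Y f"
proof (rule is_monoI[OF f(1)], rule ccontr)
  fix Z k assume k: "k \<in> Hom C Z S" "f \<cdot> k = 0" "k \<noteq> 0"
  have "f = 0" by (rule is_epi_zero[OF simple_epi[OF S k(1,3)] f(1) k(2)])
  then show False using f(2) by simp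
qed

lemma simple_simple_iso:
  assumes "simple_object S" "simple_object S'" "f \<in> Hom C S S'" "f \<noteq> 0"
  shows "is_iso S S' f"
  using assms simple_mono by (meson simple_object_def)

text \<open>Subtracting an eigenvalue of the matrix leaves a morphism with a kernel vector. It is
  not monic, hence zero by \<open>simple_mono\<close>.\<close>

lemma schur:
  assumes S: "simple_object S" and f: "f \<in> Hom C S S"
  shows "\<exists>x. f = scl C x (ide C S)"
proof -
  have "d S > 0" using S dim_zero_iff[of S] by (auto simp: simple_object_def)
  note fc = \<Phi>_car[OF f]
  obtain x v where v: "v \<in> carrier_vec (d S)" "v \<noteq> 0\<^sub>v (d S)" "\<Phi> S S f *\<^sub>v v = x \<cdot>\<^sub>v v"
    using eigenvector_exists[OF fc \<open>d S > 0\<close>] .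
  let ?s = "scl C (- x) (ide C S)"
  let ?g = "f + ?s"
  have s: "?s \<in> Hom C S S" by (intro Hom_scl ide_in_Hom)
  have gH: "?g \<in> Hom C S S" by (intro Hom_add f s)
  have one: "- x \<cdot>\<^sub>m 1\<^sub>m (d S) \<in> carrier_mat (d S) (d S)" by simp
  have "\<Phi> S S ?g = \<Phi> S S f + (- x) \<cdot>\<^sub>m 1\<^sub>m (d S)"
    by (simp only: \<Phi>_add[OF f s] \<Phi>_scl[OF ide_in_Hom] \<Phi>_ide)
  then have "\<Phi> S S ?g *\<^sub>v v = \<Phi> S S f *\<^sub>v v + (- x \<cdot>\<^sub>m 1\<^sub>m (d S)) *\<^sub>v v"
    using add_mult_distrib_mat_vec[OF fc one v(1)] by simp
  also have "(- x \<cdot>\<^sub>m 1\<^sub>m (d S)) *\<^sub>v v = (- x) \<cdot>\<^sub>v (1\<^sub>m (d S) *\<^sub>v v)"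
    using v(1) by (intro eq_vecI) (auto simp: row_smult)
  also have "\<dots> = (- x) \<cdot>\<^sub>v v" using v(1) by simp
  finally have g0: "\<Phi> S S ?g *\<^sub>v v = 0\<^sub>v (d S)" using v by (intro eq_vecI) auto
  have "?g = 0"
  proof (rule ccontr)
    assume "?g \<noteq> 0"
    then obtain M where M: "M \<in> carrier_mat (d S) (d S)" "M * \<Phi> S S ?g = 1\<^sub>m (d S)"
      using mono_left_inverse[OF simple_mono[OF S gH]] by blast
    have "v = (M * \<Phi> S S ?g) *\<^sub>v v" unfolding M(2) using v by simp
    also have "\<dots> = M *\<^sub>v (\<Phi> S S ?g *\<^sub>v v)" by (rule assoc_mult_mat_vec[OF M(1) \<Phi>_car[OF gH] v(1)])
    also have "\<dots> = 0\<^sub>v (d S)" unfolding g0 using M(1) by (intro eq_vecI) auto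
    finally show False using v(2) by simp
  qed
  then have "f = scl C x (ide C S)" by (simp add: eq_neg_iff_add_eq_0)
  then show ?thesis by blast
qed

lemma scl_ide_eq_iff:
  assumes "simple_object S"
  shows "scl C x (ide C S) = scl C y (ide C S) \<longleftrightarrow> x = y"
  using assms by (auto simp: simple_object_def)

text \<open>Induction on dimension. If the image of \<open>\<alpha> Y\<close> is smaller than
  \<open>Y\<close>, nilpotency carries over from it. Otherwise \<open>\<alpha> Y\<close> and all its
  powers are monic; a non-zero \<open>Y\<close> that is not simple would then have a proper non-zero
  subobject on which \<alpha> is nilpotent, which is impossible.\<close>

lemma nilpotent_if_zero_on_simples:
  assumes \<alpha>: "\<And>X. \<alpha> X \<in> Hom C X X" and nat: "\<And>X Y g. g \<in> Hom C X Y \<Longrightarrow> \<alpha> Y \<cdot> g = g \<cdot> \<alpha> X"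
    and simple: "\<And>S. simple_object S \<Longrightarrow> \<alpha> S = 0"
  shows "\<exists>n. pow Y (\<alpha> Y) n = 0"
proof (induction "d Y" arbitrary: Y rule: less_induct)
  case less
  obtain I e m where em: "is_epi Y I e" "is_mono I Y m" "\<alpha> Y = m \<cdot> e" using image[OF \<alpha>] .
  have H: "e \<in> Hom C Y I" "m \<in> Hom C I Y" using em by (auto simp: is_mono_def is_epi_def)
  note pH = pow_in_Hom[OF \<alpha>]
  show ?case
  proof (cases "d I < d Y")
    case True
    then obtain n where n: "pow I (\<alpha> I) n = 0" using less by blast
    \<comment> \<open>One exponent more than for \<open>I\<close>: the first factor moves into the
      image.\<close>
    have "pow Y (\<alpha> Y) (Suc n) = pow Y (\<alpha> Y) n \<cdot> \<alpha> Y"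
      using pow_natural[OF \<alpha> \<alpha> \<alpha> refl] by simp
    also have "\<dots> = (pow Y (\<alpha> Y) n \<cdot> m) \<cdot> e" unfolding em(3)[symmetric]
      using em(3) cmp_assoc[OF pH H(2,1)] by simp
    also have "pow Y (\<alpha> Y) n \<cdot> m = m \<cdot> pow I (\<alpha> I) n"
      by (rule pow_natural[OF \<alpha> \<alpha> H(2) nat[OF H(2)]])
    also have "\<dots> \<cdot> e = 0" unfolding n cmp_zero(2)[OF H(2)] by (rule cmp_zero(1)[OF H(1)])
    finally show ?thesis by blast
  next
    case False
    then have dI: "d I = d Y" using mono_dim[OF em(2)] by simp
    have \<alpha>_mono: "is_mono Y Y (\<alpha> Y)"
    proof (rule is_monoI[OF \<alpha>])
      obtain R where R: "R \<in> carrier_mat (d Y) (d I)" "\<Phi> Y I e * R = 1\<^sub>m (d I)"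
        using epi_right_inverse[OF em(1)] by blast
      have "R * \<Phi> Y I e = 1\<^sub>m (d Y)"
        using mat_mult_left_right_inverse[of "\<Phi> Y I e" "d Y" R] R \<Phi>_car[OF H(1)] dI by simp
      then have e: "is_mono Y I e" using left_inverse_mono[OF H(1)] R dI by simp
      fix Z g assume g: "g \<in> Hom C Z Y" "\<alpha> Y \<cdot> g = 0"
      have "m \<cdot> (e \<cdot> g) = 0" using g em(3) cmp_assoc[OF H(2,1) g(1)] by simp
      then have "e \<cdot> g = 0" by (rule is_mono_zero[OF em(2) cmp_in_Hom[OF H(1) g(1)]])
      then show "g = 0" by (rule is_mono_zero[OF e g(1)])
    qed
    have pow_mono: "g = 0" if "g \<in> Hom C Z Y" "pow Y (\<alpha> Y) n \<cdot> g = 0" for Z g n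
      using that(2)
    proof (induction n)
      case 0 then show ?case using ide_left[OF that(1)] by simp
    next
      case (Suc n)
      have "\<alpha> Y \<cdot> (pow Y (\<alpha> Y) n \<cdot> g) = 0" using cmp_assoc[OF \<alpha> pH that(1)] Suc.prems by simp
      then have "pow Y (\<alpha> Y) n \<cdot> g = 0" by (rule is_mono_zero[OF \<alpha>_mono cmp_in_Hom[OF pH that(1)]])
      then show ?case by (rule Suc.IH)
    qed
    show ?thesis
    proof (cases "ide C Y = 0")
      case True
      then show ?thesis by (intro exI[of _ 0]) simp
    next
      case False
      show ?thesis
      proof (cases "simple_object Y")
        case True
        then have "pow Y (\<alpha> Y) 1 = 0" using simple cmp_zero(1)[OF ide_in_Hom] by simp
        then show ?thesis by blast
      next
        assume "\<not> simple_object Y"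
        then obtain Z f where f: "is_mono Z Y f" "f \<noteq> 0" "\<not> is_iso Z Y f"
          using False by (auto simp: simple_object_def)
        have fH: "f \<in> Hom C Z Y" using f by (simp add: is_mono_def)
        have "d Z < d Y" using mono_dim[OF f(1)] mono_same_dim_iso[OF f(1)] f(3) by force
        then obtain n where "pow Z (\<alpha> Z) n = 0" using less by blast
        then have "pow Y (\<alpha> Y) n \<cdot> f = 0"
          using pow_natural[OF \<alpha> \<alpha> fH nat[OF fH]] cmp_zero(2)[OF fH] by simp
        then have "f = 0" by (rule pow_mono[OF fH])
        then show ?thesis using f(2) by simp
      qed
    qed
  qed
qed

text \<open>The exponent of the generator \<open>G\<close> serves all objects at once. A common
  exponent is what allows \<open>Psi_injective\<close> to be applied to a power.\<close>

lemma uniformly_nilpotent: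
  assumes \<alpha>: "\<And>X. \<alpha> X \<in> Hom C X X" and nat: "\<And>X Y g. g \<in> Hom C X Y \<Longrightarrow> \<alpha> Y \<cdot> g = g \<cdot> \<alpha> X"
    and simple: "\<And>S. simple_object S \<Longrightarrow> \<alpha> S = 0"
  obtains n where "\<And>Y. pow Y (\<alpha> Y) n = 0"
proof -
  obtain n where n: "pow G (\<alpha> G) n = 0" using nilpotent_if_zero_on_simples[OF assms] by blast
  have "pow Y (\<alpha> Y) n = 0" for Y
  proof (rule generator_eqI[OF pow_in_Hom[OF \<alpha>] Hom_zero])
    fix h assume h: "h \<in> Hom C G Y"
    show "pow Y (\<alpha> Y) n \<cdot> h = 0 \<cdot> h"
      using pow_natural[OF \<alpha> \<alpha> h nat[OF h]] n by (simp add: cmp_zero(1)[OF h] cmp_zero(2)[OF h])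
  qed
  then show ?thesis by (rule that)
qed

lemma idempotent_splits:
  assumes e: "e \<in> Hom C Y Y" "e \<cdot> e = e"
  obtains Z m q where "m \<in> Hom C Z Y" "q \<in> Hom C Y Z" "m \<cdot> q = e" "q \<cdot> m = ide C Z" "is_mono Z Y m"
proof -
  obtain Z q m where qm: "is_epi Y Z q" "is_mono Z Y m" "e = m \<cdot> q" using image[OF e(1)] .
  have H: "q \<in> Hom C Y Z" "m \<in> Hom C Z Y" using qm by (auto simp: is_mono_def is_epi_def)
  have "m \<cdot> ((q \<cdot> m) \<cdot> q) = m \<cdot> q"
    using e(2) qm(3) cmp_assoc[OF H(2,1) cmp_in_Hom[OF H(2,1)]] cmp_assoc[OF H H(1)] by simp
  then have "(q \<cdot> m) \<cdot> q = q"
    using qm(2) cmp_in_Hom[OF cmp_in_Hom[OF H] H(1)] H(1) unfolding is_mono_def by blast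
  then have "(q \<cdot> m) \<cdot> q = ide C Z \<cdot> q" using ide_left[OF H(1)] by simp
  then have "q \<cdot> m = ide C Z"
    using qm(1) cmp_in_Hom[OF H] ide_in_Hom[of Z] unfolding is_epi_def by blast
  then show ?thesis using that[OF H(2,1)] qm by simp
qed

text \<open>\<open>G\<close> is free of rank one, so any coordinates define a morphism from it; here
  they come from a linear section \<open>R\<close> of \<open>e\<close>.\<close>

lemma generator_lift:
  assumes "is_epi X Y e" and h: "h \<in> Hom C G Y"
  shows "\<exists>g\<in>Hom C G X. e \<cdot> g = h"
proof -
  have e: "e \<in> Hom C X Y" using assms by (simp add: is_epi_def)
  obtain R where R: "R \<in> carrier_mat (d X) (d Y)" "\<Phi> X Y e * R = 1\<^sub>m (d Y)"
    using epi_right_inverse[OF assms(1)] by blast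
  let ?x = "\<lambda>j. \<Sum>i<d Y. R $$ (j, i) * \<phi> (c Y i \<cdot> h)"
  let ?g = "\<Sum>j<d X. scl C (?x j) (b X j)"
  have gH: "?g \<in> Hom C G X" by (rule comb_b_in_Hom)
  have "e \<cdot> ?g = h"
  proof (rule coord_eqI[OF cmp_in_Hom[OF e gH] h])
    fix p assume p: "p < d Y"
    have "\<phi> (c Y p \<cdot> (e \<cdot> ?g)) = (\<Sum>j<d X. \<Phi> X Y e $$ (p, j) * ?x j)"
      using coord_apply[OF e gH p] by (simp add: coord_comb)
    also have "\<dots> = (\<Sum>j<d X. \<Sum>i<d Y. \<Phi> X Y e $$ (p, j) * R $$ (j, i) * \<phi> (c Y i \<cdot> h))"
      by (simp add: sum_distrib_left mult.assoc)
    also have "\<dots> = (\<Sum>i<d Y. \<Sum>j<d X. \<Phi> X Y e $$ (p, j) * R $$ (j, i) * \<phi> (c Y i \<cdot> h))" by (rule sum.swap)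
    also have "\<dots> = (\<Sum>i<d Y. (\<Phi> X Y e * R) $$ (p, i) * \<phi> (c Y i \<cdot> h))"
      using p by (intro sum.cong refl) (simp add: index_mult_mat_sum[OF \<Phi>_car[OF e] R(1)] sum_distrib_right)
    also have "\<dots> = \<phi> (c Y p \<cdot> h)"
      unfolding R(2) using p by (simp add: if_distrib[of "\<lambda>x. x * _"] cong: if_cong)
    finally show "\<phi> (c Y p \<cdot> (e \<cdot> ?g)) = \<phi> (c Y p \<cdot> h)" .
  qed
  then show ?thesis using gH by blast
qed

end

section \<open>Commutative semisimple algebras\<close>

context linear_category
begin

text \<open>Commutativity makes the image of a simple ideal \<open>I\<close> under \<open>t\<close>
  an ideal, so it is zero or \<open>I\<close>, and nilpotency excludes the latter. Hence
  \<open>t\<close> kills every summand of the unit, and so the unit.\<close>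

lemma semisimple_nilpotent_zero:
  assumes VH: "V \<subseteq> Hom C X X" and one: "ide C X \<in> V" and sub: "vs.subspace V"
    and mult: "\<And>a b. a \<in> V \<Longrightarrow> b \<in> V \<Longrightarrow> a \<cdot> b \<in> V"
    and comm: "\<And>a b. a \<in> V \<Longrightarrow> b \<in> V \<Longrightarrow> a \<cdot> b = b \<cdot> a"
    and ss: "semisimple_algebra (scl C) (cmp C) V"
    and t: "t \<in> V" and nil: "pow X t n = 0"
  shows "t = 0"
proof -
  obtain F where F0: "finite F \<and> (\<forall>I\<in>F. simple_left_ideal (scl C) (cmp C) V I) \<and>
      (\<forall>a\<in>V. \<exists>!x. x \<in> (\<Pi>\<^sub>E I\<in>F. I) \<and> a = (\<Sum>I\<in>F. x I))"
    using ss[unfolded semisimple_algebra_def] by (rule exE)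
  have F: "simple_left_ideal (scl C) (cmp C) V I" if "I \<in> F" for I
    using F0[THEN conjunct2, THEN conjunct1] that by (rule bspec)
  have dec: "\<exists>!x. x \<in> (\<Pi>\<^sub>E I\<in>F. I) \<and> ide C X = (\<Sum>I\<in>F. x I)"
    using F0[THEN conjunct2, THEN conjunct2] one by (rule bspec)
  have tH: "t \<in> Hom C X X" using t VH by blast
  have kill: "t \<cdot> y = 0" if I: "I \<in> F" and y: "y \<in> I" for I y
  proof -
    have li: "left_ideal (scl C) (cmp C) V I" and simple: "I \<noteq> {0}"
      "\<And>J. left_ideal (scl C) (cmp C) V J \<Longrightarrow> J \<subseteq> I \<Longrightarrow> J = {0} \<or> J = I"
      using F[OF I] unfolding simple_left_ideal_def by auto
    have IV: "I \<subseteq> V" and Isub: "vs.subspace I" and Imul: "\<And>a x. a \<in> V \<Longrightarrow> x \<in> I \<Longrightarrow> a \<cdot> x \<in> I"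
      using li unfolding left_ideal_def by auto
    let ?J = "(\<lambda>y. t \<cdot> y) ` I"
    have JI: "?J \<subseteq> I" using Imul[OF t] by auto
    have H: "x \<in> Hom C X X" if "x \<in> I" for x using that IV VH by blast
    have "left_ideal (scl C) (cmp C) V ?J"
      unfolding left_ideal_def
    proof (intro conjI ballI)
      show "?J \<subseteq> V" using JI IV by blast
      show "vs.subspace ?J"
        unfolding vs.subspace_def
      proof (intro conjI ballI allI)
        show "0 \<in> ?J" using vs.subspace_0[OF Isub] cmp_zero(2)[OF tH] by force
        fix x assume "x \<in> ?J"
        then obtain x' where x': "x = t \<cdot> x'" "x' \<in> I" by blast
        show "scl C k x \<in> ?J" for k
          using x' vs.subspace_scale[OF Isub x'(2)] by (intro image_eqI[of _ _ "scl C k x'"]) (simp_all add: cmp_scl_right[OF tH H])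
        fix y assume "y \<in> ?J"
        then obtain y' where y': "y = t \<cdot> y'" "y' \<in> I" by blast
        show "x + y \<in> ?J"
          using x' y' vs.subspace_add[OF Isub x'(2) y'(2)]
          by (intro image_eqI[of _ _ "x' + y'"]) (simp_all add: cmp_add_right[OF tH H H])
      qed
      fix a x assume a: "a \<in> V" and "x \<in> ?J"
      then obtain x' where x': "x = t \<cdot> x'" "x' \<in> I" by blast
      have aH: "a \<in> Hom C X X" using a VH by blast
      have "a \<cdot> x = (a \<cdot> t) \<cdot> x'" unfolding x' by (rule cmp_assoc[OF aH tH H[OF x'(2)], symmetric])
      also have "\<dots> = t \<cdot> (a \<cdot> x')" unfolding comm[OF a t] by (rule cmp_assoc[OF tH aH H[OF x'(2)]])
      finally show "a \<cdot> x \<in> ?J" using Imul[OF a x'(2)] by blast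
    qed
    from simple(2)[OF this JI] show ?thesis
    proof
      assume "?J = {0}" then show ?thesis using y by auto
    next
      assume J: "?J = I"
      \<comment> \<open>Every element of \<open>I\<close> is divisible by all powers of
        \<open>t\<close>, among them the one that is zero.\<close>
      have "\<exists>y'\<in>I. y = pow X t k \<cdot> y'" if "y \<in> I" for y k
        using that
      proof (induction k arbitrary: y)
        case 0 then show ?case using ide_left[OF H] by auto
      next
        case (Suc k)
        then obtain z where z: "z \<in> I" "y = t \<cdot> z" using J by blast
        obtain y' where y': "y' \<in> I" "z = pow X t k \<cdot> y'" using Suc.IH[OF z(1)] by blast
        show ?case
          using y' z cmp_assoc[OF tH pow_in_Hom[OF tH] H[OF y'(1)]] by (intro bexI[of _ y']) simp_all
      qed
      from this[of _ n] have "I \<subseteq> {0}" unfolding nil using cmp_zero(1)[OF H] by fastforce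
      then show ?thesis using simple(1) y by auto
    qed
  qed
  obtain x where x: "x \<in> (\<Pi>\<^sub>E I\<in>F. I)" "ide C X = (\<Sum>I\<in>F. x I)"
    using dec[THEN ex1_implies_ex] by (elim exE conjE)
  have xI: "x I \<in> I" if "I \<in> F" for I using x(1) that by (auto simp: PiE_def Pi_def)
  have "t = t \<cdot> (\<Sum>I\<in>F. x I)" using ide_right[OF tH] x(2) by simp
  also have "\<dots> = (\<Sum>I\<in>F. t \<cdot> x I)"
  proof (rule cmp_sum_right[OF tH])
    fix I assume "I \<in> F"
    then show "x I \<in> Hom C X X"
      using xI F VH unfolding simple_left_ideal_def left_ideal_def by blast
  qed
  also have "\<dots> = 0" using kill xI by (intro sum.neutral) auto
  finally show ?thesis .
qed

text \<open>
  Finitely many characters that are jointly injective split the algebra: interpolation yields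
  the orthogonal idempotents on which exactly one of them does not vanish.
\<close>

lemma characters_semisimple:
  assumes VH: "V \<subseteq> Hom C X X" and one: "ide C X \<in> V" and sub: "vs.subspace V"
    and mult: "\<And>a b. a \<in> V \<Longrightarrow> b \<in> V \<Longrightarrow> a \<cdot> b \<in> V"
    and K: "finite K" and lin: "\<And>\<chi>. \<chi> \<in> K \<Longrightarrow> functional_on V \<chi>"
    and chi_mult: "\<And>\<chi> a b. \<chi> \<in> K \<Longrightarrow> a \<in> V \<Longrightarrow> b \<in> V \<Longrightarrow> \<chi> (a \<cdot> b) = \<chi> a * \<chi> b"
    and chi_one: "\<And>\<chi>. \<chi> \<in> K \<Longrightarrow> \<chi> (ide C X) = 1"
    and sep: "\<And>\<chi> \<chi>'. \<chi> \<in> K \<Longrightarrow> \<chi>' \<in> K \<Longrightarrow> \<chi> \<noteq> \<chi>' \<Longrightarrow> \<exists>a\<in>V. \<chi> a \<noteq> \<chi>' a"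
    and inj: "\<And>a. a \<in> V \<Longrightarrow> (\<And>\<chi>. \<chi> \<in> K \<Longrightarrow> \<chi> a = 0) \<Longrightarrow> a = 0"
  shows "semisimple_algebra (scl C) (cmp C) V"
proof -
  note add = vs.subspace_add[OF sub] and scale = vs.subspace_scale[OF sub] and diff = vs.subspace_diff[OF sub]
  have chi_add: "\<chi> (a + a') = \<chi> a + \<chi> a'" and chi_scale: "\<chi> (scl C x a) = x * \<chi> a"
    if "\<chi> \<in> K" "a \<in> V" "a' \<in> V" for \<chi> a a' x
    using lin[OF that(1)] that(2,3) by (auto simp: functional_on_def)
  have chi_diff: "\<chi> (a - a') = \<chi> a - \<chi> a'" if "\<chi> \<in> K" "a \<in> V" "a' \<in> V" for \<chi> a a'
    using chi_add[OF that(1) diff[OF that(2,3)] that(3)] by simp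
  have chi_zero: "\<chi> 0 = 0" if "\<chi> \<in> K" for \<chi>
    using chi_scale[OF that one one, of 0] by simp
  have chi_sum: "\<chi> (\<Sum>i\<in>I. f i) = (\<Sum>i\<in>I. \<chi> (f i))" if \<chi>: "\<chi> \<in> K" and f: "\<And>i. i \<in> I \<Longrightarrow> f i \<in> V"
    for \<chi> f and I :: "'z set"
    using f
  proof (induction I rule: infinite_finite_induct)
    case (insert j I)
    then show ?case using chi_add[OF \<chi>, of "f j" "\<Sum>i\<in>I. f i"] vs.subspace_sum[OF sub, of I f] by auto
  qed (simp_all add: chi_zero[OF \<chi>])
  have eqI: "a = a'" if "a \<in> V" "a' \<in> V" "\<And>\<chi>. \<chi> \<in> K \<Longrightarrow> \<chi> a = \<chi> a'" for a a'
  proof -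
    have "a - a' = 0"
    proof (rule inj[OF diff[OF that(1,2)]])
      fix \<chi> assume k: "\<chi> \<in> K"
      show "\<chi> (a - a') = 0" using chi_diff[OF k that(1,2)] that(3)[OF k] by simp
    qed
    then show ?thesis by simp
  qed
  have "\<exists>e\<in>V. \<chi> e = 1 \<and> (\<forall>\<chi>'\<in>Y. \<chi>' e = 0)" if \<chi>: "\<chi> \<in> K" and Y: "finite Y" "Y \<subseteq> K - {\<chi>}" for \<chi> Y
    using Y
  proof (induction Y rule: finite_induct)
    case empty then show ?case using one chi_one[OF \<chi>] by auto
  next
    case (insert \<chi>' Y)
    then obtain e where e: "e \<in> V" "\<chi> e = 1" "\<And>\<chi>''. \<chi>'' \<in> Y \<Longrightarrow> \<chi>'' e = 0" by auto
    have \<chi>': "\<chi>' \<in> K" "\<chi> \<noteq> \<chi>'" using insert by auto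
    obtain a where a: "a \<in> V" "\<chi> a \<noteq> \<chi>' a" using sep[OF \<chi> \<chi>'] by blast
    \<comment> \<open>The linear interpolant with value 1 at \<chi> and 0 at \<chi>'.\<close>
    let ?f = "scl C (1 / (\<chi> a - \<chi>' a)) (a - scl C (\<chi>' a) (ide C X))"
    have s: "scl C (\<chi>' a) (ide C X) \<in> V" by (rule scale[OF one])
    note d = diff[OF a(1) s]
    have f: "?f \<in> V" by (rule scale[OF d])
    have \<chi>f: "\<psi> ?f = (\<psi> a - \<chi>' a) / (\<chi> a - \<chi>' a)" if "\<psi> \<in> K" for \<psi>
      using chi_scale[OF that d d] chi_diff[OF that a(1) s] chi_scale[OF that one one] chi_one[OF that] by simp
    have "\<chi> (e \<cdot> ?f) = 1" using chi_mult[OF \<chi> e(1) f] e(2) \<chi>f[OF \<chi>] a(2) by simp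
    moreover have "\<chi>'' (e \<cdot> ?f) = 0" if "\<chi>'' \<in> insert \<chi>' Y" for \<chi>''
    proof -
      have k: "\<chi>'' \<in> K" using that insert.prems by auto
      show ?thesis using chi_mult[OF k e(1) f] \<chi>f[OF k] e(3) that by auto
    qed
    ultimately show ?case using mult[OF e(1) f] by blast
  qed
  from this[OF _ finite_Diff[OF K] order_refl]
  have "\<forall>\<chi>\<in>K. \<exists>e. e \<in> V \<and> \<chi> e = 1 \<and> (\<forall>\<chi>'\<in>K - {\<chi>}. \<chi>' e = 0)" by blast
  then obtain e where e': "\<forall>\<chi>\<in>K. e \<chi> \<in> V \<and> \<chi> (e \<chi>) = 1 \<and> (\<forall>\<chi>'\<in>K - {\<chi>}. \<chi>' (e \<chi>) = 0)"
    using bchoice[of K "\<lambda>\<chi> e. e \<in> V \<and> \<chi> e = 1 \<and> (\<forall>\<chi>'\<in>K - {\<chi>}. \<chi>' e = 0)"] by blast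
  have eV: "e \<chi> \<in> V" if "\<chi> \<in> K" for \<chi> using e' that by blast
  have chi_e: "\<chi>' (e \<chi>) = (if \<chi>' = \<chi> then 1 else 0)" if "\<chi> \<in> K" "\<chi>' \<in> K" for \<chi> \<chi>' using e' that by auto
  \<comment> \<open>The ideals of the decomposition: by \<open>act\<close> the algebra acts on each
    through its character.\<close>
  define line where "line \<chi> = range (\<lambda>x. scl C x (e \<chi>))" for \<chi>
  have lineD: "\<exists>z. y = scl C z (e \<chi>)" if "y \<in> line \<chi>" for y \<chi>
    using that unfolding line_def by (rule rangeE) (rule exI)
  have e_ne: "e \<chi> \<noteq> 0" if "\<chi> \<in> K" for \<chi> using chi_e[OF that that] chi_zero[OF that] by auto
  have act: "a \<cdot> scl C x (e \<chi>) = scl C (x * \<chi> a) (e \<chi>)" if "\<chi> \<in> K" "a \<in> V" for \<chi> a x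
  proof (rule eqI)
    note eX = eV[OF that(1)]
    show "a \<cdot> scl C x (e \<chi>) \<in> V" "scl C (x * \<chi> a) (e \<chi>) \<in> V"
      by (intro mult scale eX that)+
    fix \<chi>' assume k: "\<chi>' \<in> K"
    show "\<chi>' (a \<cdot> scl C x (e \<chi>)) = \<chi>' (scl C (x * \<chi> a) (e \<chi>))"
      unfolding chi_mult[OF k that(2) scale[OF eX]] chi_scale[OF k eX eX] chi_e[OF that(1) k] by simp
  qed
  have inj_line: "inj_on line K"
  proof (rule inj_onI)
    fix \<chi> \<chi>' assume k: "\<chi> \<in> K" "\<chi>' \<in> K" "line \<chi> = line \<chi>'"
    have "scl C 1 (e \<chi>) \<in> line \<chi>" unfolding line_def by (rule rangeI)
    then obtain x where "scl C 1 (e \<chi>) = scl C x (e \<chi>')" using k(3) unfolding line_def by auto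
    then have "\<chi> (e \<chi>) = x * \<chi> (e \<chi>')" using chi_scale[OF k(1) eV[OF k(2)] eV[OF k(2)]] by simp
    then show "\<chi> = \<chi>'"
      unfolding chi_e[OF k(1) k(1)] chi_e[OF k(2) k(1)] by (simp split: if_splits)
  qed
  have simple: "simple_left_ideal (scl C) (cmp C) V (line \<chi>)" if \<chi>: "\<chi> \<in> K" for \<chi>
    unfolding simple_left_ideal_def
  proof (intro conjI allI impI)
    show "left_ideal (scl C) (cmp C) V (line \<chi>)"
      unfolding left_ideal_def
    proof (intro conjI ballI)
      show "line \<chi> \<subseteq> V" using scale[OF eV[OF \<chi>]] by (auto simp: line_def)
      show "vs.subspace (line \<chi>)"
        unfolding line_def vs.span_singleton[symmetric] by (rule vs.subspace_span)
      show "a \<cdot> y \<in> line \<chi>" if "a \<in> V" "y \<in> line \<chi>" for a y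
        using that act[OF \<chi>] by (auto simp: line_def)
    qed
    have "scl C 1 (e \<chi>) \<in> line \<chi>" unfolding line_def by (rule rangeI)
    then show "line \<chi> \<noteq> {0}" using e_ne[OF \<chi>] by auto
    fix J assume J: "left_ideal (scl C) (cmp C) V J \<and> J \<subseteq> line \<chi>"
    then have Js: "vs.subspace J" by (simp add: left_ideal_def)
    show "J = {0} \<or> J = line \<chi>"
    proof (rule disjCI)
      assume "J \<noteq> line \<chi>"
      show "J = {0}"
      proof (rule ccontr)
        assume "J \<noteq> {0}"
        then obtain y where y: "y \<in> J" "y \<noteq> 0" using vs.subspace_0[OF Js] by auto
        then obtain x where x: "y = scl C x (e \<chi>)" using J by (auto simp: line_def)
        then have "x \<noteq> 0" using y by auto
        have "scl C z (e \<chi>) \<in> J" for z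
          using vs.subspace_scale[OF Js y(1), of "z / x"] \<open>x \<noteq> 0\<close> by (simp add: x)
        then have "line \<chi> \<subseteq> J" by (auto simp: line_def)
        then show False using J \<open>J \<noteq> line \<chi>\<close> by blast
      qed
    qed
  qed
  let ?F = "line ` K"
  \<comment> \<open>The decomposition in \<open>semisimple_algebra\<close> is indexed by the ideals
    themselves; \<kappa> recovers the character from its line.\<close>
  define \<kappa> where "\<kappa> = inv_into K line"
  have \<kappa>: "\<kappa> I \<in> K" "line (\<kappa> I) = I" if "I \<in> ?F" for I
    using inv_into_into[OF that] f_inv_into_f[OF that] by (auto simp: \<kappa>_def)
  have \<kappa>_line: "\<kappa> (line \<chi>) = \<chi>" if "\<chi> \<in> K" for \<chi> using inv_into_f_f[OF inj_line that] by (simp add: \<kappa>_def)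
  \<comment> \<open>Of the summands, \<chi> sees only the one in its own line, so the characters
    read off all coefficients.\<close>
  have coeff: "\<chi> (\<Sum>I\<in>?F. x I) = \<chi> (x (line \<chi>))" if x: "x \<in> (\<Pi>\<^sub>E I\<in>?F. I)" and \<chi>: "\<chi> \<in> K" for x \<chi>
  proof -
    have xV: "x I \<in> V" and xl: "x I \<in> line (\<kappa> I)" if "I \<in> ?F" for I
    proof -
      have "x I \<in> I" using x that by (auto simp: PiE_def Pi_def)
      then show "x I \<in> line (\<kappa> I)" using \<kappa>[OF that] by simp
      then show "x I \<in> V" using scale[OF eV[OF \<kappa>(1)[OF that]]] by (auto simp: line_def)
    qed
    have "\<chi> (\<Sum>I\<in>?F. x I) = (\<Sum>I\<in>?F. \<chi> (x I))" by (rule chi_sum[OF \<chi> xV])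
    also have "\<dots> = (\<Sum>I\<in>{line \<chi>}. \<chi> (x I))"
    proof (rule sum.mono_neutral_right)
      show "\<forall>I\<in>?F - {line \<chi>}. \<chi> (x I) = 0"
      proof
        fix I assume I: "I \<in> ?F - {line \<chi>}"
        then have "\<kappa> I \<noteq> \<chi>" using \<kappa>(2) by auto
        moreover obtain z where z: "x I = scl C z (e (\<kappa> I))" using lineD[OF xl] I by blast
        moreover have k: "\<kappa> I \<in> K" using \<kappa>(1) I by blast
        ultimately show "\<chi> (x I) = 0"
          unfolding z chi_scale[OF \<chi> eV[OF k] eV[OF k]] chi_e[OF k \<chi>] by simp
      qed
    qed (use K \<chi> in auto)
    finally show ?thesis by simp
  qed
  have "\<exists>!x. x \<in> (\<Pi>\<^sub>E I\<in>?F. I) \<and> a = (\<Sum>I\<in>?F. x I)" if a: "a \<in> V" for a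
  proof (rule ex1I)
    let ?x = "restrict (\<lambda>I. scl C (\<kappa> I a) (e (\<kappa> I))) ?F"
    have x: "?x \<in> (\<Pi>\<^sub>E I\<in>?F. I)"
    proof (rule PiE_I)
      fix I assume I: "I \<in> ?F"
      then have "scl C (\<kappa> I a) (e (\<kappa> I)) \<in> line (\<kappa> I)" by (auto simp: line_def)
      then show "?x I \<in> I" using \<kappa>(2)[OF I] I by simp
    qed auto
    have sV: "(\<Sum>I\<in>?F. ?x I) \<in> V" using \<kappa>(1) by (intro vs.subspace_sum[OF sub]) (auto intro: scale eV)
    have "a = (\<Sum>I\<in>?F. ?x I)"
    proof (rule eqI[OF a sV])
      fix \<chi> assume \<chi>: "\<chi> \<in> K"
      show "\<chi> a = \<chi> (\<Sum>I\<in>?F. ?x I)"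
        unfolding coeff[OF x \<chi>] using \<chi> chi_scale[OF \<chi> eV[OF \<chi>] eV[OF \<chi>]] chi_e[OF \<chi> \<chi>]
        by (simp add: \<kappa>_line)
    qed
    with x show "?x \<in> (\<Pi>\<^sub>E I\<in>?F. I) \<and> a = (\<Sum>I\<in>?F. ?x I)" by blast
    fix y assume y: "y \<in> (\<Pi>\<^sub>E I\<in>?F. I) \<and> a = (\<Sum>I\<in>?F. y I)"
    show "y = ?x"
    proof (rule PiE_ext[of _ ?F "\<lambda>I. I"])
      fix I assume I: "I \<in> ?F"
      note k = \<kappa>[OF I]
      have "y I \<in> I" using y I by (auto simp: PiE_def Pi_def)
      then obtain z where z: "y I = scl C z (e (\<kappa> I))" using k(2) lineD by metis
      have "\<kappa> I a = \<kappa> I (y I)" using coeff[of y "\<kappa> I"] y k by simp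
      also have "\<dots> = z" unfolding z using chi_scale[OF k(1) eV[OF k(1)] eV[OF k(1)]] chi_e[OF k(1) k(1)] by simp
      finally show "y I = ?x I" using z I by simp
    qed (use x y in auto)
  qed
  then show ?thesis
    unfolding semisimple_algebra_def using K simple by (intro exI[of _ ?F]) auto
qed

end

section \<open>Semisimplicity of the defect algebra\<close>

locale modular_model = modular_tensor_category C L \<iota> + coordinate_model C N A d \<rho> \<Phi> G J b c \<phi>
  for C :: "('k::{alg_closed_field, field_char_0}, 'o, 'm::ab_group_add, 'x) ribbon_category_data_scheme"
    (structure) and L \<iota> N A d \<rho> \<Phi> G J b c \<phi>
begin

section \<open>Splittings at projective objects, on hom spaces\<close>

lemma epi_iff: "epi e \<longleftrightarrow> is_epi (src e) (trg e) (val e)"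
proof
  assume e: "epi e"
  then have ok: "ok e" by (simp add: epi_def)
  show "is_epi (src e) (trg e) (val e)"
    unfolding is_epi_def
  proof (intro conjI allI ballI impI)
    fix Z g h assume gh: "g \<in> Hom C (trg e) Z" "h \<in> Hom C (trg e) Z" "g \<cdot> val e = h \<cdot> val e"
    have "Arrow (trg e) g Z = Arrow (trg e) h Z"
    proof (rule epi_cancel[OF e])
      show "Arrow (trg e) g Z \<odot> e = Arrow (trg e) h Z \<odot> e" by (rule arrow.expand) (simp add: gh)
    qed (use gh in simp_all)
    then show "g = h" by simp
  qed (use ok in \<open>simp add: ok_def\<close>)
next
  assume e: "is_epi (src e) (trg e) (val e)"
  then have ok: "ok e" by (simp add: is_epi_def ok_def)
  show "epi e"
    unfolding epi_def
  proof (intro conjI allI impI ok)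
    fix g h assume gh: "ok g \<and> ok h \<and> src g = trg e \<and> src h = trg e \<and> trg g = trg h \<and> g \<odot> e = h \<odot> e"
    then have "val (g \<odot> e) = val (h \<odot> e)" by simp
    then have "val g \<cdot> val e = val h \<cdot> val e" by simp
    moreover have "val g \<in> Hom C (trg e) (trg h)" "val h \<in> Hom C (trg e) (trg h)"
      using gh by (auto simp: ok_def)
    ultimately have "val g = val h" using e unfolding is_epi_def by blast
    then show "g = h" using gh by (intro arrow.expand) simp
  qed
qed

lemma is_mono_imp_mono:
  assumes f: "is_mono X Y f"
  shows "mono (Arrow X f Y)"
  unfolding mono_def
proof (intro conjI allI impI)
  show "ok (Arrow X f Y)" using f by (simp add: is_mono_def)
  fix g h assume gh: "ok g \<and> ok h \<and> trg g = src (Arrow X f Y) \<and> trg h = src (Arrow X f Y) \<and> src g = src h \<and>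
    Arrow X f Y \<odot> g = Arrow X f Y \<odot> h"
  then have "val (Arrow X f Y \<odot> g) = val (Arrow X f Y \<odot> h)" by simp
  then have "f \<cdot> val g = f \<cdot> val h" by simp
  moreover have "val g \<in> Hom C (src h) X" "val h \<in> Hom C (src h) X" using gh by (auto simp: ok_def)
  ultimately have "val g = val h" using f unfolding is_mono_def by blast
  then show "g = h" using gh by (intro arrow.expand) simp
qed

lemma proj_retract_Hom:
  assumes "proj P" "i \<in> Hom C Q P" "r \<in> Hom C P Q" "r \<cdot> i = ide C Q"
  shows "proj Q"
proof (rule proj_retract[OF assms(1), of "Arrow Q i P" _ "Arrow P r Q"])
  show "Arrow P r Q \<odot> Arrow Q i P = \<I> Q" by (rule arrow.expand) (simp add: assms)
qed (use assms in simp_all)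

lemma proj_generator: "proj G"
  unfolding proj_def
proof (intro allI impI)
  fix e h assume eh: "epi e \<and> ok h \<and> src h = G \<and> trg h = trg e"
  then have hH: "val h \<in> Hom C G (trg e)" by (auto simp: ok_def)
  obtain g where g: "g \<in> Hom C G (src e)" "val e \<cdot> g = val h"
    using generator_lift[OF _ hH] eh epi_iff by blast
  have "e \<odot> Arrow G g (src e) = h" using eh g by (intro arrow.expand) simp
  then show "\<exists>g. ok g \<and> src g = G \<and> trg g = src e \<and> e \<odot> g = h"
    using g by (intro exI[of _ "Arrow G g (src e)"]) simp
qed

lemma mono_from_proj_splits:
  assumes "proj X" "is_mono X Y f"
  obtains s where "s \<in> Hom C Y X" "s \<cdot> f = ide C X"
proof -
  obtain s where s: "ok s" "src s = Y" "trg s = X" "s \<odot> Arrow X f Y = \<I> X"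
    using proj_mono_splits[OF assms(1) is_mono_imp_mono[OF assms(2)]] by auto
  have "val s \<cdot> f = ide C X" using arg_cong[OF s(4), of val] by simp
  moreover have "val s \<in> Hom C Y X" using s by (auto simp: ok_def)
  ultimately show ?thesis using that by blast
qed

lemma epi_to_proj_splits:
  assumes "proj X" "is_epi Y X f"
  obtains s where "s \<in> Hom C X Y" "f \<cdot> s = ide C X"
proof -
  have ef: "epi (Arrow Y f X)" using assms(2) by (simp add: epi_iff)
  obtain s where s: "ok s" "src s = X" "trg s = Y" "Arrow Y f X \<odot> s = \<I> X"
    using proj_epi_splits[OF assms(1) ef] by auto
  have "f \<cdot> val s = ide C X" using arg_cong[OF s(4), of val] by simp
  moreover have "val s \<in> Hom C X Y" using s by (auto simp: ok_def)
  ultimately show ?thesis using that by blast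
qed


subsection \<open>Functionals separating the simple projective objects\<close>

text \<open>
  For a simple projective \<open>X\<close>, a maximal family of orthogonal copies of \<open>X\<close> in \<open>Y\<close> exhausts
  \<open>Hom C X Y\<close> and \<open>Hom C Y X\<close>, because \<open>X\<close> is also injective.
\<close>

lemma isotypic_part:
  assumes X: "simple_object X" and P: "proj X"
  shows "\<exists>(n::nat) u v. (\<forall>i<n. u i \<in> Hom C X Y \<and> v i \<in> Hom C Y X \<and> v i \<cdot> u i = ide C X) \<and>
    (\<forall>h\<in>Hom C X Y. h = (\<Sum>i<n. u i \<cdot> (v i \<cdot> h))) \<and> (\<forall>h\<in>Hom C Y X. h = (\<Sum>i<n. (h \<cdot> u i) \<cdot> v i))"
proof -
  define ortho where "ortho n u v \<longleftrightarrow> (\<forall>i<n. u i \<in> Hom C X Y) \<and> (\<forall>i<n. v i \<in> Hom C Y X) \<and>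
    (\<forall>i<n. \<forall>j<n. v i \<cdot> u j = (if i = j then ide C X else 0))" for n :: nat and u v
  have ide0: "ide C X \<noteq> 0" using X by (simp add: simple_object_def)
  \<comment> \<open>Orthogonal copies are linearly independent in \<open>Hom C X Y\<close>:
    composing a relation with \<open>v j\<close> isolates one coefficient.\<close>
  have bound: "n \<le> d Y * d X" if o: "ortho n u v" for n u v
  proof (rule ccontr)
    assume "\<not> n \<le> d Y * d X"
    then have "card ({..<d Y} \<times> {..<d X}) < card {..<n}" by simp
    from underdetermined[OF _ _ this, of "\<lambda>i pq. \<Phi> X Y (u i) $$ pq"]
    obtain x where x: "\<exists>i<n. x i \<noteq> 0" "\<And>p q. p < d Y \<Longrightarrow> q < d X \<Longrightarrow> (\<Sum>i<n. x i * \<Phi> X Y (u i) $$ (p, q)) = 0"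
      by auto
    let ?s = "\<Sum>i<n. scl C (x i) (u i)"
    have uH: "u i \<in> Hom C X Y" and vH: "v i \<in> Hom C Y X" if "i < n" for i using o that by (auto simp: ortho_def)
    have sH: "?s \<in> Hom C X Y" using uH by (intro Hom_sum Hom_scl) simp
    have "\<Phi> X Y ?s = \<Phi> X Y 0"
    proof (rule eq_matI)
      fix p q assume "p < dim_row (\<Phi> X Y 0)" "q < dim_col (\<Phi> X Y 0)"
      then have pq: "p < d Y" "q < d X" by (auto simp: \<Phi>_zero)
      then show "\<Phi> X Y ?s $$ (p, q) = \<Phi> X Y 0 $$ (p, q)"
        using x(2)[OF pq] uH by (subst \<Phi>_sum_index) (auto simp: \<Phi>_zero)
    qed (use \<Phi>_car[OF sH] in \<open>auto simp: \<Phi>_zero\<close>)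
    then have s0: "?s = 0" by (rule \<Phi>_inj[OF sH Hom_zero])
    obtain j where j: "j < n" "x j \<noteq> 0" using x(1) by blast
    have "v j \<cdot> ?s = (\<Sum>i<n. scl C (x i) (v j \<cdot> u i))"
      by (rule linear_on_sum[OF linear_on_cmp(2)[OF vH[OF j(1)]]]) (auto intro: uH)
    also have "\<dots> = (\<Sum>i<n. if i = j then scl C (x j) (ide C X) else 0)"
      using o j by (intro sum.cong) (auto simp: ortho_def)
    also have "\<dots> = scl C (x j) (ide C X)" using j by simp
    finally show False using s0 cmp_zero(2)[OF vH[OF j(1)]] j(2) ide0 by simp
  qed
  have "\<exists>u v. ortho 0 u v" by (simp add: ortho_def)
  from ex_has_greatest_nat[of "\<lambda>n. \<exists>u v. ortho n u v" 0 "\<lambda>n. n" "Suc (d Y * d X)", OF this] bound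
  obtain n where n: "\<exists>u v. ortho n u v" and max: "\<And>m. \<exists>u v. ortho m u v \<Longrightarrow> m \<le> n"
    by (auto simp: less_Suc_eq_le)
  obtain u v where o: "ortho n u v" using n by blast
  have uH: "u i \<in> Hom C X Y" and vH: "v i \<in> Hom C Y X" if "i < n" for i using o that by (auto simp: ortho_def)
  have vu: "v i \<cdot> u j = (if i = j then ide C X else 0)" if "i < n" "j < n" for i j
    using o that by (auto simp: ortho_def)
  have extend: False
    if h: "h \<in> Hom C X Y" and k: "k \<in> Hom C Y X" and kh: "k \<cdot> h = ide C X"
      and vh: "\<And>i. i < n \<Longrightarrow> v i \<cdot> h = 0" and ku: "\<And>i. i < n \<Longrightarrow> k \<cdot> u i = 0" for h k
  proof -
    have "ortho (Suc n) (u(n := h)) (v(n := k))"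
      using h k kh vh ku uH vH vu by (auto simp: ortho_def less_Suc_eq)
    then have "Suc n \<le> n" using max by blast
    then show False by simp
  qed
  \<comment> \<open>The idempotent of \<open>Y\<close> that projects onto the copies found.\<close>
  define e where "e = (\<Sum>i<n. u i \<cdot> v i)"
  have eH: "e \<in> Hom C Y Y" unfolding e_def using cmp_in_Hom[OF uH vH] by (intro Hom_sum) simp
  have e_left: "e \<cdot> h = (\<Sum>i<n. u i \<cdot> (v i \<cdot> h))" if h: "h \<in> Hom C Z Y" for h Z
  proof -
    have "e \<cdot> h = (\<Sum>i<n. (u i \<cdot> v i) \<cdot> h)"
      unfolding e_def using cmp_in_Hom[OF uH vH] by (intro cmp_sum_left[OF h]) simp
    also have "\<dots> = (\<Sum>i<n. u i \<cdot> (v i \<cdot> h))" using cmp_assoc[OF uH vH h] by (intro sum.cong) simp_all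
    finally show ?thesis .
  qed
  have e_right: "h \<cdot> e = (\<Sum>i<n. (h \<cdot> u i) \<cdot> v i)" if h: "h \<in> Hom C Y Z" for h Z
  proof -
    have "h \<cdot> e = (\<Sum>i<n. h \<cdot> (u i \<cdot> v i))"
      unfolding e_def using cmp_in_Hom[OF uH vH] by (intro cmp_sum_right[OF h]) simp
    also have "\<dots> = (\<Sum>i<n. (h \<cdot> u i) \<cdot> v i)" using cmp_assoc[OF h uH vH] by (intro sum.cong) simp_all
    finally show ?thesis .
  qed
  have ve: "v i \<cdot> e = v i" and eu: "e \<cdot> u i = u i" if i: "i < n" for i
  proof -
    have "v i \<cdot> e = (\<Sum>j<n. (if i = j then ide C X else 0) \<cdot> v j)"
      unfolding e_right[OF vH[OF i]] using vu i by (intro sum.cong) simp_all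
    also have "\<dots> = (\<Sum>j<n. if i = j then v i else 0)"
      using ide_left[OF vH] cmp_zero(1)[OF vH] by (intro sum.cong) auto
    finally show "v i \<cdot> e = v i" using i by simp
    have "e \<cdot> u i = (\<Sum>j<n. u j \<cdot> (if j = i then ide C X else 0))"
      unfolding e_left[OF uH[OF i]] using vu i by (intro sum.cong) simp_all
    also have "\<dots> = (\<Sum>j<n. if j = i then u i else 0)"
      using ide_right[OF uH] cmp_zero(2)[OF uH] by (intro sum.cong) auto
    finally show "e \<cdot> u i = u i" using i by simp
  qed
  have left: "h = e \<cdot> h" if h: "h \<in> Hom C X Y" for h
  proof (rule ccontr)
    assume "h \<noteq> e \<cdot> h"
    let ?h = "h - e \<cdot> h"
    have ehH: "e \<cdot> h \<in> Hom C X Y" by (rule cmp_in_Hom[OF eH h])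
    have hH: "?h \<in> Hom C X Y" by (rule Hom_diff[OF h ehH])
    have vh: "v i \<cdot> ?h = 0" if i: "i < n" for i
      using cmp_diff_right[OF vH[OF i] h ehH] cmp_assoc[OF vH[OF i] eH h] ve[OF i] by simp
    have eh0: "e \<cdot> ?h = 0" unfolding e_left[OF hH] using vh cmp_zero(2)[OF uH] by simp
    obtain s where s: "s \<in> Hom C Y X" "s \<cdot> ?h = ide C X"
      using mono_from_proj_splits[OF P simple_mono[OF X hH]] \<open>h \<noteq> e \<cdot> h\<close> by auto
    \<comment> \<open>The part \<open>?h\<close> of \<open>h\<close> outside the copies would be a
      further copy. The correction makes its retraction vanish on the old ones, while
      \<open>?k \<cdot> ?h\<close> is still the identity because
      \<open>e \<cdot> ?h = 0\<close>.\<close>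
    let ?k = "s - s \<cdot> e"
    have seH: "s \<cdot> e \<in> Hom C Y X" by (rule cmp_in_Hom[OF s(1) eH])
    have kH: "?k \<in> Hom C Y X" by (rule Hom_diff[OF s(1) seH])
    have "?k \<cdot> ?h = ide C X"
      using cmp_diff_left[OF hH s(1) seH] cmp_assoc[OF s(1) eH hH] s(2) eh0 cmp_zero(2)[OF s(1)] by simp
    moreover have "?k \<cdot> u i = 0" if i: "i < n" for i
      using cmp_diff_left[OF uH[OF i] s(1) seH] cmp_assoc[OF s(1) eH uH[OF i]] eu[OF i] by simp
    ultimately show False using extend[OF hH kH] vh by blast
  qed
  have right: "h = h \<cdot> e" if h: "h \<in> Hom C Y X" for h
  proof (rule ccontr)
    assume "h \<noteq> h \<cdot> e"
    let ?h = "h - h \<cdot> e"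
    have heH: "h \<cdot> e \<in> Hom C Y X" by (rule cmp_in_Hom[OF h eH])
    have hH: "?h \<in> Hom C Y X" by (rule Hom_diff[OF h heH])
    have hu: "?h \<cdot> u i = 0" if i: "i < n" for i
      using cmp_diff_left[OF uH[OF i] h heH] cmp_assoc[OF h eH uH[OF i]] eu[OF i] by simp
    have he0: "?h \<cdot> e = 0" unfolding e_right[OF hH] using hu cmp_zero(1)[OF vH] by simp
    obtain s where s: "s \<in> Hom C X Y" "?h \<cdot> s = ide C X"
      using epi_to_proj_splits[OF P simple_epi[OF X hH]] \<open>h \<noteq> h \<cdot> e\<close> by auto
    let ?k = "s - e \<cdot> s"
    have esH: "e \<cdot> s \<in> Hom C X Y" by (rule cmp_in_Hom[OF eH s(1)])
    have kH: "?k \<in> Hom C X Y" by (rule Hom_diff[OF s(1) esH])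
    have "?h \<cdot> ?k = ide C X"
      using cmp_diff_right[OF hH s(1) esH] cmp_assoc[OF hH eH s(1)] s(2) he0 cmp_zero(1)[OF s(1)] by simp
    moreover have "v i \<cdot> ?k = 0" if i: "i < n" for i
      using cmp_diff_right[OF vH[OF i] s(1) esH] cmp_assoc[OF vH[OF i] eH s(1)] ve[OF i] by simp
    ultimately show False using extend[OF kH hH] hu by blast
  qed
  have "\<forall>i<n. u i \<in> Hom C X Y \<and> v i \<in> Hom C Y X \<and> v i \<cdot> u i = ide C X"
    using uH vH vu by simp
  moreover have "\<forall>h\<in>Hom C X Y. h = (\<Sum>i<n. u i \<cdot> (v i \<cdot> h))"
    by (intro ballI) (rule trans[OF left e_left])
  moreover have "\<forall>h\<in>Hom C Y X. h = (\<Sum>i<n. (h \<cdot> u i) \<cdot> v i)"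
    by (intro ballI) (rule trans[OF right e_right])
  ultimately show ?thesis by (intro exI[of _ n] exI[of _ u] exI[of _ v] conjI)
qed

section \<open>Scalars by which endomorphisms of simple objects act\<close>

definition scalar :: "'o \<Rightarrow> 'm \<Rightarrow> 'k" where
  "scalar S f = (SOME x. f = scl C x (ide C S))"

lemma scalar:
  assumes "simple_object S" "f \<in> Hom C S S"
  shows "f = scl C (scalar S f) (ide C S)"
  unfolding scalar_def using schur[OF assms] by (rule someI_ex)

lemma scalar_scl [simp]: "simple_object S \<Longrightarrow> scalar S (scl C x (ide C S)) = x"
  using scalar[of S "scl C x (ide C S)"] scl_ide_eq_iff Hom_scl[OF ide_in_Hom] by metis

lemma scalar_ide [simp]: "simple_object S \<Longrightarrow> scalar S (ide C S) = 1"
  using scalar_scl[of S 1] by simp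

lemma functional_scalar:
  assumes S: "simple_object S"
  shows "functional_on (Hom C S S) (scalar S)"
  unfolding functional_on_def
proof (intro conjI ballI allI)
  fix f g x assume f: "f \<in> Hom C S S"
  note fs = scalar[OF S f]
  have "scl C x f = scl C (x * scalar S f) (ide C S)" by (subst fs) simp
  then show "scalar S (scl C x f) = x * scalar S f" by (simp add: S)
  assume g: "g \<in> Hom C S S"
  have "f + g = scl C (scalar S f + scalar S g) (ide C S)"
    by (subst fs, subst scalar[OF S g]) (simp add: vs.scale_left_distrib)
  then show "scalar S (f + g) = scalar S f + scalar S g" by (simp add: S)
qed

text \<open>\<open>cocharacter_functional\<close> with \<open>X\<close> in both roles and \<phi> the
  scalar: the value at \<open>Y\<close> counts the orthogonal copies of \<open>X\<close> in
  \<open>Y\<close>. At \<open>X\<close> itself there is at least one, and characteristic zero keeps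
  the count non-zero in the field.\<close>

lemma simple_projective_functional:
  assumes X: "simple_object X" and P: "proj X"
  obtains \<xi> where "functional_on (Hom C \<^bold>1 L) \<xi>"
    "\<And>Y. Hom C X Y = {0} \<Longrightarrow> \<xi> (cocharacter Y) = 0" "\<xi> (cocharacter X) \<noteq> 0"
proof -
  \<comment> \<open>One predicate on triples, so that a single application of choice yields matching
    counts and families for all \<open>Y\<close>.\<close>
  define Q where "Q Y t \<longleftrightarrow>
    (\<forall>i<fst t. fst (snd t) i \<in> Hom C X Y \<and> snd (snd t) i \<in> Hom C Y X \<and> snd (snd t) i \<cdot> fst (snd t) i = ide C X) \<and>
    (\<forall>h\<in>Hom C X Y. h = (\<Sum>i<fst t. fst (snd t) i \<cdot> (snd (snd t) i \<cdot> h))) \<and>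
    (\<forall>h\<in>Hom C Y X. h = (\<Sum>i<fst t. (h \<cdot> fst (snd t) i) \<cdot> snd (snd t) i))"
    for Y and t :: "nat \<times> (nat \<Rightarrow> 'm) \<times> (nat \<Rightarrow> 'm)"
  have "\<exists>t. Q Y t" for Y
  proof -
    obtain n u v where "(\<forall>i<(n::nat). u i \<in> Hom C X Y \<and> v i \<in> Hom C Y X \<and> v i \<cdot> u i = ide C X) \<and>
      (\<forall>h\<in>Hom C X Y. h = (\<Sum>i<n. u i \<cdot> (v i \<cdot> h))) \<and> (\<forall>h\<in>Hom C Y X. h = (\<Sum>i<n. (h \<cdot> u i) \<cdot> v i))"
      using isotypic_part[OF X P, of Y] by (elim exE) (rule that)
    then show ?thesis unfolding Q_def by (intro exI[of _ "(n, u, v)"]) (simp only: fst_conv snd_conv)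
  qed
  then have "\<forall>Y. \<exists>t. Q Y t" by blast
  from choice[OF this] obtain t where t: "\<forall>Y. Q Y (t Y)" ..
  define n u v where "n Y = fst (t Y)" and "u Y = fst (snd (t Y))" and "v Y = snd (snd (t Y))" for Y
  have Q: "(\<forall>i<n Y. u Y i \<in> Hom C X Y \<and> v Y i \<in> Hom C Y X \<and> v Y i \<cdot> u Y i = ide C X) \<and>
    (\<forall>h\<in>Hom C X Y. h = (\<Sum>i<n Y. u Y i \<cdot> (v Y i \<cdot> h))) \<and>
    (\<forall>h\<in>Hom C Y X. h = (\<Sum>i<n Y. (h \<cdot> u Y i) \<cdot> v Y i))" for Y
    using t[rule_format, of Y] unfolding Q_def n_def u_def v_def .
  have uH: "u Y i \<in> Hom C X Y" and vH: "v Y i \<in> Hom C Y X" and vu: "v Y i \<cdot> u Y i = ide C X" if "i < n Y" for Y i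
    using Q[of Y] that by auto
  have "\<exists>\<xi>. functional_on (Hom C \<^bold>1 L) \<xi> \<and> (\<forall>Y. \<xi> (cocharacter Y) = of_nat (n Y))"
  proof (rule cocharacter_functional[OF functional_scalar[OF X] uH vH])
    show "scalar X (v Y i \<cdot> u Y i) = 1" if "i < n Y" for Y i using vu[OF that] X by simp
    show "h = (\<Sum>i<n Y. scl C (scalar X (v Y i \<cdot> h)) (u Y i))" if h: "h \<in> Hom C X Y" for Y h
    proof -
      have "u Y i \<cdot> (v Y i \<cdot> h) = scl C (scalar X (v Y i \<cdot> h)) (u Y i)" if i: "i < n Y" for i
      proof -
        have "u Y i \<cdot> (v Y i \<cdot> h) = u Y i \<cdot> scl C (scalar X (v Y i \<cdot> h)) (ide C X)"
          using scalar[OF X cmp_in_Hom[OF vH[OF i] h]] by simp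
        then show ?thesis using cmp_scl_right[OF uH[OF i] ide_in_Hom] ide_right[OF uH[OF i]] by simp
      qed
      then have "(\<Sum>i<n Y. u Y i \<cdot> (v Y i \<cdot> h)) = (\<Sum>i<n Y. scl C (scalar X (v Y i \<cdot> h)) (u Y i))" by simp
      then show ?thesis using Q[of Y] h by metis
    qed
    show "h = (\<Sum>i<n Y. scl C (scalar X (h \<cdot> u Y i)) (v Y i))" if h: "h \<in> Hom C Y X" for Y h
    proof -
      have "(h \<cdot> u Y i) \<cdot> v Y i = scl C (scalar X (h \<cdot> u Y i)) (v Y i)" if i: "i < n Y" for i
      proof -
        have "(h \<cdot> u Y i) \<cdot> v Y i = scl C (scalar X (h \<cdot> u Y i)) (ide C X) \<cdot> v Y i"
          using scalar[OF X cmp_in_Hom[OF h uH[OF i]]] by simp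
        then show ?thesis using cmp_scl_left[OF ide_in_Hom vH[OF i]] ide_left[OF vH[OF i]] by simp
      qed
      then have "(\<Sum>i<n Y. (h \<cdot> u Y i) \<cdot> v Y i) = (\<Sum>i<n Y. scl C (scalar X (h \<cdot> u Y i)) (v Y i))" by simp
      then show ?thesis using Q[of Y] h by metis
    qed
  qed
  then obtain \<xi> where \<xi>: "functional_on (Hom C \<^bold>1 L) \<xi>" "\<And>Y. \<xi> (cocharacter Y) = of_nat (n Y)" by blast
  have ide0: "ide C X \<noteq> 0" using X by (simp add: simple_object_def)
  have "n Y = 0" if "Hom C X Y = {0}" for Y
  proof (rule ccontr)
    assume "n Y \<noteq> 0"
    then have "u Y 0 = 0" using uH[of 0 Y] that by simp
    then show False using vu[of 0 Y] cmp_zero(2)[OF vH[of 0 Y]] \<open>n Y \<noteq> 0\<close> ide0 by simp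
  qed
  moreover have "n X \<noteq> 0"
  proof
    assume "n X = 0"
    then show False using Q[of X] ide_in_Hom[of X] ide0 by auto
  qed
  ultimately show ?thesis using that \<xi> by simp
qed

text \<open>Pairing \<open>G\<close> with \<open>J\<close> counts the underlying dimension, which is
  positive at every non-zero object. This detects \<open>P\<close>, on which the functionals of the
  simple projectives vanish.\<close>

lemma dimension_functional:
  obtains \<xi> where "functional_on (Hom C \<^bold>1 L) \<xi>" "\<And>Y. \<xi> (cocharacter Y) = of_nat (d Y)"
proof -
  have "\<exists>\<xi>. functional_on (Hom C \<^bold>1 L) \<xi> \<and> (\<forall>Y. \<xi> (cocharacter Y) = of_nat (d Y))"
    by (rule cocharacter_functional[OF \<phi> b c _ exp_b exp_c]) (simp_all add: coord_cb)
  then show ?thesis using that by blast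
qed


text \<open>
  A loop coloured by a projective \<open>D\<close> factors through \<open>D\<^sup>\<or> \<otimes> D \<otimes> W\<close>, which is projective; by
  Schur's lemma it is zero on a simple \<open>W\<close> unless \<open>W\<close> is a retract of that object.
\<close>

lemma Psi_projective:
  assumes D: "proj D" and W: "simple_object W" and nz: "Psi W (defect_operator D) \<noteq> 0"
  shows "proj W"
proof -
  let ?i = "acoev (D\<^sup>\<or>) \<boxtimes> \<I> W" and ?r = "(aev D \<boxtimes> \<I> W) \<odot> (\<I> (D\<^sup>\<or>) \<boxtimes> dbr D W)"
  have iH: "val ?i \<in> Hom C W (D\<^sup>\<or> \<otimes>\<^sub>o D \<otimes>\<^sub>o W)" by (rule val_in_Hom) simp_all
  have rH: "val ?r \<in> Hom C (D\<^sup>\<or> \<otimes>\<^sub>o D \<otimes>\<^sub>o W) W" by (rule val_in_Hom) simp_all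
  have "?r \<odot> ?i = loop D W" by (simp add: loop_def)
  then have ri: "val ?r \<cdot> val ?i = Psi W (defect_operator D)"
    unfolding Psi_defect_operator by (metis arrow_sel(3))
  obtain x where x: "Psi W (defect_operator D) = scl C x (ide C W)"
    using schur[OF W Psi_in_Hom[OF defect_operator_in_Hom]] by blast
  then have "x \<noteq> 0" using nz by auto
  have "scl C (1 / x) (val ?r) \<cdot> val ?i = ide C W"
    unfolding cmp_scl_left[OF rH iH] ri x using \<open>x \<noteq> 0\<close> by simp
  moreover have "proj (D\<^sup>\<or> \<otimes>\<^sub>o D \<otimes>\<^sub>o W)" by (intro proj_tensor_left proj_tensor_right D)
  ultimately show ?thesis using proj_retract_Hom[OF _ iH Hom_scl[OF rH]] by blast
qed


subsection \<open>A projective object without simple projective summands\<close>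

definition decomposable :: "'o \<Rightarrow> bool" where
  "decomposable Y \<longleftrightarrow> (\<exists>(n::nat) S i p.
     (\<forall>j<n. simple_object (S j) \<and> proj (S j) \<and> i j \<in> Hom C (S j) Y \<and> p j \<in> Hom C Y (S j)) \<and>
     (\<forall>j<n. \<forall>l<n. p j \<cdot> i l = (if j = l then ide C (S j) else 0)) \<and>
     (\<Sum>j<n. i j \<cdot> p j) = ide C Y)"

text \<open>Induction on dimension: a simple projective subobject is injective, hence splits off,
  and its complement is a smaller projective object.\<close>

lemma proj_decomposable:
  assumes hyp: "\<forall>P. proj P \<and> ide C P \<noteq> 0 \<longrightarrow> (\<exists>X f. simple_object X \<and> proj X \<and> f \<in> Hom C X P \<and> f \<noteq> 0)"
    and "proj P"
  shows "decomposable P"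
  using assms(2)
proof (induction "d P" arbitrary: P rule: less_induct)
  case less
  show ?case
  proof (cases "ide C P = 0")
    case True
    then show ?thesis unfolding decomposable_def by (intro exI[of _ 0]) simp
  next
    case False
    then obtain X f where X: "simple_object X" "proj X" and f: "f \<in> Hom C X P" "f \<noteq> 0"
      using hyp less.prems by blast
    obtain s where s: "s \<in> Hom C P X" "s \<cdot> f = ide C X"
      using mono_from_proj_splits[OF X(2) simple_mono[OF X(1) f]] by blast
    define e where "e = ide C P - f \<cdot> s"
    have fsH: "f \<cdot> s \<in> Hom C P P" by (rule cmp_in_Hom[OF f(1) s(1)])
    have eH: "e \<in> Hom C P P" unfolding e_def by (rule Hom_diff[OF ide_in_Hom fsH])
    have ef: "e \<cdot> f = 0"
      unfolding e_def cmp_diff_left[OF f(1) ide_in_Hom fsH] cmp_assoc[OF f(1) s(1) f(1)] s(2)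
      by (simp add: ide_left[OF f(1)] ide_right[OF f(1)])
    have se: "s \<cdot> e = 0"
      unfolding e_def cmp_diff_right[OF s(1) ide_in_Hom fsH] cmp_assoc[OF s(1) f(1) s(1), symmetric] s(2)
      by (simp add: ide_left[OF s(1)] ide_right[OF s(1)])
    have ee: "e \<cdot> e = e"
    proof -
      have "e \<cdot> e = e \<cdot> ide C P - e \<cdot> (f \<cdot> s)"
        by (subst (2) e_def) (rule cmp_diff_right[OF eH ide_in_Hom fsH])
      also have "e \<cdot> (f \<cdot> s) = (e \<cdot> f) \<cdot> s" by (rule cmp_assoc[OF eH f(1) s(1), symmetric])
      finally show ?thesis by (simp add: ef cmp_zero(1)[OF s(1)] ide_right[OF eH])
    qed
    obtain Z m q where m: "m \<in> Hom C Z P" "is_mono Z P m" and q: "q \<in> Hom C P Z"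
      and mq: "m \<cdot> q = e" "q \<cdot> m = ide C Z"
      using idempotent_splits[OF eH ee] by blast
    have Z: "proj Z" by (rule proj_retract_Hom[OF less.prems m(1) q mq(2)])
    have qf: "q \<cdot> f = 0"
    proof (rule is_mono_zero[OF m(2) cmp_in_Hom[OF q f(1)]])
      show "m \<cdot> (q \<cdot> f) = 0" unfolding cmp_assoc[OF m(1) q f(1), symmetric] mq by (rule ef)
    qed
    have sm: "s \<cdot> m = 0"
    proof -
      have "s \<cdot> m = s \<cdot> (m \<cdot> (q \<cdot> m))" unfolding mq by (simp add: ide_right[OF m(1)])
      also have "\<dots> = (s \<cdot> (m \<cdot> q)) \<cdot> m"
        unfolding cmp_assoc[OF m(1) q m(1), symmetric] by (rule cmp_assoc[OF s(1) cmp_in_Hom[OF m(1) q] m(1), symmetric])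
      finally show ?thesis unfolding mq se by (simp add: cmp_zero(1)[OF m(1)])
    qed
    \<comment> \<open>The complement is proper: otherwise \<open>m\<close> is an isomorphism,
      \<open>s \<cdot> m = 0\<close> forces \<open>s = 0\<close>, and \<open>X\<close> is
      zero.\<close>
    have "d Z \<noteq> d P"
    proof
      assume "d Z = d P"
      then have "is_iso Z P m" by (rule mono_same_dim_iso[OF m(2)])
      then have "is_epi Z P m" by (rule iso_epi)
      then have "s = 0" by (rule is_epi_zero[OF _ s(1) sm])
      then have "ide C X = 0" using s(2) cmp_zero(1)[OF f(1)] by simp
      then show False using X(1) by (simp add: simple_object_def)
    qed
    then have "d Z < d P" using mono_dim[OF m(2)] by simp
    from less.hyps[OF this Z] obtain n S i p where dec:
      "(\<forall>j<(n::nat). simple_object (S j) \<and> proj (S j) \<and> i j \<in> Hom C (S j) Z \<and> p j \<in> Hom C Z (S j)) \<and>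
       (\<forall>j<n. \<forall>l<n. p j \<cdot> i l = (if j = l then ide C (S j) else 0)) \<and> (\<Sum>j<n. i j \<cdot> p j) = ide C Z"
      unfolding decomposable_def by (elim exE) (rule that)
    have S: "simple_object (S j) \<and> proj (S j) \<and> i j \<in> Hom C (S j) Z \<and> p j \<in> Hom C Z (S j)" if "j < n" for j
      using dec that by simp
    have pi: "p j \<cdot> i l = (if j = l then ide C (S j) else 0)" if "j < n" "l < n" for j l
      using dec that by simp
    have sum: "(\<Sum>j<n. i j \<cdot> p j) = ide C Z" using dec by simp
    have iH: "i j \<in> Hom C (S j) Z" and pH: "p j \<in> Hom C Z (S j)" if "j < n" for j using S that by auto
    let ?S = "S(n := X)" and ?i = "\<lambda>j. if j < n then m \<cdot> i j else f" and ?p = "\<lambda>j. if j < n then p j \<cdot> q else s"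
    have 1: "\<forall>j<Suc n. simple_object (?S j) \<and> proj (?S j) \<and> ?i j \<in> Hom C (?S j) P \<and> ?p j \<in> Hom C P (?S j)"
      using S X f s cmp_in_Hom[OF m(1) iH] cmp_in_Hom[OF pH q] by (auto simp: less_Suc_eq)
    have 2: "(p j \<cdot> q) \<cdot> (m \<cdot> i l) = (if j = l then ide C (S j) else 0)" if jl: "j < n" "l < n" for j l
    proof -
      have "(p j \<cdot> q) \<cdot> (m \<cdot> i l) = p j \<cdot> (q \<cdot> (m \<cdot> i l))"
        by (rule cmp_assoc[OF pH[OF jl(1)] q cmp_in_Hom[OF m(1) iH[OF jl(2)]]])
      also have "q \<cdot> (m \<cdot> i l) = i l"
        unfolding cmp_assoc[OF q m(1) iH[OF jl(2)], symmetric] mq by (rule ide_left[OF iH[OF jl(2)]])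
      finally show ?thesis using pi[OF jl] by simp
    qed
    have 3: "(p j \<cdot> q) \<cdot> f = 0" and 4: "s \<cdot> (m \<cdot> i j) = 0" if j: "j < n" for j
      using cmp_assoc[OF pH[OF j] q f(1)] cmp_assoc[OF s(1) m(1) iH[OF j]] qf sm
        cmp_zero(2)[OF pH[OF j]] cmp_zero(1)[OF iH[OF j]] by simp_all
    have 5: "\<forall>j<Suc n. \<forall>l<Suc n. ?p j \<cdot> ?i l = (if j = l then ide C (?S j) else 0)"
      using 2 3 4 s(2) by (auto simp: less_Suc_eq)
    have "(m \<cdot> i j) \<cdot> (p j \<cdot> q) = m \<cdot> ((i j \<cdot> p j) \<cdot> q)" if j: "j < n" for j
      using cmp_assoc[OF m(1) iH[OF j] cmp_in_Hom[OF pH[OF j] q]] cmp_assoc[OF iH[OF j] pH[OF j] q] by simp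
    then have "(\<Sum>j<n. ?i j \<cdot> ?p j) = (\<Sum>j<n. m \<cdot> ((i j \<cdot> p j) \<cdot> q))" by simp
    also have "\<dots> = m \<cdot> (\<Sum>j<n. (i j \<cdot> p j) \<cdot> q)"
      by (rule cmp_sum_right[OF m(1), symmetric]) (auto intro: cmp_in_Hom[OF cmp_in_Hom[OF iH pH] q])
    also have "(\<Sum>j<n. (i j \<cdot> p j) \<cdot> q) = (\<Sum>j<n. i j \<cdot> p j) \<cdot> q"
      by (rule cmp_sum_left[OF q, symmetric]) (auto intro: cmp_in_Hom[OF iH pH])
    finally have "(\<Sum>j<n. ?i j \<cdot> ?p j) = e" by (simp add: sum ide_left[OF q] mq)
    then have "(\<Sum>j<Suc n. ?i j \<cdot> ?p j) = ide C P" by (simp add: e_def)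
    with 1 5 show ?thesis
      unfolding decomposable_def by (intro exI[of _ "Suc n"] exI[of _ ?S] exI[of _ ?i] exI[of _ ?p] conjI)
  qed
qed

lemma semisimple_category_if:
  assumes hyp: "\<forall>P. proj P \<and> ide C P \<noteq> 0 \<longrightarrow> (\<exists>X f. simple_object X \<and> proj X \<and> f \<in> Hom C X P \<and> f \<noteq> 0)"
  shows semisimple_category
proof -
  have one: "ide C \<^bold>1 \<noteq> 0" using simple_unit by (simp add: simple_object_def)
  have "ide C G \<noteq> 0"
  proof
    assume 0: "ide C G = 0"
    have d1: "0 < d \<^bold>1" using one dim_zero_iff[of "\<^bold>1"] by simp
    have "b \<^bold>1 0 = b \<^bold>1 0 \<cdot> ide C G" by (simp add: ide_right[OF b[OF d1]])
    then have "b \<^bold>1 0 = 0" unfolding 0 by (simp add: cmp_zero(2)[OF b[OF d1]])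
    then show False
      using coord_cb[OF d1 d1] by (simp add: cmp_zero(2)[OF c[OF d1]] functional_on_zero[OF \<phi>])
  qed
  have ev: "ev C G \<noteq> 0"
  proof
    assume 0: "ev C G = 0"
    have cH: "coev C G \<otimes>\<^sub>m ide C G \<in> Hom C G (G \<otimes>\<^sub>o G\<^sup>\<or> \<otimes>\<^sub>o G)"
      using tensor_in_Hom[OF coev_in_Hom[of G] ide_in_Hom[of G]] by simp
    have "ide C G \<otimes>\<^sub>m (0 :: 'm) = 0" by (rule linear_on_zero[OF linear_on_tensor(2)[OF ide_in_Hom]])
    then have "ide C G = 0" using zigzag[of G] cmp_zero(1)[OF cH] unfolding 0 by simp
    then show False using \<open>ide C G \<noteq> 0\<close> by simp
  qed
  \<comment> \<open>A projective object with a non-zero map to the unit, namely the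
    evaluation.\<close>
  let ?P = "G\<^sup>\<or> \<otimes>\<^sub>o G"
  have P: "proj ?P" by (rule proj_tensor_left[OF proj_generator])
  obtain n S i p where dec:
    "(\<forall>j<(n::nat). simple_object (S j) \<and> proj (S j) \<and> i j \<in> Hom C (S j) ?P \<and> p j \<in> Hom C ?P (S j)) \<and>
     (\<forall>j<n. \<forall>l<n. p j \<cdot> i l = (if j = l then ide C (S j) else 0)) \<and> (\<Sum>j<n. i j \<cdot> p j) = ide C ?P"
    using proj_decomposable[OF hyp P] unfolding decomposable_def by (elim exE) (rule that)
  have S: "simple_object (S j) \<and> proj (S j) \<and> i j \<in> Hom C (S j) ?P \<and> p j \<in> Hom C ?P (S j)" if "j < n" for j
    using dec that by simp
  have sum: "(\<Sum>j<n. i j \<cdot> p j) = ide C ?P" using dec by simp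
  have iH: "i j \<in> Hom C (S j) ?P" and pH: "p j \<in> Hom C ?P (S j)" if "j < n" for j using S that by auto
  \<comment> \<open>The evaluation is the sum of its restrictions to the summands. A summand where
    it does not vanish is isomorphic to the unit, as both are simple.\<close>
  have "\<exists>j<n. ev C G \<cdot> i j \<noteq> 0"
  proof (rule ccontr)
    assume "\<not> ?thesis"
    then have z: "ev C G \<cdot> (i j \<cdot> p j) = 0" if "j < n" for j
      using cmp_assoc[OF ev_in_Hom iH[OF that] pH[OF that]] cmp_zero(1)[OF pH[OF that]] that by simp
    have "ev C G = ev C G \<cdot> (\<Sum>j<n. i j \<cdot> p j)" unfolding sum by (simp add: ide_right[OF ev_in_Hom])
    also have "\<dots> = (\<Sum>j<n. ev C G \<cdot> (i j \<cdot> p j))"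
      by (rule cmp_sum_right[OF ev_in_Hom]) (auto intro: cmp_in_Hom[OF iH pH])
    finally show False using z ev by simp
  qed
  then obtain j where j: "j < n" "ev C G \<cdot> i j \<noteq> 0" by blast
  have "is_iso (S j) \<^bold>1 (ev C G \<cdot> i j)"
    using simple_simple_iso[OF _ simple_unit cmp_in_Hom[OF ev_in_Hom iH[OF j(1)]] j(2)] S[OF j(1)] by blast
  then obtain g where "g \<in> Hom C \<^bold>1 (S j)" "(ev C G \<cdot> i j) \<cdot> g = ide C \<^bold>1" unfolding is_iso_def by blast
  then have "proj \<^bold>1"
    using proj_retract_Hom[OF _ _ cmp_in_Hom[OF ev_in_Hom iH[OF j(1)]]] S[OF j(1)] by blast
  \<comment> \<open>\<open>Y\<close> is its own product with the unit.\<close>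
  then have "proj Y" for Y using proj_tensor_right[of "\<^bold>1" Y] by simp
  then have dec: "decomposable Y" for Y using proj_decomposable[OF hyp] by blast
  show ?thesis
    unfolding semisimple_category_def
  proof
    fix Y
    obtain n S i p where
      "(\<forall>j<(n::nat). simple_object (S j) \<and> proj (S j) \<and> i j \<in> Hom C (S j) Y \<and> p j \<in> Hom C Y (S j)) \<and>
       (\<forall>j<n. \<forall>l<n. p j \<cdot> i l = (if j = l then ide C (S j) else 0)) \<and> (\<Sum>j<n. i j \<cdot> p j) = ide C Y"
      using dec[of Y] unfolding decomposable_def by (elim exE) (rule that)
    then show "\<exists>(n::nat) S i p. (\<forall>j<n. simple_object (S j) \<and> i j \<in> Hom C (S j) Y \<and> p j \<in> Hom C Y (S j)) \<and>
       (\<forall>j<n. \<forall>l<n. p j \<cdot> i l = (if j = l then ide C (S j) else 0)) \<and> (\<Sum>j<n. i j \<cdot> p j) = ide C Y"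
      by (intro exI[of _ n] exI[of _ S] exI[of _ i] exI[of _ p]) simp
  qed
qed


subsection \<open>Nilpotent elements\<close>

lemma ide_L_in_defect_span: "ide C L \<in> defect_span"
  using defect_operator_in_defect_span[of "\<^bold>1"] by (simp add: defect_operator_unit)

lemma pow_in_defect_span: "t \<in> defect_span \<Longrightarrow> pow L t n \<in> defect_span"
  by (induction n) (auto intro: ide_L_in_defect_span defect_span_cmp)

lemma Psi_pow: "t \<in> defect_span \<Longrightarrow> Psi W (pow L t n) = pow W (Psi W t) n"
  by (induction n) (simp_all add: Psi_ide Psi_cmp pow_in_defect_span)

lemma nilpotent_if_Psi_zero_on_simples:
  assumes t: "t \<in> defect_span" and z: "\<And>S. simple_object S \<Longrightarrow> Psi S t = 0"
  shows "\<exists>n. pow L t n = 0"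
proof -
  obtain n where n: "\<And>W. pow W (Psi W t) n = 0"
    using uniformly_nilpotent[of "\<lambda>W. Psi W t", OF Psi_in_Hom[OF defect_span_subset_Hom[OF t]] Psi_natural[OF _ t] z]
    by blast
  have "pow L t n = 0"
    by (rule Psi_injective[OF pow_in_defect_span[OF t]]) (simp add: Psi_pow[OF t] n)
  then show ?thesis by blast
qed

lemma defect_operator_unit_part: "defect_operator D \<cdot> \<iota> \<^bold>1 = cocharacter D"
  using arg_cong[OF aop_unit_part, of val D] by simp

lemma cocharacter_in_Hom: "cocharacter D \<in> Hom C \<^bold>1 L"
  using val_in_Hom[of "achar D" "\<^bold>1" L] by simp

lemma semisimple_algebra_imp:
  assumes ss: "semisimple_algebra (scl C) (cmp C) defect_span"
  shows semisimple_category
proof (rule ccontr)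
  assume "\<not> semisimple_category"
  then obtain P where P: "proj P" "ide C P \<noteq> 0"
    and noX: "\<And>X f. simple_object X \<Longrightarrow> proj X \<Longrightarrow> f \<in> Hom C X P \<Longrightarrow> f = 0"
    using semisimple_category_if by blast
  \<comment> \<open>Vanishing homs in both directions express that the simple projectives are
    pairwise non-isomorphic; a maximal family takes the place of a list of isomorphism
    classes.\<close>
  define family where "family r X \<longleftrightarrow> (\<forall>i<r. simple_object (X i) \<and> proj (X i)) \<and>
    (\<forall>i<r. \<forall>j<r. i \<noteq> j \<longrightarrow> Hom C (X i) (X j) = {0})" for r :: nat and X
  \<comment> \<open>The functional of \<open>X j\<close> vanishes on the cocharacters of the other
    members and, by the choice of \<open>P\<close>, on that of \<open>P\<close>.\<close>
  have coeff_zero: "x j = 0"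
    if fam: "family r X" and s: "(\<Sum>i<r. scl C (x i) (cocharacter (X i))) + scl C y (cocharacter P) = 0"
      and j: "j < r" for r X x y j
  proof -
    have Xj: "simple_object (X j)" "proj (X j)" using fam j by (auto simp: family_def)
    obtain \<xi> where \<xi>: "functional_on (Hom C \<^bold>1 L) \<xi>" "\<And>Y. Hom C (X j) Y = {0} \<Longrightarrow> \<xi> (cocharacter Y) = 0"
      "\<xi> (cocharacter (X j)) \<noteq> 0" using simple_projective_functional[OF Xj] by blast
    let ?s = "\<Sum>i<r. scl C (x i) (cocharacter (X i))"
    have H: "?s \<in> Hom C \<^bold>1 L" "scl C y (cocharacter P) \<in> Hom C \<^bold>1 L"
      by (intro Hom_sum Hom_scl cocharacter_in_Hom)+
    have "0 = \<xi> (?s + scl C y (cocharacter P))" unfolding s by (simp add: functional_on_zero[OF \<xi>(1)])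
    also have "\<dots> = \<xi> ?s + y * \<xi> (cocharacter P)"
      using \<xi>(1) H cocharacter_in_Hom[of P] unfolding functional_on_def by simp
    also have "Hom C (X j) P = {0}" using noX[OF Xj] by auto
    then have "\<xi> (cocharacter P) = 0" by (rule \<xi>(2))
    also have "\<xi> ?s = (\<Sum>i<r. x i * \<xi> (cocharacter (X i)))"
      by (rule functional_on_sum[OF \<xi>(1)]) (rule cocharacter_in_Hom)
    also have "\<dots> = (\<Sum>i<r. if i = j then x j * \<xi> (cocharacter (X j)) else 0)"
    proof (intro sum.cong refl)
      fix i assume i: "i \<in> {..<r}"
      show "x i * \<xi> (cocharacter (X i)) = (if i = j then x j * \<xi> (cocharacter (X j)) else 0)"
      proof (cases "i = j")
        case False
        then have "Hom C (X j) (X i) = {0}" using fam i j by (auto simp: family_def)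
        then show ?thesis using False \<xi>(2) by simp
      qed simp
    qed
    finally show ?thesis using j \<xi>(3) by simp
  qed
  \<comment> \<open>The cocharacters of a family are independent, by the case \<open>y = 0\<close>
    of \<open>coeff_zero\<close>, and they lie in one space of matrices.\<close>
  have bound: "r \<le> d L * d \<^bold>1" if fam: "family r X" for r X
  proof (rule ccontr)
    assume "\<not> r \<le> d L * d \<^bold>1"
    then have "card ({..<d L} \<times> {..<d \<^bold>1}) < card {..<r}" by simp
    from underdetermined[OF _ _ this, of "\<lambda>i pq. \<Phi> \<^bold>1 L (cocharacter (X i)) $$ pq"]
    obtain x where x: "\<exists>i<r. x i \<noteq> 0"
      "\<And>p q. p < d L \<Longrightarrow> q < d \<^bold>1 \<Longrightarrow> (\<Sum>i<r. x i * \<Phi> \<^bold>1 L (cocharacter (X i)) $$ (p, q)) = 0" by auto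
    let ?s = "\<Sum>i<r. scl C (x i) (cocharacter (X i))"
    have sH: "?s \<in> Hom C \<^bold>1 L" by (intro Hom_sum Hom_scl cocharacter_in_Hom)
    have "\<Phi> \<^bold>1 L ?s = \<Phi> \<^bold>1 L 0"
    proof (rule eq_matI)
      fix p q assume "p < dim_row (\<Phi> \<^bold>1 L 0)" "q < dim_col (\<Phi> \<^bold>1 L 0)"
      then have pq: "p < d L" "q < d \<^bold>1" by (auto simp: \<Phi>_zero)
      then show "\<Phi> \<^bold>1 L ?s $$ (p, q) = \<Phi> \<^bold>1 L 0 $$ (p, q)"
        using x(2)[OF pq] cocharacter_in_Hom by (subst \<Phi>_sum_index) (auto simp: \<Phi>_zero)
    qed (use \<Phi>_car[OF sH] in \<open>auto simp: \<Phi>_zero\<close>)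
    then have "?s = 0" by (rule \<Phi>_inj[OF sH Hom_zero])
    then have "?s + scl C 0 (cocharacter P) = 0" by simp
    then show False using coeff_zero[OF fam] x(1) by blast
  qed
  have "\<exists>X. family 0 X" by (simp add: family_def)
  from ex_has_greatest_nat[of "\<lambda>r. \<exists>X. family r X" 0 "\<lambda>r. r" "Suc (d L * d \<^bold>1)", OF this] bound
  obtain r where r: "\<exists>X. family r X" and max: "\<And>m. \<exists>X. family m X \<Longrightarrow> m \<le> r"
    by (auto simp: less_Suc_eq_le)
  obtain X where fam: "family r X" using r by blast
  have X: "simple_object (X i)" "proj (X i)" if "i < r" for i using fam that by (auto simp: family_def)
  define Y where "Y = X(r := P)"
  have projY: "proj (Y i)" if "i < Suc r" for i using that X P by (auto simp: Y_def less_Suc_eq)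
  have "card {..<r} < card {..<Suc r}" by simp
  \<comment> \<open>\<open>Suc r\<close> coefficients against \<open>r\<close> scalars: the extra
    operator is that of \<open>P\<close>.\<close>
  from underdetermined[OF _ _ this, of "\<lambda>i j. scalar (X j) (Psi (X j) (defect_operator (Y i)))"]
  obtain x where x: "\<exists>i<Suc r. x i \<noteq> 0"
    "\<And>j. j < r \<Longrightarrow> (\<Sum>i<Suc r. x i * scalar (X j) (Psi (X j) (defect_operator (Y i)))) = 0" by auto
  define t where "t = (\<Sum>i<Suc r. scl C (x i) (defect_operator (Y i)))"
  have tE: "t \<in> defect_span"
    unfolding t_def by (intro vs.subspace_sum[OF defect_span_subspace] vs.subspace_scale[OF defect_span_subspace] defect_operator_in_defect_span)
  have Psi_t: "Psi W t = (\<Sum>i<Suc r. scl C (x i) (Psi W (defect_operator (Y i))))" for W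
    unfolding t_def by (rule linear_on_sum[OF linear_on_Psi]) (rule defect_operator_in_Hom)
  have PsiX: "Psi (X j) t = 0" if j: "j < r" for j
  proof -
    have "Psi (X j) t = (\<Sum>i<Suc r. scl C (x i * scalar (X j) (Psi (X j) (defect_operator (Y i)))) (ide C (X j)))"
      unfolding Psi_t
    proof (intro sum.cong refl)
      fix i
      show "scl C (x i) (Psi (X j) (defect_operator (Y i))) =
        scl C (x i * scalar (X j) (Psi (X j) (defect_operator (Y i)))) (ide C (X j))"
        by (subst scalar[OF X(1)[OF j] Psi_in_Hom[OF defect_operator_in_Hom]]) simp
    qed
    also have "\<dots> = scl C (\<Sum>i<Suc r. x i * scalar (X j) (Psi (X j) (defect_operator (Y i)))) (ide C (X j))"
      by (rule vs.scale_sum_left[symmetric])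
    finally show ?thesis unfolding x(2)[OF j] by simp
  qed
  have "Psi W t = 0" if W: "simple_object W" for W
  proof (cases "proj W")
    case False
    then have "Psi W (defect_operator (Y i)) = 0" if "i < Suc r" for i
      using Psi_projective[OF projY[OF that] W] by blast
    then show ?thesis unfolding Psi_t by (intro sum.neutral) auto
  next
    case True
    \<comment> \<open>By maximality there is a non-zero morphism between \<open>W\<close> and some
      \<open>X j\<close>, in one direction or the other; naturality carries the vanishing of
      \<open>Psi\<close> along it.\<close>
    have "\<not> family (Suc r) (X(r := W))" using max[of "Suc r"] by auto
    then obtain j where j: "j < r" "Hom C (X j) W \<noteq> {0} \<or> Hom C W (X j) \<noteq> {0}"
      using fam W True by (auto simp: family_def less_Suc_eq)
    note pH = Psi_in_Hom[OF defect_span_subset_Hom[OF tE]]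
    from j(2) show ?thesis
    proof
      assume "Hom C (X j) W \<noteq> {0}"
      then obtain g where g: "g \<in> Hom C (X j) W" "g \<noteq> 0" using Hom_zero[of "X j" W] by blast
      have "Psi W t \<cdot> g = 0"
        unfolding Psi_natural[OF g(1) tE] PsiX[OF j(1)] by (rule cmp_zero(2)[OF g(1)])
      then show ?thesis by (rule is_epi_zero[OF simple_epi[OF W g] pH])
    next
      assume "Hom C W (X j) \<noteq> {0}"
      then obtain g where g: "g \<in> Hom C W (X j)" "g \<noteq> 0" using Hom_zero[of W "X j"] by blast
      have "g \<cdot> Psi W t = 0"
        unfolding Psi_natural[OF g(1) tE, symmetric] PsiX[OF j(1)] by (rule cmp_zero(1)[OF g(1)])
      then show ?thesis by (rule is_mono_zero[OF simple_mono[OF W g] pH])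
    qed
  qed
  then obtain n where "pow L t n = 0" using nilpotent_if_Psi_zero_on_simples[OF tE] by blast
  then have t0: "t = 0"
    using defect_span_subset_Hom by (intro semisimple_nilpotent_zero[OF _ ide_L_in_defect_span defect_span_subspace defect_span_cmp defect_span_commute ss tE]) auto
  have i1: "\<iota> \<^bold>1 \<in> Hom C \<^bold>1 L" using iota_in_Hom[of "\<^bold>1"] by simp
  have "t \<cdot> \<iota> \<^bold>1 = (\<Sum>i<Suc r. scl C (x i) (defect_operator (Y i) \<cdot> \<iota> \<^bold>1))"
    unfolding t_def by (rule linear_on_sum[OF linear_on_cmp(1)[OF i1]]) (rule defect_operator_in_Hom)
  then have "(\<Sum>i<Suc r. scl C (x i) (cocharacter (Y i))) = 0"
    unfolding t0 defect_operator_unit_part by (simp add: cmp_zero(1)[OF i1])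
  then have rel: "(\<Sum>i<r. scl C (x i) (cocharacter (X i))) + scl C (x r) (cocharacter P) = 0"
    by (simp add: Y_def)
  have xj: "x j = 0" if "j < r" for j by (rule coeff_zero[OF fam rel that])
  then have "scl C (x r) (cocharacter P) = 0" using rel by simp
  \<comment> \<open>Only the coefficient of \<open>P\<close> is left, and the dimension functional
    detects it.\<close>
  moreover obtain \<xi> where \<xi>: "functional_on (Hom C \<^bold>1 L) \<xi>" "\<And>Y. \<xi> (cocharacter Y) = of_nat (d Y)"
    using dimension_functional by blast
  ultimately have "x r * of_nat (d P) = 0"
    using functional_on_zero[OF \<xi>(1)] cocharacter_in_Hom[of P] unfolding functional_on_def by metis
  moreover have "d P \<noteq> 0" using P(2) dim_zero_iff by simp
  ultimately have "x r = 0" by simp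
  with xj x(1) show False by (auto simp: less_Suc_eq)
qed

text \<open>The simple summands of the single object \<open>G\<close> are enough: their scalars
  determine \<open>Psi G t\<close>, and since \<open>G\<close> generates, they determine every
  \<open>Psi W t\<close> and with it \<open>t\<close>.\<close>

lemma semisimple_category_imp:
  assumes ss: semisimple_category
  shows "semisimple_algebra (scl C) (cmp C) defect_span"
proof -
  \<comment> \<open>Restricted to the span, so that characters which agree there are equal
    functions. Isomorphic summands then give one element of \<open>?K\<close>, and distinct elements
    are separated.\<close>
  define \<chi> where "\<chi> S = restrict (\<lambda>t. scalar S (Psi S t)) defect_span" for S
  obtain n S i p where dec:
    "(\<forall>j<(n::nat). simple_object (S j) \<and> i j \<in> Hom C (S j) G \<and> p j \<in> Hom C G (S j)) \<and>
     (\<forall>j<n. \<forall>l<n. p j \<cdot> i l = (if j = l then ide C (S j) else 0)) \<and> (\<Sum>j<n. i j \<cdot> p j) = ide C G"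
    using ss[unfolded semisimple_category_def, rule_format, of G] by (elim exE) (rule that)
  have S: "simple_object (S j) \<and> i j \<in> Hom C (S j) G \<and> p j \<in> Hom C G (S j)" if "j < n" for j
    using dec that by simp
  have sum: "(\<Sum>j<n. i j \<cdot> p j) = ide C G" using dec by simp
  have ipH: "i j \<in> Hom C (S j) G" "p j \<in> Hom C G (S j)" if "j < n" for j using S that by auto
  let ?K = "\<chi> ` S ` {..<n}"
  have Psi_scalar: "Psi S t = scl C (\<chi> S t) (ide C S)" if "simple_object S" "t \<in> defect_span" for S t
    unfolding \<chi>_def using that scalar[OF that(1) Psi_in_Hom[OF defect_span_subset_Hom[OF that(2)]]] by simp
  have zero: "t = 0" if t: "t \<in> defect_span" and z: "\<And>j. j < n \<Longrightarrow> \<chi> (S j) t = 0" for t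
  proof (rule Psi_injective[OF t])
    fix W
    note PH = Psi_in_Hom[OF defect_span_subset_Hom[OF t]]
    show "Psi W t = 0"
    proof (rule generator_eqI[OF PH Hom_zero])
      fix h assume h: "h \<in> Hom C G W"
      have "Psi G t \<cdot> (i j \<cdot> p j) = 0" if j: "j < n" for j
      proof -
        have "Psi G t \<cdot> (i j \<cdot> p j) = (Psi G t \<cdot> i j) \<cdot> p j" by (rule cmp_assoc[OF PH ipH[OF j], symmetric])
        also have "Psi G t \<cdot> i j = i j \<cdot> Psi (S j) t" by (rule Psi_natural[OF ipH(1)[OF j] t])
        also have "Psi (S j) t = 0" using Psi_scalar[OF _ t] S[OF j] z[OF j] by simp
        finally show ?thesis by (simp add: cmp_zero(2)[OF ipH(1)[OF j]] cmp_zero(1)[OF ipH(2)[OF j]])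
      qed
      then have "(\<Sum>j<n. Psi G t \<cdot> (i j \<cdot> p j)) = 0" by simp
      moreover have "Psi G t \<cdot> (\<Sum>j<n. i j \<cdot> p j) = (\<Sum>j<n. Psi G t \<cdot> (i j \<cdot> p j))"
        by (rule cmp_sum_right[OF PH]) (auto intro: cmp_in_Hom[OF ipH])
      ultimately have "Psi G t = 0" unfolding sum by (simp add: ide_right[OF PH])
      then show "Psi W t \<cdot> h = 0 \<cdot> h"
        unfolding Psi_natural[OF h t] by (simp add: cmp_zero(1)[OF h] cmp_zero(2)[OF h])
    qed
  qed
  show ?thesis
  proof (rule characters_semisimple[of defect_span L ?K])
    show "defect_span \<subseteq> Hom C L L" using defect_span_subset_Hom by blast
    show "ide C L \<in> defect_span" by (rule ide_L_in_defect_span)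
    show "vs.subspace defect_span" by (rule defect_span_subspace)
    show "a \<cdot> b \<in> defect_span" if "a \<in> defect_span" "b \<in> defect_span" for a b by (rule defect_span_cmp[OF that])
    show "finite ?K" by simp
    fix \<psi> assume "\<psi> \<in> ?K"
    then obtain j where j: "j < n" and \<psi>: "\<psi> = \<chi> (S j)" by blast
    have T: "simple_object (S j)" using S[OF j] by blast
    note lin = functional_on_comp[OF linear_on_Psi Psi_in_Hom functional_scalar[OF T]]
    show "functional_on defect_span \<psi>"
      using lin defect_span_subset_Hom vs.subspace_add[OF defect_span_subspace] vs.subspace_scale[OF defect_span_subspace]
      by (simp add: \<psi> \<chi>_def functional_on_def)
    show "\<psi> (ide C L) = 1" using T ide_L_in_defect_span by (simp add: \<psi> \<chi>_def Psi_ide)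
    show "\<psi> (a \<cdot> b) = \<psi> a * \<psi> b" if ab: "a \<in> defect_span" "b \<in> defect_span" for a b
    proof -
      have "Psi (S j) (a \<cdot> b) = Psi (S j) a \<cdot> Psi (S j) b" by (rule Psi_cmp[OF ab])
      also have "\<dots> = scl C (\<psi> a) (ide C (S j)) \<cdot> scl C (\<psi> b) (ide C (S j))"
        unfolding \<psi> Psi_scalar[OF T ab(1)] Psi_scalar[OF T ab(2)] ..
      also have "\<dots> = scl C (\<psi> a * \<psi> b) (ide C (S j))"
        by (simp add: cmp_scl_left[OF ide_in_Hom Hom_scl[OF ide_in_Hom]] cmp_scl_right[OF ide_in_Hom ide_in_Hom]
            ide_left[OF ide_in_Hom])
      finally show ?thesis using T defect_span_cmp[OF ab] by (simp add: \<psi> \<chi>_def)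
    qed
    fix \<psi>' assume "\<psi>' \<in> ?K" "\<psi> \<noteq> \<psi>'"
    then obtain k where \<psi>': "\<psi>' = \<chi> (S k)" by blast
    show "\<exists>a\<in>defect_span. \<psi> a \<noteq> \<psi>' a"
    proof (rule ccontr)
      assume "\<not> ?thesis"
      then have "\<psi> = \<psi>'" unfolding \<psi> \<psi>' \<chi>_def by (intro ext) (auto simp: restrict_def)
      then show False using \<open>\<psi> \<noteq> \<psi>'\<close> by simp
    qed
  next
    fix a assume "a \<in> defect_span" "\<And>\<psi>. \<psi> \<in> ?K \<Longrightarrow> \<psi> a = 0"
    then show "a = 0" by (intro zero) auto
  qed
qed

end

theorem mainTheorem3:
  fixes C :: "('k::{alg_closed_field, field_char_0}, 'o, 'm::ab_group_add) ribbon_category_data"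
    and L :: 'o and \<iota> :: "'o \<Rightarrow> 'm"
  assumes "modular_tensor_category C L \<iota>"
  shows "semisimple_algebra (scl C) (cmp C) (canonical_coend.defect_algebra C L \<iota>) \<longleftrightarrow>
         linear_category.semisimple_category C"
proof -
  interpret modular_tensor_category C L \<iota> by (rule assms)
  obtain n A d \<rho> \<Phi> where model: "finite_model C n A d \<rho> \<Phi>"
  proof -
    from finite obtain n A d \<rho> \<Phi> where "matrix_algebra n (A :: 'k mat set) \<and>
        (\<forall>X. fd_module n A (d X) (\<rho> X)) \<and>
        (\<forall>X Y. bij_betw (\<Phi> X Y) (Hom C X Y) (fd_module_hom A (d X) (\<rho> X) (d Y) (\<rho> Y))) \<and>
        (\<forall>X Y. \<forall>f\<in>Hom C X Y. \<forall>g\<in>Hom C X Y. \<Phi> X Y (f + g) = \<Phi> X Y f + \<Phi> X Y g) \<and>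
        (\<forall>X Y c. \<forall>f\<in>Hom C X Y. \<Phi> X Y (scl C c f) = c \<cdot>\<^sub>m \<Phi> X Y f) \<and>
        (\<forall>X. \<Phi> X X (ide C X) = 1\<^sub>m (d X)) \<and>
        (\<forall>X Y Z. \<forall>g\<in>Hom C Y Z. \<forall>f\<in>Hom C X Y. \<Phi> X Z (cmp C g f) = \<Phi> Y Z g * \<Phi> X Y f) \<and>
        (\<forall>e \<sigma>. fd_module n A e \<sigma> \<longrightarrow> (\<exists>X. fd_module_iso A e \<sigma> (d X) (\<rho> X)))"
      unfolding finite_category_def by (elim exE) (rule that)
    then have "finite_model C n A d \<rho> \<Phi>"
      by (intro finite_model.intro linear_category_axioms finite_model_axioms.intro) blast+
    then show ?thesis by (rule that)
  qed
  obtain G J b c \<phi> where "coordinate_model C n A d \<rho> \<Phi> G J b c \<phi>"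
  proof (rule finite_model.coordinates[OF model])
    fix G J b c \<phi>
    assume "functional_on (Hom C G J) \<phi>"
      "\<And>Y i. i < d Y \<Longrightarrow> b Y i \<in> Hom C G Y" "\<And>Y i. i < d Y \<Longrightarrow> c Y i \<in> Hom C Y J"
      "\<And>X Y f i j. f \<in> Hom C X Y \<Longrightarrow> i < d Y \<Longrightarrow> j < d X \<Longrightarrow>
        \<phi> (cmp C (c Y i) (cmp C f (b X j))) = \<Phi> X Y f $$ (i, j)"
      "\<And>Y h. h \<in> Hom C G Y \<Longrightarrow> h = (\<Sum>i<d Y. scl C (\<phi> (cmp C (c Y i) h)) (b Y i))"
      "\<And>Y h. h \<in> Hom C Y J \<Longrightarrow> h = (\<Sum>i<d Y. scl C (\<phi> (cmp C h (b Y i))) (c Y i))"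
    then have "coordinate_model C n A d \<rho> \<Phi> G J b c \<phi>"
      by (intro coordinate_model.intro model coordinate_model_axioms.intro)
    then show ?thesis by (rule that)
  qed
  then interpret modular_model C L \<iota> n A d \<rho> \<Phi> G J b c \<phi>
    by (intro modular_model.intro modular_tensor_category_axioms)
  show ?thesis
    unfolding defect_algebra_eq using semisimple_algebra_imp semisimple_category_imp by blast
qed

end
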